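(* Let $X$ be a complex Banach space, let $\omega\in[0,\pi)$, let $A\in\mathrm{Sect}_\omega(X)$, and let $\alpha\in\mathbb{C}$ with $0<\operatorname{Re}\alpha<1$. For $x\in X$ consider the problem $$u''(t)+\frac{1-2\alpha}{t}u'(t)=Au(t)\quad(t>0),\qquad u(0)=x. \qquad (P_x)$$ If $u$ is a solution of $(P_0)$, then $u=0$. In particular, solutions are unique: for every $x\in X$ the problem $(P_x)$ has at most one solution, and if $\mathcal{D}(A)$ is dense in $X$ then for every $x\in X$ it has exactly one solution.
   Context: Solution: a solution of $(P_x)$ is a function $u\in C_{\mathrm b}([0,\infty);X)$ (bounded and continuous) such that $u(0)=x$, $u(t)\in\mathcal{D}(A)$ for all $t>0$, $Au\in L^1_{\mathrm{loc}}((0,\infty);X)$, and for all $\phi\in C_{\mathrm c}^\infty((0,\infty))$ $$\int_0^\infty\Bigl(u(t)\phi''(t)-u(t)\frac{d}{dt}\Bigl(\frac{1-2\alpha}{t}\phi(t)\Bigr)\Bigr)dt=\int_0^\infty Au(t)\,\phi(t)\,dt .$$ Sectorial operators: for $\theta\in(0,\pi)$, $S_\theta:=\{z\in\mathbb{C}\setminus(-\infty,0]:|\arg z|<\theta\}$ with $\arg z\in(-\pi,\pi)$; $S_0:=(0,\infty)$. A linear operator $A$ in $X$ (neither assumed densely defined nor injective) is sectorial if $(-\infty,0)\subseteq\rho(A)$ and $\sup_{\lambda>0}\|\lambda(\lambda+A)^{-1}\|<\infty$. Its angle of sectoriality is the infimum of all $\theta\in[0,\pi)$ such that $\sigma(A)\subseteq\overline{S_\theta}$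 and $\sup_{z\in\mathbb{C}\setminus S_\phi,\,z\ne0}\|z(z-A)^{-1}\|<\infty$ for every $\phi\in(\theta,\pi)$. $\mathrm{Sect}_\omega(X)$ is the set of sectorial operators with angle of sectoriality $\omega$. *)

theory Defs
  imports "HOL-Analysis.Analysis"
begin

section \<open>Complex Banach spaces\<close>

text \<open>The distribution only has real Banach spaces; a complex one is a real one whose
  scalar multiplication extends to a complex scalar multiplication compatible with the norm.\<close>

class complex_banach = banach +
  fixes scaleC :: "complex \<Rightarrow> 'a \<Rightarrow> 'a" (infixr \<open>*\<^sub>C\<close> 75)
  assumes scaleC_add_right: "a *\<^sub>C (x + y) = a *\<^sub>C x + a *\<^sub>C y"
    and scaleC_add_left: "(a + b) *\<^sub>C x = a *\<^sub>C x + b *\<^sub>C x"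
    and scaleC_scaleC: "a *\<^sub>C (b *\<^sub>C x) = (a * b) *\<^sub>C x"
    and scaleC_of_real: "complex_of_real r *\<^sub>C x = r *\<^sub>R x"
    and norm_scaleC: "norm (a *\<^sub>C x) = cmod a * norm x"

instantiation complex :: complex_banach
begin

definition scaleC_complex :: "complex \<Rightarrow> complex \<Rightarrow> complex"
  where "scaleC_complex a x = a * x"

instance
  by standard (simp_all add: scaleC_complex_def algebra_simps norm_mult scaleR_conv_of_real)

end


section \<open>The Bochner integral in arbitrary Banach spaces\<close>

text \<open>The library's \<^const>\<open>has_bochner_integral\<close> is restricted to second countable codomains.
  Without that restriction, Borel measurability has to be replaced by strong measurability;
  the rest of the definition is unchanged.\<close>

definition strongly_measurable :: "'a measure \<Rightarrow> ('a \<Rightarrow> 'b::real_normed_vector) \<Rightarrow> bool"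
  where "strongly_measurable M f \<longleftrightarrow>
    (\<exists>s. (\<forall>i. simple_function M (s i)) \<and> (AE x in M. (\<lambda>i::nat. s i x) \<longlonglongrightarrow> f x))"

definition has_strong_bochner_integral ::
    "'a measure \<Rightarrow> ('a \<Rightarrow> 'b::real_normed_vector) \<Rightarrow> 'b \<Rightarrow> bool"
  where "has_strong_bochner_integral M f I \<longleftrightarrow>
    strongly_measurable M f \<and>
    (\<exists>s. (\<forall>i. Bochner_Integration.simple_bochner_integrable M (s i)) \<and>
         (\<lambda>i::nat. \<integral>\<^sup>+x. ennreal (norm (f x - s i x)) \<partial>M) \<longlonglongrightarrow> 0 \<and>
         (\<lambda>i. Bochner_Integration.simple_bochner_integral M (s i)) \<longlonglongrightarrow> I)"

definition strong_bochner_integrable ::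
    "'a measure \<Rightarrow> ('a \<Rightarrow> 'b::real_normed_vector) \<Rightarrow> bool"
  where "strong_bochner_integrable M f \<longleftrightarrow> (\<exists>I. has_strong_bochner_integral M f I)"

definition strong_bochner_integral :: "'a measure \<Rightarrow> ('a \<Rightarrow> 'b::real_normed_vector) \<Rightarrow> 'b"
  where "strong_bochner_integral M f = (THE I. has_strong_bochner_integral M f I)"

lemma strongly_measurable_AE_norm_measurable:
  fixes f :: "'a \<Rightarrow> 'b::real_normed_vector"
  assumes f: "strongly_measurable M f" and s: "simple_function M s"
  shows "\<exists>g. g \<in> borel_measurable M \<and> (AE x in M. ennreal (norm (f x - s x)) = g x)"
proof -
  obtain r where r: "\<And>i. simple_function M (r i)" "AE x in M. (\<lambda>i::nat. r i x) \<longlonglongrightarrow> f x"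
    using f unfolding strongly_measurable_def by blast
  define h where "h i x = ennreal (norm (r i x - s x))" for i x
  have "simple_function M (h i)" for i
    unfolding h_def using r(1)[of i] s
    by (rule simple_function_compose2[where h = "\<lambda>a b. ennreal (norm (a - b))"])
  then have "h i \<in> borel_measurable M" for i
    by (rule borel_measurable_simple_function)
  then have "(\<lambda>x. liminf (\<lambda>i. h i x)) \<in> borel_measurable M"
    by measurable
  moreover have "AE x in M. ennreal (norm (f x - s x)) = liminf (\<lambda>i. h i x)"
    using r(2)
  proof eventually_elim
    case (elim x)
    have "(\<lambda>i. h i x) \<longlonglongrightarrow> ennreal (norm (f x - s x))"
      unfolding h_def by (intro tendsto_intros elim)
    then show ?case by (simp add: lim_imp_Liminf)
  qed
  ultimately show ?thesis by blast
qed

lemma has_strong_bochner_integral_unique: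
  assumes "has_strong_bochner_integral M f I" "has_strong_bochner_integral M f J"
  shows "I = J"
proof -
  obtain s where s: "\<And>i. Bochner_Integration.simple_bochner_integrable M (s i)"
      "(\<lambda>i::nat. \<integral>\<^sup>+x. ennreal (norm (f x - s i x)) \<partial>M) \<longlonglongrightarrow> 0"
      "(\<lambda>i. Bochner_Integration.simple_bochner_integral M (s i)) \<longlonglongrightarrow> I"
    using assms(1) unfolding has_strong_bochner_integral_def by blast
  obtain t where t: "\<And>i. Bochner_Integration.simple_bochner_integrable M (t i)"
      "(\<lambda>i::nat. \<integral>\<^sup>+x. ennreal (norm (f x - t i x)) \<partial>M) \<longlonglongrightarrow> 0"
      "(\<lambda>i. Bochner_Integration.simple_bochner_integral M (t i)) \<longlonglongrightarrow> J"
    using assms(2) unfolding has_strong_bochner_integral_def by blast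
  have f: "strongly_measurable M f"
    using assms(1) unfolding has_strong_bochner_integral_def by blast
  have sf: "simple_function M (s i)" "simple_function M (t i)" for i
    using s(1)[of i] t(1)[of i] by (auto elim: simple_bochner_integrable.cases)
  let ?S = "\<lambda>i. \<integral>\<^sup>+x. ennreal (norm (f x - s i x)) \<partial>M"
  let ?T = "\<lambda>i. \<integral>\<^sup>+x. ennreal (norm (f x - t i x)) \<partial>M"
  have bound: "ennreal (norm (Bochner_Integration.simple_bochner_integral M (s i) - Bochner_Integration.simple_bochner_integral M (t i)))
      \<le> ?S i + ?T i" for i
  proof -
    obtain g where g: "g \<in> borel_measurable M" "AE x in M. ennreal (norm (f x - s i x)) = g x"
      using strongly_measurable_AE_norm_measurable[OF f sf(1)] by blast
    obtain h where h: "h \<in> borel_measurable M" "AE x in M. ennreal (norm (f x - t i x)) = h x"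
      using strongly_measurable_AE_norm_measurable[OF f sf(2)] by blast
    have st: "Bochner_Integration.simple_bochner_integrable M (\<lambda>x. s i x - t i x)"
      by (rule simple_bochner_integrable_compose2[OF _ s(1) t(1)]) simp
    have "Bochner_Integration.simple_bochner_integral M (s i) - Bochner_Integration.simple_bochner_integral M (t i)
        = Bochner_Integration.simple_bochner_integral M (\<lambda>x. s i x - t i x)"
      using s(1) t(1) by (simp add: simple_bochner_integral_diff)
    then have "ennreal (norm (Bochner_Integration.simple_bochner_integral M (s i) - Bochner_Integration.simple_bochner_integral M (t i)))
        \<le> ennreal (Bochner_Integration.simple_bochner_integral M (\<lambda>x. norm (s i x - t i x)))"
      using simple_bochner_integral_norm_bound[OF st] by (simp add: ennreal_leI)
    also have "\<dots> = (\<integral>\<^sup>+x. ennreal (norm (s i x - t i x)) \<partial>M)"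
      by (rule simple_bochner_integral_eq_nn_integral)
         (auto intro: simple_bochner_integrable_compose2[OF _ s(1) t(1),
            where p = "\<lambda>a b. norm (a - b)"])
    also have "\<dots> \<le> (\<integral>\<^sup>+x. g x + h x \<partial>M)"
    proof (rule nn_integral_mono_AE)
      show "AE x in M. ennreal (norm (s i x - t i x)) \<le> g x + h x"
        using g(2) h(2)
      proof eventually_elim
        case (elim x)
        have "norm (s i x - t i x) \<le> norm (f x - s i x) + norm (f x - t i x)"
          using norm_triangle_ineq4[of "f x - t i x" "f x - s i x"] by simp
        then have "ennreal (norm (s i x - t i x))
            \<le> ennreal (norm (f x - s i x) + norm (f x - t i x))"
          by (rule ennreal_leI)
        also have "\<dots> = g x + h x"
          using elim by (metis ennreal_plus norm_ge_zero)
        finally show ?case .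
      qed
    qed
    also have "\<dots> = (\<integral>\<^sup>+x. g x \<partial>M) + (\<integral>\<^sup>+x. h x \<partial>M)"
      using g(1) h(1) by (rule nn_integral_add)
    also have "\<dots> = ?S i + ?T i"
      using nn_integral_cong_AE[OF g(2)] nn_integral_cong_AE[OF h(2)] by simp
    finally show ?thesis .
  qed
  have "(\<lambda>i. ?S i + ?T i) \<longlonglongrightarrow> 0"
    using tendsto_add[OF s(2) t(2)] by simp
  then have "(\<lambda>i. ennreal (norm (Bochner_Integration.simple_bochner_integral M (s i)
      - Bochner_Integration.simple_bochner_integral M (t i)))) \<longlonglongrightarrow> 0"
    by (rule tendsto_sandwich[OF _ _ tendsto_const, rotated 2])
       (auto simp: bound)
  then have "(\<lambda>i. norm (Bochner_Integration.simple_bochner_integral M (s i)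
      - Bochner_Integration.simple_bochner_integral M (t i))) \<longlonglongrightarrow> 0"
    by (simp flip: ennreal_0)
  moreover have "(\<lambda>i. norm (Bochner_Integration.simple_bochner_integral M (s i)
      - Bochner_Integration.simple_bochner_integral M (t i))) \<longlonglongrightarrow> norm (I - J)"
    by (intro tendsto_intros s t)
  ultimately show "I = J"
    using LIMSEQ_unique by fastforce
qed

lemma strong_bochner_integral_eq:
  "has_strong_bochner_integral M f I \<Longrightarrow> strong_bochner_integral M f = I"
  unfolding strong_bochner_integral_def using has_strong_bochner_integral_unique by blast

lemma has_bochner_integral_imp_strong:
  fixes f :: "'a \<Rightarrow> 'b::{real_normed_vector, second_countable_topology}"
  assumes "has_bochner_integral M f I"
  shows "has_strong_bochner_integral M f I"
  using assms
proof cases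
  case (1 s)
  obtain F where F: "\<And>i::nat. simple_function M (F i)"
      "\<And>x. x \<in> space M \<Longrightarrow> (\<lambda>i. F i x) \<longlonglongrightarrow> f x"
    using borel_measurable_implies_sequence_metric[OF 1(1), of 0] by blast
  then have "strongly_measurable M f"
    unfolding strongly_measurable_def by (intro exI[of _ F]) auto
  with 1 show ?thesis
    unfolding has_strong_bochner_integral_def by blast
qed


section \<open>Sectorial operators\<close>

text \<open>An unbounded operator is given by its domain \<open>D\<close> and a function \<open>A\<close> of which only the
  values on \<open>D\<close> matter.\<close>

definition linear_operator :: "'a::complex_banach set \<Rightarrow> ('a \<Rightarrow> 'a) \<Rightarrow> bool"
  where "linear_operator D A \<longleftrightarrow>
    0 \<in> D \<and> (\<forall>x\<in>D. \<forall>y\<in>D. x + y \<in> D \<and> A (x + y) = A x + A y) \<and>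
    (\<forall>c. \<forall>x\<in>D. c *\<^sub>C x \<in> D \<and> A (c *\<^sub>C x) = c *\<^sub>C A x)"

definition resolvent :: "'a::complex_banach set \<Rightarrow> ('a \<Rightarrow> 'a) \<Rightarrow> complex \<Rightarrow> 'a \<Rightarrow> 'a"
  where "resolvent D A z = inv_into D (\<lambda>x. z *\<^sub>C x - A x)"

definition resolvent_set :: "'a::complex_banach set \<Rightarrow> ('a \<Rightarrow> 'a) \<Rightarrow> complex set"
  where "resolvent_set D A =
    {z. bij_betw (\<lambda>x. z *\<^sub>C x - A x) D UNIV \<and> bounded_linear (resolvent D A z)}"

definition spectrum_op :: "'a::complex_banach set \<Rightarrow> ('a \<Rightarrow> 'a) \<Rightarrow> complex set"
  where "spectrum_op D A = - resolvent_set D A"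

definition sector :: "real \<Rightarrow> complex set"
  where "sector \<theta> =
    (if \<theta> = 0 then complex_of_real ` {0<..} else {z. z \<notin> \<real>\<^sub>\<le>\<^sub>0 \<and> \<bar>Arg z\<bar> < \<theta>})"

definition sectorial :: "'a::complex_banach set \<Rightarrow> ('a \<Rightarrow> 'a) \<Rightarrow> bool"
  where "sectorial D A \<longleftrightarrow>
    linear_operator D A \<and>
    complex_of_real ` {..<0} \<subseteq> resolvent_set D A \<and>
    bdd_above ((\<lambda>l::real. onorm (\<lambda>x. complex_of_real l *\<^sub>C
      inv_into D (\<lambda>y. complex_of_real l *\<^sub>C y + A y) x)) ` {0<..})"

text \<open>In the suprema below \<open>z\<close> always lies in the resolvent set, because a point outside the
  sector of angle \<open>\<phi> > \<theta>\<close> other than \<open>0\<close> is outside the closed sector of angle \<open>\<theta>\<close>. The set of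
  admissible angles of a sectorial operator is nonempty, so the infimum is meaningful.\<close>

definition sectoriality_angle :: "'a::complex_banach set \<Rightarrow> ('a \<Rightarrow> 'a) \<Rightarrow> real"
  where "sectoriality_angle D A = Inf {\<theta>. 0 \<le> \<theta> \<and> \<theta> < pi \<and>
    spectrum_op D A \<subseteq> closure (sector \<theta>) \<and>
    (\<forall>\<phi>. \<theta> < \<phi> \<and> \<phi> < pi \<longrightarrow>
      bdd_above ((\<lambda>z. onorm (\<lambda>x. z *\<^sub>C resolvent D A z x)) ` {z. z \<notin> sector \<phi> \<and> z \<noteq> 0}))}"

definition Sect :: "real \<Rightarrow> ('a::complex_banach set \<times> ('a \<Rightarrow> 'a)) set"
  where "Sect \<omega> = {(D, A). sectorial D A \<and> sectoriality_angle D A = \<omega>}"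


section \<open>Solutions\<close>

abbreviation vderiv :: "(real \<Rightarrow> 'a::real_normed_vector) \<Rightarrow> real \<Rightarrow> 'a"
  where "vderiv f \<equiv> \<lambda>t. vector_derivative f (at t)"

text \<open>Complex-valued test functions on the half-line, extended by zero to the whole line.\<close>

definition test_function :: "(real \<Rightarrow> complex) \<Rightarrow> bool"
  where "test_function \<phi> \<longleftrightarrow>
    (\<forall>n t. ((vderiv ^^ n) \<phi>) differentiable (at t)) \<and>
    (\<exists>K. compact K \<and> K \<subseteq> {0<..} \<and> (\<forall>t. t \<notin> K \<longrightarrow> \<phi> t = 0))"

text \<open>Only the values of \<open>u\<close> on \<open>{0..}\<close> matter.\<close>

definition is_solution ::
    "'a::complex_banach set \<Rightarrow> ('a \<Rightarrow> 'a) \<Rightarrow> complex \<Rightarrow> 'a \<Rightarrow> (real \<Rightarrow> 'a) \<Rightarrow> bool"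
  where "is_solution D A \<alpha> x u \<longleftrightarrow>
    continuous_on {0..} u \<and> bounded (u ` {0..}) \<and>
    u 0 = x \<and>
    (\<forall>t>0. u t \<in> D) \<and>
    (\<forall>K. compact K \<and> K \<subseteq> {0<..} \<longrightarrow>
      strong_bochner_integrable (lebesgue_on K) (\<lambda>t. A (u t))) \<and>
    (\<forall>\<phi>. test_function \<phi> \<longrightarrow>
      strong_bochner_integral (lebesgue_on {0<..})
        (\<lambda>t. vderiv (vderiv \<phi>) t *\<^sub>C u t
           - vderiv (\<lambda>s. (1 - 2 * \<alpha>) / complex_of_real s * \<phi> s) t *\<^sub>C u t)
      = strong_bochner_integral (lebesgue_on {0<..}) (\<lambda>t. \<phi> t *\<^sub>C A (u t)))"

end

theory Submission
  imports Defs "HOL-Computational_Algebra.Polynomial" "HOL-Real_Asymp.Real_Asymp"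
begin

text \<open>Write \<open>R s = (s + A)\<^sup>-\<^sup>1\<close> for \<open>s > 0\<close> and \<open>B\<^sub>\<nu> z = 2\<^sup>\<nu> z\<^bsup>\<nu>/2\<^esup> J\<^sub>\<nu>(\<surd>z)\<close>, so that
  \<open>B\<^sub>\<alpha>(t\<^sup>2 s)\<close> solves \<open>v'' + (1 - 2\<alpha>) v' / t = - s v\<close>. Only the resolvents on the negative half-line
  are needed, so the angle plays no role.

  Uniqueness: applying \<open>R s\<close> to the weak equation gives \<open>\<integral> \<phi> u = R s (\<integral> (L\<^sup>* \<phi> + s \<phi>) u)\<close> for every
  test function \<open>\<phi>\<close>, where \<open>L\<^sup>*\<close> is the formal adjoint. For \<open>\<phi>\<close> a cutoff of the eigenfunction
  \<open>t\<^bsup>1-2\<alpha>\<^esup> B\<^sub>\<alpha>(t\<^sup>2 s)\<close> of \<open>L\<^sup>*\<close>, only terms with derivatives of the cutoff remain on the right. Integrate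
  over \<open>s\<close> against \<open>exp (- p\<^sub>0 s) - exp (- p\<^sub>1 s)\<close>. On the right, the \<open>s\<close>-integrals are small enough for
  small and for large \<open>t\<close> (after integration by parts in \<open>s\<close>) that everything vanishes as the cutoff is
  removed, because \<open>u\<close> is bounded and \<open>u 0 = 0\<close>. On the left, the Laplace transform of the
  eigenfunction is a multiple of \<open>t exp (- t\<^sup>2 / (4 p))\<close>. Letting \<open>p\<^sub>1\<close> tend to infinity, \<open>u\<close> is orthogonal to
  all these Gaussians, hence zero by the Weierstrass approximation theorem in the variable
  \<open>exp (- t\<^sup>2)\<close>.

  Existence: the integral of \<open>t\<^sup>-\<^sup>6 B\<^bsub>\<alpha>+3\<^esub>(t\<^sup>2 s) (R s)\<^sup>4 x\<close> over \<open>s > 0\<close> converges absolutely, whatever the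
  angle of \<open>A\<close>, and solves the equation. The substitution \<open>z = t\<^sup>2 s\<close> and \<open>s\<^sup>4 (R s)\<^sup>4 x \<rightarrow> x\<close> for
  \<open>s \<rightarrow> \<infinity>\<close> show that it tends to a multiple of \<open>x\<close> as \<open>t \<rightarrow> 0\<close>; the factor
  \<open>\<integral> B\<^bsub>\<alpha>+3\<^esub> z / z\<^sup>4 dz\<close> is nonzero, by a Laplace transform.\<close>

subsection \<open>Bessel functions\<close>

text \<open>A solution gives no control of \<open>A u\<close> near 0 or infinity beyond local
  integrability; once the resolvent is applied, \<open>A\<close> is gone and only the bound on
  \<open>u\<close> enters. Since \<open>R s\<close> is merely O(1/s), the weight must vanish at s =
  0, hence a difference of two exponentials. For large t the kernel is only bounded by t^(1-a),
  where a = Re \<alpha>; on the strip [N, 2N] of the cutoff this leaves N^(1-a). An integration by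
  parts in s gains 1/t, and one of them already leaves N^(-a). At the lower end no power is to
  spare, so u(0) = 0 has to make that term small. The second Gaussian disappears for large p1
  because its L1 norm is of order p1^(-a). The representation used for existence is, up to the
  factor 3! = 6, the formal integral of B_\<alpha>(t^2 s) \<open>R s x\<close> after three
  integrations by parts, each raising the Bessel index and the resolvent power by one. Three is the
  least number for which the growth bounds proved here make the integral for \<open>A u\<close>
  converge absolutely.\<close>

definition bcoeff :: "complex \<Rightarrow> nat \<Rightarrow> complex"
  where "bcoeff \<nu> m = (-1/4) ^ m * rGamma (\<nu> + 1 + of_nat m) / fact m"

definition bser :: "complex \<Rightarrow> complex \<Rightarrow> complex"
  where "bser \<nu> z = (\<Sum>m. bcoeff \<nu> m * z ^ m)"

text \<open>In terms of the Bessel function of the first kind, \<open>bess \<nu> t = 2\<^sup>\<nu> t\<^bsup>\<nu>/2\<^esup> J\<^sub>\<nu>(\<surd>t)\<close>.\<close>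

definition bess :: "complex \<Rightarrow> real \<Rightarrow> complex"
  where "bess \<nu> t = of_real t powr \<nu> * bser \<nu> (of_real t)"

lemma bcoeff_shift: "(\<nu> + of_nat m) * bcoeff \<nu> m = bcoeff (\<nu> - 1) m"
proof -
  have "(\<nu> + of_nat m) * rGamma (\<nu> + 1 + of_nat m) = rGamma (\<nu> + of_nat m)"
    using rGamma_plus1[of "\<nu> + of_nat m"] by (simp add: add_ac)
  then have "(-1/4) ^ m * ((\<nu> + of_nat m) * rGamma (\<nu> + 1 + of_nat m)) / fact m = bcoeff (\<nu> - 1) m"
    by (simp add: bcoeff_def)
  then show ?thesis by (simp add: bcoeff_def mult_ac)
qed

lemma bcoeff_Suc: "of_nat (Suc m) * bcoeff (\<nu> - 1) (Suc m) = - bcoeff \<nu> m / 4"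
proof -
  have "\<nu> - 1 + 1 + of_nat (Suc m) = \<nu> + 1 + of_nat m" by simp
  moreover have "c * (-1/4 * P * g / (c * F)) = - (P * g / F) / 4" if "c \<noteq> 0" for c P g F :: complex
    using that by (simp add: field_simps)
  ultimately show ?thesis
    unfolding bcoeff_def fact_Suc power_Suc of_nat_mult by (metis of_nat_neq_0)
qed

text \<open>For n >= |\<nu>| + 2 the factor \<nu> + 1 + n between consecutive values of
  \<open>rGamma\<close> has modulus at least 1. Dropping it leaves 1 / (4 (n + 1)), which is all
  that a ratio test needs.\<close>

lemma norm_bcoeff_Suc:
  assumes "norm \<nu> + 2 \<le> real n"
  shows "norm (bcoeff \<nu> (Suc n)) \<le> norm (bcoeff \<nu> n) / (4 * real (Suc n))"
proof -
  let ?w = "\<nu> + 1 + of_nat n"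
  have "real (Suc n) \<le> norm (?w) + norm \<nu>"
    using norm_triangle_ineq4[of ?w \<nu>] norm_of_nat[of "Suc n", where 'a = complex] by simp
  then have w: "norm ?w \<ge> 1" using assms by simp
  have "rGamma ?w = ?w * rGamma (?w + 1)" using rGamma_plus1[of ?w] by simp
  then have "norm (rGamma ?w) = norm ?w * norm (rGamma (?w + 1))" by (simp add: norm_mult)
  then have r: "norm (rGamma (?w + 1)) \<le> norm (rGamma ?w)"
    using w by (simp add: mult_le_cancel_right1)
  have "norm (of_nat (Suc n) :: complex) = real (Suc n)" by (rule norm_of_nat)
  moreover have "\<nu> + 1 + of_nat (Suc n) = ?w + 1" by simp
  ultimately have "norm (bcoeff \<nu> (Suc n)) = (1/4) ^ n * norm (rGamma (?w + 1)) / fact n / (4 * real (Suc n))"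
    unfolding bcoeff_def fact_Suc power_Suc of_nat_mult by (simp only: norm_mult norm_divide norm_power) simp
  also have "\<dots> \<le> (1/4) ^ n * norm (rGamma ?w) / fact n / (4 * real (Suc n))"
    by (intro divide_right_mono mult_left_mono r) auto
  also have "\<dots> = norm (bcoeff \<nu> n) / (4 * real (Suc n))"
    by (simp add: bcoeff_def norm_mult norm_divide norm_power)
  finally show ?thesis .
qed

lemma summable_bser: "summable (\<lambda>m. bcoeff \<nu> m * z ^ m)"
proof (rule summable_ratio_test[where c = "1/2" and N = "nat \<lceil>norm \<nu> + 2 + norm z\<rceil>"])
  fix n assume "nat \<lceil>norm \<nu> + 2 + norm z\<rceil> \<le> n"
  then have n: "norm \<nu> + 2 + norm z \<le> real n" by linarith
  have "norm (bcoeff \<nu> (Suc n) * z ^ Suc n) \<le> norm (bcoeff \<nu> n) / (4 * real (Suc n)) * norm (z ^ Suc n)"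
    unfolding norm_mult by (intro mult_right_mono norm_bcoeff_Suc) (use n norm_ge_zero[of z] in linarith, simp)
  also have "\<dots> = norm (bcoeff \<nu> n * z ^ n) * (norm z / (4 * real (Suc n)))"
    by (simp add: norm_mult norm_power)
  also have "\<dots> \<le> norm (bcoeff \<nu> n * z ^ n) * (1/2)"
  proof (intro mult_left_mono)
    have "norm z \<le> 1/2 * (4 * real (Suc n))"
      using n norm_ge_zero[of \<nu>] norm_ge_zero[of z] unfolding of_nat_Suc by argo
    then show "norm z / (4 * real (Suc n)) \<le> 1/2" by (subst divide_le_eq) auto
  qed simp
  finally show "norm (bcoeff \<nu> (Suc n) * z ^ Suc n) \<le> 1/2 * norm (bcoeff \<nu> n * z ^ n)" by simp
qed simp

text \<open>The second part is \<open>bcoeff_shift\<close> summed over m, because z d/dz multiplies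
  the coefficient of z^m by m. Up to a power of z, its left-hand side is the derivative of z^\<nu>
  \<open>bser \<nu> z\<close>.\<close>

lemma bser_shift:
  shows "(bser \<nu> has_field_derivative (\<Sum>m. diffs (bcoeff \<nu>) m * z ^ m)) (at z)"
    and "\<nu> * bser \<nu> z + z * (\<Sum>m. diffs (bcoeff \<nu>) m * z ^ m) = bser (\<nu> - 1) z"
proof -
  show "(bser \<nu> has_field_derivative (\<Sum>m. diffs (bcoeff \<nu>) m * z ^ m)) (at z)"
    unfolding bser_def by (rule termdiffs_strong_converges_everywhere, rule summable_bser)
  have "summable (\<lambda>m. diffs (bcoeff \<nu>) m * z ^ m)"
    by (rule termdiff_converges_all, rule summable_bser)
  then have "(\<lambda>m. z * (diffs (bcoeff \<nu>) m * z ^ m)) sums (z * (\<Sum>m. diffs (bcoeff \<nu>) m * z ^ m))"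
    by (intro sums_mult summable_sums)
  then have "(\<lambda>m. of_nat (Suc m) * bcoeff \<nu> (Suc m) * z ^ Suc m) sums (z * (\<Sum>m. diffs (bcoeff \<nu>) m * z ^ m))"
    by (simp add: diffs_def mult_ac)
  then have "(\<lambda>m. of_nat m * bcoeff \<nu> m * z ^ m) sums (z * (\<Sum>m. diffs (bcoeff \<nu>) m * z ^ m))"
    by (subst (asm) sums_Suc_iff) simp
  then have "(\<lambda>m. \<nu> * (bcoeff \<nu> m * z ^ m) + of_nat m * bcoeff \<nu> m * z ^ m) sums
      (\<nu> * bser \<nu> z + z * (\<Sum>m. diffs (bcoeff \<nu>) m * z ^ m))"
    unfolding bser_def by (intro sums_add sums_mult summable_sums summable_bser)
  then have "(\<lambda>m. bcoeff (\<nu> - 1) m * z ^ m) sums (\<nu> * bser \<nu> z + z * (\<Sum>m. diffs (bcoeff \<nu>) m * z ^ m))"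
    by (simp add: bcoeff_shift[symmetric] algebra_simps)
  then show "\<nu> * bser \<nu> z + z * (\<Sum>m. diffs (bcoeff \<nu>) m * z ^ m) = bser (\<nu> - 1) z"
    unfolding bser_def by (simp add: sums_iff)
qed

text \<open>Compared coefficientwise, the first two series combine to m
  \<open>bcoeff (\<nu> - 1) m\<close>. The term m = 0 vanishes, and after a shift of the index
  \<open>bcoeff_Suc\<close> turns the remainder into -z/4 times the third series.\<close>

lemma bser_recurrence: "bser (\<nu> - 2) z + (1 - \<nu>) * bser (\<nu> - 1) z + z * bser \<nu> z / 4 = 0"
proof -
  have c: "bcoeff (\<nu> - 2) m + (1 - \<nu>) * bcoeff (\<nu> - 1) m = of_nat m * bcoeff (\<nu> - 1) m" for m
    using bcoeff_shift[of "\<nu> - 1" m] by (simp add: algebra_simps)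
  have "(\<lambda>m. bcoeff (\<nu> - 2) m * z ^ m + (1 - \<nu>) * (bcoeff (\<nu> - 1) m * z ^ m)) sums
     (bser (\<nu> - 2) z + (1 - \<nu>) * bser (\<nu> - 1) z)"
    unfolding bser_def by (intro sums_add sums_mult summable_sums summable_bser)
  moreover have "bcoeff (\<nu> - 2) m * z ^ m + (1 - \<nu>) * (bcoeff (\<nu> - 1) m * z ^ m)
      = of_nat m * bcoeff (\<nu> - 1) m * z ^ m" for m
    using arg_cong[OF c[of m], of "\<lambda>c. c * z ^ m"] by (simp add: algebra_simps)
  ultimately have "(\<lambda>m. of_nat m * bcoeff (\<nu> - 1) m * z ^ m) sums
     (bser (\<nu> - 2) z + (1 - \<nu>) * bser (\<nu> - 1) z)" by simp
  then have "(\<lambda>m. of_nat (Suc m) * bcoeff (\<nu> - 1) (Suc m) * z ^ Suc m) sums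
     (bser (\<nu> - 2) z + (1 - \<nu>) * bser (\<nu> - 1) z)"
    by (subst sums_Suc_iff) simp
  moreover have "(\<lambda>m. (- z / 4) * (bcoeff \<nu> m * z ^ m)) sums ((- z / 4) * bser \<nu> z)"
    unfolding bser_def by (intro sums_mult summable_sums summable_bser)
  moreover have "of_nat (Suc m) * bcoeff (\<nu> - 1) (Suc m) * z ^ Suc m = (- z / 4) * (bcoeff \<nu> m * z ^ m)" for m
    unfolding bcoeff_Suc by simp
  ultimately have "bser (\<nu> - 2) z + (1 - \<nu>) * bser (\<nu> - 1) z = (- z / 4) * bser \<nu> z"
    by (metis (mono_tags, lifting) sums_cong sums_unique2)
  then show ?thesis by simp
qed

lemma of_real_has_vector_derivative: "(complex_of_real has_vector_derivative 1) (at t)"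
  using has_vector_derivative_of_real[of "\<lambda>t. t" 1 "at t", where 'a = complex] by simp

lemma inverse_of_real_power_has_vector_derivative:
  assumes "0 < t"
  shows "((\<lambda>t. inverse (complex_of_real t) ^ j) has_vector_derivative - (of_nat j * inverse (of_real t) ^ Suc j)) (at t)"
proof -
  have "((\<lambda>z. inverse z ^ j) has_field_derivative - (of_nat j * inverse z ^ Suc j)) (at z)" if "z \<noteq> 0" for z :: complex
  proof (cases j)
    case (Suc i)
    have "((\<lambda>z. inverse z ^ j) has_field_derivative of_nat j * (- (inverse z * 1 * inverse z) * inverse z ^ (j - Suc 0))) (at z)"
      by (rule DERIV_power[OF DERIV_inverse'[OF DERIV_ident that]])
    then show ?thesis unfolding Suc by (simp add: mult_ac)
  qed simp
  from field_vector_diff_chain_at[OF of_real_has_vector_derivative this[of "of_real t"]]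
  show ?thesis using assms by (simp add: o_def)
qed

lemma powr_of_real_has_vector_derivative:
  assumes "0 < t"
  shows "((\<lambda>t. of_real t powr b) has_vector_derivative (b * of_real t powr (b - 1) :: complex)) (at t)"
proof -
  have "complex_of_real t \<notin> \<real>\<^sub>\<le>\<^sub>0" using assms by auto
  then have "((\<lambda>z. z powr b) has_field_derivative b * of_real t powr (b - 1)) (at (of_real t))"
    by (rule has_field_derivative_powr)
  then show ?thesis
    using field_vector_diff_chain_at[OF of_real_has_vector_derivative, of "\<lambda>z. z powr b"]
    by (simp add: o_def)
qed

text \<open>The normalisation 2^\<nu> t^(\<nu>/2) of the Bessel function is made for this rule:
  differentiation lowers the index and creates no factor, so B_(\<nu>+1) is an antiderivative of
  B_\<nu>. All integrations by parts rest on this.\<close>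

lemma bess_has_vector_derivative:
  assumes "0 < t"
  shows "(bess \<nu> has_vector_derivative bess (\<nu> - 1) t) (at t)"
proof -
  let ?d = "\<Sum>m. diffs (bcoeff \<nu>) m * of_real t ^ m"
  have "((\<lambda>t. bser \<nu> (of_real t)) has_vector_derivative ?d) (at t)"
    using field_vector_diff_chain_at[OF of_real_has_vector_derivative, of "bser \<nu>"] bser_shift(1)[of \<nu> "of_real t"]
    by (simp add: o_def)
  then have "(bess \<nu> has_vector_derivative (of_real t powr \<nu> * ?d + (\<nu> * of_real t powr (\<nu> - 1)) * bser \<nu> (of_real t))) (at t)"
    unfolding bess_def
    by (intro has_vector_derivative_mult powr_of_real_has_vector_derivative assms)
  moreover have "complex_of_real t powr \<nu> = of_real t powr (\<nu> - 1) * of_real t"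
    using assms by (simp add: powr_diff)
  then have "of_real t powr \<nu> * ?d + (\<nu> * of_real t powr (\<nu> - 1)) * bser \<nu> (of_real t) = bess (\<nu> - 1) t"
    unfolding bess_def bser_shift(2)[symmetric] by (simp add: algebra_simps)
  ultimately show ?thesis by simp
qed

lemma bess_recurrence:
  assumes "0 < t"
  shows "of_real t * bess (\<nu> - 2) t + (1 - \<nu>) * bess (\<nu> - 1) t + bess \<nu> t / 4 = 0"
proof -
  have p: "complex_of_real t powr \<nu> = of_real t powr (\<nu> - 1) * of_real t"
     "of_real t * complex_of_real t powr (\<nu> - 2) = of_real t powr (\<nu> - 1)"
    using assms by (auto simp: powr_diff power2_eq_square)
  have "of_real t * bess (\<nu> - 2) t + (1 - \<nu>) * bess (\<nu> - 1) t + bess \<nu> t / 4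
     = of_real t powr (\<nu> - 1) * (bser (\<nu> - 2) t + (1 - \<nu>) * bser (\<nu> - 1) t + of_real t * bser \<nu> t / 4)"
    unfolding bess_def p(1) mult.assoc[symmetric] p(2) by (simp add: algebra_simps)
  then show ?thesis by (simp add: bser_recurrence)
qed

lemma continuous_on_bess: "continuous_on {0<..} (bess \<nu>)"
  by (intro continuous_at_imp_continuous_on ballI)
     (auto intro: has_vector_derivative_continuous bess_has_vector_derivative)

section \<open>Growth of the Bessel functions at zero and at infinity\<close>

lemma norm_powr_of_real: "0 < t \<Longrightarrow> norm (complex_of_real t powr \<nu>) = t powr Re \<nu>"
  by (simp add: norm_powr_real_powr)

lemma bess_bound_near_0: "\<exists>C\<ge>0. \<forall>t. 0 < t \<and> t \<le> 1 \<longrightarrow> norm (bess \<nu> t) \<le> C * t powr Re \<nu>"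
proof -
  have "continuous_on UNIV (bser \<nu>)"
    using bser_shift(1) by (meson DERIV_continuous continuous_at_imp_continuous_on)
  then have "continuous_on {0..1} (\<lambda>t. bser \<nu> (of_real t))"
    by (rule continuous_on_compose2) (auto intro: continuous_intros)
  then have "bounded ((\<lambda>t. bser \<nu> (of_real t)) ` {0..1})"
    by (intro compact_imp_bounded compact_continuous_image) auto
  then obtain C where C: "\<And>t. t \<in> {0..1} \<Longrightarrow> norm (bser \<nu> (of_real t)) \<le> C"
    unfolding bounded_iff by blast
  have "0 \<le> C" using C[of 0] norm_ge_zero[of "bser \<nu> (of_real 0)"] by (simp del: norm_ge_zero)
  moreover have "norm (bess \<nu> t) \<le> C * t powr Re \<nu>" if "0 < t" "t \<le> 1" for t
    using C[of t] that by (simp add: bess_def norm_mult norm_powr_of_real mult_left_mono mult.commute)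
  ultimately show ?thesis by blast
qed

text \<open>The energy \<open>E t = t powr -a * |bess \<alpha> t|\<^sup>2 + 4 * t powr (1-a) * |bess (\<alpha>-1) t|\<^sup>2\<close> is decreasing,
  because the cross terms in its derivative cancel.\<close>

lemma bess_bound_at_top:
  assumes a: "0 \<le> Re \<alpha>" "Re \<alpha> \<le> 1"
  shows "\<exists>C\<ge>0. \<forall>t\<ge>1. norm (bess \<alpha> t) \<le> C * t powr (Re \<alpha> / 2) \<and>
            norm (bess (\<alpha> - 1) t) \<le> C * t powr ((Re \<alpha> - 1) / 2)"
proof -
  define a where "a = Re \<alpha>"
  define E where "E t = t powr (-a) * (norm (bess \<alpha> t))\<^sup>2 + 4 * (t powr (1 - a) * (norm (bess (\<alpha> - 1) t))\<^sup>2)" for t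
  have sq: "((\<lambda>t. (norm (f t))\<^sup>2) has_real_derivative 2 * (f t \<bullet> f')) (at t)"
    if "(f has_vector_derivative f') (at t)" for f :: "real \<Rightarrow> complex" and f' t
    using has_derivative_inner[OF that[unfolded has_vector_derivative_def] that[unfolded has_vector_derivative_def]]
    by (simp add: power2_norm_eq_inner has_field_derivative_def inner_commute algebra_simps fun_eq_iff mult_commute_abs)
  have dec: "E t \<le> E 1" if "1 \<le> t" for t
  proof (rule DERIV_nonpos_imp_nonincreasing[OF that])
    fix x :: real assume x: "1 \<le> x" "x \<le> t"
    let ?B = "bess \<alpha> x" and ?b = "bess (\<alpha> - 1) x"
    have d1: "(bess \<alpha> has_vector_derivative ?b) (at x)"
      using bess_has_vector_derivative x by simp
    have d2: "(bess (\<alpha> - 1) has_vector_derivative bess (\<alpha> - 2) x) (at x)"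
      using bess_has_vector_derivative[of x "\<alpha> - 1"] x by simp
    have e: "bess (\<alpha> - 2) x = ((\<alpha> - 1) * ?b - ?B / 4) / of_real x"
      using bess_recurrence[of x \<alpha>] x by (simp add: field_simps)
    have "b \<bullet> (((\<alpha> - 1) * b - B / 4) / of_real x) = ((a - 1) * (b \<bullet> b) - (b \<bullet> B) / 4) / x" for b B
      using x by (simp add: inner_complex_def a_def field_simps)
    then have i: "?b \<bullet> bess (\<alpha> - 2) x = ((a - 1) * (norm ?b)\<^sup>2 - (?b \<bullet> ?B) / 4) / x"
      unfolding e power2_norm_eq_inner .
    let ?D = "x powr (-a) * (2 * (?B \<bullet> ?b)) + (-a * x powr (-a - 1)) * (norm ?B)\<^sup>2
      + 4 * (x powr (1 - a) * (2 * (?b \<bullet> bess (\<alpha> - 2) x)) + ((1 - a) * x powr (1 - a - 1)) * (norm ?b)\<^sup>2)"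
    have "(E has_real_derivative ?D) (at x)"
      unfolding E_def using x
      by (intro DERIV_add DERIV_mult' DERIV_cmult sq[OF d1] sq[OF d2] has_real_derivative_powr) auto
    moreover have p: "x powr (-a) = x * x powr (-a - 1)" "x powr (1 - a) = x * (x * x powr (-a - 1))"
      using x powr_add[of x "-a-1" 1] powr_add[of x "-a" 1] by (auto simp: algebra_simps)
    have "?D = x powr (-a - 1) * (-a * (norm ?B)\<^sup>2 + 4 * (a - 1) * x * (norm ?b)\<^sup>2)"
      unfolding i p(2) using x p(1) by (simp add: field_simps inner_commute)
    \<comment> \<open>Both remaining coefficients, -a and 4 (a - 1) x, are nonpositive because 0 <=
      a <= 1.\<close>
    moreover have "\<dots> \<le> 0"
    proof (rule mult_nonneg_nonpos[OF _ add_nonpos_nonpos])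
      show "- a * (norm ?B)\<^sup>2 \<le> 0" using a by (intro mult_nonpos_nonneg) (auto simp: a_def)
      show "4 * (a - 1) * x * (norm ?b)\<^sup>2 \<le> 0"
        using a x by (intro mult_nonpos_nonneg[OF mult_nonpos_nonneg]) (auto simp: a_def)
    qed simp
    ultimately show "\<exists>y. DERIV E x :> y \<and> y \<le> 0" by metis
  qed
  have E0: "0 \<le> E 1" by (simp add: E_def)
  have "norm (bess \<alpha> t) \<le> sqrt (E 1) * t powr (a / 2)" if t: "1 \<le> t" for t
  proof -
    have "0 \<le> 4 * (t powr (1 - a) * (norm (bess (\<alpha> - 1) t))\<^sup>2)" by simp
    then have "t powr (-a) * (norm (bess \<alpha> t))\<^sup>2 \<le> E 1"
      using dec[OF t] unfolding E_def[of t] by linarith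
    then have "(norm (bess \<alpha> t))\<^sup>2 \<le> E 1 * t powr a"
      using t by (simp add: powr_minus field_simps)
    also have "\<dots> = (sqrt (E 1) * t powr (a / 2))\<^sup>2"
      using E0 t powr_add[of t "a / 2" "a / 2"] by (simp add: power_mult_distrib) (simp add: power2_eq_square)
    finally show ?thesis using E0 by (simp add: abs_le_square_iff[symmetric])
  qed
  moreover have "norm (bess (\<alpha> - 1) t) \<le> sqrt (E 1) * t powr ((a - 1) / 2)" if t: "1 \<le> t" for t
  proof -
    have "0 \<le> t powr (-a) * (norm (bess \<alpha> t))\<^sup>2" "0 \<le> t powr (1 - a) * (norm (bess (\<alpha> - 1) t))\<^sup>2"
      by simp_all
    then have "t powr (1 - a) * (norm (bess (\<alpha> - 1) t))\<^sup>2 \<le> E 1"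
      using dec[OF t] unfolding E_def[of t] by linarith
    then have "(norm (bess (\<alpha> - 1) t))\<^sup>2 \<le> E 1 * t powr (a - 1)"
      using t by (simp add: powr_diff field_simps)
    also have "\<dots> = (sqrt (E 1) * t powr ((a - 1) / 2))\<^sup>2"
      using E0 t powr_add[of t "(a - 1) / 2" "(a - 1) / 2"] by (simp add: power_mult_distrib) (simp add: power2_eq_square)
    finally show ?thesis using E0 by (simp add: abs_le_square_iff[symmetric])
  qed
  ultimately show ?thesis unfolding a_def using E0 by (intro exI[of _ "sqrt (E 1)"]) auto
qed

text \<open>The three-term recurrence expresses index \<alpha> + k + 1 through two neighbours, so
  the induction carries the bounds for \<alpha> + k and \<alpha> + k - 1 together. Its factor t
  raises the exponent (a + k - 1)/2 to (a + k + 1)/2, which is the claimed growth.\<close>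

lemma bess_bound_sqrt:
  assumes a: "0 < Re \<alpha>" "Re \<alpha> < 1"
  shows "\<exists>C\<ge>0. \<forall>t\<ge>1. norm (bess (\<alpha> + of_nat k) t) \<le> C * t powr ((Re \<alpha> + real k) / 2)"
proof -
  obtain C0 where C0: "0 \<le> C0" "\<And>t. 1 \<le> t \<Longrightarrow> norm (bess \<alpha> t) \<le> C0 * t powr (Re \<alpha> / 2)"
     "\<And>t. 1 \<le> t \<Longrightarrow> norm (bess (\<alpha> - 1) t) \<le> C0 * t powr ((Re \<alpha> - 1) / 2)"
    using bess_bound_at_top[of \<alpha>] a by auto
  have "\<exists>C\<ge>0. \<forall>t\<ge>1. norm (bess (\<alpha> + of_nat k) t) \<le> C * t powr ((Re \<alpha> + real k) / 2) \<and>
          norm (bess (\<alpha> + of_nat k - 1) t) \<le> C * t powr ((Re \<alpha> + real k - 1) / 2)" for k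
  proof (induction k)
    case 0
    then show ?case using C0 by auto
  next
    case (Suc k)
    then obtain C where C: "0 \<le> C" "\<And>t. 1 \<le> t \<Longrightarrow> norm (bess (\<alpha> + of_nat k) t) \<le> C * t powr ((Re \<alpha> + real k) / 2)"
       "\<And>t. 1 \<le> t \<Longrightarrow> norm (bess (\<alpha> + of_nat k - 1) t) \<le> C * t powr ((Re \<alpha> + real k - 1) / 2)"
      by auto
    let ?C = "4 * (C + norm (\<alpha> + of_nat k) * C)"
    have "norm (bess (\<alpha> + of_nat (Suc k)) t) \<le> ?C * t powr ((Re \<alpha> + real (Suc k)) / 2)" if t: "1 \<le> t" for t
    proof -
      have rec: "b = - 4 * (x - y)" if "x - y + b / 4 = 0" for b x y :: complex
        using that by (simp add: field_simps)
      have "bess (\<alpha> + of_nat (Suc k)) t = - 4 * (of_real t * bess (\<alpha> + of_nat k - 1) t - (\<alpha> + of_nat k) * bess (\<alpha> + of_nat k) t)"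
        using bess_recurrence[of t "\<alpha> + of_nat (Suc k)"] t
        by (intro rec) (simp add: algebra_simps)
      then have "norm (bess (\<alpha> + of_nat (Suc k)) t) = 4 * norm (of_real t * bess (\<alpha> + of_nat k - 1) t - (\<alpha> + of_nat k) * bess (\<alpha> + of_nat k) t)"
        by (metis norm_mult norm_minus_cancel norm_numeral)
      then have "norm (bess (\<alpha> + of_nat (Suc k)) t) \<le> 4 * (t * norm (bess (\<alpha> + of_nat k - 1) t) + norm (\<alpha> + of_nat k) * norm (bess (\<alpha> + of_nat k) t))"
        using norm_triangle_ineq4[of "of_real t * bess (\<alpha> + of_nat k - 1) t" "(\<alpha> + of_nat k) * bess (\<alpha> + of_nat k) t"] t
        by (simp add: norm_mult)
      also have "\<dots> \<le> 4 * (t * (C * t powr ((Re \<alpha> + real k - 1) / 2)) + norm (\<alpha> + of_nat k) * (C * t powr ((Re \<alpha> + real k) / 2)))"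
        using t by (intro mult_left_mono add_mono C(2,3)) auto
      also have "t * (C * t powr ((Re \<alpha> + real k - 1) / 2)) = C * t powr ((Re \<alpha> + real (Suc k)) / 2)"
        using t powr_add[of t 1 "(Re \<alpha> + real k - 1) / 2"] by (simp add: field_simps)
      also have "4 * (C * t powr ((Re \<alpha> + real (Suc k)) / 2) + norm (\<alpha> + of_nat k) * (C * t powr ((Re \<alpha> + real k) / 2)))
          \<le> 4 * (C * t powr ((Re \<alpha> + real (Suc k)) / 2) + norm (\<alpha> + of_nat k) * (C * t powr ((Re \<alpha> + real (Suc k)) / 2)))"
        using t C(1) by (intro mult_left_mono add_mono powr_mono) auto
      finally show ?thesis by (simp add: algebra_simps)
    qed
    moreover have "norm (bess (\<alpha> + of_nat (Suc k) - 1) t) \<le> ?C * t powr ((Re \<alpha> + real (Suc k) - 1) / 2)" if t: "1 \<le> t" for t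
    proof -
      have "norm (bess (\<alpha> + of_nat k) t) \<le> C * t powr ((Re \<alpha> + real k) / 2)" by (rule C(2)[OF t])
      also have "\<dots> \<le> ?C * t powr ((Re \<alpha> + real k) / 2)"
        using C(1) mult_nonneg_nonneg[OF norm_ge_zero[of "\<alpha> + of_nat k"] C(1)]
        by (intro mult_right_mono) (argo, simp)
      finally show ?thesis by simp
    qed
    moreover have "0 \<le> ?C" using C(1) by simp
    ultimately show ?case by blast
  qed
  then show ?thesis by meson
qed

text \<open>The bound valid near 0 and the one valid at infinity both extend to the whole half-line,
  since the larger exponent gives the smaller power for t <= 1 and the larger one for t >= 1. Having
  both without case distinctions allows integrals to be dominated at both ends.\<close>

lemma bess_bounds:
  assumes a: "0 < Re \<alpha>" "Re \<alpha> < 1"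
  obtains C where "0 \<le> C"
    "\<And>t. 0 < t \<Longrightarrow> norm (bess (\<alpha> + of_nat k) t) \<le> C * t powr ((Re \<alpha> + real k) / 2)"
    "\<And>t. 0 < t \<Longrightarrow> norm (bess (\<alpha> + of_nat k) t) \<le> C * t powr (Re \<alpha> + real k)"
proof -
  obtain C1 where C1: "0 \<le> C1" "\<And>t. 0 < t \<Longrightarrow> t \<le> 1 \<Longrightarrow> norm (bess (\<alpha> + of_nat k) t) \<le> C1 * t powr (Re \<alpha> + real k)"
    using bess_bound_near_0[of "\<alpha> + of_nat k"] by auto
  obtain C2 where C2: "0 \<le> C2" "\<And>t. 1 \<le> t \<Longrightarrow> norm (bess (\<alpha> + of_nat k) t) \<le> C2 * t powr ((Re \<alpha> + real k) / 2)"
    using bess_bound_sqrt[OF a, of k] by auto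
  have le: "c * x \<le> max C1 C2 * y" if "c \<in> {C1, C2}" "x \<le> y" "0 \<le> x" for c x y
    using that C1(1) C2(1) by (intro mult_mono) auto
  show ?thesis
  proof (rule that[of "max C1 C2"])
    fix t :: real assume t: "0 < t"
    show "norm (bess (\<alpha> + of_nat k) t) \<le> max C1 C2 * t powr ((Re \<alpha> + real k) / 2)"
    proof (cases "t \<le> 1")
      case True
      have "t powr (Re \<alpha> + real k) \<le> t powr ((Re \<alpha> + real k) / 2)"
        using True t a by (intro powr_mono') auto
      with C1(2)[OF t True] le[of C1] show ?thesis by (meson insertI1 order_trans powr_ge_zero)
    next
      case False
      then show ?thesis
        by (intro order_trans[OF C2(2)] le) auto
    qed
    show "norm (bess (\<alpha> + of_nat k) t) \<le> max C1 C2 * t powr (Re \<alpha> + real k)"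
    proof (cases "t \<le> 1")
      case True
      then show ?thesis
        using t by (intro order_trans[OF C1(2)] le) auto
    next
      case False
      have "t powr ((Re \<alpha> + real k) / 2) \<le> t powr (Re \<alpha> + real k)"
        using False t a by (intro powr_mono) auto
      then show ?thesis
        using False by (intro order_trans[OF C2(2)] le) auto
    qed
  qed (use C1 in auto)
qed

subsection \<open>Strong Bochner integrals\<close>

text \<open>The bridge from strong Bochner integrals to gauge integrals: both are the same sum over
  level sets. The value 0 is treated apart, because its level set may have infinite measure.\<close>

lemma simple_bochner_integral_has_integral:
  fixes s :: "real \<Rightarrow> 'b::banach"
  assumes s: "Bochner_Integration.simple_bochner_integrable (lebesgue_on \<Omega>) s" and \<Omega>: "\<Omega> \<in> sets lebesgue"
  shows "(s has_integral Bochner_Integration.simple_bochner_integral (lebesgue_on \<Omega>) s) \<Omega>"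
proof -
  let ?M = "lebesgue_on \<Omega>"
  have sf: "simple_function ?M s" and fin: "emeasure ?M {y \<in> space ?M. s y \<noteq> 0} \<noteq> \<infinity>"
    using s by (auto elim: simple_bochner_integrable.cases)
  define Y where "Y y = {x \<in> \<Omega>. s x = y}" for y
  have meas: "Y y \<in> sets ?M" for y
    using simple_functionD(2)[OF sf, of "{y}"] unfolding Y_def by (simp add: vimage_def Int_def conj_commute)
  have lm: "Y y \<in> lmeasurable" and m: "measure ?M (Y y) = measure lebesgue (Y y)" if "y \<noteq> 0" for y
  proof -
    have l: "Y y \<in> sets lebesgue"
      using meas[of y] \<Omega> by (simp add: sets_restrict_space_iff)
    have sub: "Y y \<subseteq> \<Omega>" by (auto simp: Y_def)
    have "{y \<in> space ?M. s y \<noteq> 0} \<in> sets ?M"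
      using simple_functionD(2)[OF sf, of "- {0}"] by (simp add: vimage_def Int_def conj_commute)
    then have "emeasure ?M (Y y) \<le> emeasure ?M {y \<in> space ?M. s y \<noteq> 0}"
      using that by (intro emeasure_mono) (auto simp: Y_def)
    then have "emeasure ?M (Y y) < \<infinity>" using fin by (simp add: less_top order_le_less_trans)
    moreover have "emeasure ?M (Y y) = emeasure lebesgue (Y y)"
      using sub \<Omega> by (simp add: emeasure_restrict_space)
    ultimately show "Y y \<in> lmeasurable" using l by (auto intro: fmeasurableI)
    show "measure ?M (Y y) = measure lebesgue (Y y)"
      using sub \<Omega> by (simp add: measure_restrict_space)
  qed
  have fins: "finite (s ` \<Omega>)" using simple_functionD(1)[OF sf] by simp
  have "((\<lambda>x. indicator (Y y) x *\<^sub>R y) has_integral (measure ?M (Y y) *\<^sub>R y)) UNIV" for y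
  proof (cases "y = 0")
    case False
    then have "(indicator (Y y) has_integral measure ?M (Y y)) UNIV"
      using lm m lmeasurable_iff_has_integral by metis
    then show ?thesis by (rule has_integral_scaleR_left)
  qed simp
  then have "((\<lambda>x. \<Sum>y\<in>s ` \<Omega>. indicator (Y y) x *\<^sub>R y) has_integral (\<Sum>y\<in>s ` \<Omega>. measure ?M (Y y) *\<^sub>R y)) UNIV"
    by (intro has_integral_sum fins)
  moreover have "(\<Sum>y\<in>s ` \<Omega>. indicator (Y y) x *\<^sub>R y) = (if x \<in> \<Omega> then s x else 0)" for x
  proof (cases "x \<in> \<Omega>")
    case True
    then have "(\<Sum>y\<in>s ` \<Omega>. indicator (Y y) x *\<^sub>R y) = (\<Sum>y\<in>s ` \<Omega>. if y = s x then s x else 0)"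
      by (intro sum.cong) (auto simp: Y_def)
    then show ?thesis using True fins by simp
  next
    case False
    then show ?thesis by (auto simp: Y_def intro!: sum.neutral)
  qed
  ultimately show ?thesis
    unfolding simple_bochner_integral_def Y_def by (simp add: has_integral_restrict_UNIV)
qed

lemma simple_function_grid:
  fixes f :: "real \<Rightarrow> 'b::real_normed_vector"
  assumes a: "0 < a" and n: "0 < (n::real)"
  shows "Bochner_Integration.simple_bochner_integrable (lebesgue_on {0<..})
          (\<lambda>t. if t \<in> {a..b} then f (of_int \<lceil>n * t\<rceil> / n) else 0)"
proof -
  let ?M = "lebesgue_on {0<..} :: real measure"
  \<comment> \<open>The integer 0 can encode a point outside \<open>{a..b}\<close>, because the
    ceiling is positive for t >= a > 0. Since \<open>c\<close> is integer-valued with finite range,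
    composing it with any function gives a simple function.\<close>
  define c where "c t = (if t \<in> {a..b} then \<lceil>n * t\<rceil> else 0)" for t
  have pos: "0 < \<lceil>n * t\<rceil>" if "a \<le> t" for t
    using a n that by (simp add: zero_less_ceiling)
  have fin: "finite (c ` space ?M)"
  proof (rule finite_subset)
    show "c ` space ?M \<subseteq> {0..max 0 \<lceil>n * b\<rceil>}"
      using pos n by (auto simp: c_def le_max_iff_disj less_imp_le[OF pos] simp del: ceiling_le_iff zero_less_ceiling zero_le_ceiling intro!: ceiling_mono)
  qed simp
  have "(\<lambda>t. c t) \<in> measurable borel (count_space UNIV)"
    unfolding c_def by measurable
  then have "c \<in> measurable ?M (count_space UNIV)"
    by (intro measurable_restrict_space1 measurable_completion) simp
  then have "simple_function ?M c"
    using fin simple_function_eq_measurable by blast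
  then have "simple_function ?M (\<lambda>t. (\<lambda>j. if j = 0 then 0 else f (of_int j / n)) (c t))"
    by (rule simple_function_compose1)
  moreover have "(\<lambda>t. (\<lambda>j. if j = 0 then 0 else f (of_int j / n)) (c t)) = (\<lambda>t. if t \<in> {a..b} then f (of_int \<lceil>n * t\<rceil> / n) else 0)"
  proof
    fix t show "(\<lambda>j. if j = 0 then 0 else f (of_int j / n)) (c t) = (if t \<in> {a..b} then f (of_int \<lceil>n * t\<rceil> / n) else 0)"
      using pos[of t] by (auto simp: c_def simp del: zero_less_ceiling)
  qed
  ultimately have sf: "simple_function ?M (\<lambda>t. if t \<in> {a..b} then f (of_int \<lceil>n * t\<rceil> / n) else 0)" (is "simple_function _ ?s")
    by simp
  have "{y \<in> space ?M. ?s y \<noteq> 0} \<subseteq> {a..b}" by auto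
  then have "emeasure ?M {y \<in> space ?M. ?s y \<noteq> 0} \<le> emeasure ?M {a..b}"
    using a by (intro emeasure_mono) (auto simp: sets_restrict_space_iff)
  also have "\<dots> = emeasure lebesgue {a..b}"
    using a by (intro emeasure_restrict_space) auto
  also have "\<dots> < \<infinity>"
    using emeasure_compact_finite[of "{a..b}"] by simp
  finally show ?thesis using sf by (intro simple_bochner_integrable.intros) auto
qed

lemma simple_approx_uniform:
  fixes f :: "real \<Rightarrow> 'b::real_normed_vector"
  assumes f: "continuous_on {0<..} f" and a: "0 < a" and e: "0 < e"
  obtains s where "Bochner_Integration.simple_bochner_integrable (lebesgue_on {0<..}) s"
    "\<And>t. t \<notin> {a..b} \<Longrightarrow> s t = 0" "\<And>t. t \<in> {a..b} \<Longrightarrow> norm (f t - s t) \<le> e"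
proof -
  \<comment> \<open>The sampling point lies to the right of t by less than 1/n < 1, possibly beyond
    b; hence the interval up to b + 1.\<close>
  have "uniformly_continuous_on {a..b+1} f"
    using a by (intro compact_uniformly_continuous continuous_on_subset[OF f]) auto
  then obtain d where d: "0 < d" "\<And>x y. x \<in> {a..b+1} \<Longrightarrow> y \<in> {a..b+1} \<Longrightarrow> dist y x < d \<Longrightarrow> dist (f y) (f x) < e"
    unfolding uniformly_continuous_on_def using e by metis
  define n where "n = 2 / min d 1"
  have n: "0 < n" "1 / n < d" "1 / n < 1" using d(1) by (auto simp: n_def min_def)
  show ?thesis
  proof (rule that[OF simple_function_grid[OF a n(1), of b f]])
    fix t assume t: "t \<in> {a..b}"
    let ?y = "of_int \<lceil>n * t\<rceil> / n"
    have 1: "t \<le> ?y" "?y < t + 1 / n"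
      using n(1) le_of_int_ceiling[of "n * t"] ceiling_correct[of "n * t"] by (auto simp: field_simps)
    then have "dist (f t) (f ?y) < e"
      using t n(2,3) by (intro d(2)) (auto simp: dist_real_def)
    then show "norm (f t - (if t \<in> {a..b} then f ?y else 0)) \<le> e"
      using t by (simp add: dist_norm)
  qed auto
qed

lemma emeasure_Icc_pos:
  assumes "0 < a" "a \<le> b"
  shows "emeasure (lebesgue_on {0<..}) {a..b::real} = ennreal (b - a)"
  using assms by (subst emeasure_restrict_space) auto

text \<open>Every strong integral over the half-line with continuous integrand of compact support is
  evaluated through this lemma. Simple functions within 1/(i+1) of f uniformly on
  \<open>{a..b}\<close> have an L1 error of at most (b - a)/(i+1), and the same estimate controls
  their gauge integrals.\<close>

lemma has_strong_bochner_integral_compact_support: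
  fixes f :: "real \<Rightarrow> 'b::banach"
  assumes f: "continuous_on {0<..} f" and a: "0 < a" "a \<le> b" and z: "\<And>t. 0 < t \<Longrightarrow> t \<notin> {a..b} \<Longrightarrow> f t = 0"
  shows "has_strong_bochner_integral (lebesgue_on {0<..}) f (integral {a..b} f)"
proof -
  let ?M = "lebesgue_on {0<..} :: real measure"
  have "\<exists>s. \<forall>i. Bochner_Integration.simple_bochner_integrable ?M (s i) \<and> (\<forall>t. t \<notin> {a..b} \<longrightarrow> s i t = 0)
         \<and> (\<forall>t\<in>{a..b}. norm (f t - s i t) \<le> 1 / real (Suc i))"
    by (intro choice allI) (metis simple_approx_uniform[OF f a(1)] of_nat_0_less_iff zero_less_Suc zero_less_divide_1_iff)
  then obtain s where s: "\<And>i. Bochner_Integration.simple_bochner_integrable ?M (s i)"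
     "\<And>i t. t \<notin> {a..b} \<Longrightarrow> s i t = 0" "\<And>i t. t \<in> {a..b} \<Longrightarrow> norm (f t - s i t) \<le> 1 / real (Suc i)"
    by blast
  have le: "norm (f t - s i t) \<le> 1 / real (Suc i) * indicator {a..b} t" if "0 < t" for i t
    using s(2,3) z that by (auto simp: indicator_def)
  have lim0: "(\<lambda>i. 1 / real (Suc i)) \<longlonglongrightarrow> 0"
    using LIMSEQ_inverse_real_of_nat by (simp add: inverse_eq_divide)
  have "strongly_measurable ?M f"
    unfolding strongly_measurable_def
  proof (intro exI[of _ s] conjI allI AE_I2)
    show "simple_function ?M (s i)" for i using s(1)[of i] by (auto elim: simple_bochner_integrable.cases)
    fix t assume "t \<in> space ?M"
    then have t: "0 < t" by simp
    have "(\<lambda>i. norm (s i t - f t)) \<longlonglongrightarrow> 0"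
    proof (rule tendsto_sandwich[OF _ _ tendsto_const lim0])
      show "\<forall>\<^sub>F i in sequentially. norm (s i t - f t) \<le> 1 / real (Suc i)"
      proof (intro always_eventually allI)
        fix i
        have "1 / real (Suc i) * indicator {a..b} t \<le> 1 / real (Suc i)"
          by (auto simp: indicator_def)
        then show "norm (s i t - f t) \<le> 1 / real (Suc i)"
          using le[OF t, of i] by (simp add: norm_minus_commute)
      qed
    qed simp
    then show "(\<lambda>i. s i t) \<longlonglongrightarrow> f t" by (simp add: LIM_zero_iff tendsto_norm_zero_iff)
  qed
  moreover have "(\<lambda>i. \<integral>\<^sup>+x. ennreal (norm (f x - s i x)) \<partial>?M) \<longlonglongrightarrow> 0"
  proof (rule tendsto_sandwich[OF _ _ tendsto_const])
    have "(\<integral>\<^sup>+x. ennreal (norm (f x - s i x)) \<partial>?M) \<le> ennreal (1 / real (Suc i) * (b - a))" for i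
    proof -
      have "(\<integral>\<^sup>+x. ennreal (norm (f x - s i x)) \<partial>?M) \<le> (\<integral>\<^sup>+x. ennreal (1 / real (Suc i)) * indicator {a..b} x \<partial>?M)"
      proof (rule nn_integral_mono)
        fix x :: real assume "x \<in> space ?M"
        then have "ennreal (norm (f x - s i x)) \<le> ennreal (1 / real (Suc i) * indicator {a..b} x)"
          by (intro ennreal_leI le) simp
        then show "ennreal (norm (f x - s i x)) \<le> ennreal (1 / real (Suc i)) * indicator {a..b} x"
          by (auto simp: indicator_def split: if_splits)
      qed
      also have "\<dots> = ennreal (1 / real (Suc i)) * ennreal (b - a)"
        using a emeasure_Icc_pos[OF a] by (subst nn_integral_cmult_indicator) (auto simp: sets_restrict_space_iff)
      finally show ?thesis using a by (simp add: ennreal_mult[symmetric])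
    qed
    then show "\<forall>\<^sub>F i in sequentially. (\<integral>\<^sup>+x. ennreal (norm (f x - s i x)) \<partial>?M) \<le> ennreal (1 / real (Suc i) * (b - a))"
      by simp
    show "(\<lambda>i. ennreal (1 / real (Suc i) * (b - a))) \<longlonglongrightarrow> 0"
      using tendsto_mult_left_zero[OF lim0, of "b - a"] by (metis ennreal_0 tendsto_ennrealI)
  qed simp
  moreover have "(\<lambda>i. Bochner_Integration.simple_bochner_integral ?M (s i)) \<longlonglongrightarrow> integral {a..b} f"
  proof -
    have fi: "(f has_integral integral {a..b} f) {a..b}"
      using a by (intro integrable_integral integrable_continuous_real continuous_on_subset[OF f]) auto
    have si: "(s i has_integral Bochner_Integration.simple_bochner_integral ?M (s i)) {a..b}" for i
    proof -
      have "(s i has_integral Bochner_Integration.simple_bochner_integral ?M (s i)) {0<..}"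
        by (rule simple_bochner_integral_has_integral[OF s(1)]) auto
      then have "((\<lambda>x. if x \<in> {0<..} then s i x else 0) has_integral Bochner_Integration.simple_bochner_integral ?M (s i)) UNIV"
        by (simp only: has_integral_restrict_UNIV)
      moreover have "(\<lambda>x. if x \<in> {0<..} then s i x else 0) = (\<lambda>x. if x \<in> {a..b} then s i x else 0)"
        using s(2)[of _ i] a by (auto simp: fun_eq_iff)
      ultimately show ?thesis by (simp only: has_integral_restrict_UNIV)
    qed
    have "norm (Bochner_Integration.simple_bochner_integral ?M (s i) - integral {a..b} f) \<le> 1 / real (Suc i) * (b - a)" for i
      using has_integral_bound_real[OF _ _ has_integral_diff[OF si[of i] fi], of "1 / real (Suc i)" "{}"] s(3)[of _ i] a
      by (simp add: norm_minus_commute)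
    then have "(\<lambda>i. Bochner_Integration.simple_bochner_integral ?M (s i) - integral {a..b} f) \<longlonglongrightarrow> 0"
      using tendsto_mult_left_zero[OF lim0, of "b - a"] by (rule Lim_null_comparison[OF always_eventually[OF allI]])
    then show ?thesis by (simp add: LIM_zero_iff)
  qed
  ultimately show ?thesis
    unfolding has_strong_bochner_integral_def using s(1) by blast
qed

text \<open>The function norm (f - s) is only almost everywhere equal to a Borel function.
  Additivity of the nonnegative integral is applied to such Borel versions, and the resulting
  integrals are then carried back.\<close>

lemma strong_nn_integral_triangle:
  fixes f :: "'a \<Rightarrow> 'b::real_normed_vector"
  assumes f: "strongly_measurable M f" and s: "simple_function M s" and t: "simple_function M t"
    and k: "\<And>x. x \<in> space M \<Longrightarrow> norm (k x) \<le> c * norm (f x - s x) + d * norm (f x - t x)" and c: "0 \<le> c" "0 \<le> d"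
  shows "(\<integral>\<^sup>+x. ennreal (norm (k x)) \<partial>M) \<le>
     ennreal c * (\<integral>\<^sup>+x. ennreal (norm (f x - s x)) \<partial>M) + ennreal d * (\<integral>\<^sup>+x. ennreal (norm (f x - t x)) \<partial>M)"
proof -
  obtain g where g: "g \<in> borel_measurable M" "AE x in M. ennreal (norm (f x - s x)) = g x"
    using strongly_measurable_AE_norm_measurable[OF f s] by blast
  obtain h where h: "h \<in> borel_measurable M" "AE x in M. ennreal (norm (f x - t x)) = h x"
    using strongly_measurable_AE_norm_measurable[OF f t] by blast
  have "(\<integral>\<^sup>+x. ennreal (norm (k x)) \<partial>M) \<le> (\<integral>\<^sup>+x. ennreal c * g x + ennreal d * h x \<partial>M)"
  proof (rule nn_integral_mono_AE)
    show "AE x in M. ennreal (norm (k x)) \<le> ennreal c * g x + ennreal d * h x"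
      using g(2) h(2) AE_space
    proof eventually_elim
      case (elim x)
      then have "ennreal (norm (k x)) \<le> ennreal (c * norm (f x - s x) + d * norm (f x - t x))"
        using k by (intro ennreal_leI) auto
      also have "\<dots> = ennreal c * g x + ennreal d * h x"
        unfolding elim(1,2)[symmetric] using c by (simp add: ennreal_mult[symmetric] ennreal_plus[symmetric] del: ennreal_plus)
      finally show ?case .
    qed
  qed
  also have "\<dots> = ennreal c * (\<integral>\<^sup>+x. g x \<partial>M) + ennreal d * (\<integral>\<^sup>+x. h x \<partial>M)"
    using g(1) h(1) by (simp add: nn_integral_add nn_integral_cmult)
  also have "(\<integral>\<^sup>+x. g x \<partial>M) = (\<integral>\<^sup>+x. ennreal (norm (f x - s x)) \<partial>M)"
    using nn_integral_cong_AE[OF g(2)] by simp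
  also have "(\<integral>\<^sup>+x. h x \<partial>M) = (\<integral>\<^sup>+x. ennreal (norm (f x - t x)) \<partial>M)"
    using nn_integral_cong_AE[OF h(2)] by simp
  finally show ?thesis .
qed

text \<open>In a Banach space the limit of the simple integrals need not be supplied: L1
  approximation makes them a Cauchy sequence.\<close>

lemma strong_bochner_integrableI:
  fixes f :: "'a \<Rightarrow> 'b::banach"
  assumes f: "strongly_measurable M f" and s: "\<And>i. Bochner_Integration.simple_bochner_integrable M (s i)"
    and lim: "(\<lambda>i::nat. \<integral>\<^sup>+x. ennreal (norm (f x - s i x)) \<partial>M) \<longlonglongrightarrow> 0"
  shows "strong_bochner_integrable M f"
proof -
  let ?I = "\<lambda>i. Bochner_Integration.simple_bochner_integral M (s i)"
  let ?S = "\<lambda>i. \<integral>\<^sup>+x. ennreal (norm (f x - s i x)) \<partial>M"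
  have sf: "simple_function M (s i)" for i
    using s[of i] by (auto elim: simple_bochner_integrable.cases)
  have bound: "ennreal (norm (?I i - ?I j)) \<le> ?S i + ?S j" for i j
  proof -
    have st: "Bochner_Integration.simple_bochner_integrable M (\<lambda>x. s i x - s j x)"
      by (rule simple_bochner_integrable_compose2[OF _ s s]) simp
    have "?I i - ?I j = Bochner_Integration.simple_bochner_integral M (\<lambda>x. s i x - s j x)"
      using s by (simp add: simple_bochner_integral_diff)
    then have "ennreal (norm (?I i - ?I j)) \<le> ennreal (Bochner_Integration.simple_bochner_integral M (\<lambda>x. norm (s i x - s j x)))"
      using simple_bochner_integral_norm_bound[OF st] by (simp add: ennreal_leI)
    also have "\<dots> = (\<integral>\<^sup>+x. ennreal (norm (s i x - s j x)) \<partial>M)"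
      by (rule simple_bochner_integral_eq_nn_integral)
         (auto intro: simple_bochner_integrable_compose2[OF _ s s, where p = "\<lambda>a b. norm (a - b)"])
    also have "\<dots> \<le> ennreal 1 * ?S i + ennreal 1 * ?S j"
    proof (rule strong_nn_integral_triangle[OF f sf sf])
      show "norm (s i x - s j x) \<le> 1 * norm (f x - s i x) + 1 * norm (f x - s j x)" for x
        using norm_triangle_ineq4[of "f x - s j x" "f x - s i x"] by simp
    qed simp_all
    finally show ?thesis by simp
  qed
  have "Cauchy ?I"
  proof (rule CauchyI)
    fix e :: real assume e: "0 < e"
    then have "\<forall>\<^sub>F i in sequentially. ?S i < ennreal (e / 2)"
      by (intro order_tendstoD(2)[OF lim]) simp
    then obtain N where N: "\<And>i. N \<le> i \<Longrightarrow> ?S i < ennreal (e / 2)"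
      unfolding eventually_sequentially by blast
    have "norm (?I m - ?I n) < e" if "N \<le> m" "N \<le> n" for m n
    proof -
      have "ennreal (norm (?I m - ?I n)) \<le> ?S m + ?S n" by (rule bound)
      also have "\<dots> < ennreal (e / 2) + ennreal (e / 2)"
        using N that by (intro add_strict_mono) auto
      also have "\<dots> = ennreal e" using e by (simp add: ennreal_plus[symmetric] del: ennreal_plus)
      finally show ?thesis using e by (simp add: ennreal_less_iff)
    qed
    then show "\<exists>M. \<forall>m\<ge>M. \<forall>n\<ge>M. norm (?I m - ?I n) < e" by blast
  qed
  then obtain I where "?I \<longlonglongrightarrow> I" by (auto simp: Cauchy_convergent_iff convergent_def)
  then show ?thesis
    unfolding strong_bochner_integrable_def has_strong_bochner_integral_def using f s lim by blast
qed

lemma has_strong_bochner_integral_bounded_linear: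
  fixes f :: "'a \<Rightarrow> 'b::real_normed_vector" and T :: "'b \<Rightarrow> 'c::real_normed_vector"
  assumes f: "has_strong_bochner_integral M f I" and T: "bounded_linear T"
  shows "has_strong_bochner_integral M (\<lambda>x. T (f x)) (T I)"
proof -
  interpret T: bounded_linear T by fact
  obtain K where K: "0 \<le> K" "\<And>x. norm (T x) \<le> norm x * K" using T.nonneg_bounded by blast
  obtain s where s: "\<And>i. Bochner_Integration.simple_bochner_integrable M (s i)"
      "(\<lambda>i::nat. \<integral>\<^sup>+x. ennreal (norm (f x - s i x)) \<partial>M) \<longlonglongrightarrow> 0"
      "(\<lambda>i. Bochner_Integration.simple_bochner_integral M (s i)) \<longlonglongrightarrow> I" and fm: "strongly_measurable M f"
    using f unfolding has_strong_bochner_integral_def by blast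
  have sf: "simple_function M (s i)" for i
    using s(1)[of i] by (auto elim: simple_bochner_integrable.cases)
  have "strongly_measurable M (\<lambda>x. T (f x))"
  proof -
    obtain r where r: "\<And>i. simple_function M (r i)" "AE x in M. (\<lambda>i::nat. r i x) \<longlonglongrightarrow> f x"
      using fm unfolding strongly_measurable_def by blast
    have "AE x in M. (\<lambda>i. T (r i x)) \<longlonglongrightarrow> T (f x)"
      using r(2) by eventually_elim (rule T.tendsto)
    then show ?thesis
      unfolding strongly_measurable_def using simple_function_compose1[OF r(1), of T] by (intro exI[of _ "\<lambda>i x. T (r i x)"]) auto
  qed
  moreover have "Bochner_Integration.simple_bochner_integrable M (\<lambda>x. T (s i x))" for i
    by (rule simple_bochner_integrable_compose2[OF _ s(1) s(1), where p = "\<lambda>a b. T a"]) simp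
  moreover have "(\<lambda>i. \<integral>\<^sup>+x. ennreal (norm (T (f x) - T (s i x))) \<partial>M) \<longlonglongrightarrow> 0"
  proof (rule tendsto_sandwich[OF _ _ tendsto_const])
    have "(\<integral>\<^sup>+x. ennreal (norm (T (f x) - T (s i x))) \<partial>M) \<le> ennreal K * (\<integral>\<^sup>+x. ennreal (norm (f x - s i x)) \<partial>M) + ennreal 0 * (\<integral>\<^sup>+x. ennreal (norm (f x - s i x)) \<partial>M)" for i
      using K(2)[of "f _ - s i _"] K(1)
      by (intro strong_nn_integral_triangle[OF fm sf sf]) (auto simp: T.diff mult.commute)
    then show "\<forall>\<^sub>F i in sequentially. (\<integral>\<^sup>+x. ennreal (norm (T (f x) - T (s i x))) \<partial>M) \<le> ennreal K * (\<integral>\<^sup>+x. ennreal (norm (f x - s i x)) \<partial>M)"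
      by simp
    show "(\<lambda>i. ennreal K * (\<integral>\<^sup>+x. ennreal (norm (f x - s i x)) \<partial>M)) \<longlonglongrightarrow> 0"
      using ennreal_tendsto_cmult[OF _ s(2), of "ennreal K"] by simp
  qed simp
  moreover have "(\<lambda>i. Bochner_Integration.simple_bochner_integral M (\<lambda>x. T (s i x))) \<longlonglongrightarrow> T I"
    using T.tendsto[OF s(3)] by (simp add: simple_bochner_integral_linear[OF T.linear_axioms s(1)])
  ultimately show ?thesis
    unfolding has_strong_bochner_integral_def by (intro conjI exI[of _ "\<lambda>i x. T (s i x)"]) auto
qed

lemma nn_integral_norm_finite_of_approx:
  fixes g :: "'a \<Rightarrow> 'b::real_normed_vector"
  assumes "Bochner_Integration.simple_bochner_integrable M s"
  shows "(\<integral>\<^sup>+x. ennreal (norm (s x)) \<partial>M) < \<infinity>"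
proof -
  have "Bochner_Integration.simple_bochner_integrable M (\<lambda>x. norm (s x))"
    by (rule simple_bochner_integrable_compose2[OF _ assms assms, where p = "\<lambda>a b. norm a"]) simp
  then have "ennreal (Bochner_Integration.simple_bochner_integral M (\<lambda>x. norm (s x))) = (\<integral>\<^sup>+x. ennreal (norm (s x)) \<partial>M)"
    by (rule simple_bochner_integral_eq_nn_integral) simp
  then show ?thesis by (metis ennreal_less_top infinity_ennreal_def)
qed

section \<open>Complex scalar multiplication as a bounded bilinear map\<close>

lemma bounded_bilinear_scaleC: "bounded_bilinear (scaleC :: complex \<Rightarrow> 'a::complex_banach \<Rightarrow> 'a)"
proof
  fix r :: real and a :: complex and b :: 'a
  have "r *\<^sub>R a = complex_of_real r * a" by (simp add: scaleR_conv_of_real)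
  then show "(r *\<^sub>R a) *\<^sub>C b = r *\<^sub>R (a *\<^sub>C b)"
    by (simp add: scaleC_scaleC[symmetric] scaleC_of_real)
  have "a *\<^sub>C (r *\<^sub>R b) = (a * complex_of_real r) *\<^sub>C b"
    by (simp add: scaleC_of_real[symmetric] scaleC_scaleC)
  also have "\<dots> = r *\<^sub>R (a *\<^sub>C b)"
    by (simp add: mult.commute[of a] scaleC_scaleC[symmetric] scaleC_of_real)
  finally show "a *\<^sub>C (r *\<^sub>R b) = r *\<^sub>R (a *\<^sub>C b)" .
  show "\<exists>K. \<forall>a b. norm (a *\<^sub>C (b::'a)) \<le> norm a * norm b * K"
    by (intro exI[of _ 1]) (simp add: norm_scaleC)
qed (simp_all add: scaleC_add_left scaleC_add_right)

interpretation scaleC: bounded_bilinear "scaleC :: complex \<Rightarrow> 'a::complex_banach \<Rightarrow> 'a"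
  by (rule bounded_bilinear_scaleC)

lemmas continuous_on_scaleC [continuous_intros] = scaleC.continuous_on
lemmas scaleC_zero [simp] = scaleC.zero_left scaleC.zero_right
lemma scaleC_one [simp]: "1 *\<^sub>C x = (x :: 'a::complex_banach)"
  using scaleC_of_real[of 1 x] by simp

text \<open>\<open>K\<close> is an arbitrary compact set, so simple functions that approximate y
  uniformly on the interval from Inf K to Sup K are restricted to it. The finite measure of
  \<open>K\<close> turns uniform approximation into L1 approximation.\<close>

lemma strong_bochner_integrable_compact:
  fixes y :: "real \<Rightarrow> 'b::banach"
  assumes y: "continuous_on {0<..} y" and K: "compact K" "K \<subseteq> {0<..}"
  shows "strong_bochner_integrable (lebesgue_on K) y"
proof (cases "K = {}")
  case True
  have "strongly_measurable (lebesgue_on K) y"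
    unfolding strongly_measurable_def using True by (intro exI[of _ "\<lambda>_ _. 0"]) auto
  then show ?thesis
    using True by (intro strong_bochner_integrableI[where s = "\<lambda>_ _. 0"])
      (auto simp: nn_integral_empty simple_bochner_integrable.simps)
next
  case False
  define a where "a = Inf K"
  define b where "b = Sup K"
  have bdd: "bdd_below K" "bdd_above K" using compact_imp_bounded[OF K(1)] by (auto intro: bounded_imp_bdd_below bounded_imp_bdd_above)
  have aK: "a \<in> K" unfolding a_def
    using K(1) False bdd by (intro closed_contains_Inf) (auto intro: compact_imp_closed)
  have Kab: "K \<subseteq> {a..b}" unfolding a_def b_def
    using bdd by (auto intro: cInf_lower cSup_upper)
  have a: "0 < a" "a \<le> b" using aK K(2) Kab by auto
  let ?P = "lebesgue_on {0<..} :: real measure" let ?M = "lebesgue_on K"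
  have KS: "K \<in> sets lebesgue" using K(1) by (simp add: borel_compact)
  have KP: "lebesgue_on K = restrict_space ?P K"
    using K(2) KS by (subst restrict_restrict_space) (auto simp: Int_absorb1)
  have "\<exists>s. \<forall>i. Bochner_Integration.simple_bochner_integrable ?P (s i) \<and> (\<forall>t\<in>{a..b}. norm (y t - s i t) \<le> 1 / real (Suc i))"
    by (intro choice allI) (metis simple_approx_uniform[OF y a(1)] of_nat_0_less_iff zero_less_Suc zero_less_divide_1_iff)
  then obtain s where s: "\<And>i. Bochner_Integration.simple_bochner_integrable ?P (s i)"
     "\<And>i t. t \<in> {a..b} \<Longrightarrow> norm (y t - s i t) \<le> 1 / real (Suc i)"
    by blast
  have lim0: "(\<lambda>i. 1 / real (Suc i)) \<longlonglongrightarrow> 0"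
    using LIMSEQ_inverse_real_of_nat by (simp add: inverse_eq_divide)
  have em: "emeasure ?M K < \<infinity>"
    using emeasure_compact_finite[OF K(1)] KS by (simp add: emeasure_restrict_space borel_compact K(1))
  have sM: "Bochner_Integration.simple_bochner_integrable ?M (s i)" for i
  proof (intro simple_bochner_integrable.intros)
    have "simple_function ?P (s i)" using s(1)[of i] by (auto elim: simple_bochner_integrable.cases)
    note * = this
    show sf: "simple_function ?M (s i)"
      unfolding simple_function_def
    proof (intro conjI ballI)
      show "finite (s i ` space ?M)"
        by (rule finite_subset[OF _ simple_functionD(1)[OF *]]) (use K(2) in auto)
      fix y
      have "K \<inter> (s i -` {y} \<inter> space ?P) \<in> sets (restrict_space ?P K)"
        by (subst sets_restrict_space) (rule imageI, rule simple_functionD(2)[OF *])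
      moreover have "s i -` {y} \<inter> space ?M = K \<inter> (s i -` {y} \<inter> space ?P)" using K(2) by auto
      ultimately show "s i -` {y} \<inter> space ?M \<in> sets ?M"
        using KP by metis
    qed
    have "emeasure ?M {x \<in> space ?M. s i x \<noteq> 0} \<le> emeasure ?M K"
      by (intro emeasure_mono) (auto simp: KS sets_restrict_space_iff)
    from le_less_trans[OF this em] show "emeasure ?M {x \<in> space ?M. s i x \<noteq> 0} \<noteq> \<infinity>"
      by (rule less_imp_neq)
  qed
  show ?thesis
  proof (rule strong_bochner_integrableI[OF _ sM])
    show "strongly_measurable ?M y"
      unfolding strongly_measurable_def
    proof (intro exI[of _ s] conjI allI AE_I2)
      show "simple_function ?M (s i)" for i using sM[of i] by (auto elim: simple_bochner_integrable.cases)
      fix t assume "t \<in> space ?M"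
      then have "t \<in> {a..b}" using Kab by auto
      then have "(\<lambda>i. s i t - y t) \<longlonglongrightarrow> 0"
        using s(2) by (intro Lim_null_comparison[OF _ lim0] always_eventually allI) (simp add: norm_minus_commute)
      then show "(\<lambda>i. s i t) \<longlonglongrightarrow> y t" by (simp add: LIM_zero_iff)
    qed
    show "(\<lambda>i. \<integral>\<^sup>+x. ennreal (norm (y x - s i x)) \<partial>?M) \<longlonglongrightarrow> 0"
    proof (rule tendsto_sandwich[OF _ _ tendsto_const])
      have "(\<integral>\<^sup>+x. ennreal (norm (y x - s i x)) \<partial>?M) \<le> ennreal (1 / real (Suc i)) * emeasure ?M K" for i
      proof -
        have "(\<integral>\<^sup>+x. ennreal (norm (y x - s i x)) \<partial>?M) \<le> (\<integral>\<^sup>+x. ennreal (1 / real (Suc i)) \<partial>?M)"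
          using Kab by (intro nn_integral_mono ennreal_leI s(2)) auto
        then show ?thesis by simp
      qed
      then show "\<forall>\<^sub>F i in sequentially. (\<integral>\<^sup>+x. ennreal (norm (y x - s i x)) \<partial>?M) \<le> ennreal (1 / real (Suc i)) * emeasure ?M K"
        by simp
      have "(\<lambda>i. ennreal (1 / real (Suc i))) \<longlonglongrightarrow> 0"
        using lim0 by (metis ennreal_0 tendsto_ennrealI)
      then have "(\<lambda>i. emeasure ?M K * ennreal (1 / real (Suc i))) \<longlonglongrightarrow> emeasure ?M K * 0"
        using em by (intro ennreal_tendsto_cmult) auto
      then show "(\<lambda>i. ennreal (1 / real (Suc i)) * emeasure ?M K) \<longlonglongrightarrow> 0"
        by (simp add: mult.commute)
    qed simp
  qed
qed

text \<open>This gives a meaning to the right-hand side of the weak equation, where g is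
  \<open>A u\<close> and only integrability over compact sets is known. The product of simple
  approximations \<open>\<psi> i\<close> of \<phi> and \<open>s i\<close> of g has an L1 error of at
  most B ||g - s_i|| + d_i ||s_i||, with B a bound for \<phi>.\<close>

lemma strong_bochner_integrable_scaleC:
  fixes g :: "real \<Rightarrow> 'b::complex_banach"
  assumes \<phi>: "continuous_on {0<..} \<phi>" "\<And>t. 0 < t \<Longrightarrow> t \<notin> {a..b} \<Longrightarrow> \<phi> t = 0" and a: "0 < a" "a \<le> b"
    and g: "strong_bochner_integrable (lebesgue_on {a..b}) g"
  shows "strong_bochner_integrable (lebesgue_on {0<..}) (\<lambda>t. \<phi> t *\<^sub>C g t)"
proof -
  let ?P = "lebesgue_on {0<..} :: real measure" let ?M = "lebesgue_on {a..b}"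
  have sub: "{a..b} \<subseteq> {0<..}" using a by auto
  have KP: "?M = restrict_space ?P {a..b}"
    using sub by (simp add: restrict_restrict_space Int_absorb1)
  have KS: "{a..b} \<in> sets ?P" using sub by (simp add: sets_restrict_space_iff)
  obtain s where s: "\<And>i. Bochner_Integration.simple_bochner_integrable ?M (s i)"
      "(\<lambda>i::nat. \<integral>\<^sup>+x. ennreal (norm (g x - s i x)) \<partial>?M) \<longlonglongrightarrow> 0" and gm: "strongly_measurable ?M g"
    using g unfolding strong_bochner_integrable_def has_strong_bochner_integral_def by blast
  have sf: "simple_function ?M (s i)" for i
    using s(1)[of i] by (auto elim: simple_bochner_integrable.cases)
  have ext: "simple_function ?P (\<lambda>x. if x \<in> {a..b} then h x else 0)" if "simple_function ?M h" for h :: "real \<Rightarrow> 'b"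
  proof -
    have "simple_function ?M h \<longleftrightarrow> finite (h ` {a..b}) \<and> (\<forall>x\<in>h ` {a..b}. h -` {x} \<inter> {a..b} \<in> sets ?M)"
      by (simp add: simple_function_def)
    then have 1: "finite (h ` {a..b})" "\<And>x. h -` {x} \<inter> {a..b} \<in> sets ?M"
      using that simple_functionD(2)[OF that] by auto
    have 2: "h -` {x} \<inter> {a..b} \<in> sets ?P" for x
      using 1(2)[of x] KS unfolding KP by (simp add: sets_restrict_space_iff)
    show ?thesis
      unfolding simple_function_def
    proof (intro conjI ballI)
      show "finite ((\<lambda>x. if x \<in> {a..b} then h x else 0) ` space ?P)"
        by (rule finite_subset[of _ "insert 0 (h ` {a..b})"]) (use 1 in auto)
      fix y
      have "(\<lambda>x. if x \<in> {a..b} then h x else 0) -` {y} \<inter> space ?P = (h -` {y} \<inter> {a..b}) \<union> (if y = 0 then space ?P - {a..b} else {})"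
        using sub by (auto split: if_splits)
      then show "(\<lambda>x. if x \<in> {a..b} then h x else 0) -` {y} \<inter> space ?P \<in> sets ?P"
        using 2 KS by (simp add: sets.Un sets.Diff sets.top del: space_restrict_space space_lebesgue_on)
    qed
  qed
  have fin: "(\<integral>\<^sup>+x. ennreal (norm (s i x)) \<partial>?M) < \<infinity>" for i
    by (rule nn_integral_norm_finite_of_approx[OF s(1)])
  \<comment> \<open>The accuracy demanded of \<open>\<psi> i\<close> is fixed after
    \<open>s i\<close>, so that d_i times the L1 norm of \<open>s i\<close> is at most 1/(i+1)
    although these norms are not known to be bounded in advance. The summand 1 avoids division by
    zero.\<close>
  define d where "d i = 1 / (real (Suc i) * (1 + enn2real (\<integral>\<^sup>+x. ennreal (norm (s i x)) \<partial>?M)))" for i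
  have d: "0 < d i" for i by (auto simp: d_def intro!: divide_pos_pos mult_pos_pos add_pos_nonneg)
  have "\<exists>\<psi>. \<forall>i. Bochner_Integration.simple_bochner_integrable ?P (\<psi> i) \<and> (\<forall>t\<in>{a..b}. norm (\<phi> t - \<psi> i t) \<le> d i)"
    by (intro choice allI) (metis simple_approx_uniform[OF \<phi>(1) a(1) d])
  then obtain \<psi> where \<psi>: "\<And>i. Bochner_Integration.simple_bochner_integrable ?P (\<psi> i)"
     "\<And>i t. t \<in> {a..b} \<Longrightarrow> norm (\<phi> t - \<psi> i t) \<le> d i"
    by blast
  have \<psi>f: "simple_function ?P (\<psi> i)" for i
    using \<psi>(1)[of i] by (auto elim: simple_bochner_integrable.cases)
  have "bounded (\<phi> ` {a..b})"
    using \<phi>(1) sub by (intro compact_imp_bounded compact_continuous_image) (auto intro: continuous_on_subset)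
  then obtain B where B: "\<And>t. t \<in> {a..b} \<Longrightarrow> norm (\<phi> t) \<le> B" unfolding bounded_iff by blast
  have B0: "0 \<le> B" using B[of a] a norm_ge_zero[of "\<phi> a"] by (simp del: norm_ge_zero)
  have lim0: "(\<lambda>i. 1 / real (Suc i)) \<longlonglongrightarrow> 0"
    using LIMSEQ_inverse_real_of_nat by (simp add: inverse_eq_divide)
  have dle: "d i \<le> 1 / real (Suc i)" for i
    unfolding d_def by (intro divide_left_mono) (auto simp: mult_le_cancel_left1 intro!: mult_pos_pos add_pos_nonneg)
  have \<psi>lim: "(\<lambda>i. \<psi> i t) \<longlonglongrightarrow> \<phi> t" if "t \<in> {a..b}" for t
  proof -
    have "(\<lambda>i. \<psi> i t - \<phi> t) \<longlonglongrightarrow> 0"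
      using \<psi>(2)[OF that] dle by (intro Lim_null_comparison[OF _ lim0] always_eventually allI) (metis norm_minus_commute order_trans)
    then show ?thesis by (simp add: LIM_zero_iff)
  qed
  let ?r = "\<lambda>i x. if x \<in> {a..b} then \<psi> i x *\<^sub>C s i x else 0"
  have rsf: "simple_function ?P (\<lambda>x. if x \<in> {a..b} then \<psi> i x *\<^sub>C h x else 0)" if "simple_function ?M h" for h :: "real \<Rightarrow> 'b" and i
  proof -
    have "simple_function ?P (\<lambda>x. \<psi> i x *\<^sub>C (if x \<in> {a..b} then h x else 0))"
      by (rule simple_function_compose2[OF \<psi>f ext[OF that]])
    then show ?thesis by (simp add: if_distrib[of "scaleC _"] cong: if_cong)
  qed
  show ?thesis
  proof (rule strong_bochner_integrableI[where s = ?r])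
    obtain q where q: "\<And>i. simple_function ?M (q i)" "AE x in ?M. (\<lambda>i::nat. q i x) \<longlonglongrightarrow> g x"
      using gm unfolding strongly_measurable_def by blast
    have "AE x in ?P. x \<in> {a..b} \<longrightarrow> (\<lambda>i. q i x) \<longlonglongrightarrow> g x"
      using q(2)[unfolded KP] KS by (subst (asm) AE_restrict_space_iff) auto
    then have "AE x in ?P. (\<lambda>i. if x \<in> {a..b} then \<psi> i x *\<^sub>C q i x else 0) \<longlonglongrightarrow> \<phi> x *\<^sub>C g x"
      using AE_space
    proof eventually_elim
      case (elim x)
      then show ?case
      proof (cases "x \<in> {a..b}")
        case True
        then show ?thesis using elim scaleC.tendsto[OF \<psi>lim[OF True], of "\<lambda>i. q i x"] by simp
      next
        case False
        then have "(\<lambda>i. if x \<in> {a..b} then \<psi> i x *\<^sub>C q i x else 0) = (\<lambda>i. \<phi> x *\<^sub>C g x)"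
          using \<phi>(2)[of x] elim by auto
        then show ?thesis by simp
      qed
    qed
    then show "strongly_measurable ?P (\<lambda>t. \<phi> t *\<^sub>C g t)"
      unfolding strongly_measurable_def using rsf[OF q(1)] by (intro exI[of _ "\<lambda>i x. if x \<in> {a..b} then \<psi> i x *\<^sub>C q i x else 0"]) auto
    show "Bochner_Integration.simple_bochner_integrable ?P (?r i)" for i
    proof (intro simple_bochner_integrable.intros rsf sf)
      have "emeasure ?P {x \<in> space ?P. ?r i x \<noteq> 0} \<le> emeasure ?P {a..b}"
        using KS by (intro emeasure_mono) auto
      also have "\<dots> < \<infinity>"
        using emeasure_Icc_pos[OF a] by simp
      finally show "emeasure ?P {x \<in> space ?P. ?r i x \<noteq> 0} \<noteq> \<infinity>"
        by (rule less_imp_neq)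
    qed
    show "(\<lambda>i. \<integral>\<^sup>+x. ennreal (norm (\<phi> x *\<^sub>C g x - ?r i x)) \<partial>?P) \<longlonglongrightarrow> 0"
    proof (rule tendsto_sandwich[OF _ _ tendsto_const])
      have "(\<integral>\<^sup>+x. ennreal (norm (\<phi> x *\<^sub>C g x - ?r i x)) \<partial>?P) \<le>
          ennreal B * (\<integral>\<^sup>+x. ennreal (norm (g x - s i x)) \<partial>?M) + ennreal (1 / real (Suc i))" for i
      proof -
        have "(\<integral>\<^sup>+x. ennreal (norm (\<phi> x *\<^sub>C g x - ?r i x)) \<partial>?P) = (\<integral>\<^sup>+x. ennreal (norm (\<phi> x *\<^sub>C g x - ?r i x)) * indicator {a..b} x \<partial>?P)"
          using \<phi>(2) by (intro nn_integral_cong) (auto simp: indicator_def)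
        also have "\<dots> = (\<integral>\<^sup>+x. ennreal (norm (\<phi> x *\<^sub>C g x - ?r i x)) \<partial>?M)"
          unfolding KP using KS sub by (subst nn_integral_restrict_space) (auto simp: Int_absorb2)
        also have "\<dots> \<le> (\<integral>\<^sup>+x. ennreal (norm (norm (g x - s i x) * B + d i * norm (s i x))) \<partial>?M)"
        proof (intro nn_integral_mono ennreal_leI)
          fix x assume "x \<in> space ?M"
          then have x: "x \<in> {a..b}" by simp
          have "norm (\<phi> x *\<^sub>C g x - ?r i x) = norm (\<phi> x *\<^sub>C (g x - s i x) + (\<phi> x - \<psi> i x) *\<^sub>C s i x)"
            using x by (simp add: scaleC.diff_left scaleC.diff_right)
          also have "\<dots> \<le> norm (\<phi> x) * norm (g x - s i x) + norm (\<phi> x - \<psi> i x) * norm (s i x)"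
            by (rule norm_triangle_mono) (simp_all add: norm_scaleC)
          also have "\<dots> \<le> B * norm (g x - s i x) + d i * norm (s i x)"
            using B[OF x] \<psi>(2)[OF x] by (intro add_mono mult_right_mono) auto
          finally show "norm (\<phi> x *\<^sub>C g x - ?r i x) \<le> norm (norm (g x - s i x) * B + d i * norm (s i x))"
            by (simp add: mult.commute)
        qed
        also have "\<dots> \<le> ennreal B * (\<integral>\<^sup>+x. ennreal (norm (g x - s i x)) \<partial>?M) + ennreal (d i) * (\<integral>\<^sup>+x. ennreal (norm (s i x)) \<partial>?M)"
        proof -
          obtain u where u: "u \<in> borel_measurable ?M" "AE x in ?M. ennreal (norm (g x - s i x)) = u x"
            using strongly_measurable_AE_norm_measurable[OF gm sf] by blast
          have v: "(\<lambda>x. ennreal (norm (s i x))) \<in> borel_measurable ?M"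
            by (rule borel_measurable_simple_function, rule simple_function_compose1[OF sf])
          have "(\<integral>\<^sup>+x. ennreal (norm (norm (g x - s i x) * B + d i * norm (s i x))) \<partial>?M) = (\<integral>\<^sup>+x. ennreal B * u x + ennreal (d i) * ennreal (norm (s i x)) \<partial>?M)"
          proof (rule nn_integral_cong_AE)
            show "AE x in ?M. ennreal (norm (norm (g x - s i x) * B + d i * norm (s i x))) = ennreal B * u x + ennreal (d i) * ennreal (norm (s i x))"
              using u(2)
            proof eventually_elim
              case (elim x)
              show ?case
                unfolding elim[symmetric] using B0 d[of i] less_imp_le[OF d]
                by (simp add: ennreal_mult[symmetric] ennreal_plus[symmetric] abs_of_nonneg mult.commute del: ennreal_plus)
            qed
          qed
          also have "\<dots> = ennreal B * (\<integral>\<^sup>+x. u x \<partial>?M) + ennreal (d i) * (\<integral>\<^sup>+x. ennreal (norm (s i x)) \<partial>?M)"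
            using u(1) v by (simp add: nn_integral_add nn_integral_cmult)
          finally show ?thesis using nn_integral_cong_AE[OF u(2)] by simp
        qed
        also have "ennreal (d i) * (\<integral>\<^sup>+x. ennreal (norm (s i x)) \<partial>?M) \<le> ennreal (1 / real (Suc i))"
        proof -
          have "(\<integral>\<^sup>+x. ennreal (norm (s i x)) \<partial>?M) = ennreal (enn2real (\<integral>\<^sup>+x. ennreal (norm (s i x)) \<partial>?M))"
            using fin[of i] by (simp add: less_top)
          moreover have "d i * enn2real (\<integral>\<^sup>+x. ennreal (norm (s i x)) \<partial>?M) \<le> 1 / real (Suc i)"
          proof -
            have "d i * e \<le> 1 / real (Suc i)" if "d i = 1 / (real (Suc i) * (1 + e))" "0 \<le> e" for e
            proof -
              have "e / (1 + e) * (1 / real (Suc i)) \<le> 1 * (1 / real (Suc i))"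
                using that(2) by (intro mult_right_mono) auto
              then show ?thesis unfolding that(1) by (simp add: mult.commute)
            qed
            then show ?thesis using d_def by simp
          qed
          ultimately show ?thesis
            using less_imp_le[OF d] by (metis ennreal_leI ennreal_mult')
        qed
        finally show ?thesis by simp
      qed
      then show "\<forall>\<^sub>F i in sequentially. (\<integral>\<^sup>+x. ennreal (norm (\<phi> x *\<^sub>C g x - ?r i x)) \<partial>?P) \<le>
          ennreal B * (\<integral>\<^sup>+x. ennreal (norm (g x - s i x)) \<partial>?M) + ennreal (1 / real (Suc i))" by simp
      have "(\<lambda>i. ennreal (1 / real (Suc i))) \<longlonglongrightarrow> 0"
        using lim0 by (metis ennreal_0 tendsto_ennrealI)
      then have "(\<lambda>i. ennreal B * (\<integral>\<^sup>+x. ennreal (norm (g x - s i x)) \<partial>?M) + ennreal (1 / real (Suc i))) \<longlonglongrightarrow> ennreal B * 0 + 0"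
        by (intro tendsto_add ennreal_tendsto_cmult s(2)) auto
      then show "(\<lambda>i. ennreal B * (\<integral>\<^sup>+x. ennreal (norm (g x - s i x)) \<partial>?M) + ennreal (1 / real (Suc i))) \<longlonglongrightarrow> 0"
        by simp
    qed simp
  qed
qed

subsection \<open>A smooth step function\<close>

definition hump_poly :: "real poly" where "hump_poly = [:-1, 1:] * [:2, -1:]"

text \<open>With q = (t - 1)(2 - t), the pair (p, j) encodes p q^(-j) exp(-1/q) on (1, 2), extended
  by 0. Encoding these functions by data lets all derivatives of the standard bump arise by
  iterating one map on pairs.\<close>

definition hump :: "real poly \<times> nat \<Rightarrow> real \<Rightarrow> real"
  where "hump x t = (if 1 < t \<and> t < 2 then
    poly (fst x) t * inverse (poly hump_poly t) ^ snd x * exp (- inverse (poly hump_poly t)) else 0)"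

text \<open>The derivative of p q^(-j) exp(-1/q), brought to the common denominator q^(j+2).\<close>

definition hump_step :: "real poly \<times> nat \<Rightarrow> real poly \<times> nat"
  where "hump_step x = (pderiv (fst x) * hump_poly\<^sup>2 - of_nat (snd x) * fst x * hump_poly * pderiv hump_poly
    + fst x * pderiv hump_poly, snd x + 2)"

lemma poly_hump_poly: "poly hump_poly t = (t - 1) * (2 - t)"
  by (simp add: hump_poly_def algebra_simps)

lemma hump_poly_pos: "1 < t \<Longrightarrow> t < 2 \<Longrightarrow> 0 < poly hump_poly t"
  by (simp add: poly_hump_poly)

lemma hump_has_derivative_inside:
  assumes "1 < t" "t < 2"
  shows "(hump x has_real_derivative hump (hump_step x) t) (at t)"
proof -
  define p j where "p = fst x" and "j = snd x"
  let ?q = "poly hump_poly t"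
  let ?q' = "poly (pderiv hump_poly) t"
  let ?r = "inverse ?q"
  have q: "?q \<noteq> 0" using hump_poly_pos assms by force
  have r: "((\<lambda>t. inverse (poly hump_poly t)) has_real_derivative - (?r * ?q' * ?r)) (at t)"
    by (rule DERIV_inverse'[OF poly_DERIV q])
  have rj: "((\<lambda>t. inverse (poly hump_poly t) ^ j) has_real_derivative - (real j * ?q' * ?r ^ (j + 1))) (at t)"
  proof (cases j)
    case (Suc i)
    show ?thesis
      using DERIV_power[OF r, of j] unfolding Suc by (simp add: algebra_simps)
  qed simp
  have e: "((\<lambda>t. exp (- inverse (poly hump_poly t))) has_real_derivative exp (- ?r) * (?r * ?q' * ?r)) (at t)"
    using DERIV_fun_exp[OF DERIV_minus[OF r]] by simp
  note D = DERIV_mult'[OF DERIV_mult'[OF poly_DERIV[of p t] rj] e]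
  have eq: "poly p t * ?r ^ j * (exp (- ?r) * (?r * ?q' * ?r)) +
      (poly p t * - (real j * ?q' * ?r ^ (j + 1)) + poly (pderiv p) t * ?r ^ j) * exp (- ?r) = hump (hump_step x) t"
  proof -
    have key: "P * R * (E * (r * q' * r)) + (P * - (J * q' * (r * R)) + P' * R) * E
       = (P' * q\<^sup>2 - J * P * q * q' + P * q') * (R * r\<^sup>2) * E" if "q * r = 1" for P R E r q' J P' q :: real
    proof -
      have "q\<^sup>2 * r\<^sup>2 = 1" "q * r\<^sup>2 = r" using that by (simp_all add: power2_eq_square) algebra+
      then show ?thesis by algebra
    qed
    have "hump (hump_step x) t = (poly (pderiv p) t * ?q\<^sup>2 - real j * poly p t * ?q * ?q' + poly p t * ?q') * (?r ^ j * ?r\<^sup>2) * exp (- ?r)"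
      using assms by (simp add: hump_def hump_step_def p_def j_def power_add power2_eq_square)
    then show ?thesis
      using key[OF right_inverse[OF q], of "poly p t" "?r ^ j" "exp (- ?r)" ?q' "real j" "poly (pderiv p) t"] by simp
  qed
  have "((\<lambda>t. poly p t * inverse (poly hump_poly t) ^ j * exp (- inverse (poly hump_poly t))) has_real_derivative hump (hump_step x) t) (at t)"
    using D unfolding eq .
  moreover have "\<forall>\<^sub>F s in nhds t. hump x s = poly p s * inverse (poly hump_poly s) ^ j * exp (- inverse (poly hump_poly s))"
    using eventually_nhds_in_open[of "{1<..<2}" t] assms
    by (auto elim!: eventually_mono simp: p_def j_def hump_def)
  ultimately show ?thesis
    by (subst DERIV_cong_ev[OF refl _ refl])
qed

text \<open>With y = 1/q, exp y >= (1 + y/k)^k >= (y/k)^k; take reciprocals.\<close>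

lemma exp_inverse_bound:
  assumes q: "0 < (q::real)" and k: "0 < k"
  shows "exp (- inverse q) \<le> real k ^ k * q ^ k"
proof -
  have "(1 + inverse q / real k) ^ k \<le> exp (inverse q)"
    using q k by (intro exp_ge_one_plus_x_over_n_power_n) (auto intro: order_trans[of _ 0])
  moreover have "(inverse q / real k) ^ k \<le> (1 + inverse q / real k) ^ k"
    using q by (intro power_mono) auto
  ultimately have "1 / (q ^ k * real k ^ k) \<le> exp (inverse q)"
    by (simp add: power_divide power_inverse field_simps)
  then have "1 / exp (inverse q) \<le> real k ^ k * q ^ k"
    using q k by (simp add: field_simps)
  then show ?thesis by (simp add: exp_minus inverse_eq_divide)
qed

text \<open>Taking k = j + 2 in \<open>exp_inverse_bound\<close>, the exponential absorbs the pole
  q^(-j) and leaves q^2, which is at most (t - 1)^2 and at most (t - 2)^2 on (1, 2). Such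
  second-order vanishing yields the derivative 0 at both endpoints, for every p and j.\<close>

lemma hump_bound: "\<exists>C. \<forall>t. \<bar>hump x t\<bar> \<le> C * (t - 1)\<^sup>2 \<and> \<bar>hump x t\<bar> \<le> C * (t - 2)\<^sup>2"
proof -
  define p j where "p = fst x" and "j = snd x"
  have "bounded (poly p ` {1..2})"
    by (intro compact_imp_bounded compact_continuous_image continuous_intros) auto
  then obtain B where B: "\<And>t. t \<in> {1..2} \<Longrightarrow> \<bar>poly p t\<bar> \<le> B"
    unfolding bounded_iff real_norm_def by blast
  have B0: "0 \<le> B" using B[of 1] abs_ge_zero[of "poly p 1"] by (simp del: abs_ge_zero)
  let ?K = "real (j + 2) ^ (j + 2)"
  have K: "0 \<le> B * ?K" using B0 by simp
  have bnd: "\<bar>hump x t\<bar> \<le> B * ?K * ((t - 1) * (2 - t))\<^sup>2" if t: "1 < t" "t < 2" for t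
  proof -
    let ?q = "(t - 1) * (2 - t)"
    have q: "0 < ?q" using t by simp
    have "\<bar>hump x t\<bar> = \<bar>poly p t\<bar> * (inverse ?q ^ j * exp (- inverse ?q))"
      using t q by (simp add: hump_def p_def j_def poly_hump_poly abs_mult)
    also have "\<dots> \<le> B * (inverse ?q ^ j * (?K * ?q ^ (j + 2)))"
      using q t by (intro mult_mono B exp_inverse_bound) (auto intro!: mult_nonneg_nonneg B0)
    also have "\<dots> = B * ?K * ?q\<^sup>2"
    proof -
      have "inverse r ^ j * r ^ (j + 2) = r\<^sup>2" if "r \<noteq> 0" for r :: real
      proof -
        have "inverse r ^ j * r ^ j = 1" using that by (simp flip: power_mult_distrib)
        then show ?thesis by (simp add: power_add power2_eq_square)
      qed
      from this[OF less_imp_neq[OF q, symmetric]] have "inverse ?q ^ j * ?q ^ (j + 2) = ?q\<^sup>2" .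
      then show ?thesis by (simp only: mult_ac)
    qed
    finally show ?thesis .
  qed
  have "\<bar>hump x t\<bar> \<le> B * ?K * (t - 1)\<^sup>2 \<and> \<bar>hump x t\<bar> \<le> B * ?K * (t - 2)\<^sup>2" for t
  proof (cases "1 < t \<and> t < 2")
    case True
    have a: "0 \<le> t - 1" "t - 1 \<le> 1" "0 \<le> 2 - t" "2 - t \<le> 1" using True by auto
    have "((t - 1) * (2 - t))\<^sup>2 \<le> (t - 1)\<^sup>2"
      using a mult_left_mono[OF a(4,1)] by (intro power_mono) auto
    moreover have "((t - 1) * (2 - t))\<^sup>2 \<le> (2 - t)\<^sup>2"
      using a mult_right_mono[OF a(2,3)] by (intro power_mono) auto
    ultimately have "B * ?K * ((t - 1) * (2 - t))\<^sup>2 \<le> B * ?K * (t - 1)\<^sup>2"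
      "B * ?K * ((t - 1) * (2 - t))\<^sup>2 \<le> B * ?K * (2 - t)\<^sup>2"
      using K by (auto intro!: mult_left_mono)
    then show ?thesis
      using order_trans[OF bnd] True unfolding power2_commute[of t 2] by simp
  next
    case False
    then have "hump x t = 0" by (auto simp: hump_def)
    then show ?thesis using K by (simp add: mult_nonneg_nonneg)
  qed
  then show ?thesis by blast
qed

lemma has_real_derivative_zero_of_quadratic:
  fixes f :: "real \<Rightarrow> real"
  assumes b: "\<And>s. \<bar>f s\<bar> \<le> C * (s - t)\<^sup>2"
  shows "(f has_real_derivative 0) (at t)"
proof -
  have f0: "f t = 0" using b[of t] by simp
  have "((\<lambda>s. (f s - f t) / (s - t)) \<longlongrightarrow> 0) (at t)"
  proof (rule Lim_null_comparison)
    show "\<forall>\<^sub>F s in at t. norm ((f s - f t) / (s - t)) \<le> C * \<bar>s - t\<bar>"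
      unfolding eventually_at_filter
    proof (intro always_eventually allI impI)
      fix s assume s: "s \<noteq> t"
      have "\<bar>f s\<bar> / \<bar>s - t\<bar> \<le> (C * (s - t)\<^sup>2) / \<bar>s - t\<bar>"
        using b by (intro divide_right_mono) auto
      also have "C * (s - t)\<^sup>2 = C * \<bar>s - t\<bar> * \<bar>s - t\<bar>"
        by (simp add: power2_eq_square flip: abs_mult)
      also have "C * \<bar>s - t\<bar> * \<bar>s - t\<bar> / \<bar>s - t\<bar> = C * \<bar>s - t\<bar>" using s by simp
      finally show "norm ((f s - f t) / (s - t)) \<le> C * \<bar>s - t\<bar>"
        by (simp add: f0)
    qed
    have "((\<lambda>s. C * \<bar>s - t\<bar>) \<longlongrightarrow> C * \<bar>t - t\<bar>) (at t)"
      by (intro tendsto_intros)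
    then show "((\<lambda>s. C * \<bar>s - t\<bar>) \<longlongrightarrow> 0) (at t)" by simp
  qed
  then show ?thesis by (simp add: has_field_derivative_iff)
qed

lemma hump_has_derivative: "(hump x has_real_derivative hump (hump_step x) t) (at t)"
proof -
  obtain C where C: "\<And>s. \<bar>hump x s\<bar> \<le> C * (s - 1)\<^sup>2" "\<And>s. \<bar>hump x s\<bar> \<le> C * (s - 2)\<^sup>2"
    using hump_bound[of x] by blast
  consider "1 < t \<and> t < 2" | "t = 1 \<or> t = 2" | "t < 1 \<or> 2 < t" by linarith
  then show ?thesis
  proof cases
    case 1 then show ?thesis using hump_has_derivative_inside by blast
  next
    case 2
    then have "(hump x has_real_derivative 0) (at t)"
      using has_real_derivative_zero_of_quadratic[of "hump x" C] C by blast
    moreover have "hump (hump_step x) t = 0" using 2 by (auto simp: hump_def)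
    ultimately show ?thesis by simp
  next
    case 3
    have "open ({..<1} \<union> {2<..} :: real set)" by (intro open_Un) auto
    then have "\<forall>\<^sub>F s in nhds t. s \<in> {..<1} \<union> {2<..}"
      using 3 by (intro eventually_nhds_in_open) auto
    then have "\<forall>\<^sub>F s in nhds t. hump x s = 0"
      by (rule eventually_mono) (auto simp: hump_def)
    then have "(hump x has_real_derivative 0) (at t) \<longleftrightarrow> ((\<lambda>_. 0) has_real_derivative 0) (at t)"
      by (intro DERIV_cong_ev) auto
    moreover have "hump (hump_step x) t = 0" using 3 by (auto simp: hump_def)
    ultimately show ?thesis by simp
  qed
qed

text \<open>The step is a normalised primitive of the bump. It is delivered as the sequence of all
  its derivatives, so that later differentiations only increase an index.\<close>

lemma smooth_step_exists:
  obtains \<theta> :: "nat \<Rightarrow> real \<Rightarrow> real"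
  where "\<And>n t. (\<theta> n has_real_derivative \<theta> (Suc n) t) (at t)"
    and "\<And>t. t \<le> 1 \<Longrightarrow> \<theta> 0 t = 0" and "\<And>t. 2 \<le> t \<Longrightarrow> \<theta> 0 t = 1"
    and "mono (\<theta> 0)" and "\<And>n t. t \<notin> {1..2} \<Longrightarrow> \<theta> (Suc n) t = 0"
proof -
  define x0 :: "real poly \<times> nat" where "x0 = (1, 0)"
  define h where "h n = hump ((hump_step ^^ n) x0)" for n
  have h: "(h n has_real_derivative h (Suc n) t) (at t)" for n t
    unfolding h_def using hump_has_derivative by simp
  have h0: "h n t = 0" if "t \<notin> {1<..<2}" for n t
    using that by (auto simp: h_def hump_def)
  have hpos: "0 \<le> h 0 t" "t \<in> {1<..<2} \<Longrightarrow> 0 < h 0 t" for t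
    by (auto simp: h_def x0_def hump_def)
  have hc: "continuous_on S (h n)" for S n
    using h by (meson DERIV_isCont continuous_at_imp_continuous_on)
  define H where "H t = integral {0..t} (h 0)" for t
  have hi: "h 0 integrable_on {a..b}" for a b
    by (intro integrable_continuous_real hc)
  have Hder: "(H has_real_derivative h 0 t) (at t)" for t
  proof (cases "0 < t")
    case True
    have "(H has_real_derivative h 0 t) (at t within {0..t+1})"
      unfolding H_def using True by (intro integral_has_real_derivative hc) auto
    moreover have "at t within {0..t+1} = at t" using True by (intro at_within_interior) auto
    ultimately show ?thesis by simp
  next
    case False
    have z: "H s = 0" if "s < 1" for s
    proof -
      have "H s = integral {0..s} (\<lambda>_. 0)"
        unfolding H_def using that by (intro integral_cong h0) auto
      then show ?thesis by simp
    qed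
    have "\<forall>\<^sub>F s in nhds t. H s = 0"
      using False eventually_nhds_in_open[of "{..<1}" t] z by (auto elim!: eventually_mono)
    then have "(H has_real_derivative 0) (at t) \<longleftrightarrow> ((\<lambda>_. 0) has_real_derivative 0) (at t)"
      by (intro DERIV_cong_ev) auto
    then show ?thesis using h0[of t 0] False by simp
  qed
  have Hmono: "mono H"
  proof (rule monoI)
    fix a b :: real assume "a \<le> b"
    then show "H a \<le> H b"
      by (rule DERIV_nonneg_imp_nondecreasing) (use Hder hpos in blast)
  qed
  have Hconst: "H b = H a" if "\<And>s. s \<in> {a<..<b} \<Longrightarrow> h 0 s = 0" "a \<le> b" for a b
  proof (cases "a = b")
    case False
    then have "a < b" using that by simp
    then show ?thesis
    proof (rule DERIV_isconst2[where x = b])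
      show "continuous_on {a..b} H" using Hder by (meson DERIV_isCont continuous_at_imp_continuous_on)
      fix x assume "a < x" "x < b"
      then show "(H has_real_derivative 0) (at x)"
        using Hder[of x] that(1)[of x] by simp
    qed (use \<open>a < b\<close> in auto)
  qed simp
  have H1: "H t = 0" if "t \<le> 1" for t
  proof -
    have "H 0 = 0" by (simp add: H_def)
    moreover have "H 1 = H 0" by (rule Hconst) (auto intro: h0)
    moreover have "H 1 = H t" by (rule Hconst) (auto intro: h0 simp: that)
    ultimately show ?thesis by simp
  qed
  have H2: "H t = H 2" if "2 \<le> t" for t
    by (rule Hconst) (auto intro: h0 simp: that)
  have "H 1 < H 2"
  proof (rule DERIV_pos_imp_increasing_open[where f = H])
    show "continuous_on {1..2} H" using Hder by (meson DERIV_isCont continuous_at_imp_continuous_on)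
  next
    show "\<exists>y. (H has_real_derivative y) (at x) \<and> 0 < y" if "1 < x" "x < 2" for x
      using Hder[of x] hpos(2)[of x] that by auto
  qed simp
  then have c: "0 < H 2" using H1[of 1] by simp
  \<comment> \<open>Index 0 is the primitive and index n + 1 the n-th derivative of the bump.
    Dividing by \<open>H 2\<close>, the total mass of the bump, makes the plateau equal to
    1.\<close>
  define \<theta> where "\<theta> n t = (case n of 0 \<Rightarrow> H t | Suc n \<Rightarrow> h n t) / H 2" for n t
  show ?thesis
  proof (rule that[of \<theta>])
    show "(\<theta> n has_real_derivative \<theta> (Suc n) t) (at t)" for n t
      unfolding \<theta>_def using Hder h by (cases n) (auto intro!: DERIV_cdivide)
    show "mono (\<theta> 0)"
      using Hmono c by (auto simp: \<theta>_def mono_def intro!: divide_right_mono)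
    show "\<theta> 0 t = 0" if "t \<le> 1" for t using H1[OF that] by (simp add: \<theta>_def)
    show "\<theta> 0 t = 1" if "2 \<le> t" for t using c H2[OF that] by (simp add: \<theta>_def)
    show "\<theta> (Suc n) t = 0" if "t \<notin> {1..2}" for n t
    proof -
      have "t \<notin> {1<..<2}" using that by auto
      then show ?thesis using h0 by (simp add: \<theta>_def)
    qed
  qed
qed

subsection \<open>Improper integrals with a dominating function\<close>

text \<open>For b > 0 this is an increasing function with limits 0 and 1, hence of total mass 1. Its
  derivative \<open>majorant b\<close> is comparable with s^(b-1) near 0 and with s^(-b-1) at
  infinity, so a single parameter controls an improper integral at both ends by an explicit
  primitive.\<close>

definition majorant_int :: "real \<Rightarrow> real \<Rightarrow> real"
  where "majorant_int b s = s powr b / (1 + s powr b)"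

definition majorant :: "real \<Rightarrow> real \<Rightarrow> real"
  where "majorant b s = b * s powr (b - 1) / (1 + s powr b)\<^sup>2"

lemma one_plus_powr_pos: "0 < 1 + (s::real) powr b"
  using powr_ge_zero[of s b] by linarith

lemma majorant_int_has_derivative:
  assumes "0 < s" shows "(majorant_int b has_real_derivative majorant b s) (at s)"
proof -
  have nz: "1 + s powr b \<noteq> 0" using one_plus_powr_pos[of s b] by simp
  have d: "((\<lambda>s. s powr b) has_real_derivative b * s powr (b - 1)) (at s)"
    by (rule has_real_derivative_powr[OF assms])
  have "(majorant_int b has_real_derivative
     ((b * s powr (b - 1)) * (1 + s powr b) - s powr b * (0 + b * s powr (b - 1))) / ((1 + s powr b) * (1 + s powr b))) (at s)"
    unfolding majorant_int_def by (intro DERIV_divide DERIV_add d DERIV_const nz)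
  moreover have "((b * s powr (b - 1)) * (1 + s powr b) - s powr b * (0 + b * s powr (b - 1))) / ((1 + s powr b) * (1 + s powr b)) = majorant b s"
    unfolding majorant_def by (simp add: algebra_simps power2_eq_square)
  ultimately show ?thesis by simp
qed

lemma majorant_int_bounds: "0 \<le> majorant_int b s" "majorant_int b s \<le> 1"
  unfolding majorant_int_def divide_le_eq_1_pos[OF one_plus_powr_pos]
  using one_plus_powr_pos[of s b] by simp_all

lemma majorant_nonneg: "0 \<le> b \<Longrightarrow> 0 \<le> majorant b s"
  by (simp add: majorant_def)

lemma majorant_int_tendsto_0: assumes "0 < b" shows "(majorant_int b \<longlongrightarrow> 0) (at_right 0)"
proof -
  have "((\<lambda>s. s powr b) \<longlongrightarrow> 0 powr b) (at_right 0)"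
    using assms by (intro tendsto_powr2 tendsto_intros) (auto simp: eventually_at_filter)
  then have "(majorant_int b \<longlongrightarrow> 0 / (1 + 0)) (at_right 0)"
    unfolding majorant_int_def using assms by (intro tendsto_intros) auto
  then show ?thesis by simp
qed

lemma majorant_int_eq: "0 < s \<Longrightarrow> majorant_int b s = 1 - majorant_int b (1 / s)"
proof -
  assume s: "0 < s"
  have "(1 / s) powr b = 1 / s powr b" using s by (simp add: powr_divide)
  then show ?thesis
    using one_plus_powr_pos[of s b] one_plus_powr_pos[of "1 / s" b] s by (simp add: majorant_int_def field_simps)
qed

definition window :: "nat \<Rightarrow> real set" where "window n = {1 / real (Suc n)..real (Suc n)}"

text \<open>The mass of \<open>majorant b\<close> outside \<open>window n\<close>: by the symmetry s
  -> 1/s in \<open>majorant_int_eq\<close> both tails are equal.\<close>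

definition window_tail :: "real \<Rightarrow> nat \<Rightarrow> real" where "window_tail b n = 2 * majorant_int b (1 / real (Suc n))"

lemma window_tail_tendsto_0: assumes "0 < b" shows "window_tail b \<longlonglongrightarrow> 0"
proof -
  have "filterlim (\<lambda>n. 1 / real (Suc n)) (at_right 0) sequentially"
    using LIMSEQ_inverse_real_of_nat by (auto simp: filterlim_at inverse_eq_divide intro!: always_eventually)
  from filterlim_compose[OF majorant_int_tendsto_0[OF assms] this]
  have "(\<lambda>n. 2 * majorant_int b (1 / real (Suc n))) \<longlonglongrightarrow> 2 * 0"
    by (intro tendsto_intros)
  then show ?thesis by (simp add: window_tail_def[abs_def])
qed

lemma window_subset: "window n \<subseteq> {0<..}"
proof
  fix s assume "s \<in> window n"
  moreover have "0 < 1 / real (Suc n)" by simp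
  ultimately show "s \<in> {0<..}" unfolding window_def by (metis atLeastAtMost_iff greaterThan_iff less_le_trans)
qed

text \<open>The dilated density \<tau> \<open>majorant b (\<tau> * s)\<close> has the primitive
  \<open>majorant_int b (\<tau> * s)\<close>, whose total mass does not depend on \<tau>. With
  \<tau> = t^2 this later yields estimates uniform in t.\<close>

lemma norm_integral_le_majorant_int:
  fixes f :: "real \<Rightarrow> 'b::banach"
  assumes f: "continuous_on {x..y} f" and xy: "0 < x" "x \<le> y" and \<tau>: "0 < \<tau>"
    and b: "\<And>s. s \<in> {x..y} \<Longrightarrow> norm (f s) \<le> C * (\<tau> * majorant b (\<tau> * s))"
  shows "norm (integral {x..y} f) \<le> C * (majorant_int b (\<tau> * y) - majorant_int b (\<tau> * x))"
proof -
  have "((\<lambda>s. C * (\<tau> * majorant b (\<tau> * s))) has_integral C * majorant_int b (\<tau> * y) - C * majorant_int b (\<tau> * x)) {x..y}"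
  proof (rule fundamental_theorem_of_calculus[OF xy(2)])
    fix s assume s: "s \<in> {x..y}"
    have "((\<lambda>s. C * majorant_int b (\<tau> * s)) has_real_derivative C * (majorant b (\<tau> * s) * (\<tau> * 1))) (at s)"
      using s xy \<tau> by (intro DERIV_cmult DERIV_chain2[OF majorant_int_has_derivative] DERIV_ident) auto
    then show "((\<lambda>s. C * majorant_int b (\<tau> * s)) has_vector_derivative C * (\<tau> * majorant b (\<tau> * s))) (at s within {x..y})"
      by (simp add: has_real_derivative_iff_has_vector_derivative mult.commute has_vector_derivative_at_within)
  qed
  then have h: "integral {x..y} (\<lambda>s. C * (\<tau> * majorant b (\<tau> * s))) = C * majorant_int b (\<tau> * y) - C * majorant_int b (\<tau> * x)"
    "(\<lambda>s. C * (\<tau> * majorant b (\<tau> * s))) integrable_on {x..y}" by (auto simp: has_integral_iff)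
  have "norm (integral {x..y} f) \<le> integral {x..y} (\<lambda>s. C * (\<tau> * majorant b (\<tau> * s)))"
    by (rule integral_norm_bound_integral[OF integrable_continuous_real[OF f] h(2) b])
  then show ?thesis unfolding h(1) by (simp add: algebra_simps)
qed

lemma norm_integral_le_majorant:
  fixes f :: "real \<Rightarrow> 'b::banach"
  assumes f: "continuous_on {x..y} f" and xy: "0 < x" and \<tau>: "0 < \<tau>" and C: "0 \<le> C"
    and b: "\<And>s. s \<in> {x..y} \<Longrightarrow> norm (f s) \<le> C * (\<tau> * majorant b (\<tau> * s))"
  shows "norm (integral {x..y} f) \<le> C"
proof (cases "x \<le> y")
  case True
  have "norm (integral {x..y} f) \<le> C * (majorant_int b (\<tau> * y) - majorant_int b (\<tau> * x))"
    by (rule norm_integral_le_majorant_int) (use assms True in auto)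
  also have "\<dots> \<le> C * 1"
    using majorant_int_bounds(2)[of b "\<tau> * y"] majorant_int_bounds(1)[of b "\<tau> * x"] C by (intro mult_left_mono) linarith+
  finally show ?thesis by simp
qed (use C in simp)

text \<open>For s <= 1 the denominator (1 + s^b)^2 is at most 4, and for s >= 1 it is at most 4
  s^(2b). The constant 4/b compensates this 4 and the factor b in \<open>majorant\<close>.\<close>

lemma majorant_bound:
  assumes b: "0 < b" and p: "b - 1 \<le> p" "q \<le> - b - 1" and C: "0 \<le> C" and s: "0 < s"
    and f: "s \<le> 1 \<Longrightarrow> f \<le> C * s powr p" "1 \<le> s \<Longrightarrow> f \<le> C * s powr q"
  shows "f \<le> 4 * C / b * majorant b s"
proof (cases "s \<le> 1")
  case True
  have "s powr b \<le> 1" using powr_mono'[of 0 b s] True b s by simp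
  then have le: "(1 + s powr b)\<^sup>2 \<le> 2\<^sup>2" using powr_ge_zero[of s b] by (intro power_mono) auto
  have "f \<le> C * s powr p" using f True by simp
  also have "\<dots> \<le> C * s powr (b - 1)" using C p True s by (intro mult_left_mono powr_mono') auto
  also have "C * s powr (b - 1) \<le> C * (4 / b * majorant b s)"
  proof (rule mult_left_mono[OF _ C])
    have "4 / b * majorant b s = s powr (b - 1) * (4 / (1 + s powr b)\<^sup>2)" using b by (simp add: majorant_def)
    moreover have "1 \<le> 4 / (1 + s powr b)\<^sup>2"
      using le one_plus_powr_pos[of s b] by (subst le_divide_eq) auto
    ultimately show "s powr (b - 1) \<le> 4 / b * majorant b s"
      by (metis mult.right_neutral mult_left_mono powr_ge_zero)
  qed
  finally show ?thesis by (simp add: mult_ac)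
next
  case False
  then have s1: "1 \<le> s" by simp
  have "1 \<le> s powr b" using s1 b by (simp add: ge_one_powr_ge_zero)
  then have le: "(1 + s powr b)\<^sup>2 \<le> (2 * s powr b)\<^sup>2" by (intro power_mono) auto
  have "f \<le> C * s powr q" using f s1 by simp
  also have "\<dots> \<le> C * s powr (- b - 1)" using C p s1 by (intro mult_left_mono powr_mono) auto
  also have "C * s powr (- b - 1) \<le> C * (4 / b * majorant b s)"
  proof (rule mult_left_mono[OF _ C])
    have "4 / b * majorant b s = s powr (b - 1) * (4 / (1 + s powr b)\<^sup>2)" using b by (simp add: majorant_def)
    moreover have "4 / (2 * s powr b)\<^sup>2 \<le> 4 / (1 + s powr b)\<^sup>2"
      using le one_plus_powr_pos[of s b] s by (intro divide_left_mono mult_pos_pos zero_less_power) auto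
    moreover have "s powr (b - 1) * (4 / (2 * s powr b)\<^sup>2) = s powr (- b - 1)"
    proof -
      have "(s powr b)\<^sup>2 = s powr (b + b)" unfolding powr_add power2_eq_square ..
      then have "s powr (b - 1) * (4 / (2 * s powr b)\<^sup>2) = s powr (b - 1) / s powr (b + b)"
        by (simp add: power_mult_distrib)
      also have "\<dots> = s powr (- b - 1)" by (simp flip: powr_diff)
      finally show ?thesis .
    qed
    ultimately show "s powr (- b - 1) \<le> 4 / b * majorant b s"
      by (metis mult_left_mono powr_ge_zero)
  qed
  finally show ?thesis by (simp add: mult_ac)
qed

text \<open>Absolutely convergent vector-valued integrals over the half-line are taken as limits
  over windows. Exchanging integrals, applying operators and passing to uniform limits in a
  parameter then concern only continuous functions on compact intervals.\<close>

definition improper :: "(real \<Rightarrow> 'b::banach) \<Rightarrow> 'b"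
  where "improper f = lim (\<lambda>n. integral (window n) f)"

lemma integral_window_diff:
  fixes f :: "real \<Rightarrow> 'b::banach"
  assumes f: "continuous_on {0<..} f" and b: "0 < b" and C: "0 \<le> C"
    and d: "\<And>s. 0 < s \<Longrightarrow> norm (f s) \<le> C * majorant b s" and mn: "m \<le> n"
  shows "norm (integral (window n) f - integral (window m) f) \<le> C * window_tail b m"
proof -
  define x y u v where "x = 1 / real (Suc n)" "y = 1 / real (Suc m)" "u = real (Suc m)" "v = real (Suc n)"
  have o: "0 < x" "x \<le> y" "y \<le> u" "u \<le> v"
    using mn by (auto simp: x_y_u_v_def field_simps)
  have c: "continuous_on {p..q} f" if "0 < p" for p q
    by (rule continuous_on_subset[OF f]) (use that in auto)
  have i: "f integrable_on {p..q}" if "0 < p" for p q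
    by (rule integrable_continuous_real[OF c[OF that]])
  have "integral {x..v} f = integral {x..y} f + integral {y..u} f + integral {u..v} f"
    using o by (simp add: Henstock_Kurzweil_Integration.integral_combine[where c = y, of x u, symmetric]
        Henstock_Kurzweil_Integration.integral_combine[where c = u, of x v, symmetric] i)
  then have "integral (window n) f - integral (window m) f = integral {x..y} f + integral {u..v} f"
    by (simp add: window_def x_y_u_v_def)
  then have "norm (integral (window n) f - integral (window m) f) \<le> norm (integral {x..y} f) + norm (integral {u..v} f)"
    using norm_triangle_ineq[of "integral {x..y} f" "integral {u..v} f"] by simp
  also have "norm (integral {x..y} f) \<le> C * (majorant_int b (1 * y) - majorant_int b (1 * x))"
    by (rule norm_integral_le_majorant_int) (use o d c in auto)
  also have "norm (integral {u..v} f) \<le> C * (majorant_int b (1 * v) - majorant_int b (1 * u))"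
    by (rule norm_integral_le_majorant_int) (use o d c in auto)
  finally have "norm (integral (window n) f - integral (window m) f) \<le> C * (majorant_int b y - majorant_int b x) + C * (majorant_int b v - majorant_int b u)"
    by simp
  also have "\<dots> = C * (majorant_int b y - majorant_int b x + majorant_int b v - majorant_int b u)" by (simp add: algebra_simps)
  also have "\<dots> \<le> C * window_tail b m"
  proof (rule mult_left_mono[OF _ C])
    have "majorant_int b u = 1 - majorant_int b y" using majorant_int_eq[of u b] o by (simp add: x_y_u_v_def)
    then show "majorant_int b y - majorant_int b x + majorant_int b v - majorant_int b u \<le> window_tail b m"
      using majorant_int_bounds(1)[of b x] majorant_int_bounds(2)[of b v] by (simp add: window_tail_def x_y_u_v_def)
  qed
  finally show ?thesis .
qed

lemma improper_window:
  fixes f :: "real \<Rightarrow> 'b::banach"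
  assumes f: "continuous_on {0<..} f" and b: "0 < b" and C: "0 \<le> C"
    and d: "\<And>s. 0 < s \<Longrightarrow> norm (f s) \<le> C * majorant b s"
  shows "(\<lambda>n. integral (window n) f) \<longlonglongrightarrow> improper f"
    and "norm (improper f - integral (window m) f) \<le> C * window_tail b m"
proof -
  have t: "(\<lambda>m. C * window_tail b m) \<longlonglongrightarrow> 0" using tendsto_mult_right_zero[OF window_tail_tendsto_0[OF b]] by simp
  have "Cauchy (\<lambda>n. integral (window n) f)"
    unfolding Cauchy_def
  proof (intro allI impI)
    fix e :: real assume "0 < e"
    then obtain N where N: "\<And>n. N \<le> n \<Longrightarrow> C * window_tail b n < e / 2"
      using order_tendstoD(2)[OF t, of "e / 2"] unfolding eventually_sequentially by auto
    have "dist (integral (window m) f) (integral (window n) f) < e" if "N \<le> m" "N \<le> n" for m n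
    proof -
      have "dist (integral (window m) f) (integral (window N) f) < e / 2" "dist (integral (window n) f) (integral (window N) f) < e / 2"
        unfolding dist_norm using that N[of N]
          integral_window_diff[OF f b C d that(1)] integral_window_diff[OF f b C d that(2)] by linarith+
      then show ?thesis by (rule dist_triangle_half_l)
    qed
    then show "\<exists>M. \<forall>m\<ge>M. \<forall>n\<ge>M. dist (integral (window m) f) (integral (window n) f) < e" by blast
  qed
  then show l: "(\<lambda>n. integral (window n) f) \<longlonglongrightarrow> improper f"
    unfolding improper_def by (simp add: Cauchy_convergent_iff convergent_LIMSEQ_iff)
  show "norm (improper f - integral (window m) f) \<le> C * window_tail b m"
  proof (rule tendsto_upperbound)
    show "(\<lambda>n. norm (integral (window n) f - integral (window m) f)) \<longlonglongrightarrow> norm (improper f - integral (window m) f)"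
      by (intro tendsto_intros l)
    show "\<forall>\<^sub>F n in sequentially. norm (integral (window n) f - integral (window m) f) \<le> C * window_tail b m"
      using eventually_ge_at_top[of m] by eventually_elim (rule integral_window_diff[OF f b C d])
  qed simp
qed

lemma improper_uniform_limit:
  fixes f :: "'i \<Rightarrow> real \<Rightarrow> 'b::banach"
  assumes f: "\<And>i. i \<in> T \<Longrightarrow> continuous_on {0<..} (f i)" and b: "0 < b" and C: "0 \<le> C"
    and d: "\<And>i s. i \<in> T \<Longrightarrow> 0 < s \<Longrightarrow> norm (f i s) \<le> C * majorant b s"
  shows "uniform_limit T (\<lambda>n i. integral (window n) (f i)) (\<lambda>i. improper (f i)) sequentially"
proof (rule uniform_limitI)
  fix e :: real assume e: "0 < e"
  have t: "(\<lambda>m. C * window_tail b m) \<longlonglongrightarrow> 0" using tendsto_mult_right_zero[OF window_tail_tendsto_0[OF b]] by simp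
  show "\<forall>\<^sub>F n in sequentially. \<forall>i\<in>T. dist (integral (window n) (f i)) (improper (f i)) < e"
    using order_tendstoD(2)[OF t e]
  proof eventually_elim
    case (elim n)
    show ?case
    proof
      fix i assume i: "i \<in> T"
      show "dist (integral (window n) (f i)) (improper (f i)) < e"
        using le_less_trans[OF improper_window(2)[OF f[OF i] b C d[OF i]] elim]
        by (simp add: dist_norm norm_minus_commute)
    qed
  qed
qed

text \<open>For complex values this links window limits with Lebesgue integrals, where Fubini and
  termwise integration compute explicit values. The majorant is integrable because of its monotone
  bounded primitive; dominated convergence along the windows then gives the equality.\<close>

lemma improper_eq_set_lebesgue_integral:
  fixes f :: "real \<Rightarrow> complex"
  assumes f: "continuous_on {0<..} f" and b: "0 < b" and C: "0 \<le> C"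
    and d: "\<And>s. 0 < s \<Longrightarrow> norm (f s) \<le> C * majorant b s"
  shows "set_integrable lborel {0<..} f" and "improper f = (LINT s:{0<..}|lborel. f s)"
proof -
  have "set_integrable lborel (einterval 0 \<infinity>) (majorant b)"
  proof (rule interval_integral_FTC_nonneg(1)[where F = "majorant_int b" and A = 0 and B = 1])
    show "DERIV (majorant_int b) x :> majorant b x" if "0 < ereal x" "ereal x < \<infinity>" for x
      using that by (intro majorant_int_has_derivative) simp
    show "isCont (majorant b) x" if "0 < ereal x" "ereal x < \<infinity>" for x
      unfolding majorant_def using that one_plus_powr_pos[of x b]
      by (intro continuous_intros) auto
    show "AE x in lborel. 0 < ereal x \<longrightarrow> ereal x < \<infinity> \<longrightarrow> 0 \<le> majorant b x"
      using b by (simp add: majorant_nonneg)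
    show "((majorant_int b \<circ> real_of_ereal) \<longlongrightarrow> 0) (at_right 0)"
      using majorant_int_tendsto_0[OF b] by (simp add: zero_ereal_def ereal_tendsto_simps)
    have "((\<lambda>s. 1 - majorant_int b (1 / s)) \<longlongrightarrow> 1 - 0) at_top"
      by (intro tendsto_intros filterlim_compose[OF majorant_int_tendsto_0[OF b]])
         (use filterlim_inverse_at_right_top in \<open>simp add: inverse_eq_divide\<close>)
    then have "(majorant_int b \<longlongrightarrow> 1 - 0) at_top"
      by (rule Lim_transform_eventually) (use eventually_gt_at_top[of 0] in \<open>eventually_elim; simp add: majorant_int_eq[symmetric]\<close>)
    then show "((majorant_int b \<circ> real_of_ereal) \<longlongrightarrow> 1) (at_left \<infinity>)"
      by (simp add: ereal_tendsto_simps)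
  qed simp
  moreover have "einterval 0 \<infinity> = ({0<..} :: real set)"
    by (auto simp: einterval_def)
  ultimately have majorant: "set_integrable lborel {0<..} (majorant b)" by simp
  have Cd: "set_integrable lborel {0<..} (\<lambda>s. C * majorant b s)"
    using majorant by simp
  have fm: "set_borel_measurable lborel {0<..} f"
    using f borel_measurable_continuous_on_indicator[of "{0<..}" f] by (simp add: set_borel_measurable_def)
  show int: "set_integrable lborel {0<..} f"
    by (rule set_integrable_bound[OF Cd fm]) (use d in \<open>auto intro!: AE_I2 order_trans[OF _ abs_ge_self]\<close>)
  have "(\<lambda>n. LINT s|lborel. indicator (window n) s *\<^sub>R f s) \<longlonglongrightarrow> (LINT s|lborel. indicator {0<..} s *\<^sub>R f s)"
  proof (rule integral_dominated_convergence)
    show "(\<lambda>s. indicator {0<..} s *\<^sub>R f s) \<in> borel_measurable lborel"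
      using fm by (simp add: set_borel_measurable_def)
    have fm': "(\<lambda>s. indicator {0<..} s *\<^sub>R f s) \<in> borel_measurable lborel"
      using fm by (simp add: set_borel_measurable_def)
    have "indicator (window n) s *\<^sub>R f s = indicator (window n) s *\<^sub>R (indicator {0<..} s *\<^sub>R f s)" for n s
      using window_subset[of n] by (auto simp: indicator_def)
    moreover have "(\<lambda>s. indicator (window n) s *\<^sub>R (indicator {0<..} s *\<^sub>R f s)) \<in> borel_measurable lborel" for n
      by (rule borel_measurable_scaleR[OF borel_measurable_indicator fm']) (simp add: window_def)
    ultimately show "(\<lambda>s. indicator (window n) s *\<^sub>R f s) \<in> borel_measurable lborel" for n by presburger
    show "integrable lborel (\<lambda>s. indicator {0<..} s *\<^sub>R (C * majorant b s))"
      using Cd by (simp add: set_integrable_def)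
    show "AE s in lborel. norm (indicator (window n) s *\<^sub>R f s) \<le> indicator {0<..} s *\<^sub>R (C * majorant b s)" for n
      using d window_subset[of n] C majorant_nonneg[of b] b by (intro AE_I2) (auto simp: indicator_def)
    show "AE s in lborel. (\<lambda>n. indicator (window n) s *\<^sub>R f s) \<longlonglongrightarrow> indicator {0<..} s *\<^sub>R f s"
    proof (intro AE_I2 tendsto_eventually)
      fix s :: real
      show "\<forall>\<^sub>F n in sequentially. indicator (window n) s *\<^sub>R f s = indicator {0<..} s *\<^sub>R f s"
      proof (cases "0 < s")
        case True
        obtain N where N: "s \<le> real N" "1 / s \<le> real N"
          by (metis real_arch_simple nle_le order_trans of_nat_le_iff)
        have "s \<in> window n" if "N \<le> n" for n
        proof -
          have "s \<le> real (Suc n)" "1 / s \<le> real (Suc n)" using N that by linarith+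
          then show ?thesis using True by (simp add: window_def field_simps)
        qed
        then show ?thesis using True by (auto simp: eventually_sequentially intro!: exI[of _ N])
      next
        case False
        then show ?thesis using window_subset by (intro always_eventually allI) (auto simp: indicator_def)
      qed
    qed
  qed
  moreover have "(LINT s|lborel. indicator (window n) s *\<^sub>R f s) = integral (window n) f" for n
  proof -
    have "set_integrable lborel (window n) f"
      by (rule set_integrable_subset[OF int _ window_subset]) (simp add: window_def)
    then show ?thesis using set_borel_integral_eq_integral(2) by (simp add: set_lebesgue_integral_def)
  qed
  ultimately show "improper f = (LINT s:{0<..}|lborel. f s)"
    using improper_window(1)[OF f b C d] LIMSEQ_unique by (fastforce simp: set_lebesgue_integral_def)
qed

subsection \<open>Resolvents on the negative half-line\<close>

text \<open>The content of sectoriality that the proof works with: a two-sided inverse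
  \<open>R s\<close> of s + A for every s > 0, with norm O(1/s). Taking \<open>R\<close> with values
  in the space of bounded operators makes it a curve in a Banach space that can be differentiated in
  norm. The bound M >= 1 is arranged by enlarging the constant.\<close>

locale nonneg_operator =
  fixes D :: "'a::complex_banach set" and A :: "'a \<Rightarrow> 'a" and R :: "real \<Rightarrow> 'a \<Rightarrow>\<^sub>L 'a" and M :: real
  assumes lin: "linear_operator D A"
    and R_in: "0 < s \<Longrightarrow> R s x \<in> D"
    and A_R: "0 < s \<Longrightarrow> A (R s x) = x - s *\<^sub>R R s x"
    and R_A: "0 < s \<Longrightarrow> x \<in> D \<Longrightarrow> R s (s *\<^sub>R x + A x) = x"
    and R_bound: "0 < s \<Longrightarrow> norm (R s) \<le> M / s"
    and M1: "1 \<le> M"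

text \<open>The resolvent at -s inverts -s - A, so \<open>R s x\<close> is its value at -x. Through
  this change of sign, bijectivity and boundedness pass to s + A, and the norm bound is the supremum
  in the definition of sectoriality.\<close>

lemma sectorial_imp_nonneg_operator:
  fixes D :: "'a::complex_banach set"
  assumes "sectorial D A"
  shows "\<exists>R M. nonneg_operator D A R M"
proof -
  have lin: "linear_operator D A" and rho: "\<And>s. 0 < s \<Longrightarrow> complex_of_real (- s) \<in> resolvent_set D A"
    and bdd: "bdd_above ((\<lambda>l::real. onorm (\<lambda>x. complex_of_real l *\<^sub>C
      inv_into D (\<lambda>y. complex_of_real l *\<^sub>C y + A y) x)) ` {0<..})"
    using assms unfolding sectorial_def by auto
  define Q where "Q s = inv_into D (\<lambda>y. complex_of_real s *\<^sub>C y + A y)" for s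
  have bij: "bij_betw (\<lambda>y. complex_of_real s *\<^sub>C y + A y) D UNIV" if s: "0 < s" for s
  proof -
    have "bij_betw (\<lambda>x. complex_of_real (- s) *\<^sub>C x - A x) D UNIV"
      using rho[OF s] by (simp add: resolvent_set_def)
    then have "bij_betw (uminus \<circ> (\<lambda>x. complex_of_real (- s) *\<^sub>C x - A x)) D UNIV"
      by (rule bij_betw_trans) (simp add: bij_uminus)
    moreover have "uminus \<circ> (\<lambda>x. complex_of_real (- s) *\<^sub>C x - A x) = (\<lambda>y. complex_of_real s *\<^sub>C y + A y)"
      by (simp add: fun_eq_iff scaleC_of_real del: of_real_minus)
    ultimately show ?thesis by simp
  qed
  have Qin: "Q s x \<in> D" and Qeq: "s *\<^sub>R Q s x + A (Q s x) = x" if s: "0 < s" for s x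
    using bij_betw_inv_into[OF bij[OF s]] bij_betw_inv_into_right[OF bij[OF s], of x]
    by (auto simp: Q_def bij_betw_def scaleC_of_real)
  have Qinv: "Q s (s *\<^sub>R x + A x) = x" if "0 < s" "x \<in> D" for s x
    using bij_betw_inv_into_left[OF bij[OF that(1)] that(2)] by (simp add: Q_def scaleC_of_real)
  have bl: "bounded_linear (Q s)" if s: "0 < s" for s
  proof -
    have r: "bounded_linear (resolvent D A (complex_of_real (- s)))"
      and b: "bij_betw (\<lambda>x. complex_of_real (- s) *\<^sub>C x - A x) D UNIV"
      using rho[OF s] by (auto simp: resolvent_set_def)
    have "resolvent D A (complex_of_real (- s)) (- x) = Q s x" for x
    proof -
      have "- x = complex_of_real (- s) *\<^sub>C Q s x - A (Q s x)"
        using arg_cong[OF Qeq[OF s, of x], of uminus] by (simp add: scaleC_of_real del: of_real_minus)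
      then show ?thesis
        using bij_betw_inv_into_left[OF b Qin[OF s, of x]] by (simp add: resolvent_def)
    qed
    then have "Q s = (\<lambda>x. resolvent D A (complex_of_real (- s)) (- x))" by auto
    then show ?thesis
      using bounded_linear_compose[OF r bounded_linear_minus[OF bounded_linear_ident]] by simp
  qed
  obtain M0 where M0: "\<And>s. 0 < s \<Longrightarrow> onorm (\<lambda>x. complex_of_real s *\<^sub>C Q s x) \<le> M0"
    using bdd unfolding bdd_above_def Q_def by auto
  define R where "R s = Blinfun (Q s)" for s
  have R: "R s x = Q s x" if "0 < s" for s x
    using bl[OF that] by (simp add: R_def bounded_linear_Blinfun_apply)
  have "nonneg_operator D A R (max M0 1)"
  proof
    fix s :: real and x assume s: "0 < s"
    show "R s x \<in> D" using Qin R s by simp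
    show "A (R s x) = x - s *\<^sub>R R s x" using Qeq[OF s, of x] R[OF s] by (simp add: algebra_simps)
    show "norm (R s) \<le> max M0 1 / s"
    proof (rule norm_blinfun_bound)
      fix y
      have "norm (complex_of_real s *\<^sub>C Q s y) \<le> onorm (\<lambda>x. complex_of_real s *\<^sub>C Q s x) * norm y"
        by (rule onorm) (use bl[OF s] in \<open>simp add: scaleC_of_real bounded_linear_const_scaleR\<close>)
      also have "\<dots> \<le> max M0 1 * norm y"
        using M0[OF s] by (intro mult_right_mono) auto
      finally show "norm (R s y) \<le> max M0 1 / s * norm y"
        using s R[OF s] by (simp add: norm_scaleC field_simps)
    qed (use s in simp)
  qed (use lin R Qinv in auto)
  then show ?thesis by blast
qed

context nonneg_operator begin

lemma R_norm: "0 < s \<Longrightarrow> norm (R s x) \<le> M / s * norm x"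
  using norm_blinfun[of "R s" x] R_bound[of s] by (meson mult_right_mono norm_ge_zero order_trans)

lemma R_scaleC: assumes "0 < s" shows "R s (c *\<^sub>C x) = c *\<^sub>C R s x"
proof -
  have "c *\<^sub>C R s x \<in> D" "A (c *\<^sub>C R s x) = c *\<^sub>C A (R s x)"
    using lin R_in[OF assms] by (auto simp: linear_operator_def)
  moreover have "s *\<^sub>R (c *\<^sub>C R s x) + c *\<^sub>C (x - s *\<^sub>R R s x) = c *\<^sub>C x"
    using scaleC_add_right[of c "s *\<^sub>R R s x" "x - s *\<^sub>R R s x"]
    by (simp add: scaleC_of_real[symmetric] scaleC_scaleC mult.commute)
  ultimately show ?thesis
    using R_A[OF assms, of "c *\<^sub>C R s x"] A_R[OF assms] by simp
qed

lemma resolvent_identity: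
  assumes "0 < s" "0 < r"
  shows "R s x - R r x = (r - s) *\<^sub>R R s (R r x)"
proof -
  have "s *\<^sub>R R r x + A (R r x) = x + (s - r) *\<^sub>R R r x"
    using A_R[OF assms(2)] by (simp add: algebra_simps)
  then have "R r x = R s x + (s - r) *\<^sub>R R s (R r x)"
    using R_A[OF assms(1) R_in[OF assms(2)], of x] by (simp add: blinfun.add_right blinfun.scaleR_right)
  then show ?thesis by (simp add: algebra_simps)
qed

lemma R_continuous: assumes "0 < s" shows "continuous (at s) R"
proof -
  have "(\<lambda>r. norm (R r - R s)) \<midarrow>s\<rightarrow> 0"
  proof (rule tendsto_sandwich[OF _ _ tendsto_const])
    show "\<forall>\<^sub>F r in at s. norm (R r - R s) \<le> \<bar>s - r\<bar> * (M / r * (M / s))"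
    proof (rule eventually_mono[OF eventually_at_in_open'[of "{0<..}" s]])
      fix r :: real assume "r \<in> {0<..}"
      then have r: "0 < r" by simp
      show "norm (R r - R s) \<le> \<bar>s - r\<bar> * (M / r * (M / s))"
      proof (rule norm_blinfun_bound)
        fix x
        have "norm ((R r - R s) x) = \<bar>s - r\<bar> * norm (R r (R s x))"
          using resolvent_identity[OF r assms] by (simp add: blinfun.diff_left)
        also have "\<dots> \<le> \<bar>s - r\<bar> * (M / r * (M / s * norm x))"
        proof (rule mult_left_mono)
          have "norm (R r (R s x)) \<le> M / r * norm (R s x)" by (rule R_norm[OF r])
          also have "\<dots> \<le> M / r * (M / s * norm x)"
            using M1 r by (intro mult_left_mono R_norm[OF assms]) auto
          finally show "norm (R r (R s x)) \<le> M / r * (M / s * norm x)" .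
        qed simp
        finally show "norm ((R r - R s) x) \<le> \<bar>s - r\<bar> * (M / r * (M / s)) * norm x"
          by (simp add: mult.assoc)
      qed (use r assms M1 in simp)
    qed (use assms in auto)
    have "(\<lambda>r. \<bar>s - r\<bar> * (M / r * (M / s))) \<midarrow>s\<rightarrow> \<bar>s - s\<bar> * (M / s * (M / s))"
      using assms by (intro tendsto_intros) auto
    then show "(\<lambda>r. \<bar>s - r\<bar> * (M / r * (M / s))) \<midarrow>s\<rightarrow> 0" by simp
  qed simp
  then show ?thesis
    by (simp add: continuous_at LIM_zero_iff tendsto_norm_zero_iff)
qed

lemma continuous_on_R: "continuous_on {0<..} R"
  using R_continuous by (simp add: continuous_at_imp_continuous_on)

text \<open>By the resolvent identity the first-order remainder equals (s - r) (R r - R s) R s, so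
  continuity of \<open>R\<close> already gives differentiability.\<close>

lemma R_has_vector_derivative:
  assumes "0 < s" shows "(R has_vector_derivative - (R s o\<^sub>L R s)) (at s)"
  unfolding has_vector_derivative_def
proof (rule has_derivativeI_sandwich[where e = s and H = "\<lambda>r. norm (R r - R s) * norm (R s)"])
  show "bounded_linear (\<lambda>h. h *\<^sub>R - (R s o\<^sub>L R s))" by (rule bounded_linear_scaleR_left)
  fix r assume r: "r \<noteq> s" "dist r s < s"
  then have r0: "0 < r" using assms by (auto simp: dist_real_def)
  have "R r - R s - (r - s) *\<^sub>R - (R s o\<^sub>L R s) = (s - r) *\<^sub>R ((R r - R s) o\<^sub>L R s)"
  proof (rule blinfun_eqI)
    fix x
    have "(R r - R s - (r - s) *\<^sub>R - (R s o\<^sub>L R s)) x = (R r x - R s x) + (r - s) *\<^sub>R R s (R s x)"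
      by (simp add: blinfun.bilinear_simps)
    also have "\<dots> = ((s - r) *\<^sub>R ((R r - R s) o\<^sub>L R s)) x"
      unfolding resolvent_identity[OF r0 assms] by (simp add: blinfun.bilinear_simps algebra_simps)
    finally show "(R r - R s - (r - s) *\<^sub>R - (R s o\<^sub>L R s)) x = ((s - r) *\<^sub>R ((R r - R s) o\<^sub>L R s)) x" .
  qed
  then have "norm (R r - R s - (r - s) *\<^sub>R - (R s o\<^sub>L R s)) = \<bar>s - r\<bar> * norm ((R r - R s) o\<^sub>L R s)"
    by simp
  also have "\<dots> \<le> \<bar>s - r\<bar> * (norm (R r - R s) * norm (R s))"
    by (intro mult_left_mono norm_blinfun_compose) auto
  finally show "norm (R r - R s - (r - s) *\<^sub>R - (R s o\<^sub>L R s)) / norm (r - s) \<le> norm (R r - R s) * norm (R s)"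
    using r by (simp add: divide_le_eq abs_minus_commute mult.commute)
next
  have "((\<lambda>r. norm (R r - R s) * norm (R s)) \<longlongrightarrow> norm (R s - R s) * norm (R s)) (at s)"
    by (intro tendsto_intros R_continuous[OF assms, unfolded continuous_at])
  then show "((\<lambda>r. norm (R r - R s) * norm (R s)) \<longlongrightarrow> 0) (at s within UNIV)" by simp
qed (use assms in auto)

primrec Rp :: "nat \<Rightarrow> real \<Rightarrow> 'a \<Rightarrow>\<^sub>L 'a" where
  "Rp 0 s = id_blinfun" |
  "Rp (Suc k) s = R s o\<^sub>L Rp k s"

lemma Rp_has_vector_derivative:
  assumes "0 < s" shows "(Rp k has_vector_derivative - (real k *\<^sub>R Rp (Suc k) s)) (at s)"
proof (induction k)
  case 0
  have "Rp 0 = (\<lambda>_. id_blinfun)" by (simp add: fun_eq_iff)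
  then show ?case by simp
next
  case (Suc k)
  have "Rp (Suc k) = (\<lambda>s. R s o\<^sub>L Rp k s)" by (simp add: fun_eq_iff)
  moreover have "((\<lambda>s. R s o\<^sub>L Rp k s) has_vector_derivative
     ((R s o\<^sub>L (- (real k *\<^sub>R Rp (Suc k) s))) + ((- (R s o\<^sub>L R s)) o\<^sub>L Rp k s))) (at s)"
    using bounded_bilinear.has_vector_derivative[OF bounded_bilinear_blinfun_compose R_has_vector_derivative[OF assms] Suc.IH] by simp
  moreover have "(R s o\<^sub>L (- (real k *\<^sub>R Rp (Suc k) s))) + ((- (R s o\<^sub>L R s)) o\<^sub>L Rp k s) = - (real (Suc k) *\<^sub>R Rp (Suc (Suc k)) s)"
    by (rule blinfun_eqI) (simp add: blinfun.bilinear_simps algebra_simps)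
  ultimately show ?case by simp
qed

lemma continuous_on_Rp: "continuous_on {0<..} (Rp k)"
  using Rp_has_vector_derivative by (meson continuous_at_imp_continuous_on greaterThan_iff has_vector_derivative_continuous)

lemma Rp_norm: assumes "0 < s" shows "norm (Rp k s x) \<le> (M / s) ^ k * norm x"
proof (induction k)
  case (Suc k)
  have "norm (Rp (Suc k) s x) \<le> M / s * norm (Rp k s x)" using R_norm[OF assms] by simp
  also have "\<dots> \<le> M / s * ((M / s) ^ k * norm x)" using assms M1 by (intro mult_left_mono Suc) auto
  finally show ?case by (simp add: mult.assoc)
qed simp

text \<open>For x in the domain, s R s x - x = - R s (A x) is O(1/s). The induction applies the
  uniformly bounded operator s R s once more. The rate 1/s is what later gives a rate of convergence
  at t = 0.\<close>

lemma Rp_approx: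
  assumes "x \<in> D" shows "\<exists>C\<ge>0. \<forall>s>0. norm (s ^ k *\<^sub>R Rp k s x - x) \<le> C / s"
proof (induction k)
  case (Suc k)
  then obtain C where C: "0 \<le> C" "\<And>s. 0 < s \<Longrightarrow> norm (s ^ k *\<^sub>R Rp k s x - x) \<le> C / s" by blast
  show ?case
  proof (intro exI[of _ "M * C + M * norm (A x)"] conjI allI impI)
    fix s :: real assume s: "0 < s"
    have "x = R s (s *\<^sub>R x + A x)" using R_A[OF s assms] by simp
    then have e: "s *\<^sub>R R s x - x = - R s (A x)" by (simp add: blinfun.bilinear_simps)
        (metis add_diff_cancel_left' minus_diff_eq)
    have "s ^ Suc k *\<^sub>R Rp (Suc k) s x - x = s *\<^sub>R R s (s ^ k *\<^sub>R Rp k s x - x) + (s *\<^sub>R R s x - x)"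
      by (simp add: blinfun.bilinear_simps algebra_simps)
    then have "norm (s ^ Suc k *\<^sub>R Rp (Suc k) s x - x) \<le> norm (s *\<^sub>R R s (s ^ k *\<^sub>R Rp k s x - x)) + norm (R s (A x))"
      unfolding e by (metis norm_minus_cancel norm_triangle_ineq)
    also have "norm (s *\<^sub>R R s (s ^ k *\<^sub>R Rp k s x - x)) \<le> s * (M / s * (C / s))"
    proof -
      have "norm (R s (s ^ k *\<^sub>R Rp k s x - x)) \<le> M / s * (C / s)"
        using R_norm[OF s] C(2)[OF s] s M1 by (meson divide_nonneg_pos less_le_trans mult_left_mono order_trans zero_le_one)
      then show ?thesis using s by (simp del: times_divide_eq_left times_divide_eq_right)
    qed
    also have "norm (R s (A x)) \<le> M / s * norm (A x)" by (rule R_norm[OF s])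
    finally show "norm (s ^ Suc k *\<^sub>R Rp (Suc k) s x - x) \<le> (M * C + M * norm (A x)) / s"
      using s by (simp add: add_divide_distrib)
  qed (use C M1 in simp)
qed (rule exI[of _ 0], simp)

end

subsection \<open>Test functions\<close>

text \<open>Iterated derivatives need not be computed: it is enough that \<phi> belongs to some
  family of functions closed under differentiation.\<close>

lemma test_functionI:
  assumes S: "\<phi> \<in> S" "\<And>f. f \<in> S \<Longrightarrow> \<exists>f'\<in>S. \<forall>t. (f has_vector_derivative f' t) (at t)"
    and K: "compact K" "K \<subseteq> {0<..}" "\<And>t. t \<notin> K \<Longrightarrow> \<phi> t = 0"
  shows "test_function \<phi>"
proof -
  have "(vderiv ^^ n) \<phi> \<in> S" for n
  proof (induction n)
    case (Suc n)
    then obtain f' where f': "f' \<in> S" "\<And>t. ((vderiv ^^ n) \<phi> has_vector_derivative f' t) (at t)"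
      using S(2) by blast
    have "vderiv ((vderiv ^^ n) \<phi>) = f'"
      using vector_derivative_at[OF f'(2)] by (simp add: fun_eq_iff)
    then show ?case using f'(1) by simp
  qed (use S in simp)
  then have "(vderiv ^^ n) \<phi> differentiable (at t)" for n t
    using S(2) by (meson differentiableI_vector)
  then show ?thesis
    unfolding test_function_def using K by blast
qed

text \<open>A typical term in an iterated derivative of a cutoff times F: n is the order of the
  derivative of the cutoff, j the power of 1/t that has accumulated.\<close>

definition mode :: "(nat \<Rightarrow> real \<Rightarrow> real) \<Rightarrow> complex \<Rightarrow> nat \<Rightarrow> nat \<Rightarrow> (real \<Rightarrow> complex) \<Rightarrow> real \<Rightarrow> complex"
  where "mode X c n j F t = c * of_real (X n t) * inverse (of_real t) ^ j * F t"

inductive_set modes :: "(nat \<Rightarrow> real \<Rightarrow> real) \<Rightarrow> (real \<Rightarrow> complex) \<Rightarrow> (real \<Rightarrow> complex) \<Rightarrow> (real \<Rightarrow> complex) set"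
  for X F G where
  fst: "mode X c n j F \<in> modes X F G" |
  snd: "mode X c n j G \<in> modes X F G" |
  add: "f \<in> modes X F G \<Longrightarrow> g \<in> modes X F G \<Longrightarrow> (\<lambda>t. f t + g t) \<in> modes X F G"

lemma mode_has_vector_derivative:
  assumes X: "\<And>n t. (X n has_real_derivative X (Suc n) t) (at t)" and X0: "\<And>n t. t < c0 \<Longrightarrow> X n t = 0" and c0: "0 < c0"
    and F: "\<And>t. 0 < t \<Longrightarrow> (F has_vector_derivative F' t) (at t)"
  shows "(mode X c n j F has_vector_derivative
     mode X c (Suc n) j F t + (mode X (- (of_nat j * c)) n (Suc j) F t + mode X c n j F' t)) (at t)"
proof (cases "0 < t")
  case True
  have i: "((\<lambda>t. inverse (complex_of_real t) ^ j) has_vector_derivative - (of_nat j * inverse (of_real t) ^ Suc j)) (at t)"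
    by (rule inverse_of_real_power_has_vector_derivative[OF True])
  have x: "((\<lambda>t. c * of_real (X n t)) has_vector_derivative c * of_real (X (Suc n) t)) (at t)"
    using X[of n t] by (intro has_vector_derivative_mult_right has_vector_derivative_of_real)
      (simp add: has_real_derivative_iff_has_vector_derivative)
  from has_vector_derivative_mult[OF has_vector_derivative_mult[OF x i] F[OF True]]
  show ?thesis
    unfolding mode_def by (simp add: algebra_simps mode_def[abs_def])
next
  case False
  have "\<forall>y\<in>{..<c0}. 0 = mode X c n j F y" by (simp add: mode_def X0)
  moreover have "((\<lambda>_. 0) has_vector_derivative 0) (at t)" by simp
  ultimately have "(mode X c n j F has_vector_derivative 0) (at t)"
    using has_vector_derivative_transform_within_open[of "\<lambda>_. 0" 0 t "{..<c0}" "mode X c n j F"] False c0 by auto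
  moreover have "t < c0" using False c0 by simp
  ultimately show ?thesis by (simp add: mode_def X0)
qed

text \<open>A first-order linear system with coefficients polynomial in \<open>1/t\<close> makes the span of the
  \<open>mode\<close> functions closed under differentiation.\<close>

lemma test_function_times_system:
  assumes X: "\<And>n t. (X n has_real_derivative X (Suc n) t) (at t)"
    and X0: "\<And>n t. t \<notin> {c0..c1} \<Longrightarrow> X n t = 0" and c0: "0 < c0"
    and F: "\<And>t. 0 < t \<Longrightarrow> (F has_vector_derivative f1 * inverse (of_real t) * F t + f2 * G t) (at t)"
    and G: "\<And>t. 0 < t \<Longrightarrow> (G has_vector_derivative g1 * inverse (of_real t) * G t + g2 * F t) (at t)"
  shows "test_function (\<lambda>t. of_real (X 0 t) * F t)"
proof (rule test_functionI[where S = "modes X F G" and K = "{c0..c1}"])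
  have "(\<lambda>t. of_real (X 0 t) * F t) = mode X 1 0 0 F" by (simp add: mode_def fun_eq_iff)
  then show "(\<lambda>t. of_real (X 0 t) * F t) \<in> modes X F G" by (simp add: modes.fst)
  have X0': "\<And>n t. t < c0 \<Longrightarrow> X n t = 0" using X0 by auto
  fix f assume "f \<in> modes X F G"
  then show "\<exists>f'\<in>modes X F G. \<forall>t. (f has_vector_derivative f' t) (at t)"
  proof induction
    case (fst c n j)
    let ?f = "\<lambda>t. mode X c (Suc n) j F t + (mode X (- (of_nat j * c)) n (Suc j) F t +
        (mode X (c * f1) n (Suc j) F t + mode X (c * f2) n j G t))"
    have "mode X c n j (\<lambda>t. f1 * inverse (of_real t) * F t + f2 * G t) t = mode X (c * f1) n (Suc j) F t + mode X (c * f2) n j G t" for t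
      by (simp add: mode_def algebra_simps)
    note eq = this
    have "(mode X c n j F has_vector_derivative ?f t) (at t)" for t
      unfolding eq[symmetric] by (rule mode_has_vector_derivative[where X = X and F = F and F' = "\<lambda>t. f1 * inverse (of_real t) * F t + f2 * G t", OF X X0' c0 F])
    moreover have "?f \<in> modes X F G" by (intro modes.intros)
    ultimately show ?case by (intro bexI[of _ ?f] allI)
  next
    case (snd c n j)
    let ?f = "\<lambda>t. mode X c (Suc n) j G t + (mode X (- (of_nat j * c)) n (Suc j) G t +
        (mode X (c * g1) n (Suc j) G t + mode X (c * g2) n j F t))"
    have "mode X c n j (\<lambda>t. g1 * inverse (of_real t) * G t + g2 * F t) t = mode X (c * g1) n (Suc j) G t + mode X (c * g2) n j F t" for t
      by (simp add: mode_def algebra_simps)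
    note eq = this
    have "(mode X c n j G has_vector_derivative ?f t) (at t)" for t
      unfolding eq[symmetric] by (rule mode_has_vector_derivative[where X = X and F = G and F' = "\<lambda>t. g1 * inverse (of_real t) * G t + g2 * F t", OF X X0' c0 G])
    moreover have "?f \<in> modes X F G" by (intro modes.intros)
    ultimately show ?case by (intro bexI[of _ ?f] allI)
  next
    case (add f g)
    then obtain f' g' where "f' \<in> modes X F G" "g' \<in> modes X F G"
      "\<And>t. (f has_vector_derivative f' t) (at t)" "\<And>t. (g has_vector_derivative g' t) (at t)" by blast
    then show ?case
      by (intro bexI[of _ "\<lambda>t. f' t + g' t"] allI has_vector_derivative_add modes.add) auto
  qed
qed (use c0 X0 in auto)

lemma test_functionE:
  assumes "test_function \<phi>"
  obtains a b where "0 < a" "a \<le> b" "\<And>t. t \<notin> {a..b} \<Longrightarrow> \<phi> t = 0"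
    "\<And>t. t \<notin> {a..b} \<Longrightarrow> vderiv \<phi> t = 0" "\<And>t. t \<notin> {a..b} \<Longrightarrow> vderiv (vderiv \<phi>) t = 0"
    "\<And>t. (\<phi> has_vector_derivative vderiv \<phi> t) (at t)"
    "\<And>t. (vderiv \<phi> has_vector_derivative vderiv (vderiv \<phi>) t) (at t)"
    "continuous_on UNIV (vderiv (vderiv \<phi>))"
proof -
  obtain K where K: "compact K" "K \<subseteq> {0<..}" "\<And>t. t \<notin> K \<Longrightarrow> \<phi> t = 0"
    and d: "\<And>n t. ((vderiv ^^ n) \<phi>) differentiable (at t)"
    using assms unfolding test_function_def by blast
  have "\<exists>a b. 0 < a \<and> a \<le> b \<and> K \<subseteq> {a..b}"
  proof (cases "K = {}")
    case True
    then show ?thesis by (intro exI[of _ 1]) auto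
  next
    case False
    have bdd: "bdd_below K" "bdd_above K"
      using compact_imp_bounded[OF K(1)] by (auto intro: bounded_imp_bdd_below bounded_imp_bdd_above)
    have "Inf K \<in> K" using K(1) False bdd by (intro closed_contains_Inf) (auto intro: compact_imp_closed)
    moreover have "K \<subseteq> {Inf K..Sup K}" using bdd by (auto intro: cInf_lower cSup_upper)
    ultimately show ?thesis using K(2) by (intro exI[of _ "Inf K"] exI[of _ "Sup K"]) auto
  qed
  then obtain a b where ab: "0 < a" "a \<le> b" "K \<subseteq> {a..b}" by blast
  have z: "vderiv f t = 0" if "\<And>t. t \<notin> {a..b} \<Longrightarrow> f t = 0" "t \<notin> {a..b}" for f :: "real \<Rightarrow> complex" and t
  proof -
    have "open (- {a..b})" by (intro open_Compl) simp
    then have "(f has_vector_derivative 0) (at t)"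
      using has_vector_derivative_transform_within_open[of "\<lambda>_. 0" 0 t "- {a..b}" f] that by auto
    then show ?thesis by (rule vector_derivative_at)
  qed
  show ?thesis
  proof (rule that[OF ab(1,2)])
    show 0: "\<phi> t = 0" if "t \<notin> {a..b}" for t using K(3) ab(3) that by blast
    show 1: "vderiv \<phi> t = 0" if "t \<notin> {a..b}" for t using z[OF 0 that] .
    show "vderiv (vderiv \<phi>) t = 0" if "t \<notin> {a..b}" for t using z[OF 1 that] .
    show "(\<phi> has_vector_derivative vderiv \<phi> t) (at t)" for t
      using d[of 0 t] by (simp add: vector_derivative_works)
    show "(vderiv \<phi> has_vector_derivative vderiv (vderiv \<phi>) t) (at t)" for t
      using d[of 1 t] by (simp add: vector_derivative_works)
    show "continuous_on UNIV (vderiv (vderiv \<phi>))"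
      using d[of 2] by (auto simp: numeral_2_eq_2 intro!: continuous_at_imp_continuous_on differentiable_imp_continuous_within)
  qed
qed

definition adj :: "complex \<Rightarrow> (real \<Rightarrow> complex) \<Rightarrow> real \<Rightarrow> complex"
  where "adj \<alpha> \<phi> t = vderiv (vderiv \<phi>) t - vderiv (\<lambda>s. (1 - 2 * \<alpha>) / complex_of_real s * \<phi> s) t"

lemma of_real_inverse_has_vector_derivative:
  assumes "0 < t"
  shows "((\<lambda>t. c / complex_of_real t) has_vector_derivative - (c / (of_real t)\<^sup>2)) (at t)"
proof -
  have "((\<lambda>z. c / z) has_field_derivative - (c / (of_real t)\<^sup>2)) (at (complex_of_real t))"
    using assms by (auto intro!: derivative_eq_intros simp: power2_eq_square)
  from field_vector_diff_chain_at[OF of_real_has_vector_derivative this]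
  show ?thesis by (simp add: o_def)
qed

lemma adj_eq:
  assumes "(\<phi> has_vector_derivative \<phi>') (at t)" "0 < t"
  shows "adj \<alpha> \<phi> t = vderiv (vderiv \<phi>) t - (1 - 2 * \<alpha>) * (\<phi>' / of_real t - \<phi> t / (of_real t)\<^sup>2)"
proof -
  have "((\<lambda>s. (1 - 2 * \<alpha>) / complex_of_real s * \<phi> s) has_vector_derivative
     (1 - 2 * \<alpha>) / complex_of_real t * \<phi>' + - ((1 - 2 * \<alpha>) / (of_real t)\<^sup>2) * \<phi> t) (at t)"
    by (rule has_vector_derivative_mult[OF of_real_inverse_has_vector_derivative[OF assms(2)] assms(1)])
  note vector_derivative_at[OF this]
  moreover have "(1 - 2 * \<alpha>) / complex_of_real t * \<phi>' + - ((1 - 2 * \<alpha>) / (of_real t)\<^sup>2) * \<phi> t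
      = (1 - 2 * \<alpha>) * (\<phi>' / of_real t - \<phi> t / (of_real t)\<^sup>2)"
    unfolding right_diff_distrib by simp
  ultimately show ?thesis
    unfolding adj_def by simp
qed

lemma adj_zero_outside:
  assumes "\<And>t. t \<notin> {a..b} \<Longrightarrow> \<phi> t = 0" "\<And>t. t \<notin> {a..b} \<Longrightarrow> vderiv \<phi> t = 0" "\<And>t. t \<notin> {a..b} \<Longrightarrow> vderiv (vderiv \<phi>) t = 0"
    "\<And>t. (\<phi> has_vector_derivative vderiv \<phi> t) (at t)" "0 < t" "t \<notin> {a..b}"
  shows "adj \<alpha> \<phi> t = 0"
  using assms by (subst adj_eq[OF assms(4)]) auto

lemma continuous_on_adj:
  assumes "\<And>t. (\<phi> has_vector_derivative vderiv \<phi> t) (at t)"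
    "\<And>t. (vderiv \<phi> has_vector_derivative vderiv (vderiv \<phi>) t) (at t)"
    "continuous_on UNIV (vderiv (vderiv \<phi>))"
  shows "continuous_on {0<..} (adj \<alpha> \<phi>)"
proof -
  have c: "continuous_on S \<phi>" "continuous_on S (vderiv \<phi>)" "continuous_on S (vderiv (vderiv \<phi>))" for S
    using assms by (auto intro: continuous_at_imp_continuous_on has_vector_derivative_continuous continuous_on_subset)
  have "continuous_on {0<..} (\<lambda>t. vderiv (vderiv \<phi>) t - (1 - 2 * \<alpha>) * (vderiv \<phi> t / of_real t - \<phi> t / (of_real t)\<^sup>2))"
    by (intro continuous_intros c) auto
  then show ?thesis
    by (rule continuous_on_eq) (use adj_eq[OF assms(1)] in auto)
qed

subsection \<open>The weak equation under the resolvent\<close>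

lemma has_strong_bochner_integral_cong:
  assumes "has_strong_bochner_integral M f I" and eq: "\<And>x. x \<in> space M \<Longrightarrow> f x = g x"
  shows "has_strong_bochner_integral M g I"
proof -
  have "strongly_measurable M f = strongly_measurable M g"
    unfolding strongly_measurable_def using eq by (intro ex_cong1 conj_cong refl AE_cong) auto
  moreover have "(\<integral>\<^sup>+x. ennreal (norm (f x - s x)) \<partial>M) = (\<integral>\<^sup>+x. ennreal (norm (g x - s x)) \<partial>M)" for s
    using eq by (intro nn_integral_cong) simp
  ultimately show ?thesis using assms(1) unfolding has_strong_bochner_integral_def by simp
qed

context nonneg_operator begin

text \<open>The equation after application of the resolvent: \<open>A\<close> has disappeared, all
  integrals are over compact intervals, and the condition is linear in u. The interval is any one
  carrying \<phi>, since the cutoffs used later bring their own.\<close>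

definition weak :: "complex \<Rightarrow> (real \<Rightarrow> 'a) \<Rightarrow> bool"
  where "weak \<alpha> u \<longleftrightarrow> (\<forall>\<phi> a b s. test_function \<phi> \<and> 0 < a \<and> a \<le> b \<and> (\<forall>t. t \<notin> {a..b} \<longrightarrow> \<phi> t = 0) \<and> 0 < s \<longrightarrow>
    integral {a..b} (\<lambda>t. \<phi> t *\<^sub>C u t) = R s (integral {a..b} (\<lambda>t. (adj \<alpha> \<phi> t + of_real s * \<phi> t) *\<^sub>C u t)))"

lemma integral_cong_support:
  fixes f :: "real \<Rightarrow> 'b::banach"
  assumes "\<And>t. t \<in> {a..b} \<union> {c..d} \<Longrightarrow> t \<notin> {a..b} \<inter> {c..d} \<Longrightarrow> f t = 0"
  shows "integral {a..b} f = integral {c..d} f"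
proof -
  have "integral {a..b} f = integral UNIV (\<lambda>t. if t \<in> {a..b} then f t else 0)"
    by (rule integral_restrict_UNIV[symmetric])
  also have "(\<lambda>t. if t \<in> {a..b} then f t else 0) = (\<lambda>t. if t \<in> {c..d} then f t else 0)"
  proof
    fix t show "(if t \<in> {a..b} then f t else 0) = (if t \<in> {c..d} then f t else 0)"
      using assms[of t] by (cases "t \<in> {a..b}"; cases "t \<in> {c..d}") auto
  qed
  also have "integral UNIV \<dots> = integral {c..d} f"
    by (rule integral_restrict_UNIV)
  finally show ?thesis .
qed

text \<open>\<open>R s\<close> may be moved into the strong integral of \<phi> A u, where R s (A u)
  = u - s R s u. The right-hand side of the equation thus becomes an integral of a continuous
  function, and s times \<phi> u is absorbed into the left-hand side.\<close>

lemma solution_imp_weak: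
  assumes sol: "is_solution D A \<alpha> x u"
  shows "weak \<alpha> u"
  unfolding weak_def
proof (intro allI impI, elim conjE)
  fix \<phi> a0 b0 and s :: real
  assume \<phi>: "test_function \<phi>" and a0: "0 < a0" "a0 \<le> b0" and sup0: "\<forall>t. t \<notin> {a0..b0} \<longrightarrow> \<phi> t = 0" and s: "0 < s"
  obtain a b where ab: "0 < a" "a \<le> b" and sup: "\<And>t. t \<notin> {a..b} \<Longrightarrow> \<phi> t = 0"
    "\<And>t. t \<notin> {a..b} \<Longrightarrow> vderiv \<phi> t = 0" "\<And>t. t \<notin> {a..b} \<Longrightarrow> vderiv (vderiv \<phi>) t = 0"
    and d: "\<And>t. (\<phi> has_vector_derivative vderiv \<phi> t) (at t)"
    "\<And>t. (vderiv \<phi> has_vector_derivative vderiv (vderiv \<phi>) t) (at t)"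
    "continuous_on UNIV (vderiv (vderiv \<phi>))"
    by (rule test_functionE[OF \<phi>]) blast
  have uc: "continuous_on {0<..} u"
    using sol unfolding is_solution_def by (auto intro: continuous_on_subset)
  have \<phi>c: "continuous_on {0<..} \<phi>"
    using d(1) by (auto intro: continuous_at_imp_continuous_on has_vector_derivative_continuous)
  have ac: "continuous_on {0<..} (adj \<alpha> \<phi>)" by (rule continuous_on_adj[OF d])
  have Rc: "continuous_on {0<..} (\<lambda>t. R s (u t))" by (intro continuous_intros uc)
  have az: "adj \<alpha> \<phi> t = 0" if "0 < t" "t \<notin> {a..b}" for t
    by (rule adj_zero_outside[OF sup d(1) that])
  have sub: "{p..q} \<subseteq> {0<..}" if "0 < p" for p q :: real using that by auto
  let ?M = "lebesgue_on {0<..} :: real measure"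
  let ?I = "integral {a..b} (\<lambda>t. adj \<alpha> \<phi> t *\<^sub>C u t)"
  have L: "has_strong_bochner_integral ?M (\<lambda>t. adj \<alpha> \<phi> t *\<^sub>C u t) ?I"
    by (rule has_strong_bochner_integral_compact_support[OF _ ab]) (auto intro!: continuous_intros ac uc simp: az)
  have "strong_bochner_integrable ?M (\<lambda>t. \<phi> t *\<^sub>C A (u t))"
  proof (rule strong_bochner_integrable_scaleC[OF \<phi>c _ ab])
    show "strong_bochner_integrable (lebesgue_on {a..b}) (\<lambda>t. A (u t))"
      using sol sub[OF ab(1)] unfolding is_solution_def by auto
  qed (use sup in auto)
  then obtain J where J: "has_strong_bochner_integral ?M (\<lambda>t. \<phi> t *\<^sub>C A (u t)) J"
    unfolding strong_bochner_integrable_def by blast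
  have "strong_bochner_integral ?M (\<lambda>t. adj \<alpha> \<phi> t *\<^sub>C u t) = strong_bochner_integral ?M (\<lambda>t. \<phi> t *\<^sub>C A (u t))"
    using sol \<phi> unfolding is_solution_def adj_def by (simp add: scaleC.diff_left)
  then have IJ: "J = ?I"
    using strong_bochner_integral_eq[OF L] strong_bochner_integral_eq[OF J] by simp
  have "has_strong_bochner_integral ?M (\<lambda>t. R s (\<phi> t *\<^sub>C A (u t))) (R s J)"
    by (rule has_strong_bochner_integral_bounded_linear[OF J blinfun.bounded_linear_right])
  then have 1: "has_strong_bochner_integral ?M (\<lambda>t. \<phi> t *\<^sub>C u t - s *\<^sub>R R s (\<phi> t *\<^sub>C u t)) (R s J)"
  proof (rule has_strong_bochner_integral_cong)
    fix t assume "t \<in> space ?M"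
    then have "u t \<in> D" using sol unfolding is_solution_def by auto
    then have "R s (s *\<^sub>R u t + A (u t)) = u t" by (rule R_A[OF s])
    then have "R s (A (u t)) = u t - s *\<^sub>R R s (u t)" by (simp add: blinfun.bilinear_simps algebra_simps)
    then show "R s (\<phi> t *\<^sub>C A (u t)) = \<phi> t *\<^sub>C u t - s *\<^sub>R R s (\<phi> t *\<^sub>C u t)"
      by (simp add: R_scaleC[OF s] scaleC.diff_right scaleC.scaleR_right)
  qed
  have "has_strong_bochner_integral ?M (\<lambda>t. \<phi> t *\<^sub>C u t - s *\<^sub>R R s (\<phi> t *\<^sub>C u t)) (integral {a..b} (\<lambda>t. \<phi> t *\<^sub>C u t - s *\<^sub>R R s (\<phi> t *\<^sub>C u t)))"
    by (rule has_strong_bochner_integral_compact_support[OF _ ab]) (auto intro!: continuous_intros \<phi>c uc simp: sup blinfun.bilinear_simps)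
  from has_strong_bochner_integral_unique[OF 1 this]
  have RJ: "R s J = integral {a..b} (\<lambda>t. \<phi> t *\<^sub>C u t - s *\<^sub>R R s (\<phi> t *\<^sub>C u t))" .
  have i1: "(\<lambda>t. \<phi> t *\<^sub>C u t) integrable_on {a..b}"
    by (intro integrable_continuous_real continuous_intros continuous_on_subset[OF \<phi>c] continuous_on_subset[OF uc] sub ab)
  have i2: "(\<lambda>t. adj \<alpha> \<phi> t *\<^sub>C u t) integrable_on {a..b}"
    by (intro integrable_continuous_real continuous_intros continuous_on_subset[OF ac] continuous_on_subset[OF uc] sub ab)
  let ?P = "integral {a..b} (\<lambda>t. \<phi> t *\<^sub>C u t)"
  have "integral {a..b} (\<lambda>t. R s (\<phi> t *\<^sub>C u t)) = R s ?P"
    using integral_linear[OF i1 blinfun.bounded_linear_right[of "R s"]] by (simp add: o_def)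
  moreover have "(\<lambda>t. R s (\<phi> t *\<^sub>C u t)) integrable_on {a..b}"
    using integrable_linear[OF i1 blinfun.bounded_linear_right[of "R s"]] by (simp add: o_def)
  ultimately have "R s J = ?P - s *\<^sub>R R s ?P"
    unfolding RJ using i1 by (simp add: Henstock_Kurzweil_Integration.integral_diff integrable_cmul)
  then have "?P = R s (?I + s *\<^sub>R ?P)"
    unfolding IJ by (simp add: blinfun.bilinear_simps algebra_simps)
  also have "?I + s *\<^sub>R ?P = integral {a..b} (\<lambda>t. adj \<alpha> \<phi> t *\<^sub>C u t + s *\<^sub>R (\<phi> t *\<^sub>C u t))"
    using i1 i2 by (simp add: Henstock_Kurzweil_Integration.integral_add integrable_cmul)
  also have "(\<lambda>t. adj \<alpha> \<phi> t *\<^sub>C u t + s *\<^sub>R (\<phi> t *\<^sub>C u t)) = (\<lambda>t. (adj \<alpha> \<phi> t + of_real s * \<phi> t) *\<^sub>C u t)"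
    by (simp add: scaleC_add_left scaleC_scaleC[symmetric] scaleC_of_real)
  finally have "?P = R s (integral {a..b} (\<lambda>t. (adj \<alpha> \<phi> t + of_real s * \<phi> t) *\<^sub>C u t))" .
  \<comment> \<open>The interval supplied by \<open>test_functionE\<close> and the prescribed one
    may differ; \<phi> and its adjoint image vanish on their symmetric difference.\<close>
  moreover have "?P = integral {a0..b0} (\<lambda>t. \<phi> t *\<^sub>C u t)"
    by (rule integral_cong_support) (use sup sup0 in auto)
  moreover have "integral {a..b} (\<lambda>t. (adj \<alpha> \<phi> t + of_real s * \<phi> t) *\<^sub>C u t) = integral {a0..b0} (\<lambda>t. (adj \<alpha> \<phi> t + of_real s * \<phi> t) *\<^sub>C u t)"
  proof (rule integral_cong_support)
    fix t assume t: "t \<in> {a..b} \<union> {a0..b0}" "t \<notin> {a..b} \<inter> {a0..b0}"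
    then have "0 < t" using ab a0 by auto
    have "open (- {a0..b0})" by (intro open_Compl) simp
    have z: "vderiv f t = 0" if "\<And>t. t \<notin> {a0..b0} \<Longrightarrow> f t = 0" "t \<notin> {a0..b0}" for f :: "real \<Rightarrow> complex" and t
      using has_vector_derivative_transform_within_open[of "\<lambda>_. 0" 0 t "- {a0..b0}" f] that \<open>open (- {a0..b0})\<close>
      by (intro vector_derivative_at) auto
    have s1: "vderiv \<phi> t = 0" if "t \<notin> {a0..b0}" for t using z[of \<phi>] sup0 that by blast
    have s2: "vderiv (vderiv \<phi>) t = 0" if "t \<notin> {a0..b0}" for t using z[of "vderiv \<phi>"] s1 that by blast
    have "adj \<alpha> \<phi> t = 0 \<and> \<phi> t = 0"
    proof (cases "t \<in> {a..b}")
      case True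
      then have n: "t \<notin> {a0..b0}" using t by blast
      then show ?thesis using adj_zero_outside[OF _ s1 s2 d(1) \<open>0 < t\<close> n] sup0 by blast
    next
      case False
      then show ?thesis using az[OF \<open>0 < t\<close>] sup by blast
    qed
    then show "(adj \<alpha> \<phi> t + of_real s * \<phi> t) *\<^sub>C u t = 0" by simp
  qed
  ultimately show "integral {a0..b0} (\<lambda>t. \<phi> t *\<^sub>C u t) = R s (integral {a0..b0} (\<lambda>t. (adj \<alpha> \<phi> t + of_real s * \<phi> t) *\<^sub>C u t))"
    by simp
qed

end

subsection \<open>Laplace transforms\<close>

lemma Gamma_laplace:
  assumes z: "0 < Re z" and p: "0 < p"
  shows "has_bochner_integral lborel (\<lambda>s. indicator {0<..} s *\<^sub>R (complex_of_real s powr (z - 1) * of_real (exp (- p * s))))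
     (Gamma z * of_real p powr (- z))"
proof -
  let ?f = "\<lambda>t. complex_of_real t powr (z - 1) / of_real (exp t)"
  have meas: "(\<lambda>t. indicator {0<..} t *\<^sub>R ?f t) \<in> borel_measurable borel"
    by (intro borel_measurable_continuous_on_indicator continuous_intros) auto
  have "integrable lebesgue (\<lambda>t. indicator {0<..} t *\<^sub>R ?f t)"
    using absolutely_integrable_Gamma_integral'[OF z] by (simp add: set_integrable_def)
  then have i: "integrable lborel (\<lambda>t. indicator {0<..} t *\<^sub>R ?f t)"
    using meas by (simp add: integrable_completion)
  then have "(LINT t:{0<..}|lborel. ?f t) = Gamma z"
    using Gamma_integral_complex'[OF z] set_borel_integral_eq_integral(2)[of "{0<..}" ?f]
    by (simp add: set_integrable_def integral_unique)
  then have "has_bochner_integral lborel (\<lambda>t. indicator {0<..} t *\<^sub>R ?f t) (Gamma z)"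
    using i by (simp add: has_bochner_integral_iff set_lebesgue_integral_def)
  then have "has_bochner_integral lborel (\<lambda>s. indicator {0<..} (0 + p * s) *\<^sub>R ?f (0 + p * s)) (Gamma z /\<^sub>R \<bar>p\<bar>)"
    using p by (subst (asm) lborel_has_bochner_integral_real_affine_iff[where c = p and t = 0]) auto
  then have "has_bochner_integral lborel (\<lambda>s. (indicator {0<..} (0 + p * s) *\<^sub>R ?f (0 + p * s)) * of_real p powr (1 - z)) ((Gamma z /\<^sub>R \<bar>p\<bar>) * of_real p powr (1 - z))"
    by (rule has_bochner_integral_mult_left)
  moreover have "(indicator {0<..} (0 + p * s) *\<^sub>R ?f (0 + p * s)) * of_real p powr (1 - z) = indicator {0<..} s *\<^sub>R (complex_of_real s powr (z - 1) * of_real (exp (- p * s)))" for s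
  proof (cases "0 < s")
    case True
    have "(complex_of_real p * complex_of_real s) powr (z - 1) = complex_of_real p powr (z - 1) * complex_of_real s powr (z - 1)"
      using p True by (intro powr_times_real) auto
    moreover have "complex_of_real p powr (z - 1) * of_real p powr (1 - z) = 1"
      using p by (simp flip: powr_add)
    ultimately show ?thesis using True p
      by (simp add: zero_less_mult_iff exp_minus divide_inverse)
  next
    case False
    then show ?thesis using p by (simp add: zero_less_mult_iff)
  qed
  moreover have "(Gamma z /\<^sub>R \<bar>p\<bar>) * of_real p powr (1 - z) = Gamma z * of_real p powr (- z)"
    using p by (simp add: scaleR_conv_of_real powr_diff powr_minus field_simps)
  ultimately show ?thesis by simp
qed

text \<open>From m to m + 1 the left-hand side is multiplied by Re w / |w| <= 1, where w = \<nu> + 1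
  + m. This bounds the ratio that remains when the Bessel series is integrated with absolute
  values.\<close>

lemma rGamma_Gamma_bound:
  assumes "-1 < Re \<nu>"
  shows "norm (rGamma (\<nu> + 1 + of_nat m)) * Gamma (Re \<nu> + 1 + real m) \<le> norm (rGamma (\<nu> + 1)) * Gamma (Re \<nu> + 1)"
proof (induction m)
  case (Suc m)
  let ?w = "\<nu> + 1 + of_nat m" and ?x = "Re \<nu> + 1 + real m"
  have x: "0 < ?x" using assms by simp
  have xw: "?x \<le> norm ?w" using complex_Re_le_cmod[of ?w] by simp
  have "rGamma ?w = ?w * rGamma (?w + 1)" using rGamma_plus1[of ?w] by simp
  then have r: "norm (rGamma ?w) = norm ?w * norm (rGamma (?w + 1))" by (simp add: norm_mult)
  have g: "Gamma (?x + 1) = ?x * Gamma ?x"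
    using x by (intro Gamma_plus1) (auto elim!: nonpos_Ints_cases)
  have "norm (rGamma (?w + 1)) * Gamma (?x + 1) = ?x * norm (rGamma (?w + 1)) * Gamma ?x"
    unfolding g by simp
  also have "\<dots> \<le> norm ?w * norm (rGamma (?w + 1)) * Gamma ?x"
    using Gamma_real_pos[OF x] by (intro mult_right_mono xw) auto
  also have "\<dots> = norm (rGamma ?w) * Gamma ?x" using r by simp
  finally show ?case using Suc by (simp add: add_ac)
qed simp

text \<open>Termwise integration of the power series: the Gamma value of the m-th integral cancels
  the reciprocal Gamma value in its coefficient, leaving the exponential series in -\<tau>/(4p). The
  series of the L1 norms is dominated, up to a constant, by that of exp(\<tau>/(4p)).\<close>

lemma bess_laplace:
  assumes \<nu>: "-1 < Re \<nu>" and p: "0 < p" and \<tau>: "0 < \<tau>"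
  shows "has_bochner_integral lborel (\<lambda>s. indicator {0<..} s *\<^sub>R (of_real (exp (- p * s)) * bess \<nu> (\<tau> * s)))
    (of_real \<tau> powr \<nu> * of_real p powr (- \<nu> - 1) * of_real (exp (- \<tau> / (4 * p))))"
proof -
  define a where "a = Re \<nu>"
  define k where "k m = bcoeff \<nu> m * of_real \<tau> powr \<nu> * of_real \<tau> ^ m" for m
  define g where "g m s = indicator {0<..} s *\<^sub>R (complex_of_real s powr (\<nu> + of_nat m + 1 - 1) * of_real (exp (- p * s)))" for m and s :: real
  define f where "f m s = k m * g m s" for m s
  have gi: "has_bochner_integral lborel (g m) (Gamma (\<nu> + of_nat m + 1) * of_real p powr (- (\<nu> + of_nat m + 1)))" for m
    unfolding g_def by (rule Gamma_laplace) (use \<nu> p in auto)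
  have fi: "has_bochner_integral lborel (f m) (k m * (Gamma (\<nu> + of_nat m + 1) * of_real p powr (- (\<nu> + of_nat m + 1))))" for m
    unfolding f_def by (rule has_bochner_integral_mult_right) (use gi in auto)
  have val: "k m * (Gamma (\<nu> + of_nat m + 1) * of_real p powr (- (\<nu> + of_nat m + 1)))
     = of_real \<tau> powr \<nu> * of_real p powr (- \<nu> - 1) * ((of_real (- \<tau> / (4 * p)) ^ m) /\<^sub>R fact m)" for m
  proof -
    have "\<nu> + of_nat m + 1 \<notin> \<int>\<^sub>\<le>\<^sub>0"
    proof
      assume "\<nu> + of_nat m + 1 \<in> \<int>\<^sub>\<le>\<^sub>0"
      then obtain i where "\<nu> + of_nat m + 1 = of_int i" "i \<le> 0" by (auto elim!: nonpos_Ints_cases)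
      then have "Re \<nu> + real m + 1 = of_int i" by (metis Re_complex_of_real of_real_of_int_eq plus_complex.sel(1) one_complex.sel(1) complex_Re_of_nat)
      then show False using \<nu> \<open>i \<le> 0\<close> by simp
    qed
    then have rG: "rGamma (\<nu> + 1 + of_nat m) * Gamma (\<nu> + of_nat m + 1) = 1"
      by (simp add: rGamma_inverse_Gamma Gamma_eq_zero_iff add_ac)
    have pp: "complex_of_real p powr (- (\<nu> + of_nat m + 1)) = of_real p powr (- \<nu> - 1) * inverse (of_real p ^ m)"
    proof -
      have "- (\<nu> + of_nat m + 1) = (- \<nu> - 1) - of_nat m" by simp
      then have "complex_of_real p powr (- (\<nu> + of_nat m + 1)) = complex_of_real p powr ((- \<nu> - 1) - of_nat m)" by (rule arg_cong)
      also have "\<dots> = of_real p powr (- \<nu> - 1) / of_real p powr of_nat m" by (rule powr_diff)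
      also have "complex_of_real p powr of_nat m = of_real p ^ m" using p by (simp add: powr_nat')
      finally show ?thesis by (simp add: divide_inverse)
    qed
    have "k m * (Gamma (\<nu> + of_nat m + 1) * of_real p powr (- (\<nu> + of_nat m + 1)))
      = (rGamma (\<nu> + 1 + of_nat m) * Gamma (\<nu> + of_nat m + 1)) * ((-1/4) ^ m * of_real \<tau> ^ m * inverse (of_real p ^ m) / fact m) * (of_real \<tau> powr \<nu> * of_real p powr (- \<nu> - 1))"
      unfolding k_def bcoeff_def pp by simp
    also have "(-1/4) ^ m * of_real \<tau> ^ m * inverse (of_real p ^ m) = (complex_of_real (- \<tau> / (4 * p))) ^ m"
    proof -
      have "(-1/4) ^ m * of_real \<tau> ^ m * inverse (of_real p ^ m) = ((-1/4) * complex_of_real \<tau> * inverse (of_real p)) ^ m"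
        by (simp only: power_mult_distrib power_inverse)
      moreover have "(-1/4) * complex_of_real \<tau> * inverse (of_real p) = of_real (- \<tau> / (4 * p))"
        by (simp add: field_simps)
      ultimately show ?thesis by (simp only:)
    qed
    finally have "k m * (Gamma (\<nu> + of_nat m + 1) * of_real p powr (- (\<nu> + of_nat m + 1)))
      = (complex_of_real (- \<tau> / (4 * p)) ^ m / fact m) * (of_real \<tau> powr \<nu> * of_real p powr (- \<nu> - 1))"
      unfolding rG mult_1_left .
    moreover have "W /\<^sub>R fact m = W / fact m" for W :: complex
      by (simp add: scaleR_conv_of_real divide_inverse)
    ultimately show ?thesis by (simp only: mult.commute)
  qed
  have int: "integrable lborel (f m)" for m using fi by (rule integrable.intros)
  have sn: "summable (\<lambda>m. norm (bcoeff \<nu> m * z ^ m))" for z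
  proof (rule powser_insidea[OF summable_bser[of _ "of_real (norm z + 1)"]])
    have "norm z < \<bar>norm z + 1\<bar>" using norm_ge_zero[of z] by linarith
    then show "norm z < norm (complex_of_real (norm z + 1))" by (metis norm_of_real)
  qed
  have feq: "f m s = indicator {0<..} s *\<^sub>R (of_real (exp (- p * s)) * (of_real (\<tau> * s) powr \<nu> * (bcoeff \<nu> m * of_real (\<tau> * s) ^ m)))" for m s
  proof (cases "0 < s")
    case True
    have "complex_of_real s powr (\<nu> + of_nat m + 1 - 1) = of_real s powr \<nu> * of_real s ^ m"
      using True by (simp add: powr_add powr_nat')
    moreover have "complex_of_real (\<tau> * s) powr \<nu> = of_real \<tau> powr \<nu> * of_real s powr \<nu>"
      unfolding of_real_mult using \<tau> True by (intro powr_times_real) auto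
    ultimately show ?thesis
      using True unfolding f_def k_def g_def by (simp add: power_mult_distrib mult_ac)
  qed (simp add: f_def g_def)
  have s1: "AE s in lborel. summable (\<lambda>m. norm (f m s))"
  proof (rule AE_I2)
    fix s :: real
    have "norm (f m s) = (indicator {0<..} s * norm (of_real (exp (- p * s)) * of_real (\<tau> * s) powr \<nu>)) * norm (bcoeff \<nu> m * of_real (\<tau> * s) ^ m)" for m
      unfolding feq by (simp add: norm_mult mult_ac)
    then show "summable (\<lambda>m. norm (f m s))"
      using sn by (simp add: summable_mult)
  qed
  have ng: "(LINT s|lborel. norm (g m s)) = Gamma (a + real m + 1) * p powr (- (a + real m + 1))" for m
  proof -
    let ?x = "a + real m + 1"
    have "has_bochner_integral lborel (\<lambda>s. indicator {0<..} s *\<^sub>R (complex_of_real s powr (of_real ?x - 1) * of_real (exp (- p * s))))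
       (Gamma (of_real ?x) * of_real p powr (- of_real ?x))"
      by (rule Gamma_laplace) (use \<nu> p in \<open>auto simp: a_def\<close>)
    moreover have "indicator {0<..} s *\<^sub>R (complex_of_real s powr (of_real ?x - 1) * of_real (exp (- p * s))) = of_real (norm (g m s))" for s
    proof (cases "0 < s")
      case True
      have "complex_of_real s powr (of_real ?x - 1) = of_real (s powr (?x - 1))"
        using True powr_of_real[of s "?x - 1"] by simp
      then show ?thesis
        using True by (simp add: g_def norm_mult norm_powr_of_real a_def)
    qed (simp add: g_def)
    moreover have "Gamma (complex_of_real ?x) * of_real p powr (- of_real ?x) = of_real (Gamma ?x * p powr (- ?x))"
    proof -
      have "complex_of_real p powr (- of_real ?x) = of_real (p powr (- ?x))"
        using p powr_of_real[of p "- ?x"] by simp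
      then show ?thesis by (simp only: Gamma_complex_of_real of_real_mult)
    qed
    ultimately have "(LINT s|lborel. complex_of_real (norm (g m s))) = of_real (Gamma ?x * p powr (- ?x))"
      using has_bochner_integral_integral_eq by fastforce
    then show ?thesis by (simp only: integral_complex_of_real of_real_eq_iff)
  qed
  have s2: "summable (\<lambda>m. LINT s|lborel. norm (f m s))"
  proof (rule summable_comparison_test')
    let ?K = "norm (rGamma (\<nu> + 1)) * Gamma (a + 1) * (\<tau> powr a * p powr (- a - 1))"
    show "summable (\<lambda>m. ?K * ((\<tau> / (4 * p)) ^ m /\<^sub>R fact m))"
      by (intro summable_mult summable_exp_generic)
    fix m
    have "(LINT s|lborel. norm (f m s)) = norm (k m) * (Gamma (a + real m + 1) * p powr (- (a + real m + 1)))"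
      unfolding f_def norm_mult by (simp add: ng)
    also have "norm (k m) = (1/4) ^ m * norm (rGamma (\<nu> + 1 + of_nat m)) / fact m * \<tau> powr a * \<tau> ^ m"
      using \<tau> by (simp add: k_def bcoeff_def norm_mult norm_divide norm_power norm_powr_of_real a_def)
    also have "p powr (- (a + real m + 1)) = p powr (- a - 1) * inverse (p ^ m)"
    proof -
      have e: "- (a + real m + 1) = (- a - 1) - real m" by simp
      show ?thesis unfolding e powr_diff using p by (simp add: powr_realpow divide_inverse)
    qed
    also have "(1/4) ^ m * norm (rGamma (\<nu> + 1 + of_nat m)) / fact m * \<tau> powr a * \<tau> ^ m * (Gamma (a + real m + 1) * (p powr (- a - 1) * inverse (p ^ m)))
       = (norm (rGamma (\<nu> + 1 + of_nat m)) * Gamma (a + 1 + real m)) * ((\<tau> powr a * p powr (- a - 1)) * ((1/4) ^ m * \<tau> ^ m * inverse (p ^ m) / fact m))"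
      by (simp add: add_ac)
    also have "\<dots> \<le> (norm (rGamma (\<nu> + 1)) * Gamma (a + 1)) * ((\<tau> powr a * p powr (- a - 1)) * ((1/4) ^ m * \<tau> ^ m * inverse (p ^ m) / fact m))"
      using rGamma_Gamma_bound[OF \<nu>, of m] \<tau> p by (intro mult_right_mono) (auto simp: a_def)
    also have "(1/4) ^ m * \<tau> ^ m * inverse (p ^ m) = (\<tau> / (4 * p)) ^ m"
    proof -
      have "(1/4) ^ m * \<tau> ^ m * inverse (p ^ m) = ((1/4) * \<tau> * inverse p) ^ m"
        by (simp only: power_mult_distrib power_inverse)
      moreover have "(1/4) * \<tau> * inverse p = \<tau> / (4 * p)"
        by (simp add: field_simps)
      ultimately show ?thesis by (simp only:)
    qed
    finally have "(LINT s|lborel. norm (f m s)) \<le> ?K * ((\<tau> / (4 * p)) ^ m / fact m)"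
      by (simp only: mult.assoc)
    moreover have "norm (LINT s|lborel. norm (f m s)) = (LINT s|lborel. norm (f m s))"
      by simp
    moreover have "W /\<^sub>R fact m = W / fact m" for W :: real
      by (simp add: divide_inverse)
    ultimately show "norm (LINT s|lborel. norm (f m s)) \<le> ?K * ((\<tau> / (4 * p)) ^ m /\<^sub>R fact m)"
      by (simp only:)
  qed
  have sum: "(\<Sum>m. f m s) = indicator {0<..} s *\<^sub>R (of_real (exp (- p * s)) * bess \<nu> (\<tau> * s))" for s
    unfolding feq bess_def bser_def mult.assoc
    by (intro sums_unique[symmetric] sums_scaleR_right sums_mult summable_sums summable_bser)
  have "integrable lborel (\<lambda>s. \<Sum>m. f m s)"
    by (rule integrable_suminf[OF int s1 s2])
  moreover have "(\<lambda>m. LINT s|lborel. f m s) sums (LINT s|lborel. (\<Sum>m. f m s))"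
    by (rule sums_integral[OF int s1 s2])
  moreover have "(LINT s|lborel. f m s) = of_real \<tau> powr \<nu> * of_real p powr (- \<nu> - 1) * ((of_real (- \<tau> / (4 * p)) ^ m) /\<^sub>R fact m)" for m
    using has_bochner_integral_integral_eq[OF fi] val by simp
  moreover have "(\<lambda>m. of_real \<tau> powr \<nu> * of_real p powr (- \<nu> - 1) * ((of_real (- \<tau> / (4 * p)) ^ m) /\<^sub>R fact m)) sums
      (of_real \<tau> powr \<nu> * of_real p powr (- \<nu> - 1) * exp (complex_of_real (- \<tau> / (4 * p))))"
    by (intro sums_mult exp_converges)
  ultimately have "integrable lborel (\<lambda>s. \<Sum>m. f m s)" "(LINT s|lborel. (\<Sum>m. f m s)) = of_real \<tau> powr \<nu> * of_real p powr (- \<nu> - 1) * exp (complex_of_real (- \<tau> / (4 * p)))"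
    using sums_unique2 by (auto simp del: of_real_minus of_real_divide)
  then show ?thesis
    unfolding sum has_bochner_integral_iff exp_of_real by blast
qed

text \<open>With r = 1/q this is Euler's integral of r^3 exp(-s r), with value 3!/s^4. The explicit
  primitive \<open>F\<close> comes from integrating by parts three times. The formula represents
  s^(-4) as a superposition of exponentials in s.\<close>

lemma inverse_power_laplace:
  assumes s: "0 < (s::real)"
  shows "has_bochner_integral lborel (\<lambda>q. indicator {0<..} q *\<^sub>R (inverse q ^ 5 * exp (- s * inverse q))) (6 / s ^ 4)"
proof -
  define F where "F q = exp (- s * inverse q) * (inverse q ^ 3 / s + 3 * inverse q ^ 2 / s ^ 2 + 6 * inverse q / s ^ 3 + 6 / s ^ 4)" for q
  let ?f = "\<lambda>q. inverse q ^ 5 * exp (- s * inverse q)"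
  have D: "(F has_real_derivative ?f q) (at q)" if q: "0 < q" for q
  proof -
    let ?r = "inverse q"
    have r: "(inverse has_real_derivative - (?r * ?r)) (at q)"
      using DERIV_inverse[of q UNIV] q by simp
    have "(F has_real_derivative
       exp (- s * ?r) * ((3 * (- (?r * ?r)) * ?r ^ 2) / s + 3 * (2 * (- (?r * ?r)) * ?r) / s ^ 2 + 6 * (- (?r * ?r)) / s ^ 3 + 0)
       + (exp (- s * ?r) * (- s * (- (?r * ?r)))) * (?r ^ 3 / s + 3 * ?r ^ 2 / s ^ 2 + 6 * ?r / s ^ 3 + 6 / s ^ 4)) (at q)"
      unfolding F_def
      by (intro DERIV_mult' DERIV_add DERIV_cdivide DERIV_cmult DERIV_const DERIV_fun_exp r)
         (use DERIV_power[OF r, of 3] DERIV_power[OF r, of 2] in \<open>simp_all add: numeral_eq_Suc mult_ac\<close>)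
    moreover have "exp (- s * ?r) * ((3 * (- (?r * ?r)) * ?r ^ 2) / s + 3 * (2 * (- (?r * ?r)) * ?r) / s ^ 2 + 6 * (- (?r * ?r)) / s ^ 3 + 0)
       + (exp (- s * ?r) * (- s * (- (?r * ?r)))) * (?r ^ 3 / s + 3 * ?r ^ 2 / s ^ 2 + 6 * ?r / s ^ 3 + 6 / s ^ 4) = ?f q"
    proof -
      have "E * ((3 * (- (r * r)) * r ^ 2) / s + 3 * (2 * (- (r * r)) * r) / s ^ 2 + 6 * (- (r * r)) / s ^ 3 + 0)
       + (E * (- s * (- (r * r)))) * (r ^ 3 / s + 3 * r ^ 2 / s ^ 2 + 6 * r / s ^ 3 + 6 / s ^ 4) = r ^ 5 * E" for E r :: real
        using s by (simp add: field_simps eval_nat_numeral)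
      then show ?thesis by blast
    qed
    ultimately show ?thesis by simp
  qed
  have lim0: "(F \<longlongrightarrow> 0) (at_right 0)"
  proof -
    have "((\<lambda>r. exp (- s * r) * (r ^ 3 / s + 3 * r ^ 2 / s ^ 2 + 6 * r / s ^ 3 + 6 / s ^ 4)) \<longlongrightarrow> 0) at_top"
      using s by real_asymp
    from filterlim_compose[OF this filterlim_inverse_at_top_right] show ?thesis by (simp add: F_def[abs_def])
  qed
  have lim1: "(F \<longlongrightarrow> 6 / s ^ 4) at_top"
  proof -
    have "((\<lambda>r. exp (- s * r) * (r ^ 3 / s + 3 * r ^ 2 / s ^ 2 + 6 * r / s ^ 3 + 6 / s ^ 4)) \<longlongrightarrow>
       exp (- s * 0) * (0 ^ 3 / s + 3 * 0 ^ 2 / s ^ 2 + 6 * 0 / s ^ 3 + 6 / s ^ 4)) (nhds 0)"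
      using s by (intro tendsto_intros filterlim_ident) auto
    moreover have "filterlim inverse (nhds (0::real)) at_top" by (rule tendsto_inverse_0_at_top[OF filterlim_ident])
    ultimately show ?thesis using filterlim_compose by (fastforce simp: F_def[abs_def])
  qed
  have ei: "einterval 0 \<infinity> = ({0<..} :: real set)" by (auto simp: einterval_def)
  have c: "isCont ?f q" if "0 < q" for q using that by (intro continuous_intros) auto
  have 1: "0 < (\<infinity>::ereal)" "\<And>x. 0 < ereal x \<Longrightarrow> ereal x < \<infinity> \<Longrightarrow> DERIV F x :> ?f x"
    "\<And>x. 0 < ereal x \<Longrightarrow> ereal x < \<infinity> \<Longrightarrow> isCont ?f x"
    "AE x in lborel. 0 < ereal x \<longrightarrow> ereal x < \<infinity> \<longrightarrow> 0 \<le> ?f x"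
    "((F \<circ> real_of_ereal) \<longlongrightarrow> 0) (at_right 0)" "((F \<circ> real_of_ereal) \<longlongrightarrow> 6 / s ^ 4) (at_left \<infinity>)"
    using D c lim0 lim1 by (auto simp: zero_ereal_def ereal_tendsto_simps)
  have "set_integrable lborel {0<..} ?f" "(LBINT x=0..\<infinity>. ?f x) = 6 / s ^ 4 - 0"
    using interval_integral_FTC_nonneg[OF 1] unfolding ei by auto
  then show ?thesis
    unfolding set_integrable_def has_bochner_integral_iff interval_lebesgue_integral_def set_lebesgue_integral_def ei by simp
qed

text \<open>Replacing 6/s^4 by the superposition of \<open>inverse_power_laplace\<close> and
  exchanging the integrals turns the inner integral into a Laplace transform of B_(\<alpha>+3) at
  1/q, equal to q^(\<alpha>+4) exp(-q/4). With the factor q^(-5) what remains is the Gamma integral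
  of q^(\<alpha>-1) exp(-q/4), that is \<open>Gamma \<alpha>\<close> times 4^\<alpha>, and Gamma has
  no zeros.\<close>

lemma bess_normalisation:
  assumes a: "0 < Re \<alpha>" and int: "set_integrable lborel {0<..} (\<lambda>s. bess (\<alpha> + 3) s / of_real s ^ 4)"
  shows "(LINT s:{0<..}|lborel. bess (\<alpha> + 3) s / of_real s ^ 4) \<noteq> 0"
proof -
  define B where "B s = indicator {0<..} s *\<^sub>R bess (\<alpha> + 3) s" for s
  define r where "r q s = indicator {0<..} q *\<^sub>R (indicator {0<..} s *\<^sub>R (inverse q ^ 5 * exp (- s * inverse q)))" for q s :: real
  define H where "H s q = of_real (r q s) * B s" for s q
  have Bm: "B \<in> borel_measurable borel"
    unfolding B_def by (intro borel_measurable_continuous_on_indicator continuous_on_bess) auto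
  have rm: "(\<lambda>(s, q). r q s) \<in> borel_measurable (lborel \<Otimes>\<^sub>M lborel)"
    unfolding r_def by measurable
  have Hm: "case_prod H \<in> borel_measurable (lborel \<Otimes>\<^sub>M lborel)"
  proof -
    have "(\<lambda>x. B (fst x)) \<in> borel_measurable (lborel \<Otimes>\<^sub>M lborel)"
      using Bm by (intro measurable_compose[OF measurable_fst]) simp
    moreover have "(\<lambda>x. complex_of_real (r (snd x) (fst x))) \<in> borel_measurable (lborel \<Otimes>\<^sub>M lborel)"
      by (rule borel_measurable_continuous_on[OF _ rm[unfolded case_prod_unfold]]) (intro continuous_intros)
    ultimately show ?thesis
      unfolding H_def case_prod_unfold by (intro borel_measurable_times)
  qed
  have rq: "has_bochner_integral lborel (\<lambda>q. r q s) (indicator {0<..} s * (6 / s ^ 4))" for s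
    using inverse_power_laplace[of s] by (cases "0 < s") (auto simp: r_def)
  have i6: "integrable lborel (\<lambda>s. of_real (indicator {0<..} s * (6 / s ^ 4)) * B s)"
  proof -
    have "of_real (indicator {0<..} s * (6 / s ^ 4)) * B s = 6 * (indicator {0<..} s *\<^sub>R (bess (\<alpha> + 3) s / of_real s ^ 4))" for s
      by (simp add: B_def indicator_def)
    then show ?thesis
      using int unfolding set_integrable_def by (simp only: integrable_mult_right)
  qed
  have r0: "0 \<le> r q s" for q s by (simp add: r_def indicator_def)
  have Hi: "integrable (lborel \<Otimes>\<^sub>M lborel) (case_prod H)"
  proof (rule lborel_pair.Fubini_integrable[OF Hm])
    have "(\<integral>q. norm (H s q) \<partial>lborel) = norm (of_real (indicator {0<..} s * (6 / s ^ 4)) * B s)" for s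
    proof -
      have "(\<integral>q. norm (H s q) \<partial>lborel) = (\<integral>q. r q s \<partial>lborel) * norm (B s)"
        using r0 by (simp add: H_def norm_mult)
      then show ?thesis
        using has_bochner_integral_integral_eq[OF rq[of s]] by (simp add: norm_mult indicator_def del: of_real_mult of_real_divide)
    qed
    then show "integrable lborel (\<lambda>s. \<integral>q. norm (case (s, q) of (s, q) \<Rightarrow> H s q) \<partial>lborel)"
      using integrable_norm[OF i6] by simp
    have "integrable lborel (\<lambda>q. H s q)" for s
      unfolding H_def using integrable.intros[OF rq[of s]] by (intro integrable_mult_left) auto
    then show "AE s in lborel. integrable lborel (\<lambda>q. case (s, q) of (s, q) \<Rightarrow> H s q)" by simp
  qed
  have "(\<integral>q. (\<integral>s. H s q \<partial>lborel) \<partial>lborel) = (\<integral>s. (\<integral>q. H s q \<partial>lborel) \<partial>lborel)"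
    by (rule lborel_pair.Fubini_integral[OF Hi])
  also have "(\<lambda>s. \<integral>q. H s q \<partial>lborel) = (\<lambda>s. 6 * (indicator {0<..} s *\<^sub>R (bess (\<alpha> + 3) s / of_real s ^ 4)))"
  proof
    fix s
    have "(\<integral>q. H s q \<partial>lborel) = of_real (\<integral>q. r q s \<partial>lborel) * B s"
      unfolding H_def by simp
    then show "(\<integral>q. H s q \<partial>lborel) = 6 * (indicator {0<..} s *\<^sub>R (bess (\<alpha> + 3) s / of_real s ^ 4))"
      using has_bochner_integral_integral_eq[OF rq[of s]] by (simp add: B_def indicator_def)
  qed
  finally have 1: "(\<integral>q. (\<integral>s. H s q \<partial>lborel) \<partial>lborel) = 6 * (LINT s:{0<..}|lborel. bess (\<alpha> + 3) s / of_real s ^ 4)"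
    by (simp only: set_lebesgue_integral_def integral_mult_right_zero)
  have 2: "(\<integral>s. H s q \<partial>lborel) = indicator {0<..} q *\<^sub>R (complex_of_real q powr (\<alpha> - 1) * of_real (exp (- (1/4) * q)))" for q
  proof (cases "0 < q")
    case True
    have "(\<integral>s. H s q \<partial>lborel) = (\<integral>s. of_real (inverse q ^ 5) * (indicator {0<..} s *\<^sub>R (of_real (exp (- inverse q * s)) * bess (\<alpha> + 3) (1 * s))) \<partial>lborel)"
      using True by (intro Bochner_Integration.integral_cong refl) (auto simp: H_def r_def B_def indicator_def mult.commute)
    also have "\<dots> = of_real (inverse q ^ 5) * (of_real 1 powr (\<alpha> + 3) * of_real (inverse q) powr (- (\<alpha> + 3) - 1) * of_real (exp (- 1 / (4 * inverse q))))"
      using True a has_bochner_integral_integral_eq[OF bess_laplace[of "\<alpha> + 3" "inverse q" 1]]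
      by (subst integral_mult_right_zero) (simp del: of_real_inverse)
    also have "complex_of_real (inverse q) powr (- (\<alpha> + 3) - 1) = of_real q powr (\<alpha> + 4)"
    proof -
      have "complex_of_real (inverse q) powr (- (\<alpha> + 3) - 1) = exp ((- (\<alpha> + 3) - 1) * of_real (ln (inverse q)))"
        using True by (simp add: powr_def Ln_of_real del: of_real_inverse)
      also have "\<dots> = of_real q powr (\<alpha> + 4)"
        using True by (simp add: powr_def Ln_of_real ln_inverse algebra_simps)
      finally show ?thesis .
    qed
    also have "of_real (inverse q ^ 5) * (of_real 1 powr (\<alpha> + 3) * of_real q powr (\<alpha> + 4) * of_real (exp (- 1 / (4 * inverse q))))
       = complex_of_real q powr (\<alpha> - 1) * of_real (exp (- (1/4) * q))"
    proof -
      have "complex_of_real q powr (\<alpha> - 1) = of_real q powr ((\<alpha> + 4) - of_nat 5)" by (simp add: algebra_simps)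
      also have "\<dots> = of_real q powr (\<alpha> + 4) / of_real q ^ 5"
        unfolding powr_diff using True by (subst powr_nat') auto
      finally show ?thesis using True by (simp add: field_simps power_inverse)
    qed
    finally show ?thesis using True by simp
  next
    case False
    then show ?thesis by (simp add: H_def r_def)
  qed
  have "(\<integral>q. (\<integral>s. H s q \<partial>lborel) \<partial>lborel) = Gamma \<alpha> * of_real (1/4) powr (- \<alpha>)"
    unfolding 2 using has_bochner_integral_integral_eq[OF Gamma_laplace[OF a, of "1/4"]] by simp
  moreover have "Gamma \<alpha> \<noteq> 0"
    using a by (auto simp: Gamma_eq_zero_iff elim!: nonpos_Ints_cases)
  ultimately show ?thesis using 1 by auto
qed

subsection \<open>Cutoff functions\<close>

text \<open>The step is chosen once and for all, so that the bounds on its derivatives do not depend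
  on the cutoff parameter N.\<close>

definition step :: "nat \<Rightarrow> real \<Rightarrow> real"
  where "step = (SOME \<theta>. (\<forall>n t. (\<theta> n has_real_derivative \<theta> (Suc n) t) (at t)) \<and>
    (\<forall>t\<le>1. \<theta> 0 t = 0) \<and> (\<forall>t\<ge>2. \<theta> 0 t = 1) \<and> mono (\<theta> 0) \<and> (\<forall>n t. t \<notin> {1..2} \<longrightarrow> \<theta> (Suc n) t = 0))"

lemma step:
  "(step n has_real_derivative step (Suc n) t) (at t)"
  "t \<le> 1 \<Longrightarrow> step 0 t = 0" "2 \<le> t \<Longrightarrow> step 0 t = 1" "mono (step 0)"
  "t \<notin> {1..2} \<Longrightarrow> step (Suc n) t = 0"
proof -
  have "\<exists>\<theta> :: nat \<Rightarrow> real \<Rightarrow> real. (\<forall>n t. (\<theta> n has_real_derivative \<theta> (Suc n) t) (at t)) \<and>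
    (\<forall>t\<le>1. \<theta> 0 t = 0) \<and> (\<forall>t\<ge>2. \<theta> 0 t = 1) \<and> mono (\<theta> 0) \<and> (\<forall>n t. t \<notin> {1..2} \<longrightarrow> \<theta> (Suc n) t = 0)"
    by (rule smooth_step_exists) blast
  from someI_ex[OF this, folded step_def] show
    "(step n has_real_derivative step (Suc n) t) (at t)"
    "t \<le> 1 \<Longrightarrow> step 0 t = 0" "2 \<le> t \<Longrightarrow> step 0 t = 1" "mono (step 0)"
    "t \<notin> {1..2} \<Longrightarrow> step (Suc n) t = 0" by blast+
qed

lemma step_bound: "\<exists>T\<ge>0. \<forall>t. \<bar>step (Suc n) t\<bar> \<le> T"
proof -
  have "continuous_on {1..2} (step (Suc n))"
    using step(1) by (meson DERIV_isCont continuous_at_imp_continuous_on)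
  then have "bounded (step (Suc n) ` {1..2})"
    by (intro compact_imp_bounded compact_continuous_image) auto
  then obtain T where T: "\<And>t. t \<in> {1..2} \<Longrightarrow> \<bar>step (Suc n) t\<bar> \<le> T"
    unfolding bounded_iff real_norm_def by blast
  have "\<bar>step (Suc n) t\<bar> \<le> max T 0" for t
    using T[of t] step(5)[of t n] by (cases "t \<in> {1..2}") auto
  then show ?thesis by (intro exI[of _ "max T 0"]) auto
qed

text \<open>The first dilated step switches on across [1/N, 2/N] and the second switches off across
  [N, 2N]. The index n is the order of the derivative, and the chain rule is responsible for the
  powers of N.\<close>

definition cutoff :: "real \<Rightarrow> nat \<Rightarrow> real \<Rightarrow> real"
  where "cutoff N n t = N ^ n * step n (N * t) - inverse N ^ n * step n (inverse N * t)"

lemma cutoff_has_derivative: "(cutoff N n has_real_derivative cutoff N (Suc n) t) (at t)"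
proof -
  have d: "((\<lambda>t. c ^ n * step n (c * t)) has_real_derivative c ^ Suc n * step (Suc n) (c * t)) (at t)" for c
  proof -
    have "((\<lambda>t. c ^ n * step n (c * t)) has_real_derivative c ^ n * (step (Suc n) (c * t) * (c * 1))) (at t)"
      by (intro DERIV_cmult DERIV_chain2[OF step(1)] DERIV_ident)
    then show ?thesis by (simp add: mult_ac)
  qed
  show ?thesis
    unfolding cutoff_def by (intro DERIV_diff d)
qed

lemma continuous_on_cutoff: "continuous_on S (cutoff N n)"
  using cutoff_has_derivative by (meson DERIV_isCont continuous_at_imp_continuous_on)

lemma cutoff_zero:
  assumes N: "2 \<le> N" and t: "t \<notin> {1/N..2*N}"
  shows "cutoff N n t = 0"
proof (cases "t < 1/N")
  case True
  then have 1: "N * t < 1" using N by (simp add: field_simps)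
  moreover have "inverse N * t < 1"
  proof (cases "0 \<le> t")
    case True
    have "inverse N \<le> N" using N le_imp_inverse_le[of 1 N] by simp
    then have "inverse N * t \<le> N * t" using True by (intro mult_right_mono)
    then show ?thesis using 1 by linarith
  next
    case False
    then have "inverse N * t \<le> 0" using N by (simp add: mult_nonneg_nonpos)
    then show ?thesis by linarith
  qed
  ultimately show ?thesis
    using step(2)[of "N * t"] step(2)[of "inverse N * t"] step(5)[of "N * t"] step(5)[of "inverse N * t"]
    by (cases n) (simp_all add: cutoff_def)
next
  case False
  then have t: "2 * N < t" using t by auto
  then have 1: "2 < inverse N * t" using N by (simp add: field_simps)
  have "2 < N * t"
  proof -
    have "1 * t \<le> N * t" using N t by (intro mult_right_mono) auto
    then show ?thesis using t N by linarith
  qed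
  then show ?thesis
    using 1 step(3)[of "N * t"] step(3)[of "inverse N * t"] step(5)[of "N * t"] step(5)[of "inverse N * t"]
    by (cases n) (simp_all add: cutoff_def)
qed

lemma cutoff_middle:
  assumes N: "2 \<le> N" and t: "2/N < t" "t < N"
  shows "cutoff N (Suc n) t = 0" "cutoff N 0 t = 1"
proof -
  have "2 < N * t" "inverse N * t < 1" using N t by (auto simp: field_simps)
  then show "cutoff N (Suc n) t = 0" "cutoff N 0 t = 1"
    using step(2)[of "inverse N * t"] step(3)[of "N * t"] step(5)[of "N * t" n] step(5)[of "inverse N * t" n] by (simp_all add: cutoff_def)
qed

lemma cutoff_01:
  assumes N: "2 \<le> N" and t: "0 \<le> t"
  shows "0 \<le> cutoff N 0 t" "cutoff N 0 t \<le> 1"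
proof -
  have "inverse N \<le> N" using N le_imp_inverse_le[of 1 N] by simp
  then have "step 0 (inverse N * t) \<le> step 0 (N * t)"
    using t by (intro monoD[OF step(4)] mult_right_mono)
  moreover have "0 \<le> step 0 x" "step 0 x \<le> 1" for x
    using monoD[OF step(4), of "min x 1" x] monoD[OF step(4), of x "max x 2"] step(2)[of "min x 1"] step(3)[of "max x 2"] by auto
  ultimately show "0 \<le> cutoff N 0 t" "cutoff N 0 t \<le> 1"
    by (auto simp: cutoff_def intro: order_trans[OF diff_left_mono[of 0], of _ _ 1])
qed

text \<open>Near each end only one of the two dilated steps is active: each derivative costs a
  factor N at the lower end and gains a factor 1/N at the upper end.\<close>

lemma cutoff_bounds:
  assumes T: "\<And>t. \<bar>step (Suc n) t\<bar> \<le> T" and N: "2 \<le> N"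
  shows "t \<le> 2/N \<Longrightarrow> \<bar>cutoff N (Suc n) t\<bar> \<le> N ^ Suc n * T"
    and "N \<le> t \<Longrightarrow> \<bar>cutoff N (Suc n) t\<bar> \<le> inverse N ^ Suc n * T"
proof -
  assume t: "t \<le> 2/N"
  have "inverse N * t \<le> inverse N * (2/N)" using t N by (intro mult_left_mono) auto
  also have "\<dots> < 1" using N by (simp add: field_simps) (use mult_mono[of 2 N 2 N] in simp)
  finally have "step (Suc n) (inverse N * t) = 0" by (intro step(5)) auto
  then show "\<bar>cutoff N (Suc n) t\<bar> \<le> N ^ Suc n * T"
    using N T by (simp add: cutoff_def abs_mult mult_left_mono del: power_Suc)
next
  assume t: "N \<le> t"
  have "2 * 2 \<le> N * t" using t N by (intro mult_mono) auto
  then have "step (Suc n) (N * t) = 0" by (intro step(5)) auto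
  then show "\<bar>cutoff N (Suc n) t\<bar> \<le> inverse N ^ Suc n * T"
    using N T by (simp add: cutoff_def abs_mult mult_left_mono del: power_Suc)
qed

subsection \<open>The adjoint Bessel kernels\<close>

definition kap :: "complex \<Rightarrow> real \<Rightarrow> real \<Rightarrow> complex"
  where "kap \<alpha> s t = of_real t powr (1 - 2 * \<alpha>) * bess \<alpha> (t\<^sup>2 * s)"

text \<open>The companion that closes \<open>kap\<close> to a first-order linear system in t with
  coefficients in 1/t and constants. In this form the index \<alpha> - 1, which appears when
  B_\<alpha> is differentiated, is eliminated by the recurrence in favour of \<alpha> + 1.\<close>

definition mom :: "complex \<Rightarrow> real \<Rightarrow> real \<Rightarrow> complex"
  where "mom \<alpha> s t = of_real t powr (- (2 * \<alpha>)) * bess (\<alpha> + 1) (t\<^sup>2 * s)"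

lemma bess_square_has_vector_derivative:
  assumes "0 < t" "0 < s"
  shows "((\<lambda>t. bess \<nu> (t\<^sup>2 * s)) has_vector_derivative of_real (2 * t * s) * bess (\<nu> - 1) (t\<^sup>2 * s)) (at t)"
proof -
  have "((\<lambda>t. t\<^sup>2 * s) has_vector_derivative 2 * t * s) (at t)"
    by (auto intro!: derivative_eq_intros simp: has_real_derivative_iff_has_vector_derivative[symmetric])
  from vector_diff_chain_at[OF this bess_has_vector_derivative] assms
  show ?thesis by (simp add: o_def scaleR_conv_of_real)
qed

lemma powr_one_minus:
  assumes "0 < t" shows "complex_of_real t powr (1 - 2 * \<alpha>) = of_real t * of_real t powr (- (2 * \<alpha>))"
  using assms powr_add[of "complex_of_real t" 1 "- (2 * \<alpha>)"] by simp

lemma kap_has_vector_derivative: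
  assumes t: "0 < t" and s: "0 < s"
  shows "(kap \<alpha> s has_vector_derivative 1 * inverse (of_real t) * kap \<alpha> s t + (- 1 / 2) * mom \<alpha> s t) (at t)"
proof -
  let ?q = "complex_of_real t powr (- (2 * \<alpha>))" and ?z = "t\<^sup>2 * s"
  have "(kap \<alpha> s has_vector_derivative
     of_real t powr (1 - 2 * \<alpha>) * (of_real (2 * t * s) * bess (\<alpha> - 1) ?z) +
     (1 - 2 * \<alpha>) * of_real t powr (1 - 2 * \<alpha> - 1) * bess \<alpha> ?z) (at t)"
    unfolding kap_def
    by (rule has_vector_derivative_mult[OF powr_of_real_has_vector_derivative[OF t] bess_square_has_vector_derivative[OF t s]])
  moreover have "of_real t powr (1 - 2 * \<alpha>) * (of_real (2 * t * s) * bess (\<alpha> - 1) ?z) +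
     (1 - 2 * \<alpha>) * of_real t powr (1 - 2 * \<alpha> - 1) * bess \<alpha> ?z
     = 1 * inverse (of_real t) * kap \<alpha> s t + (- 1 / 2) * mom \<alpha> s t"
  proof -
    have "of_real ?z * bess (\<alpha> - 1) ?z = \<alpha> * bess \<alpha> ?z - bess (\<alpha> + 1) ?z / 4"
      using bess_recurrence[of ?z "\<alpha> + 1"] t s by (simp add: algebra_simps add_eq_0_iff2)
    moreover have "2 * (\<alpha> * x - y / 4) + (1 - 2 * \<alpha>) * x = x - y / 2" for x y
      by (simp add: algebra_simps)
    ultimately have "2 * (of_real ?z * bess (\<alpha> - 1) ?z) + (1 - 2 * \<alpha>) * bess \<alpha> ?z = bess \<alpha> ?z - bess (\<alpha> + 1) ?z / 2"
      by (simp only:)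
    then have "?q * (2 * (of_real ?z * bess (\<alpha> - 1) ?z) + (1 - 2 * \<alpha>) * bess \<alpha> ?z) = ?q * (bess \<alpha> ?z - bess (\<alpha> + 1) ?z / 2)"
      by simp
    then show ?thesis
      unfolding kap_def mom_def powr_one_minus[OF t] using t by (simp add: algebra_simps power2_eq_square)
  qed
  ultimately show ?thesis by simp
qed

lemma mom_has_vector_derivative:
  assumes t: "0 < t" and s: "0 < s"
  shows "(mom \<alpha> s has_vector_derivative (- 2 * \<alpha>) * inverse (of_real t) * mom \<alpha> s t + of_real (2 * s) * kap \<alpha> s t) (at t)"
proof -
  have "(mom \<alpha> s has_vector_derivative
     of_real t powr (- (2 * \<alpha>)) * (of_real (2 * t * s) * bess (\<alpha> + 1 - 1) (t\<^sup>2 * s)) +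
     (- (2 * \<alpha>)) * of_real t powr (- (2 * \<alpha>) - 1) * bess (\<alpha> + 1) (t\<^sup>2 * s)) (at t)"
    unfolding mom_def
    by (rule has_vector_derivative_mult[OF powr_of_real_has_vector_derivative[OF t] bess_square_has_vector_derivative[OF t s]])
  moreover have "complex_of_real t powr (- (2 * \<alpha>) - 1) = inverse (of_real t) * of_real t powr (- (2 * \<alpha>))"
    using t by (simp add: powr_diff divide_inverse mult.commute)
  ultimately show ?thesis
    unfolding kap_def mom_def powr_one_minus[OF t] by (simp add: algebra_simps)
qed

text \<open>For an eigenfunction k with L^* k = - s k and a cutoff X, the expression (L^* + s)(X k)
  equals X'' k + 2 X' k' - (1 - 2\<alpha>) X' k / t. Inserting k' = k/t - m/2, with m the companion
  \<open>mom\<close>, gives the right-hand side.\<close>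

lemma cutoff_kap:
  assumes N: "2 \<le> N" and s: "0 < s"
  shows "test_function (\<lambda>t. of_real (cutoff N 0 t) * kap \<alpha> s t)"
    and "0 < t \<Longrightarrow> adj \<alpha> (\<lambda>t. of_real (cutoff N 0 t) * kap \<alpha> s t) t + of_real s * (of_real (cutoff N 0 t) * kap \<alpha> s t)
       = of_real (cutoff N (Suc (Suc 0)) t) * kap \<alpha> s t + of_real (cutoff N (Suc 0) t) * ((1 + 2 * \<alpha>) * inverse (of_real t) * kap \<alpha> s t - mom \<alpha> s t)"
proof -
  let ?\<phi> = "\<lambda>t. complex_of_real (cutoff N 0 t) * kap \<alpha> s t"
  show "test_function ?\<phi>"
  proof (rule test_function_times_system[where X = "cutoff N"])
    show "0 < 1 / N" using N by simp
  qed (rule cutoff_has_derivative cutoff_zero[OF N] kap_has_vector_derivative[OF _ s] mom_has_vector_derivative[OF _ s]; assumption)+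
  assume t: "0 < t"
  have X: "((\<lambda>t. complex_of_real (cutoff N n t)) has_vector_derivative of_real (cutoff N (Suc n) t)) (at t)" for n t
    using cutoff_has_derivative[of N n t]
    by (intro has_vector_derivative_of_real) (simp add: has_real_derivative_iff_has_vector_derivative)
  let ?k' = "\<lambda>t. 1 * inverse (of_real t) * kap \<alpha> s t + (- 1 / 2) * mom \<alpha> s t"
  let ?\<phi>' = "\<lambda>t. of_real (cutoff N 0 t) * ?k' t + of_real (cutoff N (Suc 0) t) * kap \<alpha> s t"
  have d1: "(?\<phi> has_vector_derivative ?\<phi>' t) (at t)" if "0 < t" for t
    by (rule has_vector_derivative_mult[OF X kap_has_vector_derivative[OF that s]])
  have inv: "((\<lambda>t. inverse (complex_of_real t)) has_vector_derivative - (inverse (of_real t) * inverse (of_real t))) (at t)"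
    using of_real_inverse_has_vector_derivative[OF t, of 1] by (simp add: divide_inverse power2_eq_square)
  let ?m' = "(- 2 * \<alpha>) * inverse (of_real t) * mom \<alpha> s t + of_real (2 * s) * kap \<alpha> s t"
  let ?k'' = "inverse (of_real t) * ?k' t + - (inverse (of_real t) * inverse (of_real t)) * kap \<alpha> s t + (- 1 / 2) * ?m'"
  have dk: "(?k' has_vector_derivative ?k'') (at t)"
    unfolding mult_1_left
    by (intro has_vector_derivative_add has_vector_derivative_mult_right has_vector_derivative_mult[OF inv]
        kap_has_vector_derivative[OF t s, unfolded mult_1_left] mom_has_vector_derivative[OF t s])
  have "(?\<phi>' has_vector_derivative (of_real (cutoff N 0 t) * ?k'' + of_real (cutoff N (Suc 0) t) * ?k' t)
      + (of_real (cutoff N (Suc 0) t) * ?k' t + of_real (cutoff N (Suc (Suc 0)) t) * kap \<alpha> s t)) (at t)"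
    by (rule has_vector_derivative_add[OF has_vector_derivative_mult[OF X dk] has_vector_derivative_mult[OF X kap_has_vector_derivative[OF t s]]])
  then have "(vderiv ?\<phi> has_vector_derivative (of_real (cutoff N 0 t) * ?k'' + of_real (cutoff N (Suc 0) t) * ?k' t)
      + (of_real (cutoff N (Suc 0) t) * ?k' t + of_real (cutoff N (Suc (Suc 0)) t) * kap \<alpha> s t)) (at t)"
  proof (rule has_vector_derivative_transform_within_open)
    show "open {0::real<..}" "t \<in> {0<..}" using t by auto
    show "?\<phi>' y = vderiv ?\<phi> y" if "y \<in> {0<..}" for y
      using vector_derivative_at[OF d1[of y]] that by simp
  qed
  note d2 = vector_derivative_at[OF this]
  \<comment> \<open>A polynomial identity in independent quantities. That all terms with the
    undifferentiated cutoff \<open>X0\<close> cancel is exactly the eigenfunction equation.\<close>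
  have "X0 * (i * (1 * i * k + (- 1 / 2) * m) + - (i * i) * k + (- 1 / 2) * ((- 2 * \<alpha>) * i * m + 2 * \<sigma> * k)) + X1 * (1 * i * k + (- 1 / 2) * m)
      + (X1 * (1 * i * k + (- 1 / 2) * m) + X2 * k) - (1 - 2 * \<alpha>) * ((X0 * (1 * i * k + (- 1 / 2) * m) + X1 * k) * i - (X0 * k) * (i * i)) + \<sigma> * (X0 * k)
     = X2 * k + X1 * ((1 + 2 * \<alpha>) * i * k - m)" for X0 X1 X2 i k m \<sigma> :: complex
    by (simp add: field_simps)
  note eq = this[of "of_real (cutoff N 0 t)" "inverse (of_real t)" "kap \<alpha> s t" "mom \<alpha> s t" "of_real s" "of_real (cutoff N (Suc 0) t)" "of_real (cutoff N (Suc (Suc 0)) t)"]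
  show "adj \<alpha> ?\<phi> t + of_real s * ?\<phi> t = of_real (cutoff N (Suc (Suc 0)) t) * kap \<alpha> s t + of_real (cutoff N (Suc 0) t) * ((1 + 2 * \<alpha>) * inverse (of_real t) * kap \<alpha> s t - mom \<alpha> s t)"
    unfolding adj_eq[OF d1[OF t] t] d2
    using eq by (simp only: divide_inverse power2_eq_square inverse_mult_distrib of_real_mult of_real_numeral)
qed

lemma continuous_on_bess_compose [continuous_intros]:
  "continuous_on S f \<Longrightarrow> (\<And>x. x \<in> S \<Longrightarrow> 0 < f x) \<Longrightarrow> continuous_on S (\<lambda>x. bess \<nu> (f x))"
  by (rule continuous_on_compose2[OF continuous_on_bess]) auto

lemma continuous_on_of_real_powr:
  "continuous_on S f \<Longrightarrow> (\<And>x. x \<in> S \<Longrightarrow> 0 < f x) \<Longrightarrow> continuous_on S (\<lambda>x. complex_of_real (f x) powr c)"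
  by (rule continuous_on_compose2[where g = "\<lambda>t. complex_of_real t powr c" and t = "{0<..}"])
     (auto intro: continuous_at_imp_continuous_on has_vector_derivative_continuous powr_of_real_has_vector_derivative)

subsection \<open>Exponential weights\<close>

text \<open>From ln y <= y - 1 at y = s p / q. The constant (q/p)^q exceeds the true maximum only by
  the factor e^q.\<close>

lemma powr_exp_bounded:
  assumes p: "0 < p" and q: "0 \<le> q"
  shows "\<exists>C\<ge>0. \<forall>s>0. s powr q * exp (- p * s) \<le> (C::real)"
proof (cases "q = 0")
  case True
  then show ?thesis using p by (intro exI[of _ 1]) auto
next
  case False
  then have q: "0 < q" using q by simp
  have "s powr q * exp (- p * s) \<le> (q / p) powr q" if s: "0 < s" for s
  proof -
    let ?y = "s * (p / q)"
    have y: "0 < ?y" using s p q by simp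
    have "q * ln ?y \<le> q * (?y - 1)" using y q by (intro mult_left_mono ln_le_minus_one) auto
    also have "\<dots> \<le> p * s" using q by (simp add: field_simps)
    finally have "?y powr q \<le> exp (p * s)" using y by (simp add: powr_def)
    then have "?y powr q * (q / p) powr q * exp (- p * s) \<le> exp (p * s) * (q / p) powr q * exp (- p * s)"
      by (intro mult_right_mono) auto
    also have "\<dots> = (q / p) powr q" by (simp add: exp_minus)
    also have "?y powr q * (q / p) powr q = s powr q"
      using y s p q by (simp flip: powr_mult)
    finally show ?thesis .
  qed
  then show ?thesis by (intro exI[of _ "(q / p) powr q"]) auto
qed

text \<open>With b = q + 1 the behaviour at 0 is matched exactly, as b - 1 = q; at infinity the
  exponential beats any power.\<close>

lemma powr_exp_majorant:
  assumes p: "0 < p" and q: "- 1 < q"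
  shows "\<exists>C\<ge>0. \<exists>b>0. \<forall>s>0. s powr q * exp (- p * s) \<le> C * majorant b s"
proof -
  define b where "b = q + 1"
  have b: "0 < b" using q by (simp add: b_def)
  obtain C where C: "0 \<le> C" "\<And>s. 0 < s \<Longrightarrow> s powr (q + b + 1) * exp (- p * s) \<le> C"
    using powr_exp_bounded[OF p, of "q + b + 1"] q b by auto
  have "s powr q * exp (- p * s) \<le> 4 * max 1 C / b * majorant b s" if s: "0 < s" for s
  proof (rule majorant_bound[OF b, where p = q and q = "- b - 1"])
    show "s powr q * exp (- p * s) \<le> max 1 C * s powr q"
      using mult_left_mono[of "exp (- p * s)" "max 1 C" "s powr q"] p s by (simp add: mult.commute le_max_iff_disj)
    have "s powr q * exp (- p * s) = (s powr (q + b + 1) * exp (- p * s)) * s powr (- b - 1)"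
      by (simp add: mult_ac flip: powr_add)
    also have "\<dots> \<le> max 1 C * s powr (- b - 1)"
      using C(2)[OF s] by (intro mult_right_mono) auto
    finally show "s powr q * exp (- p * s) \<le> max 1 C * s powr (- b - 1)" .
  qed (use s b in \<open>auto simp: b_def\<close>)
  moreover have "0 \<le> 4 * max 1 C / b" using b by simp
  ultimately show ?thesis using b by blast
qed

subsection \<open>Uniqueness\<close>

lemma square_mult_powr:
  assumes "0 < (t::real)" "0 < s" shows "(t\<^sup>2 * s) powr r = t powr (2 * r) * s powr r"
proof -
  have "t\<^sup>2 = t powr 2" using assms by (simp add: powr_numeral)
  then have "(t\<^sup>2 * s) powr r = (t powr 2) powr r * s powr r" using assms by (simp only: powr_mult)
  then show ?thesis by (simp only: powr_powr)
qed

text \<open>The factor s in the bound for h compensates the 1/s of the resolvent bound. For h' no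
  such factor is available, but h' enters only next to a Bessel antiderivative that vanishes at s =
  0.\<close>

locale weight =
  fixes h h' :: "real \<Rightarrow> real" and c p :: real
  assumes h_deriv: "0 < s \<Longrightarrow> (h has_real_derivative h' s) (at s)"
    and h_bound: "0 < s \<Longrightarrow> \<bar>h s\<bar> \<le> c * s * exp (- p * s)"
    and h'_bound: "0 < s \<Longrightarrow> \<bar>h' s\<bar> \<le> c * exp (- p * s)"
    and h'_cont: "continuous_on {0<..} h'"
    and p: "0 < p" and c: "0 \<le> c"

locale bessel_operator = nonneg_operator D A R M for D :: "'a::complex_banach set" and A R M +
  fixes \<alpha> :: complex
  assumes \<alpha>: "0 < Re \<alpha>" "Re \<alpha> < 1"

section \<open>Estimates for weighted integrals over the spectral parameter s\<close>

locale bessel_operator_weight = bessel_operator D A R M \<alpha> + weight h h' c p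
  for D :: "'a::complex_banach set" and A R M \<alpha> h h' c p
begin

text \<open>The s-integral is truncated. The bounds below are uniform in \<delta> and S, so the
  truncation can be removed while the cutoff in t is held fixed.\<close>

definition kint :: "nat \<Rightarrow> real \<Rightarrow> 'a \<Rightarrow> real \<Rightarrow> real \<Rightarrow> 'a"
  where "kint k t x \<delta> S = integral {\<delta>..S} (\<lambda>s. (of_real (h s) * bess (\<alpha> + of_nat k) (t\<^sup>2 * s)) *\<^sub>C R s x)"

lemma continuous_on_h: "continuous_on {0<..} h"
  using h_deriv by (meson DERIV_isCont continuous_at_imp_continuous_on greaterThan_iff)

text \<open>The estimate for small t: B_(\<alpha>+k)(z) = O(z^(a+k)) yields the full power
  t^(2(a+k)). The zero of h cancels the 1/s of the resolvent, and the exponential makes the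
  s-integral converge.\<close>

lemma kint_small:
  "\<exists>C\<ge>0. \<forall>t>0. \<forall>x \<delta> S. 0 < \<delta> \<longrightarrow> norm (kint k t x \<delta> S) \<le> C * t powr (2 * (Re \<alpha> + real k)) * norm x"
proof -
  obtain B where B: "0 \<le> B" "\<And>t. 0 < t \<Longrightarrow> norm (bess (\<alpha> + of_nat k) t) \<le> B * t powr (Re \<alpha> + real k)"
    by (rule bess_bounds[OF \<alpha>, of k]) blast
  obtain E b where E: "0 \<le> E" "0 < b" "\<And>s. 0 < s \<Longrightarrow> s powr (Re \<alpha> + real k) * exp (- p * s) \<le> E * majorant b s"
    using powr_exp_majorant[OF p, of "Re \<alpha> + real k"] \<alpha> by auto
  let ?C = "c * B * M * E"
  have C: "0 \<le> ?C" using c B(1) M1 E(1) by simp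
  have "norm (kint k t x \<delta> S) \<le> ?C * t powr (2 * (Re \<alpha> + real k)) * norm x" if t: "0 < t" and \<delta>: "0 < \<delta>" for t x \<delta> S
    unfolding kint_def
  proof (rule norm_integral_le_majorant[OF _ \<delta> zero_less_one])
    show "continuous_on {\<delta>..S} (\<lambda>s. (of_real (h s) * bess (\<alpha> + of_nat k) (t\<^sup>2 * s)) *\<^sub>C R s x)"
      using t \<delta> by (intro continuous_intros continuous_on_subset[OF continuous_on_h] continuous_on_subset[OF continuous_on_R]) auto
    show "0 \<le> ?C * t powr (2 * (Re \<alpha> + real k)) * norm x" using C by simp
    fix s assume "s \<in> {\<delta>..S}"
    then have s: "0 < s" using \<delta> by simp
    have "norm ((of_real (h s) * bess (\<alpha> + of_nat k) (t\<^sup>2 * s)) *\<^sub>C R s x)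
       = \<bar>h s\<bar> * norm (bess (\<alpha> + of_nat k) (t\<^sup>2 * s)) * norm (R s x)"
      by (simp add: norm_scaleC norm_mult)
    also have "\<dots> \<le> (c * s * exp (- p * s)) * (B * (t\<^sup>2 * s) powr (Re \<alpha> + real k)) * (M / s * norm x)"
      using t s c B(1) by (intro mult_mono h_bound[OF s] B(2) R_norm[OF s]) auto
    also have "(t\<^sup>2 * s) powr (Re \<alpha> + real k) = t powr (2 * (Re \<alpha> + real k)) * s powr (Re \<alpha> + real k)"
      by (rule square_mult_powr[OF t s])
    also have "(c * s * exp (- p * s)) * (B * (t powr (2 * (Re \<alpha> + real k)) * s powr (Re \<alpha> + real k))) * (M / s * norm x)
       = (c * B * M * t powr (2 * (Re \<alpha> + real k)) * norm x) * (s powr (Re \<alpha> + real k) * exp (- p * s))"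
      using s by simp
    also have "\<dots> \<le> (c * B * M * t powr (2 * (Re \<alpha> + real k)) * norm x) * (E * majorant b s)"
      using c B(1) M1 by (intro mult_left_mono E(3)[OF s]) auto
    finally show "norm ((of_real (h s) * bess (\<alpha> + of_nat k) (t\<^sup>2 * s)) *\<^sub>C R s x)
        \<le> ?C * t powr (2 * (Re \<alpha> + real k)) * norm x * (1 * majorant b (1 * s))"
      by (simp add: mult_ac)
  qed
  then show ?thesis using C by blast
qed

text \<open>The estimate for large t: one integration by parts in s replaces the Bessel factor by
  t^(-2) B_(\<alpha>+k+1)(t^2 s), which is O(t^(a+k-1)) for fixed s. A direct estimate would give
  only t^(a+k). The derivative then falls on h(s) R s x.\<close>

lemma kint_large:
  "\<exists>C\<ge>0. \<forall>t>0. \<forall>x \<delta> S. 0 < \<delta> \<longrightarrow> norm (kint k t x \<delta> S) \<le> C * t powr (Re \<alpha> + real k - 1) * norm x"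
proof -
  let ?r = "(Re \<alpha> + real (Suc k)) / 2"
  have r: "0 < ?r" using \<alpha> by simp
  obtain B where B: "0 \<le> B" "\<And>t. 0 < t \<Longrightarrow> norm (bess (\<alpha> + of_nat (Suc k)) t) \<le> B * t powr ?r"
    by (rule bess_bounds[OF \<alpha>, of "Suc k"]) blast
  obtain E b where E: "0 \<le> E" "0 < b" "\<And>s. 0 < s \<Longrightarrow> s powr (?r - 1) * exp (- p * s) \<le> E * majorant b s"
    using powr_exp_majorant[OF p, of "?r - 1"] r by auto
  obtain F where F: "0 \<le> F" "\<And>s. 0 < s \<Longrightarrow> s powr ?r * exp (- p * s) \<le> F"
    using powr_exp_bounded[OF p, of ?r] r by auto
  let ?c2 = "c * M + c * M * M"
  let ?C = "2 * (c * M * B * F) + B * ?c2 * E"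
  have c2: "0 \<le> ?c2" using c M1 by simp
  have C: "0 \<le> ?C" using c B(1) M1 E(1) F(1) by simp
  have "norm (kint k t x \<delta> S) \<le> ?C * t powr (Re \<alpha> + real k - 1) * norm x" if t: "0 < t" and \<delta>: "0 < \<delta>" for t x \<delta> S
  proof (cases "\<delta> \<le> S")
    case False
    then show ?thesis using C by (simp add: kint_def)
  next
    case True
    let ?T = "t powr (Re \<alpha> + real k - 1)"
    define P where "P s = of_real (inverse (t\<^sup>2)) * bess (\<alpha> + of_nat (Suc k)) (t\<^sup>2 * s)" for s
    define G where "G s = h s *\<^sub>R R s x" for s
    define G' where "G' s = h s *\<^sub>R (- R s (R s x)) + h' s *\<^sub>R R s x" for s
    have dP: "(P has_vector_derivative bess (\<alpha> + of_nat k) (t\<^sup>2 * s)) (at s)" if s: "0 < s" for s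
    proof -
      have "((\<lambda>s. t\<^sup>2 * s) has_vector_derivative t\<^sup>2) (at s)"
        by (auto intro!: derivative_eq_intros simp: has_real_derivative_iff_has_vector_derivative[symmetric])
      from vector_diff_chain_at[OF this bess_has_vector_derivative[of _ "\<alpha> + of_nat (Suc k)"]]
      have "((\<lambda>s. bess (\<alpha> + of_nat (Suc k)) (t\<^sup>2 * s)) has_vector_derivative of_real (t\<^sup>2) * bess (\<alpha> + of_nat k) (t\<^sup>2 * s)) (at s)"
        using s t by (simp add: o_def scaleR_conv_of_real add_diff_eq[symmetric] del: of_real_power)
      from has_vector_derivative_mult_right[OF this, of "of_real (inverse (t\<^sup>2))"]
      show ?thesis using t by (simp add: P_def[abs_def] mult.assoc[symmetric])
    qed
    have dG: "(G has_vector_derivative G' s) (at s)" if s: "0 < s" for s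
    proof -
      have "((\<lambda>s. R s x) has_vector_derivative - R s (R s x)) (at s)"
        using bounded_linear.has_vector_derivative[OF blinfun.bounded_linear_left[of x] R_has_vector_derivative[OF s]]
        by (simp add: blinfun.bilinear_simps)
      then show ?thesis
        unfolding G_def G'_def by (intro has_vector_derivative_scaleR h_deriv[OF s])
    qed
    have Pb: "norm (P s) \<le> B * ?T * s powr ?r" if s: "0 < s" for s
    proof -
      have "norm (P s) \<le> inverse (t\<^sup>2) * (B * (t\<^sup>2 * s) powr ?r)"
        using B(2)[of "t\<^sup>2 * s"] t s by (simp add: P_def norm_mult norm_inverse norm_power mult_left_mono)
      also have "(t\<^sup>2 * s) powr ?r = t powr (2 * ?r) * s powr ?r"
        by (rule square_mult_powr[OF t s])
      also have "inverse (t\<^sup>2) * (B * (t powr (2 * ?r) * s powr ?r)) = B * (t powr (2 * ?r) * t powr (-2)) * s powr ?r"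
        using t by (simp add: powr_minus powr_numeral)
      also have "t powr (2 * ?r) * t powr (-2) = ?T"
      proof -
        have "2 * ?r + (-2) = Re \<alpha> + real k - 1" by (simp add: field_simps)
        then show ?thesis by (simp only: powr_add[symmetric])
      qed
      finally show ?thesis .
    qed
    have Gb: "norm (G s) \<le> c * M * exp (- p * s) * norm x" if s: "0 < s" for s
    proof -
      have "norm (G s) \<le> (c * s * exp (- p * s)) * (M / s * norm x)"
        unfolding G_def norm_scaleR using c s by (intro mult_mono h_bound[OF s] R_norm[OF s]) auto
      then show ?thesis using s by (simp add: mult_ac)
    qed
    \<comment> \<open>This is singular like 1/s at 0, but P contributes s^r with r = (a + k + 1)/2 >
      0, so the product is integrable.\<close>
    have G'b: "norm (G' s) \<le> ?c2 * exp (- p * s) / s * norm x" if s: "0 < s" for s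
    proof -
      have "norm (G' s) \<le> \<bar>h s\<bar> * norm (R s (R s x)) + \<bar>h' s\<bar> * norm (R s x)"
        unfolding G'_def by (rule norm_triangle_mono) simp_all
      also have "\<dots> \<le> (c * s * exp (- p * s)) * (M / s * (M / s * norm x)) + (c * exp (- p * s)) * (M / s * norm x)"
      proof (intro add_mono mult_mono h_bound[OF s] h'_bound[OF s] R_norm[OF s])
        show "norm (R s (R s x)) \<le> M / s * (M / s * norm x)"
          using R_norm[OF s, of "R s x"] mult_left_mono[OF R_norm[OF s, of x], of "M / s"] M1 s by simp
      qed (use c s in auto)
      also have "\<dots> = ?c2 * exp (- p * s) / s * norm x" using s by (simp add: field_simps)
      finally show ?thesis .
    qed
    have cG': "continuous_on {0<..} G'"
      unfolding G'_def by (intro continuous_intros continuous_on_h h'_cont continuous_on_R)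
    have cP: "continuous_on {0<..} P"
      using dP by (meson continuous_at_imp_continuous_on greaterThan_iff has_vector_derivative_continuous)
    have cPG': "continuous_on {\<delta>..S} (\<lambda>s. P s *\<^sub>C G' s)"
      using \<delta> by (intro continuous_intros continuous_on_subset[OF cG'] continuous_on_subset[OF cP]) auto
    have "((\<lambda>s. P s *\<^sub>C G' s + bess (\<alpha> + of_nat k) (t\<^sup>2 * s) *\<^sub>C G s) has_integral P S *\<^sub>C G S - P \<delta> *\<^sub>C G \<delta>) {\<delta>..S}"
    proof (rule fundamental_theorem_of_calculus[OF True])
      fix s assume "s \<in> {\<delta>..S}"
      then have s: "0 < s" using \<delta> by simp
      show "((\<lambda>s. P s *\<^sub>C G s) has_vector_derivative P s *\<^sub>C G' s + bess (\<alpha> + of_nat k) (t\<^sup>2 * s) *\<^sub>C G s) (at s within {\<delta>..S})"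
        by (rule has_vector_derivative_at_within, rule scaleC.has_vector_derivative[OF dP[OF s] dG[OF s]])
    qed
    from has_integral_diff[OF this integrable_integral[OF integrable_continuous_real[OF cPG']]]
    have "((\<lambda>s. bess (\<alpha> + of_nat k) (t\<^sup>2 * s) *\<^sub>C G s) has_integral P S *\<^sub>C G S - P \<delta> *\<^sub>C G \<delta> - integral {\<delta>..S} (\<lambda>s. P s *\<^sub>C G' s)) {\<delta>..S}"
      by simp
    moreover have "bess (\<alpha> + of_nat k) (t\<^sup>2 * s) *\<^sub>C G s = (of_real (h s) * bess (\<alpha> + of_nat k) (t\<^sup>2 * s)) *\<^sub>C R s x" for s
      unfolding G_def scaleC_of_real[symmetric] scaleC_scaleC by (simp only: mult.commute)
    ultimately have eq: "kint k t x \<delta> S = P S *\<^sub>C G S - P \<delta> *\<^sub>C G \<delta> - integral {\<delta>..S} (\<lambda>s. P s *\<^sub>C G' s)"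
      unfolding kint_def by (simp add: integral_unique)
    have bd: "norm (P s *\<^sub>C G s) \<le> (c * M * B * F) * ?T * norm x" if s: "0 < s" for s
    proof -
      have "norm (P s *\<^sub>C G s) \<le> (B * ?T * s powr ?r) * (c * M * exp (- p * s) * norm x)"
        unfolding norm_scaleC using B(1) by (intro mult_mono Pb[OF s] Gb[OF s]) auto
      also have "\<dots> = (c * M * B * ?T * norm x) * (s powr ?r * exp (- p * s))" by simp
      also have "\<dots> \<le> (c * M * B * ?T * norm x) * F"
        using c M1 B(1) by (intro mult_left_mono F(2)[OF s]) auto
      finally show ?thesis by (simp add: mult_ac)
    qed
    have "norm (integral {\<delta>..S} (\<lambda>s. P s *\<^sub>C G' s)) \<le> (B * ?c2 * E) * ?T * norm x"
    proof (rule norm_integral_le_majorant[OF cPG' \<delta> zero_less_one])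
      show "0 \<le> (B * ?c2 * E) * ?T * norm x" using B(1) c2 E(1) by (intro mult_nonneg_nonneg) auto
      fix s assume "s \<in> {\<delta>..S}"
      then have s: "0 < s" using \<delta> by simp
      have "norm (P s *\<^sub>C G' s) \<le> (B * ?T * s powr ?r) * (?c2 * exp (- p * s) / s * norm x)"
        unfolding norm_scaleC using B(1) by (intro mult_mono Pb[OF s] G'b[OF s]) auto
      also have "\<dots> = (B * ?c2 * ?T * norm x) * (s powr (?r - 1) * exp (- p * s))"
        using s by (simp add: powr_diff)
      also have "\<dots> \<le> (B * ?c2 * ?T * norm x) * (E * majorant b s)"
        using c2 B(1) by (intro mult_left_mono E(3)[OF s] mult_nonneg_nonneg) auto
      finally show "norm (P s *\<^sub>C G' s) \<le> (B * ?c2 * E) * ?T * norm x * (1 * majorant b (1 * s))"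
        by (simp add: mult_ac)
    qed
    then have "norm (kint k t x \<delta> S) \<le> (c * M * B * F) * ?T * norm x + (c * M * B * F) * ?T * norm x + (B * ?c2 * E) * ?T * norm x"
      unfolding eq using bd[of S] bd[of \<delta>] \<delta> True
      by (intro order_trans[OF norm_triangle_ineq4] add_mono) auto
    then show ?thesis by (simp add: algebra_simps)
  qed
  then show ?thesis using C by blast
qed

end

section \<open>Testing the weak equation with a cut-off eigenfunction\<close>

lemma integral_swap_Icc:
  fixes f :: "real \<Rightarrow> real \<Rightarrow> 'b::banach"
  assumes "continuous_on ({a..b} \<times> {c..d}) (\<lambda>(x, y). f x y)"
  shows "integral {a..b} (\<lambda>x. integral {c..d} (f x)) = integral {c..d} (\<lambda>y. integral {a..b} (\<lambda>x. f x y))"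
  using integral_swap_continuous[of a c b d f] assms by (simp add: cbox_Pair_eq)

lemma continuous_on_integral_Icc:
  fixes f :: "real \<Rightarrow> real \<Rightarrow> 'b::banach"
  assumes "continuous_on ({a..b} \<times> {c..d}) (\<lambda>(x, y). f x y)"
  shows "continuous_on {a..b} (\<lambda>x. integral {c..d} (f x))"
  using integral_continuous_on_param[of "{a..b}" c d f] assms by simp

lemma integral_scaleC_left:
  fixes w :: "'a::complex_banach"
  assumes "f integrable_on S"
  shows "integral S (\<lambda>s. f s *\<^sub>C w) = integral S f *\<^sub>C w"
  using integral_linear[OF assms scaleC.bounded_linear_left[of w]] by (simp add: o_def)

lemma integral_scaleC_right:
  fixes f :: "real \<Rightarrow> 'a::complex_banach"
  assumes "f integrable_on S"
  shows "integral S (\<lambda>s. c *\<^sub>C f s) = c *\<^sub>C integral S f"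
  using integral_linear[OF assms scaleC.bounded_linear_right[of c]] by (simp add: o_def)

lemma continuous_on_kap: "continuous_on ({0<..} \<times> {0<..}) (\<lambda>(t, s). kap \<alpha> s t)"
  unfolding kap_def case_prod_unfold by (intro continuous_intros continuous_on_of_real_powr) auto

lemma continuous_on_mom: "continuous_on ({0<..} \<times> {0<..}) (\<lambda>(t, s). mom \<alpha> s t)"
  unfolding mom_def case_prod_unfold by (intro continuous_intros continuous_on_of_real_powr) auto

context bessel_operator_weight begin

text \<open>The residual of the cut-off eigenfunction under L^* + s. Each term carries a derivative
  of the cutoff, so it lives on the two transition strips only.\<close>

definition source :: "real \<Rightarrow> real \<Rightarrow> real \<Rightarrow> complex"
  where "source N t s = of_real (cutoff N (Suc (Suc 0)) t) * kap \<alpha> s t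
    + of_real (cutoff N (Suc 0) t) * ((1 + 2 * \<alpha>) * inverse (of_real t) * kap \<alpha> s t - mom \<alpha> s t)"

lemma continuous_on_source: "continuous_on ({0<..} \<times> {0<..}) (\<lambda>(t, s). source N t s)"
proof -
  have [continuous_intros]: "continuous_on ({0<..} \<times> {0<..}) (\<lambda>x. cutoff N n (fst x))" for n
    by (rule continuous_on_compose2[OF continuous_on_cutoff[of UNIV]]) (auto intro: continuous_intros)
  show ?thesis
    unfolding source_def case_prod_unfold
    by (intro continuous_intros continuous_on_kap[unfolded case_prod_unfold] continuous_on_mom[unfolded case_prod_unfold]) auto
qed

lemma source_integral:
  assumes t: "0 < t" and \<delta>: "0 < \<delta>"
  shows "integral {\<delta>..S} (\<lambda>s. (of_real (h s) * source N t s) *\<^sub>C R s x) =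
     (of_real (cutoff N (Suc (Suc 0)) t) * of_real t powr (1 - 2 * \<alpha>)) *\<^sub>C kint 0 t x \<delta> S
     + (of_real (cutoff N (Suc 0) t) * (1 + 2 * \<alpha>) * of_real t powr (- (2 * \<alpha>))) *\<^sub>C kint 0 t x \<delta> S
     - (of_real (cutoff N (Suc 0) t) * of_real t powr (- (2 * \<alpha>))) *\<^sub>C kint 1 t x \<delta> S"
proof -
  let ?c2 = "complex_of_real (cutoff N (Suc (Suc 0)) t)" and ?c1 = "complex_of_real (cutoff N (Suc 0) t)"
  let ?q = "complex_of_real t powr (- (2 * \<alpha>))" and ?r = "complex_of_real t powr (1 - 2 * \<alpha>)"
  let ?f = "\<lambda>k s. (of_real (h s) * bess (\<alpha> + of_nat k) (t\<^sup>2 * s)) *\<^sub>C R s x"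
  have i: "?f k integrable_on {\<delta>..S}" for k
    using t \<delta> by (intro integrable_continuous_real continuous_intros continuous_on_subset[OF continuous_on_h] continuous_on_subset[OF continuous_on_R]) auto
  have i': "(\<lambda>s. c *\<^sub>C ?f k s) integrable_on {\<delta>..S}" for c k
    using integrable_linear[OF i scaleC.bounded_linear_right[of c]] by (simp add: o_def)
  have "(of_real (h s) * source N t s) *\<^sub>C R s x = (?c2 * ?r) *\<^sub>C ?f 0 s + (?c1 * (1 + 2 * \<alpha>) * ?q) *\<^sub>C ?f 0 s - (?c1 * ?q) *\<^sub>C ?f 1 s" for s
  proof -
    have "inverse (of_real t) * ?r = ?q" using t by (simp add: powr_one_minus)
    then have "H * (X2 * (?r * b0) + X1 * ((1 + 2 * \<alpha>) * inverse (of_real t) * (?r * b0) - ?q * b1))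
        = (X2 * ?r) * (H * b0) + (X1 * (1 + 2 * \<alpha>) * ?q) * (H * b0) - (X1 * ?q) * (H * b1)" for H X2 X1 b0 b1
      by (simp add: algebra_simps)
    then show ?thesis
      unfolding source_def kap_def mom_def scaleC_scaleC scaleC_add_left[symmetric] scaleC.diff_left[symmetric]
      by simp
  qed
  then have "integral {\<delta>..S} (\<lambda>s. (of_real (h s) * source N t s) *\<^sub>C R s x)
    = integral {\<delta>..S} (\<lambda>s. (?c2 * ?r) *\<^sub>C ?f 0 s + (?c1 * (1 + 2 * \<alpha>) * ?q) *\<^sub>C ?f 0 s - (?c1 * ?q) *\<^sub>C ?f 1 s)"
    by simp
  also have "\<dots> = (?c2 * ?r) *\<^sub>C kint 0 t x \<delta> S + (?c1 * (1 + 2 * \<alpha>) * ?q) *\<^sub>C kint 0 t x \<delta> S - (?c1 * ?q) *\<^sub>C kint 1 t x \<delta> S"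
    unfolding kint_def
    by (simp only: Henstock_Kurzweil_Integration.integral_diff[OF integrable_add[OF i' i'] i']
        Henstock_Kurzweil_Integration.integral_add[OF i' i'] integral_scaleC_right[OF i])
  finally show ?thesis .
qed

text \<open>For each s the weak equation is tested with the cut-off eigenfunction, multiplied by
  h(s) and integrated over s. Integrals are exchanged twice over a compact rectangle, so that the
  Laplace transform in s appears on the left and \<open>kint\<close> can be used on the
  right.\<close>

lemma cutoff_identity:
  assumes w: "weak \<alpha> w" and wc: "continuous_on {0<..} w" and N: "2 \<le> N" and \<delta>: "0 < \<delta>"
  shows "integral {1/N..2*N} (\<lambda>t. (of_real (cutoff N 0 t) * integral {\<delta>..S} (\<lambda>s. of_real (h s) * kap \<alpha> s t)) *\<^sub>C w t)
    = integral {1/N..2*N} (\<lambda>t. integral {\<delta>..S} (\<lambda>s. (of_real (h s) * source N t s) *\<^sub>C R s (w t)))"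
proof -
  let ?J = "{1/N..2*N}" and ?K = "{\<delta>..S}"
  have J: "?J \<subseteq> {0<..}" and K: "?K \<subseteq> {0<..}" using N \<delta> by (auto intro: less_le_trans[of 0 "1/N"])
  have JN: "0 < 1 / N" "1 / N \<le> 2 * N"
  proof -
    have "1 / N \<le> 1" using N by simp
    then show "1 / N \<le> 2 * N" using N by linarith
    show "0 < 1 / N" using N by simp
  qed
  have c1: "continuous_on ?J w" "continuous_on ?K h" "continuous_on ?K R"
    using wc continuous_on_h continuous_on_R J K by (blast intro: continuous_on_subset)+
  have sub: "?J \<times> ?K \<subseteq> {0<..} \<times> {0<..}" using J K by auto
  have ck: "continuous_on (?J \<times> ?K) (\<lambda>x. kap \<alpha> (snd x) (fst x))" "continuous_on (?J \<times> ?K) (\<lambda>x. source N (fst x) (snd x))"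
    using continuous_on_subset[OF continuous_on_kap sub] continuous_on_subset[OF continuous_on_source sub]
    by (simp_all add: case_prod_unfold)
  have cx: "continuous_on (?J \<times> ?K) (\<lambda>x. cutoff N 0 (fst x))"
    by (rule continuous_on_compose2[OF continuous_on_cutoff[of UNIV]]) (auto intro: continuous_intros)
  have cw: "continuous_on (?J \<times> ?K) (\<lambda>x. w (fst x))" "continuous_on (?J \<times> ?K) (\<lambda>x. h (snd x))" "continuous_on (?J \<times> ?K) (\<lambda>x. R (snd x))"
    by (rule continuous_on_compose2[OF c1(1)] continuous_on_compose2[OF c1(2)] continuous_on_compose2[OF c1(3)]; auto intro: continuous_intros)+
  have ks: "continuous_on ?K (\<lambda>s. kap \<alpha> s t)" if "t \<in> ?J" for t
  proof -
    have "0 < t" using that J by auto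
    then show ?thesis using \<delta> unfolding kap_def by (intro continuous_intros) auto
  qed
  have kt: "continuous_on ?J (\<lambda>t. kap \<alpha> s t)" "continuous_on ?J (\<lambda>t. source N t s)" if "s \<in> ?K" for s
  proof -
    have c: "continuous_on ?J (\<lambda>t. (t, s))" "(\<lambda>t. (t, s)) ` ?J \<subseteq> ?J \<times> ?K"
      using that by (auto intro: continuous_intros)
    show "continuous_on ?J (\<lambda>t. kap \<alpha> s t)" "continuous_on ?J (\<lambda>t. source N t s)"
      using continuous_on_compose2[OF ck(1) c] continuous_on_compose2[OF ck(2) c] by simp_all
  qed
  let ?L = "\<lambda>t s. (of_real (cutoff N 0 t) * (of_real (h s) * kap \<alpha> s t)) *\<^sub>C w t"
  have "integral ?J (\<lambda>t. (of_real (cutoff N 0 t) * integral ?K (\<lambda>s. of_real (h s) * kap \<alpha> s t)) *\<^sub>C w t)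
     = integral ?J (\<lambda>t. integral ?K (?L t))"
  proof (rule integral_cong)
    fix t assume t: "t \<in> ?J"
    have i: "(\<lambda>s. of_real (h s) * kap \<alpha> s t) integrable_on ?K"
      by (intro integrable_continuous_real continuous_intros c1 ks t)
    have "integral ?K (?L t) = integral ?K (\<lambda>s. of_real (cutoff N 0 t) * (of_real (h s) * kap \<alpha> s t)) *\<^sub>C w t"
      by (rule integral_scaleC_left) (intro integrable_on_mult_right i)
    then show "(of_real (cutoff N 0 t) * integral ?K (\<lambda>s. of_real (h s) * kap \<alpha> s t)) *\<^sub>C w t = integral ?K (?L t)"
      by simp
  qed
  also have "\<dots> = integral ?K (\<lambda>s. integral ?J (\<lambda>t. ?L t s))"
    by (rule integral_swap_Icc) (unfold case_prod_unfold, intro continuous_intros cx cw ck)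
  also have "\<dots> = integral ?K (\<lambda>s. integral ?J (\<lambda>t. (of_real (h s) * source N t s) *\<^sub>C R s (w t)))"
  proof (rule integral_cong)
    fix s assume s: "s \<in> ?K"
    then have s0: "0 < s" using K by auto
    have cX: "continuous_on ?J (cutoff N 0)" by (rule continuous_on_cutoff)
    have i1: "(\<lambda>t. (of_real (cutoff N 0 t) * kap \<alpha> s t) *\<^sub>C w t) integrable_on ?J"
      by (intro integrable_continuous_real continuous_intros c1 kt s cX)
    have i2: "(\<lambda>t. source N t s *\<^sub>C w t) integrable_on ?J"
      by (intro integrable_continuous_real continuous_intros c1 kt s)
    have "integral ?J (\<lambda>t. ?L t s) = integral ?J (\<lambda>t. of_real (h s) *\<^sub>C ((of_real (cutoff N 0 t) * kap \<alpha> s t) *\<^sub>C w t))"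
      by (simp add: scaleC_scaleC mult_ac)
    also have "\<dots> = of_real (h s) *\<^sub>C integral ?J (\<lambda>t. (of_real (cutoff N 0 t) * kap \<alpha> s t) *\<^sub>C w t)"
      by (rule integral_scaleC_right[OF i1])
    also have "integral ?J (\<lambda>t. (of_real (cutoff N 0 t) * kap \<alpha> s t) *\<^sub>C w t)
      = R s (integral ?J (\<lambda>t. (adj \<alpha> (\<lambda>t. of_real (cutoff N 0 t) * kap \<alpha> s t) t + of_real s * (of_real (cutoff N 0 t) * kap \<alpha> s t)) *\<^sub>C w t))"
    proof (rule w[unfolded weak_def, rule_format, of "\<lambda>t. of_real (cutoff N 0 t) * kap \<alpha> s t"], intro conjI allI impI)
      show "test_function (\<lambda>t. of_real (cutoff N 0 t) * kap \<alpha> s t)" by (rule cutoff_kap(1)[OF N s0])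
      show "of_real (cutoff N 0 t) * kap \<alpha> s t = 0" if "t \<notin> ?J" for t using cutoff_zero[OF N that] by simp
    qed (fact JN s0)+
    also have "integral ?J (\<lambda>t. (adj \<alpha> (\<lambda>t. of_real (cutoff N 0 t) * kap \<alpha> s t) t + of_real s * (of_real (cutoff N 0 t) * kap \<alpha> s t)) *\<^sub>C w t)
      = integral ?J (\<lambda>t. source N t s *\<^sub>C w t)"
      using J by (intro integral_cong) (simp add: cutoff_kap(2)[OF N s0] source_def subset_iff)
    also have "of_real (h s) *\<^sub>C R s (integral ?J (\<lambda>t. source N t s *\<^sub>C w t)) = integral ?J (\<lambda>t. of_real (h s) *\<^sub>C R s (source N t s *\<^sub>C w t))"
    proof -
      have "R s (integral ?J (\<lambda>t. source N t s *\<^sub>C w t)) = integral ?J (\<lambda>t. R s (source N t s *\<^sub>C w t))"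
        using integral_linear[OF i2 blinfun.bounded_linear_right[of "R s"]] by (simp add: o_def)
      moreover have "(\<lambda>t. R s (source N t s *\<^sub>C w t)) integrable_on ?J"
        using integrable_linear[OF i2 blinfun.bounded_linear_right[of "R s"]] by (simp add: o_def)
      ultimately show ?thesis by (simp add: integral_scaleC_right)
    qed
    finally show "integral ?J (\<lambda>t. ?L t s) = integral ?J (\<lambda>t. (of_real (h s) * source N t s) *\<^sub>C R s (w t))"
      by (simp add: R_scaleC[OF s0] scaleC_scaleC)
  qed
  also have "\<dots> = integral ?J (\<lambda>t. integral ?K (\<lambda>s. (of_real (h s) * source N t s) *\<^sub>C R s (w t)))"
    by (rule integral_swap_Icc[symmetric]) (unfold case_prod_unfold, intro continuous_intros cw ck)
  finally show ?thesis .
qed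

lemma continuous_on_source_integral:
  assumes wc: "continuous_on {0<..} w" and x: "0 < x" and \<delta>: "0 < \<delta>"
  shows "continuous_on {x..y} (\<lambda>t. integral {\<delta>..S} (\<lambda>s. (of_real (h s) * source N t s) *\<^sub>C R s (w t)))"
proof (rule continuous_on_integral_Icc)
  let ?J = "{x..y}" and ?K = "{\<delta>..S}"
  have J: "?J \<subseteq> {0<..}" and K: "?K \<subseteq> {0<..}" using x \<delta> by auto
  have c1: "continuous_on ?J w" "continuous_on ?K h" "continuous_on ?K R"
    using wc continuous_on_h continuous_on_R J K by (blast intro: continuous_on_subset)+
  have sub: "?J \<times> ?K \<subseteq> {0<..} \<times> {0<..}" using J K by auto
  have ck: "continuous_on (?J \<times> ?K) (\<lambda>x. source N (fst x) (snd x))"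
    using continuous_on_subset[OF continuous_on_source sub] by (simp add: case_prod_unfold)
  have cw: "continuous_on (?J \<times> ?K) (\<lambda>x. w (fst x))" "continuous_on (?J \<times> ?K) (\<lambda>x. h (snd x))" "continuous_on (?J \<times> ?K) (\<lambda>x. R (snd x))"
    by (rule continuous_on_compose2[OF c1(1)] continuous_on_compose2[OF c1(2)] continuous_on_compose2[OF c1(3)]; auto intro: continuous_intros)+
  show "continuous_on (?J \<times> ?K) (\<lambda>(t, s). (of_real (h s) * source N t s) *\<^sub>C R s (w t))"
    unfolding case_prod_unfold by (intro continuous_intros cw ck)
qed

text \<open>The lower strip has length 1/N and its integrand is O(N sup |w|), so its contribution is
  small only because w tends to 0. The upper strip has length N and its integrand is O(N^(-a-1)),
  giving N^(-a). Between the strips the source vanishes. It matters that \<open>N0\<close> is chosen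
  before \<delta> and S.\<close>

lemma cutoff_estimate:
  assumes w: "weak \<alpha> w" and wc: "continuous_on {0..} w" and wK: "\<And>t. 0 \<le> t \<Longrightarrow> norm (w t) \<le> K" and w0: "w 0 = 0" and e: "0 < e"
  shows "\<exists>N0\<ge>2. \<forall>N\<ge>N0. \<forall>\<delta>>0. \<forall>S.
    norm (integral {1/N..2*N} (\<lambda>t. (of_real (cutoff N 0 t) * integral {\<delta>..S} (\<lambda>s. of_real (h s) * kap \<alpha> s t)) *\<^sub>C w t)) \<le> e"
proof -
  define a where "a = Re \<alpha>"
  have a: "0 < a" "a < 1" using \<alpha> by (auto simp: a_def)
  define d where "d = norm (1 + 2 * \<alpha>)"
  have d: "0 \<le> d" by (simp add: d_def)
  have wc': "continuous_on {0<..} w" by (rule continuous_on_subset[OF wc]) auto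
  have K0: "0 \<le> K" using wK[of 0] w0 by simp
  obtain T1 T2 where T1: "0 \<le> T1" "\<And>t. \<bar>step (Suc 0) t\<bar> \<le> T1" and T2: "0 \<le> T2" "\<And>t. \<bar>step (Suc (Suc 0)) t\<bar> \<le> T2"
    using step_bound by metis
  define T where "T = max T1 T2"
  have T: "0 \<le> T" "\<And>t. \<bar>step (Suc 0) t\<bar> \<le> T" "\<And>t. \<bar>step (Suc (Suc 0)) t\<bar> \<le> T"
    using T1 T2 by (auto simp: T_def le_max_iff_disj)
  obtain C0 where C0: "0 \<le> C0" "\<And>t x \<delta> S. 0 < t \<Longrightarrow> 0 < \<delta> \<Longrightarrow> norm (kint 0 t x \<delta> S) \<le> C0 * t powr (2 * a) * norm x"
    using kint_small[of 0] by (auto simp: a_def)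
  obtain C1 where C1: "0 \<le> C1" "\<And>t x \<delta> S. 0 < t \<Longrightarrow> 0 < \<delta> \<Longrightarrow> norm (kint 1 t x \<delta> S) \<le> C1 * t powr (2 * (a + 1)) * norm x"
    using kint_small[of 1] by (auto simp: a_def)
  obtain D0 where D0: "0 \<le> D0" "\<And>t x \<delta> S. 0 < t \<Longrightarrow> 0 < \<delta> \<Longrightarrow> norm (kint 0 t x \<delta> S) \<le> D0 * t powr (a - 1) * norm x"
    using kint_large[of 0] by (auto simp: a_def)
  obtain D1 where D1: "0 \<le> D1" "\<And>t x \<delta> S. 0 < t \<Longrightarrow> 0 < \<delta> \<Longrightarrow> norm (kint 1 t x \<delta> S) \<le> D1 * t powr a * norm x"
    using kint_large[of 1] by (auto simp: a_def)
  define Cs where "Cs = T * (2 * C0 + d * C0 + C1)"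
  define Cl where "Cl = T * (D0 + d * D0 + D1) * K"
  have Cs: "0 \<le> Cs" and Cl: "0 \<le> Cl" using T C0 C1 D0 D1 d K0 by (auto simp: Cs_def Cl_def)
  define e1 where "e1 = e / (2 * (Cs + 1))"
  have e1: "0 < e1" "Cs * e1 \<le> e / 2" using e Cs by (auto simp: e1_def field_simps)
  obtain \<eta> where \<eta>: "0 < \<eta>" "\<And>t. 0 \<le> t \<Longrightarrow> t < \<eta> \<Longrightarrow> norm (w t) < e1"
  proof -
    have "continuous (at 0 within {0..}) w" using wc by (simp add: continuous_on_eq_continuous_within)
    then obtain \<eta> where "0 < \<eta>" "\<And>t. t \<in> {0..} \<Longrightarrow> dist t 0 < \<eta> \<Longrightarrow> dist (w t) (w 0) < e1"
      unfolding continuous_within_eps_delta using e1(1) by blast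
    then show ?thesis using that w0 by (auto simp: dist_norm)
  qed
  have "((\<lambda>N. Cl * N powr (- a)) \<longlongrightarrow> Cl * 0) at_top"
    using a by (intro tendsto_intros tendsto_neg_powr filterlim_ident) auto
  then have "\<forall>\<^sub>F N in at_top. Cl * N powr (- a) < e / 2"
    using e by (intro order_tendstoD(2)[where a = "e / 2"]) auto
  then obtain N1 where N1: "\<And>N. N1 \<le> N \<Longrightarrow> Cl * N powr (- a) < e / 2"
    unfolding eventually_at_top_linorder by blast
  \<comment> \<open>The term 3 / \<eta> puts the whole lower strip, which ends at 2/N, strictly
    inside [0, \<eta>), where w is below \<open>e1\<close>.\<close>
  define N0 where "N0 = max (max 2 N1) (3 / \<eta>)"
  show ?thesis
  proof (intro exI[of _ N0] conjI allI impI)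
    show "2 \<le> N0" by (simp add: N0_def)
    fix N \<delta> S :: real assume N0: "N0 \<le> N" and \<delta>: "0 < \<delta>"
    have N: "2 \<le> N" "N1 \<le> N" "3 / \<eta> \<le> N" using N0 by (auto simp: N0_def)
    let ?E = "\<lambda>t. integral {\<delta>..S} (\<lambda>s. (of_real (h s) * source N t s) *\<^sub>C R s (w t))"
    have o: "0 < 1/N" "1/N \<le> 2/N" "2/N \<le> N" "N \<le> 2 * N" "2/N \<le> 1"
      using N(1) by (auto simp: divide_right_mono) (use mult_mono[of 2 N 1 N] in \<open>simp add: field_simps\<close>)
    have \<eta>N: "2 / N < \<eta>" using N \<eta>(1) by (simp add: field_simps)
    have Eb: "norm (?E t) \<le> \<bar>cutoff N (Suc (Suc 0)) t\<bar> * t powr (1 - 2 * a) * norm (kint 0 t (w t) \<delta> S)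
        + \<bar>cutoff N (Suc 0) t\<bar> * d * t powr (- (2 * a)) * norm (kint 0 t (w t) \<delta> S)
        + \<bar>cutoff N (Suc 0) t\<bar> * t powr (- (2 * a)) * norm (kint 1 t (w t) \<delta> S)" if t: "0 < t" for t
      unfolding source_integral[OF t \<delta>]
      by (intro order_trans[OF norm_triangle_ineq4] add_mono order_trans[OF norm_triangle_ineq])
         (simp_all add: norm_scaleC norm_mult norm_powr_of_real[OF t] a_def d_def)
    have ci: "?E integrable_on {x..y}" if "0 < x" for x y
      by (rule integrable_continuous_real, rule continuous_on_source_integral[OF wc' that \<delta>])
    have small: "norm (?E t) \<le> N * Cs * e1" if t: "t \<in> {1/N..2/N}" for t
    proof -
      have "1/N \<le> t" "t \<le> 2/N" using t by auto
      then have t0: "0 < t" "t \<le> 2/N" "t \<le> 1" using o by linarith+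
      have wt: "norm (w t) \<le> e1" using \<eta>(2)[of t] t0 \<eta>N by (simp add: less_imp_le)
      have p: "t powr (1 - 2 * a) * t powr (2 * a) = t" "t powr (- (2 * a)) * t powr (2 * a) = 1"
        "t powr (- (2 * a)) * t powr (2 * (a + 1)) = t powr 2"
        using t0 by (simp_all flip: powr_add)
      have t2: "t powr 2 \<le> 1" using t0 by (intro powr_le1) auto
      \<comment> \<open>The N^2 from the second derivative of the cutoff is reduced to 2 N by t <=
        2/N; this is the 2 in \<open>Cs\<close>.\<close>
      have Nt: "N ^ Suc (Suc 0) * T * t \<le> N * T * 2"
      proof -
        have "N * t \<le> 2" using t0 N by (simp add: field_simps)
        then have "(N * T) * (N * t) \<le> (N * T) * 2" using N T by (intro mult_left_mono) auto
        then show ?thesis by (simp add: mult_ac)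
      qed
      have "norm (?E t) \<le> (N ^ Suc (Suc 0) * T) * t powr (1 - 2 * a) * (C0 * t powr (2 * a) * e1)
        + (N ^ Suc 0 * T) * d * t powr (- (2 * a)) * (C0 * t powr (2 * a) * e1)
        + (N ^ Suc 0 * T) * t powr (- (2 * a)) * (C1 * t powr (2 * (a + 1)) * e1)"
        using N T(1) d C0(1) C1(1) t0
        by (intro order_trans[OF Eb[OF t0(1)]] add_mono mult_mono order_refl
            cutoff_bounds(1)[OF T(2) N(1) t0(2)] cutoff_bounds(1)[OF T(3) N(1) t0(2)]
            order_trans[OF C0(2)[OF t0(1) \<delta>]] order_trans[OF C1(2)[OF t0(1) \<delta>]] wt) auto
      also have "\<dots> = (N ^ Suc (Suc 0) * T) * (t powr (1 - 2 * a) * t powr (2 * a)) * (C0 * e1)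
        + (N * T) * d * (t powr (- (2 * a)) * t powr (2 * a)) * (C0 * e1)
        + (N * T) * (t powr (- (2 * a)) * t powr (2 * (a + 1))) * (C1 * e1)"
        by (simp add: mult_ac)
      also have "\<dots> \<le> (N * T * 2) * (C0 * e1) + (N * T) * d * 1 * (C0 * e1) + (N * T) * 1 * (C1 * e1)"
        unfolding p using Nt t2 C0(1) C1(1) e1(1) N T(1) by (intro add_mono mult_right_mono mult_left_mono order_refl) auto
      also have "\<dots> = N * Cs * e1" by (simp add: Cs_def algebra_simps)
      finally show ?thesis .
    qed
    have large: "norm (?E t) \<le> Cl * N powr (- a) / N" if t: "t \<in> {N..2*N}" for t
    proof -
      have t0: "0 < t" "N \<le> t" "1 \<le> t" using t N by auto
      have wt: "norm (w t) \<le> K" using wK t0 by simp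
      have ta: "t powr (- a) \<le> N powr (- a)" using t0 N a by (intro powr_mono2') auto
      have p: "t powr (1 - 2 * a) * t powr (a - 1) \<le> N powr (- a)" "t powr (- (2 * a)) * t powr (a - 1) \<le> N powr (- a)"
        "t powr (- (2 * a)) * t powr a \<le> N powr (- a)"
      proof -
        have "t powr (- a - 1) \<le> t powr (- a)" using t0 by (intro powr_mono) auto
        then show "t powr (1 - 2 * a) * t powr (a - 1) \<le> N powr (- a)" "t powr (- (2 * a)) * t powr (a - 1) \<le> N powr (- a)"
          "t powr (- (2 * a)) * t powr a \<le> N powr (- a)"
          using ta by (simp_all flip: powr_add)
      qed
      have iN: "inverse N ^ Suc (Suc 0) * T \<le> T / N"
      proof -
        have "inverse N * inverse N \<le> 1 * inverse N" using N by (intro mult_right_mono) (auto simp: inverse_le_1_iff)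
        then have "(inverse N * inverse N) * T \<le> (1 * inverse N) * T" using T(1) by (rule mult_right_mono)
        then show ?thesis by (simp add: divide_inverse mult_ac)
      qed
      have "norm (?E t) \<le> (T / N) * t powr (1 - 2 * a) * (D0 * t powr (a - 1) * K)
        + (T / N) * d * t powr (- (2 * a)) * (D0 * t powr (a - 1) * K)
        + (T / N) * t powr (- (2 * a)) * (D1 * t powr a * K)"
        using N T(1) d D0(1) D1(1) t0 K0 cutoff_bounds(1)[OF T(2) N(1)] cutoff_bounds(2)[OF T(2) N(1) t0(2)]
        by (intro order_trans[OF Eb[OF t0(1)]] add_mono mult_mono order_refl
            order_trans[OF cutoff_bounds(2)[OF T(3) N(1) t0(2)] iN]
            order_trans[OF D0(2)[OF t0(1) \<delta>]] order_trans[OF D1(2)[OF t0(1) \<delta>]] wt) (auto simp: divide_inverse mult.commute)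
      also have "\<dots> = (T / N) * (D0 * K) * (t powr (1 - 2 * a) * t powr (a - 1))
        + (T / N) * d * (D0 * K) * (t powr (- (2 * a)) * t powr (a - 1))
        + (T / N) * (D1 * K) * (t powr (- (2 * a)) * t powr a)"
        by (simp add: mult_ac)
      also have "\<dots> \<le> (T / N) * (D0 * K) * N powr (- a) + (T / N) * d * (D0 * K) * N powr (- a) + (T / N) * (D1 * K) * N powr (- a)"
        using N T(1) d D0(1) D1(1) K0 by (intro add_mono mult_left_mono p) auto
      also have "\<dots> = Cl * N powr (- a) / N" by (simp add: Cl_def algebra_simps add_divide_distrib)
      finally show ?thesis .
    qed
    have mid: "integral {2/N..N} ?E = 0"
    proof -
      have "integral {2/N..N} ?E = integral {2/N<..<N} ?E"
        using integral_open_interval[of "2/N" N ?E] by (simp only: box_real)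
      also have "\<dots> = integral {2/N<..<N} (\<lambda>_. 0)"
      proof (rule integral_cong)
        fix t assume t: "t \<in> {2/N<..<N}"
        then have "0 < t" using o by auto
        then show "?E t = 0" using cutoff_middle(1)[OF N(1), of t] t by (simp add: source_integral[OF _ \<delta>])
      qed
      finally show ?thesis by simp
    qed
    have "integral {1/N..2*N} ?E = integral {1/N..2/N} ?E + integral {2/N..N} ?E + integral {N..2*N} ?E"
      using o ci by (simp add: Henstock_Kurzweil_Integration.integral_combine[where c = "2/N" and a = "1/N" and b = N, symmetric]
        Henstock_Kurzweil_Integration.integral_combine[where c = N and a = "1/N" and b = "2*N", symmetric])
    then have "norm (integral {1/N..2*N} ?E) \<le> norm (integral {1/N..2/N} ?E) + norm (integral {N..2*N} ?E)"
      using mid norm_triangle_ineq by simp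
    also have "norm (integral {1/N..2/N} ?E) \<le> (N * Cs * e1) * (2/N - 1/N)"
      using has_integral_bound_real[OF _ _ integrable_integral[OF ci[OF o(1), of "2/N"]], of "N * Cs * e1" "{}"] small o N Cs e1(1) by simp
    also have "norm (integral {N..2*N} ?E) \<le> (Cl * N powr (- a) / N) * (2 * N - N)"
      using has_integral_bound_real[OF _ _ integrable_integral[OF ci[of N "2*N"]], of "Cl * N powr (- a) / N" "{}"] large N Cl by simp
    finally have "norm (integral {1/N..2*N} ?E) \<le> Cs * e1 + Cl * N powr (- a)"
      using N by (simp add: diff_divide_distrib[symmetric])
    also have "\<dots> \<le> e" using e1(2) N1[OF N(2)] by linarith
    finally show "norm (integral {1/N..2*N} (\<lambda>t. (of_real (cutoff N 0 t) * integral {\<delta>..S} (\<lambda>s. of_real (h s) * kap \<alpha> s t)) *\<^sub>C w t)) \<le> e"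
      unfolding cutoff_identity[OF w wc' N(1) \<delta>] .
  qed
qed

end

section \<open>From exponential weights to Gaussian kernels\<close>

lemma exp_diff_weight:
  assumes p: "0 < p0" "0 < p1"
  shows "weight (\<lambda>s. exp (- p0 * s) - exp (- p1 * s)) (\<lambda>s. - p0 * exp (- p0 * s) + p1 * exp (- p1 * s)) (p0 + p1) (min p0 p1)"
proof
  fix s :: real assume s: "0 < s"
  let ?m = "min p0 p1"
  show "((\<lambda>s. exp (- p0 * s) - exp (- p1 * s)) has_real_derivative - p0 * exp (- p0 * s) + p1 * exp (- p1 * s)) (at s)"
    by (auto intro!: derivative_eq_intros)
  \<comment> \<open>From 1 + z <= exp z with z = (x - y) s. This is where the factor s, that is the
    zero of the weight at s = 0, becomes visible.\<close>
  have le: "exp (- x * s) - exp (- y * s) \<le> (y - x) * s * exp (- x * s)" for x y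
  proof -
    have "1 + (x - y) * s \<le> exp ((x - y) * s)" by (rule exp_ge_add_one_self)
    then have "exp (- x * s) * (1 + (x - y) * s) \<le> exp (- x * s) * exp ((x - y) * s)"
      by (intro mult_left_mono) auto
    also have "\<dots> = exp (- y * s)" by (simp add: algebra_simps flip: exp_add)
    finally show ?thesis by (simp add: algebra_simps)
  qed
  have e: "exp (- x * s) \<le> exp (- ?m * s)" if "x \<in> {p0, p1}" for x
    using that s by (auto intro!: mult_right_mono)
  show "\<bar>exp (- p0 * s) - exp (- p1 * s)\<bar> \<le> (p0 + p1) * s * exp (- ?m * s)"
  proof (cases "p0 \<le> p1")
    case True
    have "exp (- p1 * s) \<le> exp (- p0 * s)" using True s by simp
    then have "\<bar>exp (- p0 * s) - exp (- p1 * s)\<bar> \<le> (p1 - p0) * s * exp (- p0 * s)" using le[of p0 p1] by simp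
    also have "\<dots> \<le> (p0 + p1) * s * exp (- ?m * s)" using p s True by (intro mult_mono) auto
    finally show ?thesis .
  next
    case False
    have "exp (- p0 * s) \<le> exp (- p1 * s)" using False s by simp
    then have "\<bar>exp (- p0 * s) - exp (- p1 * s)\<bar> \<le> (p0 - p1) * s * exp (- p1 * s)" using le[of p1 p0] by simp
    also have "\<dots> \<le> (p0 + p1) * s * exp (- ?m * s)" using p s False by (intro mult_mono) auto
    finally show ?thesis .
  qed
  have "\<bar>- p0 * exp (- p0 * s) + p1 * exp (- p1 * s)\<bar> \<le> p0 * exp (- p0 * s) + p1 * exp (- p1 * s)"
    using p by (intro abs_leI) auto
  also have "\<dots> \<le> p0 * exp (- ?m * s) + p1 * exp (- ?m * s)"
    using p by (intro add_mono mult_left_mono e) auto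
  finally show "\<bar>- p0 * exp (- p0 * s) + p1 * exp (- p1 * s)\<bar> \<le> (p0 + p1) * exp (- ?m * s)"
    by (simp add: algebra_simps)
next
  show "continuous_on {0<..} (\<lambda>s. - p0 * exp (- p0 * s) + p1 * exp (- p1 * s))"
    by (intro continuous_intros)
qed (use p in auto)

text \<open>The Laplace transform of s -> \<open>kap \<alpha> s t\<close> at p in closed form. The
  factor p^(-\<alpha>-1) is kept, because its decay is what removes the second exponential.\<close>

definition gauss :: "complex \<Rightarrow> real \<Rightarrow> real \<Rightarrow> complex"
  where "gauss \<alpha> p t = of_real t * of_real p powr (- \<alpha> - 1) * of_real (exp (- (t\<^sup>2) / (4 * p)))"

text \<open>Uniformity in t comes from t^(1-2a) (t^2)^a = t <= y: the family of integrands has one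
  common majorant on the interval.\<close>

lemma exp_kap_laplace:
  assumes \<alpha>: "0 < Re \<alpha>" "Re \<alpha> < 1" and p: "0 < p" and x: "0 < x"
  shows "uniform_limit {x..y} (\<lambda>n t. integral (window n) (\<lambda>s. of_real (exp (- p * s)) * kap \<alpha> s t)) (gauss \<alpha> p) sequentially"
proof -
  obtain B where B: "0 \<le> B" "\<And>t. 0 < t \<Longrightarrow> norm (bess \<alpha> t) \<le> B * t powr Re \<alpha>"
    by (rule bess_bounds[OF \<alpha>, of 0]) auto
  obtain E b where E: "0 \<le> E" "0 < b" "\<And>s. 0 < s \<Longrightarrow> s powr Re \<alpha> * exp (- p * s) \<le> E * majorant b s"
    using powr_exp_majorant[OF p, of "Re \<alpha>"] \<alpha> by auto
  let ?f = "\<lambda>t s. of_real (exp (- p * s)) * kap \<alpha> s t"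
  have cont: "continuous_on {0<..} (?f t)" if "t \<in> {x..y}" for t
    unfolding kap_def using that x by (intro continuous_intros) auto
  have bound: "norm (?f t s) \<le> (\<bar>y\<bar> * B * E) * majorant b s" if t: "t \<in> {x..y}" and s: "0 < s" for t s
  proof -
    have t0: "0 < t" using t x by auto
    have "norm (?f t s) = exp (- p * s) * (t powr (1 - 2 * Re \<alpha>) * norm (bess \<alpha> (t\<^sup>2 * s)))"
      by (simp add: kap_def norm_mult norm_powr_of_real[OF t0])
    also have "\<dots> \<le> exp (- p * s) * (t powr (1 - 2 * Re \<alpha>) * (B * (t\<^sup>2 * s) powr Re \<alpha>))"
      using t0 s by (intro mult_left_mono B(2)) auto
    also have "\<dots> = (t powr (1 - 2 * Re \<alpha>) * t powr (2 * Re \<alpha>)) * B * (s powr Re \<alpha> * exp (- p * s))"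
      unfolding square_mult_powr[OF t0 s] by (simp add: mult_ac)
    also have "t powr (1 - 2 * Re \<alpha>) * t powr (2 * Re \<alpha>) = t" using t0 by (simp flip: powr_add)
    also have "t * B * (s powr Re \<alpha> * exp (- p * s)) \<le> \<bar>y\<bar> * B * (E * majorant b s)"
      using t t0 B(1) by (intro mult_mono E(3)[OF s]) auto
    finally show ?thesis by (simp add: mult_ac)
  qed
  have C: "0 \<le> \<bar>y\<bar> * B * E" using B(1) E(1) by simp
  have val: "improper (?f t) = gauss \<alpha> p t" if t: "t \<in> {x..y}" for t
  proof -
    have t0: "0 < t" using t x by auto
    let ?q = "complex_of_real t powr (1 - 2 * \<alpha>)"
    have "improper (?f t) = (LINT s:{0<..}|lborel. ?f t s)"
      by (rule improper_eq_set_lebesgue_integral(2)[OF cont[OF t] E(2) C bound[OF t]])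
    also have "\<dots> = (LINT s|lborel. ?q * (indicator {0<..} s *\<^sub>R (of_real (exp (- p * s)) * bess \<alpha> (t\<^sup>2 * s))))"
      unfolding set_lebesgue_integral_def kap_def by (simp add: mult_ac)
    also have "\<dots> = ?q * (of_real (t\<^sup>2) powr \<alpha> * of_real p powr (- \<alpha> - 1) * of_real (exp (- (t\<^sup>2) / (4 * p))))"
      using has_bochner_integral_integral_eq[OF bess_laplace[OF _ p, of \<alpha> "t\<^sup>2"]] \<alpha> t0
      by (subst integral_mult_right_zero) simp
    also have "\<dots> = (?q * of_real (t\<^sup>2) powr \<alpha>) * of_real p powr (- \<alpha> - 1) * of_real (exp (- (t\<^sup>2) / (4 * p)))"
      by (simp only: mult.assoc)
    also have "?q * of_real (t\<^sup>2) powr \<alpha> = of_real t"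
    proof -
      have "complex_of_real (t\<^sup>2) powr \<alpha> = exp (\<alpha> * of_real (ln (t\<^sup>2)))"
        using t0 by (simp add: powr_def Ln_of_real del: of_real_power)
      also have "\<dots> = exp ((2 * \<alpha>) * of_real (ln t))"
        using t0 by (simp add: ln_realpow mult_ac)
      also have "\<dots> = of_real t powr (2 * \<alpha>)" using t0 by (simp add: powr_def Ln_of_real)
      finally have "complex_of_real (t\<^sup>2) powr \<alpha> = of_real t powr (2 * \<alpha>)" .
      then show ?thesis using t0 by (simp flip: powr_add)
    qed
    finally show ?thesis unfolding gauss_def .
  qed
  have "uniform_limit {x..y} (\<lambda>n t. integral (window n) (?f t)) (\<lambda>t. improper (?f t)) sequentially"
    by (rule improper_uniform_limit[OF cont E(2) C bound])
  then show ?thesis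
    by (subst (asm) uniform_limit_cong'[OF refl val])
qed

lemma continuous_on_gauss [continuous_intros]: "continuous_on S (gauss \<alpha> p)"
  unfolding gauss_def by (cases "p = 0") (auto intro!: continuous_intros)

lemma norm_gauss: "0 < p \<Longrightarrow> 0 \<le> t \<Longrightarrow> norm (gauss \<alpha> p t) = p powr (- Re \<alpha> - 1) * (t * exp (- (t\<^sup>2) / (4 * p)))"
  by (simp add: gauss_def norm_mult norm_powr_of_real)

lemma gauss_integral:
  fixes x y p :: real
  assumes p: "0 < p" and xy: "x \<le> y"
  shows "((\<lambda>t. t * exp (- (t\<^sup>2) / (4 * p))) has_integral 2 * p * (exp (- (x\<^sup>2) / (4 * p)) - exp (- (y\<^sup>2) / (4 * p)))) {x..y}"
proof -
  have "((\<lambda>t. t * exp (- (t\<^sup>2) / (4 * p))) has_integral (- (2 * p * exp (- (y\<^sup>2) / (4 * p)))) - (- (2 * p * exp (- (x\<^sup>2) / (4 * p))))) {x..y}"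
  proof (rule fundamental_theorem_of_calculus[OF xy])
    fix t
    have "((\<lambda>t. - (2 * p * exp (- (t\<^sup>2) / (4 * p)))) has_real_derivative - (2 * p * (exp (- (t\<^sup>2) / (4 * p)) * (- (2 * t) / (4 * p))))) (at t)"
      using p by (auto intro!: derivative_eq_intros)
    then show "((\<lambda>t. - (2 * p * exp (- (t\<^sup>2) / (4 * p)))) has_vector_derivative t * exp (- (t\<^sup>2) / (4 * p))) (at t within {x..y})"
      using p by (simp add: has_real_derivative_iff_has_vector_derivative has_vector_derivative_at_within mult.commute)
  qed
  then show ?thesis by (simp add: algebra_simps)
qed

section \<open>Orthogonality of a weak null solution to all Gaussians\<close>

context bessel_operator begin

context
  fixes w :: "real \<Rightarrow> 'a" and K :: real
  assumes w: "weak \<alpha> w" and wc: "continuous_on {0..} w" and wK: "\<And>t. 0 \<le> t \<Longrightarrow> norm (w t) \<le> K" and w0: "w 0 = 0"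
begin

lemma K_nonneg: "0 \<le> K" using wK[of 0] w0 by simp

lemma w_cont: "0 < x \<Longrightarrow> continuous_on {x..y} w"
  by (rule continuous_on_subset[OF wc]) auto

text \<open>The threshold from \<open>cutoff_estimate\<close> is the same for all truncations. For
  each fixed N the truncation can therefore be removed by uniform convergence on the compact support
  of the cutoff.\<close>

lemma gauss_difference_small:
  assumes p01: "0 < p0" "0 < p1" and e: "0 < e"
  shows "\<exists>N0\<ge>2. \<forall>N\<ge>N0. norm (integral {1/N..2*N} (\<lambda>t. (of_real (cutoff N 0 t) * (gauss \<alpha> p0 t - gauss \<alpha> p1 t)) *\<^sub>C w t)) \<le> e"
proof -
  let ?h = "\<lambda>s. exp (- p0 * s) - exp (- p1 * s)"
  interpret weight ?h "\<lambda>s. - p0 * exp (- p0 * s) + p1 * exp (- p1 * s)" "p0 + p1" "min p0 p1"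
    by (rule exp_diff_weight[OF p01])
  interpret bessel_operator_weight D A R M \<alpha> ?h "\<lambda>s. - p0 * exp (- p0 * s) + p1 * exp (- p1 * s)" "p0 + p1" "min p0 p1" ..
  obtain N0 where N0: "2 \<le> N0" "\<And>N \<delta> S. N0 \<le> N \<Longrightarrow> 0 < \<delta> \<Longrightarrow>
    norm (integral {1/N..2*N} (\<lambda>t. (of_real (cutoff N 0 t) * integral {\<delta>..S} (\<lambda>s. of_real (?h s) * kap \<alpha> s t)) *\<^sub>C w t)) \<le> e"
    using cutoff_estimate[OF w wc wK w0 e] by auto
  have "norm (integral {1/N..2*N} (\<lambda>t. (of_real (cutoff N 0 t) * (gauss \<alpha> p0 t - gauss \<alpha> p1 t)) *\<^sub>C w t)) \<le> e" if N: "N0 \<le> N" for N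
  proof (rule field_le_epsilon)
    fix \<epsilon> :: real assume \<epsilon>: "0 < \<epsilon>"
    have N2: "2 \<le> N" and x: "0 < 1/N" "1/N \<le> 2*N"
    proof -
      show N2: "2 \<le> N" using N N0 by simp
      then have "1/N \<le> 1" by simp
      then show "0 < 1/N" "1/N \<le> 2*N" using N2 by (simp, linarith)
    qed
    let ?J = "{1/N..2*N}"
    \<comment> \<open>The accuracy of the kernels that leaves an error of at most \<epsilon> after
      integration against |w| <= K over a length of at most 2 N. The summand 1 keeps the denominator
      positive when K = 0.\<close>
    define \<rho> where "\<rho> = \<epsilon> / ((K + 1) * (2 * N))"
    have \<rho>: "0 < \<rho>" using \<epsilon> K_nonneg N2 by (simp add: \<rho>_def)
    let ?I = "\<lambda>p n t. integral (window n) (\<lambda>s. of_real (exp (- p * s)) * kap \<alpha> s t)"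
    have "uniform_limit ?J (\<lambda>n t. ?I p0 n t - ?I p1 n t) (\<lambda>t. gauss \<alpha> p0 t - gauss \<alpha> p1 t) sequentially"
      by (intro uniform_limit_minus exp_kap_laplace \<alpha> p01 x)
    from uniform_limitD[OF this \<rho>] obtain n where n: "\<And>t. t \<in> ?J \<Longrightarrow> norm (?I p0 n t - ?I p1 n t - (gauss \<alpha> p0 t - gauss \<alpha> p1 t)) < \<rho>"
      unfolding eventually_sequentially dist_norm by blast
    define \<delta> S where "\<delta> = 1 / real (Suc n)" and "S = real (Suc n)"
    have win: "window n = {\<delta>..S}" and \<delta>: "0 < \<delta>" by (auto simp: window_def \<delta>_def S_def)
    let ?H = "\<lambda>t. integral {\<delta>..S} (\<lambda>s. of_real (?h s) * kap \<alpha> s t)"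
    have kc: "continuous_on {\<delta>..S} (\<lambda>s. kap \<alpha> s t)" if "t \<in> ?J" for t
    proof -
      have "0 < t" using that x by (meson atLeastAtMost_iff less_le_trans)
      then show ?thesis using \<delta> unfolding kap_def by (intro continuous_intros) auto
    qed
    have H: "?H t = ?I p0 n t - ?I p1 n t" if "t \<in> ?J" for t
    proof -
      have "(\<lambda>s. of_real (exp (- q * s)) * kap \<alpha> s t) integrable_on {\<delta>..S}" for q
        by (intro integrable_continuous_real continuous_intros kc that)
      then have "?I p0 n t - ?I p1 n t = integral {\<delta>..S} (\<lambda>s. of_real (exp (- p0 * s)) * kap \<alpha> s t - of_real (exp (- p1 * s)) * kap \<alpha> s t)"
        unfolding win by (subst Henstock_Kurzweil_Integration.integral_diff) auto
      then show ?thesis by (simp add: left_diff_distrib)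
    qed
    have Hc: "continuous_on ?J ?H"
    proof (rule continuous_on_integral_Icc)
      have "?J \<subseteq> {0<..}"
        by (intro subsetI) (metis atLeastAtMost_iff greaterThan_iff less_le_trans x(1))
      then have "?J \<times> {\<delta>..S} \<subseteq> {0<..} \<times> {0<..}" using \<delta> by auto
      from continuous_on_subset[OF continuous_on_kap this]
      show "continuous_on (?J \<times> {\<delta>..S}) (\<lambda>(t, s). of_real (?h s) * kap \<alpha> s t)"
        unfolding case_prod_unfold by (intro continuous_intros)
    qed
    let ?F = "\<lambda>t. (of_real (cutoff N 0 t) * ?H t) *\<^sub>C w t"
    let ?G = "\<lambda>t. (of_real (cutoff N 0 t) * (gauss \<alpha> p0 t - gauss \<alpha> p1 t)) *\<^sub>C w t"
    have Fi: "?F integrable_on ?J" "?G integrable_on ?J"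
      using x by (intro integrable_continuous_real continuous_intros Hc continuous_on_cutoff w_cont; simp)+
    have "norm (?F t - ?G t) \<le> \<rho> * K" if t: "1/N \<le> t \<and> t \<le> 2*N" for t
    proof -
      have t0: "0 \<le> t" using x t by linarith
      have "?F t - ?G t = (of_real (cutoff N 0 t) * (?H t - (gauss \<alpha> p0 t - gauss \<alpha> p1 t))) *\<^sub>C w t"
        by (simp only: scaleC.diff_left[symmetric] right_diff_distrib)
      then have "norm (?F t - ?G t) = \<bar>cutoff N 0 t\<bar> * norm (?H t - (gauss \<alpha> p0 t - gauss \<alpha> p1 t)) * norm (w t)"
        by (simp add: norm_scaleC norm_mult)
      also have "\<dots> \<le> 1 * \<rho> * K"
        using n[of t] H[of t] t cutoff_01[OF N2 t0] wK[OF t0] \<rho> by (intro mult_mono) auto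
      finally show ?thesis by simp
    qed
    then have "norm (integral ?J ?F - integral ?J ?G) \<le> \<rho> * K * (2 * N - 1 / N)"
      using has_integral_bound_real[OF _ _ has_integral_diff[OF integrable_integral[OF Fi(1)] integrable_integral[OF Fi(2)]], of "\<rho> * K" "{}"] \<rho> K_nonneg x by simp
    also have "\<dots> \<le> \<epsilon>"
    proof -
      have "\<rho> * K * (2 * N - 1 / N) \<le> \<rho> * (K + 1) * (2 * N)"
        using \<rho> K_nonneg x by (intro mult_mono mult_left_mono mult_nonneg_nonneg) auto
      also have "\<dots> = \<epsilon>" using K_nonneg N2 by (simp add: \<rho>_def)
      finally show ?thesis .
    qed
    finally have "norm (integral ?J ?G) \<le> norm (integral ?J ?F) + \<epsilon>"
      using norm_triangle_ineq2[of "integral ?J ?G" "integral ?J ?F"] by (simp add: norm_minus_commute)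
    then show "norm (integral ?J ?G) \<le> e + \<epsilon>"
      using N0(2)[OF N \<delta>, of S] by linarith
  qed
  then show ?thesis using N0(1) by blast
qed

text \<open>The Gaussian with parameter p1 has L1 norm at most 2 p1^(-a), uniformly in N, so its
  pairing with w is at most 2 K p1^(-a). First p1 is made large, and then N depending on p1.\<close>

lemma gauss_small:
  assumes p0: "0 < p0" and e: "0 < e"
  shows "\<exists>N0\<ge>2. \<forall>N\<ge>N0. norm (integral {1/N..2*N} (\<lambda>t. (of_real (cutoff N 0 t) * gauss \<alpha> p0 t) *\<^sub>C w t)) \<le> e"
proof -
  have "((\<lambda>p. 2 * K * p powr (- Re \<alpha>)) \<longlongrightarrow> 2 * K * 0) at_top"
    using \<alpha> by (intro tendsto_intros tendsto_neg_powr filterlim_ident) auto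
  then have "\<forall>\<^sub>F p in at_top. 2 * K * p powr (- Re \<alpha>) < e / 2"
    using e by (intro order_tendstoD(2)[where a = "e / 2"]) auto
  then have "\<forall>\<^sub>F p in at_top. 2 * K * p powr (- Re \<alpha>) < e / 2 \<and> 0 < p"
    using eventually_gt_at_top[of 0] by (rule eventually_conj)
  then obtain p1 where p1: "2 * K * p1 powr (- Re \<alpha>) < e / 2" "0 < p1"
    using eventually_happens trivial_limit_at_top_linorder by blast
  obtain N0 where N0: "2 \<le> N0" "\<And>N. N0 \<le> N \<Longrightarrow> norm (integral {1/N..2*N} (\<lambda>t. (of_real (cutoff N 0 t) * (gauss \<alpha> p0 t - gauss \<alpha> p1 t)) *\<^sub>C w t)) \<le> e / 2"
    using gauss_difference_small[OF p0 p1(2), of "e / 2"] e by auto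
  have "norm (integral {1/N..2*N} (\<lambda>t. (of_real (cutoff N 0 t) * gauss \<alpha> p0 t) *\<^sub>C w t)) \<le> e" if N: "N0 \<le> N" for N
  proof -
    have N2: "2 \<le> N" and x: "0 < 1/N" "1/N \<le> 2*N"
    proof -
      show N2: "2 \<le> N" using N N0 by simp
      then have "1/N \<le> 1" by simp
      then show "0 < 1/N" "1/N \<le> 2*N" using N2 by (simp, linarith)
    qed
    let ?J = "{1/N..2*N}"
    let ?G = "\<lambda>p t. (of_real (cutoff N 0 t) * gauss \<alpha> p t) *\<^sub>C w t"
    have i: "?G p integrable_on ?J" for p
      using x by (intro integrable_continuous_real continuous_intros continuous_on_cutoff w_cont)
    have "integral ?J (\<lambda>t. (of_real (cutoff N 0 t) * (gauss \<alpha> p0 t - gauss \<alpha> p1 t)) *\<^sub>C w t) = integral ?J (?G p0) - integral ?J (?G p1)"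
      by (simp add: right_diff_distrib scaleC.diff_left Henstock_Kurzweil_Integration.integral_diff[OF i i])
    then have 1: "norm (integral ?J (?G p0) - integral ?J (?G p1)) \<le> e / 2" using N0(2)[OF N] by simp
    let ?g = "\<lambda>t. (K * p1 powr (- Re \<alpha> - 1)) * (t * exp (- (t\<^sup>2) / (4 * p1)))"
    have g: "(?g has_integral (K * p1 powr (- Re \<alpha> - 1)) * (2 * p1 * (exp (- ((1/N)\<^sup>2) / (4 * p1)) - exp (- ((2*N)\<^sup>2) / (4 * p1))))) ?J"
      by (rule has_integral_mult_right[OF gauss_integral[OF p1(2) x(2)]])
    have "norm (integral ?J (?G p1)) \<le> integral ?J ?g"
    proof (rule integral_norm_bound_integral[OF i])
      show "?g integrable_on ?J" using g by blast
      fix t assume "t \<in> ?J"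
      then have t0: "0 \<le> t" using x by (meson atLeastAtMost_iff less_imp_le order_trans)
      have "norm (?G p1 t) = \<bar>cutoff N 0 t\<bar> * (p1 powr (- Re \<alpha> - 1) * (t * exp (- (t\<^sup>2) / (4 * p1)))) * norm (w t)"
        using norm_gauss[OF p1(2) t0] by (simp add: norm_scaleC norm_mult)
      also have "\<dots> \<le> 1 * (p1 powr (- Re \<alpha> - 1) * (t * exp (- (t\<^sup>2) / (4 * p1)))) * K"
        using cutoff_01[OF N2 t0] wK[OF t0] t0 by (intro mult_mono) auto
      finally show "norm (?G p1 t) \<le> ?g t" by (simp add: mult_ac)
    qed
    also have "\<dots> = (K * p1 powr (- Re \<alpha> - 1)) * (2 * p1 * (exp (- ((1/N)\<^sup>2) / (4 * p1)) - exp (- ((2*N)\<^sup>2) / (4 * p1))))"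
      using g by (rule integral_unique)
    also have "\<dots> \<le> (K * p1 powr (- Re \<alpha> - 1)) * (2 * p1 * 1)"
    proof (intro mult_left_mono)
      have "exp (- ((1/N)\<^sup>2) / (4 * p1)) \<le> 1" using p1(2) by simp
      then show "exp (- ((1/N)\<^sup>2) / (4 * p1)) - exp (- ((2*N)\<^sup>2) / (4 * p1)) \<le> 1"
        using exp_gt_zero[of "- ((2*N)\<^sup>2) / (4 * p1)"] by linarith
    qed (use p1(2) K_nonneg in auto)
    also have "\<dots> = 2 * K * p1 powr (- Re \<alpha>)"
      using p1(2) powr_add[of p1 "- Re \<alpha> - 1" 1] by simp
    finally have "norm (integral ?J (?G p1)) \<le> e / 2" using p1(1) by linarith
    then show ?thesis
      using 1 norm_triangle_sub[of "integral ?J (?G p0)" "integral ?J (?G p1)"] by linarith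
  qed
  then show ?thesis using N0(1) by blast
qed

text \<open>In the variable y = exp(-t^2), the Gaussian with p = 1/(4(k+1)) is a multiple of the
  weight t exp(-t^2) times the monomial y^k. The cutoff is kept, so that only integrals over compact
  intervals occur.\<close>

definition test_int :: "real \<Rightarrow> (real \<Rightarrow> real) \<Rightarrow> 'a"
  where "test_int N P = integral {1/N..2*N} (\<lambda>t. (cutoff N 0 t * (t * exp (- (t\<^sup>2)) * P (exp (- (t\<^sup>2))))) *\<^sub>R w t)"

lemma test_int_integrable:
  assumes "continuous_on {0..1} P" "0 < N"
  shows "(\<lambda>t. (cutoff N 0 t * (t * exp (- (t\<^sup>2)) * P (exp (- (t\<^sup>2))))) *\<^sub>R w t) integrable_on {1/N..2*N}"
  using assms(2)
  by (intro integrable_continuous_real continuous_intros continuous_on_cutoff w_cont continuous_on_compose2[OF assms(1)]) auto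

lemma test_int_power: "((\<lambda>N. test_int N (\<lambda>y. y ^ k)) \<longlongrightarrow> 0) at_top"
proof -
  define p where "p = 1 / (4 * real (Suc k))"
  have p: "0 < p" by (simp add: p_def)
  let ?c = "complex_of_real p powr (- \<alpha> - 1)"
  have c: "0 < norm ?c" using p by (simp add: norm_powr_of_real)
  have e1: "- (t\<^sup>2) / (4 * p) = real (Suc k) * (- (t\<^sup>2))" for t by (simp add: p_def del: of_nat_Suc)
  have g: "(of_real (cutoff N 0 t) * gauss \<alpha> p t) *\<^sub>C w t = ?c *\<^sub>C ((cutoff N 0 t * (t * exp (- (t\<^sup>2)) * exp (- (t\<^sup>2)) ^ k)) *\<^sub>R w t)" for N t
    unfolding gauss_def e1 exp_of_nat_mult power_Suc
    by (simp add: scaleC_of_real[symmetric] scaleC_scaleC mult_ac)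
  have n: "norm (test_int N (\<lambda>y. y ^ k)) = norm (integral {1/N..2*N} (\<lambda>t. (of_real (cutoff N 0 t) * gauss \<alpha> p t) *\<^sub>C w t)) / norm ?c" if "0 < N" for N
  proof -
    have pk: "continuous_on {0..1} (\<lambda>y::real. y ^ k)" by (intro continuous_intros)
    show ?thesis
      unfolding g test_int_def integral_scaleC_right[OF test_int_integrable[OF pk that]] norm_scaleC using c by simp
  qed
  show ?thesis
  proof (rule tendstoI)
    fix e :: real assume e: "0 < e"
    then obtain N0 where N0: "2 \<le> N0" "\<And>N. N0 \<le> N \<Longrightarrow> norm (integral {1/N..2*N} (\<lambda>t. (of_real (cutoff N 0 t) * gauss \<alpha> p t) *\<^sub>C w t)) \<le> e / 2 * norm ?c"
      using gauss_small[OF p, of "e / 2 * norm ?c"] c by auto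
    have "dist (test_int N (\<lambda>y. y ^ k)) 0 < e" if "N0 \<le> N" for N
    proof -
      have "norm (test_int N (\<lambda>y. y ^ k)) \<le> e / 2"
        using N0(2)[OF that] n[of N] N0(1) that c by (simp add: divide_le_eq)
      then show ?thesis using e by simp
    qed
    then show "\<forall>\<^sub>F N in at_top. dist (test_int N (\<lambda>y. y ^ k)) 0 < e"
      unfolding eventually_at_top_linorder by blast
  qed
qed

lemma test_int_polynomial: "((\<lambda>N. test_int N (\<lambda>y. \<Sum>i\<le>n. a i * y ^ i)) \<longlongrightarrow> 0) at_top"
proof -
  have "((\<lambda>N. \<Sum>i\<le>n. a i *\<^sub>R test_int N (\<lambda>y. y ^ i)) \<longlongrightarrow> (\<Sum>i\<le>n. a i *\<^sub>R 0)) at_top"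
    by (intro tendsto_sum tendsto_scaleR tendsto_const test_int_power)
  moreover have "\<forall>\<^sub>F N in at_top. (\<Sum>i\<le>n. a i *\<^sub>R test_int N (\<lambda>y. y ^ i)) = test_int N (\<lambda>y. \<Sum>i\<le>n. a i * y ^ i)"
    using eventually_gt_at_top[of 0]
  proof eventually_elim
    case (elim N)
    have i: "(\<lambda>t. (cutoff N 0 t * (t * exp (- (t\<^sup>2)) * exp (- (t\<^sup>2)) ^ i)) *\<^sub>R w t) integrable_on {1/N..2*N}" for i
      using test_int_integrable[of "\<lambda>y. y ^ i" N] elim by (simp add: continuous_intros)
    have "(\<Sum>i\<le>n. a i *\<^sub>R test_int N (\<lambda>y. y ^ i)) = integral {1/N..2*N} (\<lambda>t. \<Sum>i\<le>n. a i *\<^sub>R ((cutoff N 0 t * (t * exp (- (t\<^sup>2)) * exp (- (t\<^sup>2)) ^ i)) *\<^sub>R w t))"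
      unfolding test_int_def
      by (subst integral_sum) (simp_all only: finite_atMost integrable_cmul[OF i] Henstock_Kurzweil_Integration.integral_cmul)
    also have "\<dots> = test_int N (\<lambda>y. \<Sum>i\<le>n. a i * y ^ i)"
      unfolding test_int_def by (simp add: sum_distrib_left scaleR_sum_left mult_ac)
    finally show ?case .
  qed
  ultimately have "((\<lambda>N. test_int N (\<lambda>y. \<Sum>i\<le>n. a i * y ^ i)) \<longlongrightarrow> (\<Sum>i\<le>n. a i *\<^sub>R 0)) at_top"
    by (rule Lim_transform_eventually)
  then show ?thesis by simp
qed

text \<open>Weierstrass approximation on [0, 1]. An approximation error \<epsilon> costs at most
  \<epsilon> K for every N, because the weight t exp(-t^2) has finite mass.\<close>

lemma test_int_continuous:
  assumes F: "continuous_on {0..1} F"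
  shows "((\<lambda>N. test_int N F) \<longlongrightarrow> 0) at_top"
proof (rule tendstoI)
  fix e :: real assume e: "0 < e"
  define \<epsilon> where "\<epsilon> = e / (2 * (K + 1))"
  have \<epsilon>: "0 < \<epsilon>" using e K_nonneg by (simp add: \<epsilon>_def)
  obtain g where g: "real_polynomial_function g" "\<And>y. y \<in> {0..1} \<Longrightarrow> \<bar>F y - g y\<bar> < \<epsilon>"
    using Stone_Weierstrass_real_polynomial_function[OF compact_Icc F \<epsilon>] by blast
  obtain a n where gs: "g = (\<lambda>y. \<Sum>i\<le>n. a i * y ^ i)"
    using g(1) unfolding real_polynomial_function_iff_sum by blast
  have "\<forall>\<^sub>F N in at_top. dist (test_int N g) 0 < e / 2"
    using tendstoD[OF test_int_polynomial[where a = a and n = n], of "e / 2"] e unfolding gs by simp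
  then show "\<forall>\<^sub>F N in at_top. dist (test_int N F) 0 < e"
    using eventually_ge_at_top[of 2]
  proof eventually_elim
    case (elim N)
    have x: "0 < 1/N" "1/N \<le> 2*N"
    proof -
      have "1/N \<le> 1" using elim by simp
      then show "0 < 1/N" "1/N \<le> 2*N" using elim(2) by (simp, linarith)
    qed
    have gc: "continuous_on {0..1} g" unfolding gs by (intro continuous_intros)
    let ?f = "\<lambda>P t. (cutoff N 0 t * (t * exp (- (t\<^sup>2)) * P (exp (- (t\<^sup>2))))) *\<^sub>R w t"
    have i: "?f F integrable_on {1/N..2*N}" "?f g integrable_on {1/N..2*N}"
      using elim by (intro test_int_integrable F gc; simp)+
    \<comment> \<open>The weight t exp(-t^2) is written as the Gaussian with p = 1/4 to match
      \<open>gauss_integral\<close>.\<close>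
    let ?b = "\<lambda>t. (\<epsilon> * K) * (t * exp (- (t\<^sup>2) / (4 * (1/4))))"
    have b: "(?b has_integral (\<epsilon> * K) * (2 * (1/4) * (exp (- ((1/N)\<^sup>2) / (4 * (1/4))) - exp (- ((2*N)\<^sup>2) / (4 * (1/4)))))) {1/N..2*N}"
      by (rule has_integral_mult_right[OF gauss_integral[OF _ x(2)]]) simp
    have "norm (test_int N F - test_int N g) = norm (integral {1/N..2*N} (\<lambda>t. ?f F t - ?f g t))"
      unfolding test_int_def using i by (simp add: Henstock_Kurzweil_Integration.integral_diff)
    also have "\<dots> \<le> integral {1/N..2*N} ?b"
    proof (rule integral_norm_bound_integral[OF integrable_diff[OF i]])
      show "?b integrable_on {1/N..2*N}" using b by blast
      fix t assume "t \<in> {1/N..2*N}"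
      then have t0: "0 \<le> t" using x by (meson atLeastAtMost_iff less_imp_le order_trans)
      have "?f F t - ?f g t = (cutoff N 0 t * (t * exp (- (t\<^sup>2)) * (F (exp (- (t\<^sup>2))) - g (exp (- (t\<^sup>2)))))) *\<^sub>R w t"
        by (simp only: scaleR_left_diff_distrib[symmetric] right_diff_distrib)
      then have "norm (?f F t - ?f g t) = \<bar>cutoff N 0 t\<bar> * (t * exp (- (t\<^sup>2)) * \<bar>F (exp (- (t\<^sup>2))) - g (exp (- (t\<^sup>2)))\<bar>) * norm (w t)"
        using t0 by (simp add: abs_mult)
      also have "\<dots> \<le> 1 * (t * exp (- (t\<^sup>2)) * \<epsilon>) * K"
        using cutoff_01[OF elim(2) t0] wK[OF t0] t0 g(2)[of "exp (- (t\<^sup>2))"] \<epsilon> by (intro mult_mono mult_left_mono) auto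
      finally show "norm (?f F t - ?f g t) \<le> ?b t" by (simp add: mult_ac)
    qed
    also have "\<dots> = (\<epsilon> * K) * (2 * (1/4) * (exp (- ((1/N)\<^sup>2) / (4 * (1/4))) - exp (- ((2*N)\<^sup>2) / (4 * (1/4)))))"
      using b by (rule integral_unique)
    also have "\<dots> \<le> (\<epsilon> * K) * 1"
    proof (rule mult_left_mono)
      have "exp (- ((1/N)\<^sup>2) / (4 * (1/4))) \<le> 1" by simp
      then show "2 * (1/4) * (exp (- ((1/N)\<^sup>2) / (4 * (1/4))) - exp (- ((2*N)\<^sup>2) / (4 * (1/4)))) \<le> 1"
        using exp_gt_zero[of "- ((2*N)\<^sup>2) / (4 * (1/4))"] by argo
    qed (use \<epsilon> K_nonneg in simp)
    also have "\<dots> \<le> \<epsilon> * (K + 1)" using \<epsilon> by (simp add: algebra_simps)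
    also have "\<dots> = e / 2"
    proof -
      have *: "e / (2 * k) * k = e / 2" if "k \<noteq> 0" for k :: real using that by simp
      show ?thesis unfolding \<epsilon>_def by (rule *) (use K_nonneg in simp)
    qed
    finally show ?case
      using elim(1) norm_triangle_sub[of "test_int N F" "test_int N g"] by (simp add: dist_norm)
  qed
qed

text \<open>A tent function in y = exp(-t^2) around exp(-t0^2) pulls back to a nonnegative function
  near t0. If w t0 were nonzero, w would stay within half its norm of w t0 there, so the vanishing
  of the pairing would force the tent to have mass 0.\<close>

lemma weak_zero:
  assumes t0: "0 < t0"
  shows "w t0 = 0"
proof (rule ccontr)
  assume nz: "w t0 \<noteq> 0"
  have "continuous (at t0 within {0..}) w" using wc t0 by (simp add: continuous_on_eq_continuous_within)
  then obtain d0 where d0: "0 < d0" "\<And>t. 0 \<le> t \<Longrightarrow> \<bar>t - t0\<bar> < d0 \<Longrightarrow> norm (w t - w t0) < norm (w t0) / 2"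
    unfolding continuous_within_eps_delta dist_norm using nz by (metis atLeast_iff half_gt_zero real_norm_def zero_less_norm_iff)
  define d where "d = min (d0 / 2) (t0 / 2)"
  have d: "0 < d" "d < d0" "d < t0" using d0(1) t0 by (auto simp: d_def)
  let ?y = "\<lambda>t. exp (- (t\<^sup>2)) :: real"
  have mono: "?y t < ?y s" if "0 \<le> s" "s < t" for s t
    using that by (simp add: power_strict_mono)
  \<comment> \<open>The smaller of the two distances in the variable y ensures that the pull-back of
    the tent of radius r is supported in \<open>{t0 - d..t0 + d}\<close>.\<close>
  define r where "r = min (?y t0 - ?y (t0 + d)) (?y (t0 - d) - ?y t0)"
  have r: "0 < r" using mono[of t0 "t0 + d"] mono[of "t0 - d" t0] d t0 by (simp add: r_def)
  define F where "F y = max 0 (r - \<bar>y - ?y t0\<bar>)" for y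
  have Fc: "continuous_on S F" for S unfolding F_def by (intro continuous_intros)
  have F0: "F (?y t) = 0" if "0 \<le> t" "t \<notin> {t0 - d..t0 + d}" for t
  proof (cases "t < t0 - d")
    case True
    have "?y (t0 - d) < ?y t" by (rule mono) (use that True in auto)
    moreover have "r \<le> ?y (t0 - d) - ?y t0" by (simp add: r_def)
    ultimately have "r \<le> \<bar>?y t - ?y t0\<bar>" by linarith
    then show ?thesis by (simp add: F_def)
  next
    case False
    then have "t0 + d < t" using that by auto
    then have "?y t < ?y (t0 + d)" by (intro mono) (use t0 d in auto)
    moreover have "r \<le> ?y t0 - ?y (t0 + d)" by (simp add: r_def)
    ultimately have "r \<le> \<bar>?y t - ?y t0\<bar>" by linarith
    then show ?thesis by (simp add: F_def)
  qed
  let ?g = "\<lambda>t. t * ?y t * F (?y t)"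
  let ?K = "{t0 - d..t0 + d}"
  have gc: "continuous_on S ?g" for S
    by (intro continuous_intros continuous_on_compose2[OF Fc[of UNIV]]) auto
  have gn: "0 \<le> ?g t" if "t \<in> ?K" for t
    using that d by (auto simp: F_def intro!: mult_nonneg_nonneg)
  have gi: "?g integrable_on ?K" by (intro integrable_continuous_real gc)
  define V where "V = integral ?K (\<lambda>t. ?g t *\<^sub>R w t)"
  have wcK: "continuous_on ?K w" using d by (intro w_cont) auto
  have gwi: "(\<lambda>t. ?g t *\<^sub>R w t) integrable_on ?K" by (intro integrable_continuous_real continuous_intros gc wcK)
  \<comment> \<open>For large N the cutoff equals 1 on the support of the tent, so the pairing is
    eventually constant and its limit 0 is attained.\<close>
  have ev: "\<forall>\<^sub>F N in at_top. test_int N F = V"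
    using eventually_ge_at_top[of "max (max 2 (t0 + d + 1)) (3 / (t0 - d))"]
  proof eventually_elim
    case (elim N)
    then have N: "2 \<le> N" "t0 + d < N" "3 / (t0 - d) \<le> N" by auto
    have lt: "2 / N < t0 - d" using N d by (simp add: field_simps)
    have N1: "1 / N \<le> 2 / N" using N by (simp add: divide_right_mono)
    show ?case
      unfolding test_int_def V_def
    proof (subst integral_cong_support[of "1/N" "2*N" "t0 - d" "t0 + d"])
      fix t assume t: "t \<in> {1/N..2*N} \<union> {t0 - d..t0 + d}" "t \<notin> {1/N..2*N} \<inter> {t0 - d..t0 + d}"
      have "{t0 - d..t0 + d} \<subseteq> {1/N..2*N}" using lt N1 N by auto
      then have "t \<notin> {t0 - d..t0 + d}" "1 / N \<le> t" using t by auto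
      moreover have "0 < 1 / N" using N by simp
      ultimately have "F (?y t) = 0" by (intro F0) linarith+
      then show "(cutoff N 0 t * ?g t) *\<^sub>R w t = 0" by simp
    next
      show "integral {t0 - d..t0 + d} (\<lambda>t. (cutoff N 0 t * ?g t) *\<^sub>R w t) = integral {t0 - d..t0 + d} (\<lambda>t. ?g t *\<^sub>R w t)"
        by (rule integral_cong) (use cutoff_middle(2)[OF N(1)] lt N in auto)
    qed
  qed
  have "((\<lambda>N. test_int N F) \<longlongrightarrow> V) at_top" by (rule tendsto_eventually[OF ev])
  from tendsto_unique[OF _ this test_int_continuous[OF Fc]] have V0: "V = 0" by simp
  let ?G = "integral ?K ?g"
  have "norm (V - ?G *\<^sub>R w t0) \<le> integral ?K (\<lambda>t. ?g t * (norm (w t0) / 2))"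
  proof -
    have gwi0: "(\<lambda>t. ?g t *\<^sub>R w t0) integrable_on ?K" by (intro integrable_continuous_real continuous_intros gc)
    have "?G *\<^sub>R w t0 = integral ?K (\<lambda>t. ?g t *\<^sub>R w t0)"
      using integral_linear[OF gi bounded_linear_scaleR_left[of "w t0"]] by (simp add: o_def)
    then have eq: "V - ?G *\<^sub>R w t0 = integral ?K (\<lambda>t. ?g t *\<^sub>R w t - ?g t *\<^sub>R w t0)"
      unfolding V_def by (simp add: Henstock_Kurzweil_Integration.integral_diff[OF gwi gwi0])
    show ?thesis
      unfolding eq
    proof (rule integral_norm_bound_integral[OF integrable_diff[OF gwi gwi0]])
      show "(\<lambda>t. ?g t * (norm (w t0) / 2)) integrable_on ?K" by (intro integrable_continuous_real continuous_intros gc)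
      fix t assume t: "t \<in> ?K"
      then have "0 \<le> t" "\<bar>t - t0\<bar> < d0" using d by auto
      then have "norm (w t - w t0) \<le> norm (w t0) / 2" using d0(2)[of t] by simp
      then have "?g t * norm (w t - w t0) \<le> ?g t * (norm (w t0) / 2)" by (intro mult_left_mono gn[OF t])
      moreover have "norm (?g t *\<^sub>R w t - ?g t *\<^sub>R w t0) = ?g t * norm (w t - w t0)"
        using gn[OF t] by (simp only: scaleR_right_diff_distrib[symmetric] norm_scaleR abs_of_nonneg)
      ultimately show "norm (?g t *\<^sub>R w t - ?g t *\<^sub>R w t0) \<le> ?g t * (norm (w t0) / 2)" by simp
    qed
  qed
  also have "\<dots> = ?G * (norm (w t0) / 2)" by (rule Henstock_Kurzweil_Integration.integral_mult_left)
  finally have "\<bar>?G\<bar> * norm (w t0) \<le> ?G * (norm (w t0) / 2)" unfolding V0 by simp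
  moreover have "0 \<le> ?G" by (intro integral_nonneg gi gn)
  moreover have "G * n \<le> 0" if "\<bar>G\<bar> * n \<le> G * (n / 2)" "0 \<le> G" for G n :: real
  proof -
    have "G * n \<le> G * n / 2" using that by simp
    then show ?thesis by linarith
  qed
  ultimately have "?G * norm (w t0) \<le> 0" by blast
  then have "?G \<le> 0" using nz by (simp add: mult_le_0_iff)
  then have "?G = 0" using \<open>0 \<le> ?G\<close> by simp
  moreover have "t0 - d < t0 + d" using d by simp
  \<comment> \<open>A continuous nonnegative function with integral 0 vanishes everywhere on the
    interval, but at t0 the tent takes its positive peak value r.\<close>
  ultimately have "?g t0 = 0"
    using integral_eq_0_iff[OF gc, of "t0 - d" "t0 + d"] gn d by auto
  then show False using t0 r by (simp add: F_def)
qed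

end

end

subsection \<open>Integrated Bessel kernels\<close>

text \<open>The k-fold antiderivative in s of B_\<alpha>(t^2 s): each integration raises the index
  by one and contributes t^(-2).\<close>

definition ker :: "complex \<Rightarrow> nat \<Rightarrow> real \<Rightarrow> real \<Rightarrow> complex"
  where "ker \<alpha> k t s = inverse (of_real t) ^ (2 * k) * bess (\<alpha> + of_nat k) (t\<^sup>2 * s)"

text \<open>Plain differentiation lowers the index to \<alpha> + k - 1; the recurrence trades it for
  \<alpha> + k + 1. Derivatives in t thus stay within the family \<open>ker\<close> with indices k
  and higher.\<close>

lemma ker_has_vector_derivative_t:
  assumes t: "0 < t" and s: "0 < s"
  shows "((\<lambda>t. ker \<alpha> k t s) has_vector_derivative 2 * \<alpha> * inverse (of_real t) * ker \<alpha> k t s - of_real t / 2 * ker \<alpha> (Suc k) t s) (at t)"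
proof -
  let ?i = "inverse (complex_of_real t)" and ?z = "t\<^sup>2 * s"
  let ?b = "\<lambda>j. bess (\<alpha> + of_nat j) ?z"
  have "((\<lambda>t. ker \<alpha> k t s) has_vector_derivative
     ?i ^ (2 * k) * (of_real (2 * t * s) * bess (\<alpha> + of_nat k - 1) ?z) + - (of_nat (2 * k) * ?i ^ Suc (2 * k)) * ?b k) (at t)"
    unfolding ker_def
    by (rule has_vector_derivative_mult[OF inverse_of_real_power_has_vector_derivative[OF t] bess_square_has_vector_derivative[OF t s]])
  moreover have "?i ^ (2 * k) * (of_real (2 * t * s) * bess (\<alpha> + of_nat k - 1) ?z) + - (of_nat (2 * k) * ?i ^ Suc (2 * k)) * ?b k
     = 2 * \<alpha> * ?i * ker \<alpha> k t s - of_real t / 2 * ker \<alpha> (Suc k) t s"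
  proof -
    have z: "0 < ?z" using t s by simp
    have e: "\<alpha> + of_nat k + 1 - 2 = \<alpha> + of_nat k - 1" "\<alpha> + of_nat k + 1 - 1 = \<alpha> + of_nat k" "\<alpha> + of_nat (Suc k) = \<alpha> + of_nat k + 1"
      by simp_all
    have "of_real ?z * bess (\<alpha> + of_nat k - 1) ?z + (1 - (\<alpha> + of_nat k + 1)) * ?b k + ?b (Suc k) / 4 = 0"
      using bess_recurrence[OF z, of "\<alpha> + of_nat k + 1"] unfolding e .
    then have r: "of_real ?z * bess (\<alpha> + of_nat k - 1) ?z = (\<alpha> + of_nat k) * ?b k - ?b (Suc k) / 4"
      by (simp add: algebra_simps add_eq_0_iff2)
    have it: "?i * of_real t = 1" using t by simp
    have "I * (2 * T * S * x) + - (2 * K * (i * I)) * b0 = 2 * \<alpha> * i * (I * b0) - T / 2 * ((i * (i * I)) * b1)"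
      if r: "T * T * S * x = (\<alpha> + K) * b0 - b1 / 4" and it: "i * T = 1" for I T S x K i b0 b1 :: complex
    proof -
      have "2 * T * S * x = 2 * i * (T * T * S * x)" using it by (metis (no_types, lifting) mult.assoc mult.commute mult.right_neutral)
      also have "\<dots> = 2 * i * ((\<alpha> + K) * b0 - b1 / 4)" unfolding r ..
      finally have 1: "2 * T * S * x = 2 * i * ((\<alpha> + K) * b0 - b1 / 4)" .
      have 2: "T / 2 * ((i * (i * I)) * b1) = (i * T) * (i * I * b1) / 2" by (simp add: mult_ac)
      show ?thesis unfolding 1 2 it by (simp add: algebra_simps)
    qed
    from this[of "of_real t" "of_real s" "bess (\<alpha> + of_nat k - 1) ?z" "of_nat k" "?b k" "?b (Suc k)" ?i "?i ^ (2 * k)"] r it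
    show ?thesis by (simp add: ker_def power2_eq_square)
  qed
  ultimately show ?thesis by simp
qed

lemma ker_has_vector_derivative_s:
  assumes t: "0 < t" and s: "0 < s"
  shows "((\<lambda>s. ker \<alpha> (Suc k) t s) has_vector_derivative ker \<alpha> k t s) (at s)"
proof -
  have "((\<lambda>s. t\<^sup>2 * s) has_vector_derivative t\<^sup>2) (at s)"
    by (auto intro!: derivative_eq_intros simp: has_real_derivative_iff_has_vector_derivative[symmetric])
  from vector_diff_chain_at[OF this bess_has_vector_derivative[of _ "\<alpha> + of_nat (Suc k)"]]
  have "((\<lambda>s. bess (\<alpha> + of_nat (Suc k)) (t\<^sup>2 * s)) has_vector_derivative of_real (t\<^sup>2) * bess (\<alpha> + of_nat k) (t\<^sup>2 * s)) (at s)"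
    using s t by (simp add: o_def scaleR_conv_of_real add_diff_eq[symmetric] del: of_real_power)
  from has_vector_derivative_mult_right[OF this, of "inverse (of_real t) ^ (2 * Suc k)"]
  have "((\<lambda>s. ker \<alpha> (Suc k) t s) has_vector_derivative inverse (of_real t) ^ (2 * Suc k) * (of_real (t\<^sup>2) * bess (\<alpha> + of_nat k) (t\<^sup>2 * s))) (at s)"
    by (simp only: ker_def)
  moreover have "inverse (complex_of_real t) ^ (2 * Suc k) * (of_real (t\<^sup>2) * x) = inverse (of_real t) ^ (2 * k) * x" for x
  proof -
    have "(i * (i * I)) * ((T * T) * x) = I * x" if "i * T = 1" for i I T :: complex
    proof -
      have "(i * (i * I)) * ((T * T) * x) = (i * T) * (i * T) * (I * x)" by (simp only: mult_ac)
      then show ?thesis using that by simp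
    qed
    from this[of "inverse (of_real t)" "of_real t" "inverse (of_real t) ^ (2 * k)"] show ?thesis
      using t by (simp add: power2_eq_square)
  qed
  ultimately show ?thesis by (simp only: ker_def)
qed

lemma ker_recurrence:
  assumes t: "0 < t" and s: "0 < s"
  shows "of_real s * ker \<alpha> k t s = (\<alpha> + of_nat k + 1) * ker \<alpha> (Suc k) t s - (of_real t)\<^sup>2 / 4 * ker \<alpha> (Suc (Suc k)) t s"
proof -
  let ?i = "inverse (complex_of_real t)" and ?z = "t\<^sup>2 * s"
  let ?b = "\<lambda>j. bess (\<alpha> + of_nat j) ?z"
  have z: "0 < ?z" using t s by simp
  have "of_real ?z * ?b k + (1 - (\<alpha> + of_nat k + 2)) * ?b (Suc k) + ?b (Suc (Suc k)) / 4 = 0"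
    using bess_recurrence[OF z, of "\<alpha> + of_nat k + 2"] by (simp add: add_ac)
  then have r: "of_real ?z * ?b k = (\<alpha> + of_nat k + 1) * ?b (Suc k) - ?b (Suc (Suc k)) / 4"
    by (simp add: algebra_simps add_eq_0_iff2)
  have it: "?i * of_real t = 1" using t by simp
  have "S * (I * b0) = c * (i * (i * I) * b1) - T * T / 4 * (i * (i * (i * (i * I))) * b2)"
    if r: "T * T * S * b0 = c * b1 - b2 / 4" and it: "i * T = 1" for I T S i c b0 b1 b2 :: complex
  proof -
    have "S * (I * b0) = (i * T) * (i * T) * (S * (I * b0))" unfolding it by simp
    also have "\<dots> = i * i * I * (T * T * S * b0)" by (simp only: mult_ac)
    also have "\<dots> = c * (i * (i * I) * b1) - i * i * I * b2 / 4" unfolding r by (simp add: algebra_simps)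
    also have "i * i * I * b2 / 4 = (i * T) * (i * T) * (i * i * I * b2 / 4)" unfolding it by simp
    also have "\<dots> = T * T / 4 * (i * (i * (i * (i * I))) * b2)" by simp
    finally show ?thesis .
  qed
  from this[of "of_real t" "of_real s" "?b k" "\<alpha> + of_nat k + 1" "?b (Suc k)" "?b (Suc (Suc k))" ?i "?i ^ (2 * k)"] r it
  show ?thesis by (simp add: ker_def power2_eq_square)
qed

lemma continuous_on_ker: "continuous_on ({0<..} \<times> {0<..}) (\<lambda>x. ker \<alpha> k (fst x) (snd x))"
  unfolding ker_def by (intro continuous_intros) auto

text \<open>With L v = v'' + (1 - 2\<alpha>) v'/t the kernel satisfies L \<open>ker k\<close> = k
  \<open>ker (k+1)\<close> - s \<open>ker k\<close>. Only k = 0 gives an eigenfunction; the extra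
  term will be matched by the derivative of a power of the resolvent.\<close>

lemma ker_adjoint:
  assumes s: "0 < s" and a: "0 < a" "a \<le> b"
    and z: "\<phi> a = 0" "\<phi> b = 0" "vderiv \<phi> a = 0" "vderiv \<phi> b = 0"
    and d: "\<And>t. (\<phi> has_vector_derivative vderiv \<phi> t) (at t)"
      "\<And>t. (vderiv \<phi> has_vector_derivative vderiv (vderiv \<phi>) t) (at t)"
      "continuous_on UNIV (vderiv (vderiv \<phi>))"
  shows "integral {a..b} (\<lambda>t. adj \<alpha> \<phi> t * ker \<alpha> k t s)
    = integral {a..b} (\<lambda>t. \<phi> t * (of_nat k * ker \<alpha> (Suc k) t s - of_real s * ker \<alpha> k t s))"
proof -
  let ?f = "\<lambda>t. ker \<alpha> k t s" and ?g = "\<lambda>t. ker \<alpha> (Suc k) t s" and ?h = "\<lambda>t. ker \<alpha> (Suc (Suc k)) t s"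
  define i where "i t = inverse (complex_of_real t)" for t
  define f' where "f' t = 2 * \<alpha> * i t * ?f t - of_real t / 2 * ?g t" for t
  define g' where "g' t = 2 * \<alpha> * i t * ?g t - of_real t / 2 * ?h t" for t
  define f'' where "f'' t = (2 * \<alpha>) * (i t * f' t + - (i t * i t) * ?f t) - (of_real t / 2 * g' t + (1/2) * ?g t)" for t
  \<comment> \<open>The bilinear concomitant: its derivative is (L^* \<phi>) f - \<phi> (L f), so
    two integrations by parts become one application of the fundamental theorem. It vanishes at the
    endpoints together with \<phi> and \<phi>'.\<close>
  define \<Phi> where "\<Phi> t = ?f t * vderiv \<phi> t - ((1 - 2 * \<alpha>) * (i t * (?f t * \<phi> t)) + f' t * \<phi> t)" for t
  have di: "(i has_vector_derivative - (i t * i t)) (at t)" if "0 < t" for t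
    using of_real_inverse_has_vector_derivative[OF that, of 1] by (simp add: i_def[abs_def] divide_inverse power2_eq_square)
  have df: "(?f has_vector_derivative f' t) (at t)" "(?g has_vector_derivative g' t) (at t)" if "0 < t" for t
    unfolding f'_def g'_def i_def by (rule ker_has_vector_derivative_t[OF that s])+
  have dt2: "((\<lambda>t. complex_of_real t / 2) has_vector_derivative 1/2) (at t)" for t
    using has_vector_derivative_mult_right[OF of_real_has_vector_derivative[of t], of "1/2"] by simp
  have df': "(f' has_vector_derivative f'' t) (at t)" if "0 < t" for t
  proof -
    have "((\<lambda>t. (2 * \<alpha>) * (i t * ?f t) - of_real t / 2 * ?g t) has_vector_derivative
       (2 * \<alpha>) * (i t * f' t + - (i t * i t) * ?f t) - (of_real t / 2 * g' t + (1/2) * ?g t)) (at t)"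
      by (intro has_vector_derivative_diff has_vector_derivative_mult_right has_vector_derivative_mult[OF di[OF that] df(1)[OF that]]
          has_vector_derivative_mult[OF dt2 df(2)[OF that]])
    then show ?thesis unfolding f'_def[abs_def] f''_def by (simp add: mult.assoc)
  qed
  have L: "f'' t + (1 - 2 * \<alpha>) * (i t * f' t) = of_nat k * ?g t - of_real s * ?f t" if t: "0 < t" for t
  proof -
    have it: "i t * of_real t = 1" using t by (simp add: i_def)
    have r: "of_real s * ?f t = (\<alpha> + of_nat k + 1) * ?g t - of_real t * of_real t / 4 * ?h t"
      using ker_recurrence[OF t s, of \<alpha> k] by (simp add: power2_eq_square)
    have "(2 * \<alpha>) * (j * (2 * \<alpha> * j * F - T / 2 * G) + - (j * j) * F) - (T / 2 * (2 * \<alpha> * j * G - T / 2 * H) + (1/2) * G)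
       + (1 - 2 * \<alpha>) * (j * (2 * \<alpha> * j * F - T / 2 * G)) = K * G - ((\<alpha> + K + 1) * G - T * T / 4 * H)"
      if "j * T = 1" for j T F G H K :: complex
    proof -
      have e1: "j * (T / 2 * G) = G / 2" "T / 2 * (2 * \<alpha> * j * G) = \<alpha> * G" for G
        using that by (simp_all add: algebra_simps)
      show ?thesis
        unfolding right_diff_distrib e1 by (simp add: algebra_simps)
    qed
    from this[OF it, of "?f t" "?g t" "?h t" "of_nat k"] show ?thesis
      unfolding f''_def f'_def g'_def r .
  qed
  have "((\<lambda>t. adj \<alpha> \<phi> t * ?f t - \<phi> t * (of_nat k * ?g t - of_real s * ?f t)) has_integral \<Phi> b - \<Phi> a) {a..b}"
  proof (rule fundamental_theorem_of_calculus[OF a(2)])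
    fix t assume "t \<in> {a..b}"
    then have t: "0 < t" using a by simp
    have "(\<Phi> has_vector_derivative (?f t * vderiv (vderiv \<phi>) t + f' t * vderiv \<phi> t)
        - ((1 - 2 * \<alpha>) * (i t * (?f t * vderiv \<phi> t + f' t * \<phi> t) + - (i t * i t) * (?f t * \<phi> t)) + (f' t * vderiv \<phi> t + f'' t * \<phi> t))) (at t)"
      unfolding \<Phi>_def[abs_def]
      by (intro has_vector_derivative_diff has_vector_derivative_add has_vector_derivative_mult_right
          has_vector_derivative_mult df(1)[OF t] df'[OF t] d di[OF t])
    moreover have "(?f t * vderiv (vderiv \<phi>) t + f' t * vderiv \<phi> t)
        - ((1 - 2 * \<alpha>) * (i t * (?f t * vderiv \<phi> t + f' t * \<phi> t) + - (i t * i t) * (?f t * \<phi> t)) + (f' t * vderiv \<phi> t + f'' t * \<phi> t))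
        = adj \<alpha> \<phi> t * ?f t - \<phi> t * (f'' t + (1 - 2 * \<alpha>) * (i t * f' t))"
      unfolding adj_eq[OF d(1) t] i_def by (simp add: divide_inverse power2_eq_square algebra_simps)
    ultimately show "(\<Phi> has_vector_derivative adj \<alpha> \<phi> t * ?f t - \<phi> t * (of_nat k * ?g t - of_real s * ?f t)) (at t within {a..b})"
      unfolding L[OF t] by (simp add: has_vector_derivative_at_within)
  qed
  then have 0: "integral {a..b} (\<lambda>t. adj \<alpha> \<phi> t * ?f t - \<phi> t * (of_nat k * ?g t - of_real s * ?f t)) = 0"
    using z by (simp add: integral_unique \<Phi>_def)
  have c: "continuous_on {a..b} (\<lambda>t. ker \<alpha> j t s)" for j
    using a s unfolding ker_def by (intro continuous_intros) auto
  have ca: "continuous_on {a..b} (adj \<alpha> \<phi>)"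
    by (rule continuous_on_subset[OF continuous_on_adj[OF d]]) (use a in auto)
  have c\<phi>: "continuous_on {a..b} \<phi>"
    using d(1) by (auto intro: continuous_at_imp_continuous_on has_vector_derivative_continuous)
  have "(\<lambda>t. adj \<alpha> \<phi> t * ?f t) integrable_on {a..b}" "(\<lambda>t. \<phi> t * (of_nat k * ?g t - of_real s * ?f t)) integrable_on {a..b}"
    by (intro integrable_continuous_real continuous_intros c ca c\<phi>)+
  then show ?thesis using 0 by (simp add: Henstock_Kurzweil_Integration.integral_diff)
qed

lemma integral_scaleC_uniform_limit:
  fixes F :: "nat \<Rightarrow> real \<Rightarrow> 'a::complex_banach"
  assumes u: "uniform_limit {a..b} F f sequentially" and F: "\<And>n. continuous_on {a..b} (F n)"
    and g: "continuous_on {a..b} g"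
  shows "(\<lambda>n. integral {a..b} (\<lambda>t. g t *\<^sub>C F n t)) \<longlonglongrightarrow> integral {a..b} (\<lambda>t. g t *\<^sub>C f t)"
proof -
  have f: "continuous_on {a..b} f"
    by (rule uniform_limit_theorem[OF _ u]) (use F in auto)
  have "uniform_limit {a..b} (\<lambda>n t. g t *\<^sub>C F n t) (\<lambda>t. g t *\<^sub>C f t) sequentially"
  proof (rule bounded_bilinear.bounded_uniform_limit[OF bounded_bilinear_scaleC])
    show "uniform_limit {a..b} (\<lambda>n. g) g sequentially" by (rule uniform_limit_const)
    show "bounded (g ` {a..b})" "bounded (f ` {a..b})"
      by (intro compact_imp_bounded compact_continuous_image g f compact_Icc)+
  qed (rule u)
  then obtain I J where IJ: "\<And>n. ((\<lambda>t. g t *\<^sub>C F n t) has_integral I n) {a..b}" "((\<lambda>t. g t *\<^sub>C f t) has_integral J) {a..b}" "I \<longlonglongrightarrow> J"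
    by (rule uniform_limit_integral[where F = sequentially]) (use F g in \<open>auto intro!: continuous_intros\<close>)
  have "integral {a..b} (\<lambda>t. g t *\<^sub>C F n t) = I n" for n using IJ(1) by (rule integral_unique)
  moreover have "integral {a..b} (\<lambda>t. g t *\<^sub>C f t) = J" using IJ(2) by (rule integral_unique)
  ultimately show ?thesis using IJ(3) by simp
qed

subsection \<open>Existence\<close>

lemma window_conv: "window n = {1 / real (Suc n)..real (Suc n)}" "0 < 1 / real (Suc n)" "1 / real (Suc n) \<le> real (Suc n)"
proof -
  have "1 / real (Suc n) \<le> 1" by simp
  also have "1 \<le> real (Suc n)" by simp
  finally show "1 / real (Suc n) \<le> real (Suc n)" .
qed (auto simp: window_def)

section \<open>Absolute convergence of the integral representation\<close>

context bessel_operator begin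

abbreviation (input) a where "a \<equiv> Re \<alpha>"

text \<open>The decay available at both ends. Near 0 the integrands are at worst s^(a+3) s^(-4) =
  s^(a-1), which requires b0 <= a. At infinity they are at worst s^((a+3)/2) s^(-3) = s^((a-3)/2),
  which requires b0 <= (1 - a)/2.\<close>

definition b0 :: real where "b0 = min a ((1 - a) / 2)"

lemma b0: "0 < b0" "b0 \<le> a" "b0 \<le> (1 - a) / 2"
proof -
  show "0 < b0" using \<alpha> by (simp add: b0_def)
  show "b0 \<le> a" unfolding b0_def by (rule min.cobounded1)
  show "b0 \<le> (1 - a) / 2" unfolding b0_def by (rule min.cobounded2)
qed

lemma ker_bound:
  assumes x: "0 < x" and k: "0 < k"
  shows "\<exists>L\<ge>0. \<forall>t\<in>{x..y}. \<forall>s>0. norm (ker \<alpha> k t s) \<le> L * s powr (a + real k) \<and> norm (ker \<alpha> k t s) \<le> L * s powr ((a + real k) / 2)"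
proof -
  obtain B where B: "0 \<le> B" "\<And>t. 0 < t \<Longrightarrow> norm (bess (\<alpha> + of_nat k) t) \<le> B * t powr ((a + real k) / 2)"
    "\<And>t. 0 < t \<Longrightarrow> norm (bess (\<alpha> + of_nat k) t) \<le> B * t powr (a + real k)"
    by (rule bess_bounds[OF \<alpha>, of k]) blast
  \<comment> \<open>On \<open>{x..y}\<close> the power t^(2a) is largest at y and t^(a-k) is largest
    at x.\<close>
  let ?L = "B * max (y powr (2 * a)) (x powr (a - real k))"
  have "norm (ker \<alpha> k t s) \<le> ?L * s powr (a + real k) \<and> norm (ker \<alpha> k t s) \<le> ?L * s powr ((a + real k) / 2)"
    if t: "t \<in> {x..y}" and s: "0 < s" for t s
  proof -
    have t0: "0 < t" using t x by auto
    have n: "norm (ker \<alpha> k t s) = t powr (- (2 * real k)) * norm (bess (\<alpha> + of_nat k) (t\<^sup>2 * s))"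
      using t0 powr_realpow[OF t0, of "2 * k"] by (simp add: ker_def norm_mult norm_power norm_inverse powr_minus power_inverse)
    have z: "0 < t\<^sup>2 * s" using t0 s by simp
    have "norm (ker \<alpha> k t s) \<le> t powr (- (2 * real k)) * (B * (t\<^sup>2 * s) powr (a + real k))"
      unfolding n by (intro mult_left_mono B(3)[OF z]) auto
    also have "\<dots> = B * (t powr (- (2 * real k)) * t powr (2 * (a + real k))) * s powr (a + real k)"
      unfolding square_mult_powr[OF t0 s] by (simp only: mult_ac)
    also have "t powr (- (2 * real k)) * t powr (2 * (a + real k)) = t powr (2 * a)" by (simp flip: powr_add)
    also have "B * t powr (2 * a) * s powr (a + real k) \<le> ?L * s powr (a + real k)"
      using t t0 \<alpha> B(1) by (intro mult_right_mono mult_left_mono) (auto simp: le_max_iff_disj intro!: disjI1 powr_mono2)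
    finally have 1: "norm (ker \<alpha> k t s) \<le> ?L * s powr (a + real k)" .
    have "norm (ker \<alpha> k t s) \<le> t powr (- (2 * real k)) * (B * (t\<^sup>2 * s) powr ((a + real k) / 2))"
      unfolding n by (intro mult_left_mono B(2)[OF z]) auto
    also have "\<dots> = B * (t powr (- (2 * real k)) * t powr (2 * ((a + real k) / 2))) * s powr ((a + real k) / 2)"
      unfolding square_mult_powr[OF t0 s] by (simp only: mult_ac)
    also have "t powr (- (2 * real k)) * t powr (2 * ((a + real k) / 2)) = t powr (a - real k)"
    proof -
      have "- (2 * real k) + 2 * ((a + real k) / 2) = a - real k" by (simp add: field_simps)
      then show ?thesis by (simp only: powr_add[symmetric])
    qed
    also have "B * t powr (a - real k) * s powr ((a + real k) / 2) \<le> ?L * s powr ((a + real k) / 2)"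
      using t x \<alpha> B(1) k by (intro mult_right_mono mult_left_mono) (auto simp: le_max_iff_disj intro!: disjI2 powr_mono2')
    finally show ?thesis using 1 by blast
  qed
  then show ?thesis using B(1) by (intro exI[of _ ?L]) (auto simp: le_max_iff_disj)
qed

text \<open>The integrand of the solution. Since A R^4 = R^3 - s R^4, the function
  \<open>yker\<close> below is its image under \<open>A\<close>, with one power of s less decay;
  \<open>bdry\<close> is the boundary term of an integration by parts in s.\<close>

definition uker :: "'a \<Rightarrow> real \<Rightarrow> real \<Rightarrow> 'a" where "uker x t s = ker \<alpha> 3 t s *\<^sub>C Rp 4 s x"
definition yker :: "'a \<Rightarrow> real \<Rightarrow> real \<Rightarrow> 'a" where "yker x t s = ker \<alpha> 3 t s *\<^sub>C (Rp 3 s x - s *\<^sub>R Rp 4 s x)"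
definition bdry :: "'a \<Rightarrow> real \<Rightarrow> real \<Rightarrow> 'a" where "bdry x t s = ker \<alpha> 4 t s *\<^sub>C Rp 3 s x"

lemma continuous_on_Rp_fst: "S \<subseteq> UNIV \<times> {0<..} \<Longrightarrow> continuous_on S (\<lambda>p. Rp k (snd p) x)"
  by (intro continuous_intros continuous_on_compose2[OF continuous_on_Rp]) auto

lemma continuous_on_uker_yker:
  "continuous_on ({0<..} \<times> {0<..}) (\<lambda>(t, s). uker x t s)" "continuous_on ({0<..} \<times> {0<..}) (\<lambda>(t, s). yker x t s)"
  "continuous_on ({0<..} \<times> {0<..}) (\<lambda>(t, s). bdry x t s)"
  unfolding uker_def yker_def bdry_def case_prod_unfold
  by (intro continuous_intros continuous_on_ker continuous_on_Rp_fst; auto)+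

lemma continuous_on_slice:
  fixes f :: "real \<Rightarrow> real \<Rightarrow> 'a"
  assumes "continuous_on ({0<..} \<times> {0<..}) (\<lambda>(t, s). f t s)"
  shows "0 < t \<Longrightarrow> continuous_on {0<..} (f t)" "0 < s \<Longrightarrow> continuous_on {0<..} (\<lambda>t. f t s)"
proof -
  assume t: "0 < t"
  have c: "continuous_on {0<..} (\<lambda>s::real. (t, s))" "(\<lambda>s. (t, s)) ` {0<..} \<subseteq> {0<..} \<times> {0<..}"
    using t by (auto intro!: continuous_intros)
  show "continuous_on {0<..} (f t)"
    using continuous_on_compose2[OF assms c] by simp
next
  assume s: "0 < s"
  have c: "continuous_on {0<..} (\<lambda>t::real. (t, s))" "(\<lambda>t. (t, s)) ` {0<..} \<subseteq> {0<..} \<times> {0<..}"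
    using s by (auto intro!: continuous_intros)
  show "continuous_on {0<..} (\<lambda>t. f t s)"
    using continuous_on_compose2[OF assms c] by simp
qed

lemma Rp_norm_powr:
  assumes s: "0 < s" shows "norm (Rp k s x) \<le> M ^ k * norm x * s powr (- real k)"
proof -
  have "(M / s) ^ k = M ^ k * s powr (- real k)"
    using s by (simp add: power_mult_distrib power_inverse powr_minus powr_realpow divide_inverse)
  then show ?thesis using Rp_norm[OF s, of k x] by (simp add: mult_ac)
qed

lemma ker_majorant:
  assumes p: "0 < p" and r: "3 \<le> r" "r \<le> 4"
  shows "\<exists>C\<ge>0. \<forall>t\<in>{p..q}. \<forall>s>0. norm (ker \<alpha> 3 t s) * s powr (- r) \<le> C * majorant b0 s"
proof -
  obtain L where L: "0 \<le> L" "\<And>t s. t \<in> {p..q} \<Longrightarrow> 0 < s \<Longrightarrow> norm (ker \<alpha> 3 t s) \<le> L * s powr (a + 3)"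
    "\<And>t s. t \<in> {p..q} \<Longrightarrow> 0 < s \<Longrightarrow> norm (ker \<alpha> 3 t s) \<le> L * s powr ((a + 3) / 2)"
    using ker_bound[OF p, of 3 q] by auto
  have "norm (ker \<alpha> 3 t s) * s powr (- r) \<le> 4 * L / b0 * majorant b0 s" if t: "t \<in> {p..q}" and s: "0 < s" for t s
  proof (rule majorant_bound[OF b0(1), where p = "a + 3 + - r" and q = "(a + 3) / 2 + - r"])
    show "norm (ker \<alpha> 3 t s) * s powr (- r) \<le> L * s powr (a + 3 + - r)"
      unfolding powr_add[of s "a + 3"] mult.assoc[symmetric] by (intro mult_right_mono L(2)[OF t s]) simp
    show "norm (ker \<alpha> 3 t s) * s powr (- r) \<le> L * s powr ((a + 3) / 2 + - r)"
      unfolding powr_add[of s "(a + 3) / 2"] mult.assoc[symmetric] by (intro mult_right_mono L(3)[OF t s]) simp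
    show "(a + 3) / 2 + - r \<le> - b0 - 1" using b0(3) r by (simp add: field_simps)
  qed (use b0 L s r in auto)
  moreover have "0 \<le> 4 * L / b0" using L(1) b0(1) by simp
  ultimately show ?thesis by blast
qed

lemma uker_bound:
  assumes p: "0 < p"
  shows "\<exists>C\<ge>0. \<forall>t\<in>{p..q}. \<forall>s>0. norm (uker x t s) \<le> C * majorant b0 s"
proof -
  obtain C where C: "0 \<le> C" "\<And>t s. t \<in> {p..q} \<Longrightarrow> 0 < s \<Longrightarrow> norm (ker \<alpha> 3 t s) * s powr (- 4) \<le> C * majorant b0 s"
    using ker_majorant[OF p, of 4 q] by auto
  have m: "0 \<le> M ^ 4 * norm x" using M1 by simp
  have "norm (uker x t s) \<le> (M ^ 4 * norm x * C) * majorant b0 s" if t: "t \<in> {p..q}" and s: "0 < s" for t s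
  proof -
    have "norm (uker x t s) \<le> norm (ker \<alpha> 3 t s) * (M ^ 4 * norm x * s powr (- 4))"
      unfolding uker_def norm_scaleC using Rp_norm_powr[OF s, of 4 x] by (intro mult_left_mono) auto
    also have "\<dots> = (M ^ 4 * norm x) * (norm (ker \<alpha> 3 t s) * s powr (- 4))" by (simp only: mult_ac)
    also have "\<dots> \<le> (M ^ 4 * norm x) * (C * majorant b0 s)" by (rule mult_left_mono[OF C(2)[OF t s] m])
    finally show ?thesis by (simp only: mult.assoc)
  qed
  then show ?thesis using mult_nonneg_nonneg[OF m C(1)] by blast
qed

lemma yker_bound:
  assumes p: "0 < p"
  shows "\<exists>C\<ge>0. \<forall>t\<in>{p..q}. \<forall>s>0. norm (yker x t s) \<le> C * majorant b0 s"
proof -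
  obtain C where C: "0 \<le> C" "\<And>t s. t \<in> {p..q} \<Longrightarrow> 0 < s \<Longrightarrow> norm (ker \<alpha> 3 t s) * s powr (- 3) \<le> C * majorant b0 s"
    using ker_majorant[OF p, of 3 q] by auto
  define m where "m = M ^ 3 * norm x + M ^ 4 * norm x"
  have m: "0 \<le> m" using M1 by (simp add: m_def)
  have "norm (yker x t s) \<le> (m * C) * majorant b0 s" if t: "t \<in> {p..q}" and s: "0 < s" for t s
  proof -
    have "norm (Rp 3 s x - s *\<^sub>R Rp 4 s x) \<le> norm (Rp 3 s x) + s * norm (Rp 4 s x)"
      using norm_triangle_ineq4[of "Rp 3 s x" "s *\<^sub>R Rp 4 s x"] s by simp
    also have "\<dots> \<le> M ^ 3 * norm x * s powr (- 3) + s * (M ^ 4 * norm x * s powr (- 4))"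
      using Rp_norm_powr[OF s, of 3 x] Rp_norm_powr[OF s, of 4 x] s by (intro add_mono mult_left_mono) auto
    also have "s * (M ^ 4 * norm x * s powr (- 4)) = M ^ 4 * norm x * s powr (- 3)"
      using s powr_add[of s 1 "-4"] by simp
    finally have R3: "norm (Rp 3 s x - s *\<^sub>R Rp 4 s x) \<le> m * s powr (- 3)" by (simp add: m_def algebra_simps)
    have "norm (yker x t s) \<le> norm (ker \<alpha> 3 t s) * (m * s powr (- 3))"
      unfolding yker_def norm_scaleC by (intro mult_left_mono R3) auto
    also have "\<dots> = m * (norm (ker \<alpha> 3 t s) * s powr (- 3))" by (simp only: mult_ac)
    also have "\<dots> \<le> m * (C * majorant b0 s)" by (rule mult_left_mono[OF C(2)[OF t s] m])
    finally show ?thesis by (simp only: mult.assoc)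
  qed
  then show ?thesis using mult_nonneg_nonneg[OF m C(1)] by blast
qed

definition usol :: "'a \<Rightarrow> real \<Rightarrow> 'a" where "usol x t = improper (uker x t)"
definition ysol :: "'a \<Rightarrow> real \<Rightarrow> 'a" where "ysol x t = improper (yker x t)"

lemma usol_limit:
  assumes p: "0 < p"
  shows "uniform_limit {p..q} (\<lambda>n t. integral (window n) (uker x t)) (usol x) sequentially"
proof -
  obtain C where C: "0 \<le> C" "\<And>t s. t \<in> {p..q} \<Longrightarrow> 0 < s \<Longrightarrow> norm (uker x t s) \<le> C * majorant b0 s"
    using uker_bound[OF p, of q x] by blast
  have "uniform_limit {p..q} (\<lambda>n t. integral (window n) (uker x t)) (\<lambda>t. improper (uker x t)) sequentially"
    by (rule improper_uniform_limit[OF _ b0(1) C]) (use p in \<open>auto intro: continuous_on_slice(1)[OF continuous_on_uker_yker(1)]\<close>)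
  then show ?thesis by (simp add: usol_def[abs_def])
qed

lemma ysol_limit:
  assumes p: "0 < p"
  shows "uniform_limit {p..q} (\<lambda>n t. integral (window n) (yker x t)) (ysol x) sequentially"
proof -
  obtain C where C: "0 \<le> C" "\<And>t s. t \<in> {p..q} \<Longrightarrow> 0 < s \<Longrightarrow> norm (yker x t s) \<le> C * majorant b0 s"
    using yker_bound[OF p, of q x] by blast
  have "uniform_limit {p..q} (\<lambda>n t. integral (window n) (yker x t)) (\<lambda>t. improper (yker x t)) sequentially"
    by (rule improper_uniform_limit[OF _ b0(1) C]) (use p in \<open>auto intro: continuous_on_slice(1)[OF continuous_on_uker_yker(2)]\<close>)
  then show ?thesis by (simp add: ysol_def[abs_def])
qed

lemma usol_tendsto: "0 < t \<Longrightarrow> (\<lambda>n. integral (window n) (uker x t)) \<longlonglongrightarrow> usol x t"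
  using tendsto_uniform_limitI[OF usol_limit[where p = t and q = t and x = x], of t] by simp

lemma ysol_tendsto: "0 < t \<Longrightarrow> (\<lambda>n. integral (window n) (yker x t)) \<longlonglongrightarrow> ysol x t"
  using tendsto_uniform_limitI[OF ysol_limit[where p = t and q = t and x = x], of t] by simp

text \<open>The boundary term is O(s^(a+1)) near 0 and O(s^((a-2)/2)) at infinity, uniformly for t
  in a compact interval; both exponents have the right sign for 0 < a < 1.\<close>

lemma bdry_limit:
  assumes p: "0 < p"
  shows "uniform_limit {p..q} (\<lambda>n t. bdry x t (real (Suc n)) - bdry x t (1 / real (Suc n))) (\<lambda>t. 0) sequentially"
proof -
  obtain L where L: "0 \<le> L" "\<And>t s. t \<in> {p..q} \<Longrightarrow> 0 < s \<Longrightarrow> norm (ker \<alpha> 4 t s) \<le> L * s powr (a + 4)"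
    "\<And>t s. t \<in> {p..q} \<Longrightarrow> 0 < s \<Longrightarrow> norm (ker \<alpha> 4 t s) \<le> L * s powr ((a + 4) / 2)"
    using ker_bound[OF p, of 4 q] by auto
  let ?C = "L * (M ^ 3 * norm x)"
  have R3: "norm (Rp 3 s x) \<le> M ^ 3 * norm x * s powr (- 3)" if "0 < s" for s using Rp_norm_powr[OF that, of 3 x] by simp
  have 1: "norm (bdry x t s) \<le> ?C * s powr (a + 1)" if t: "t \<in> {p..q}" and s: "0 < s" for t s
  proof -
    have "norm (bdry x t s) \<le> (L * s powr (a + 4)) * (M ^ 3 * norm x * s powr (- 3))"
      unfolding bdry_def norm_scaleC using L(1) by (intro mult_mono L(2)[OF t s] R3[OF s]) auto
    also have "\<dots> = ?C * (s powr (a + 4) * s powr (- 3))" by (simp only: mult_ac)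
    also have "s powr (a + 4) * s powr (- 3) = s powr (a + 1)" by (simp add: add.commute flip: powr_add)
    finally show ?thesis .
  qed
  have 2: "norm (bdry x t s) \<le> ?C * s powr ((a - 2) / 2)" if t: "t \<in> {p..q}" and s: "0 < s" for t s
  proof -
    have "norm (bdry x t s) \<le> (L * s powr ((a + 4) / 2)) * (M ^ 3 * norm x * s powr (- 3))"
      unfolding bdry_def norm_scaleC using L(1) by (intro mult_mono L(3)[OF t s] R3[OF s]) auto
    also have "\<dots> = ?C * (s powr ((a + 4) / 2) * s powr (- 3))" by (simp only: mult_ac)
    also have "s powr ((a + 4) / 2) * s powr (- 3) = s powr ((a - 2) / 2)"
    proof -
      have "(a + 4) / 2 + - 3 = (a - 2) / 2" by (simp add: field_simps)
      then show ?thesis by (simp only: powr_add[symmetric])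
    qed
    finally show ?thesis .
  qed
  have l1: "(\<lambda>n. real (Suc n) powr ((a - 2) / 2)) \<longlonglongrightarrow> 0"
    using \<alpha> by (intro tendsto_neg_powr filterlim_compose[OF filterlim_real_sequentially filterlim_Suc]) auto
  have l2: "(\<lambda>n. (1 / real (Suc n)) powr (a + 1)) \<longlonglongrightarrow> 0"
  proof -
    have "(\<lambda>n. real (Suc n) powr (- (a + 1))) \<longlonglongrightarrow> 0"
      using \<alpha> by (intro tendsto_neg_powr filterlim_compose[OF filterlim_real_sequentially filterlim_Suc]) auto
    moreover have "real (Suc n) powr (- (a + 1)) = (1 / real (Suc n)) powr (a + 1)" for n
      by (simp only: powr_divide powr_one_eq_one powr_minus_divide of_nat_0_le_iff zero_le_one)
    ultimately show ?thesis by simp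
  qed
  have "(\<lambda>n. ?C * real (Suc n) powr ((a - 2) / 2) + ?C * (1 / real (Suc n)) powr (a + 1)) \<longlonglongrightarrow> ?C * 0 + ?C * 0"
    by (intro tendsto_add tendsto_mult tendsto_const l1 l2)
  then have l: "(\<lambda>n. ?C * real (Suc n) powr ((a - 2) / 2) + ?C * (1 / real (Suc n)) powr (a + 1)) \<longlonglongrightarrow> 0" by simp
  show ?thesis
  proof (rule uniform_limitI)
    fix e :: real assume e: "0 < e"
    show "\<forall>\<^sub>F n in sequentially. \<forall>t\<in>{p..q}. dist (bdry x t (real (Suc n)) - bdry x t (1 / real (Suc n))) 0 < e"
      using order_tendstoD(2)[OF l e]
    proof eventually_elim
      case (elim n)
      show ?case
      proof
        fix t assume t: "t \<in> {p..q}"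
        have "norm (bdry x t (real (Suc n)) - bdry x t (1 / real (Suc n))) \<le> ?C * real (Suc n) powr ((a - 2) / 2) + ?C * (1 / real (Suc n)) powr (a + 1)"
          by (intro order_trans[OF norm_triangle_ineq4] add_mono 1[OF t] 2[OF t]) auto
        then show "dist (bdry x t (real (Suc n)) - bdry x t (1 / real (Suc n))) 0 < e" using elim by simp
      qed
    qed
  qed
qed

text \<open>The scalar factor on the left is L \<open>ker 3\<close>. Because d/ds (ker_4 R^3) =
  ker_3 R^3 - 3 ker_4 R^4, the term 3 ker_4 R^4 becomes ker_3 R^3 up to a boundary term, and what
  remains is the integrand of \<open>A u\<close>.\<close>

lemma window_identity:
  assumes t: "0 < t"
  shows "integral (window n) (\<lambda>s. (3 * ker \<alpha> 4 t s - of_real s * ker \<alpha> 3 t s) *\<^sub>C Rp 4 s x)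
     = integral (window n) (yker x t) - (bdry x t (real (Suc n)) - bdry x t (1 / real (Suc n)))"
proof -
  let ?J = "{1 / real (Suc n)..real (Suc n)}"
  have "((\<lambda>s. ker \<alpha> 4 t s *\<^sub>C - (3 *\<^sub>R Rp 4 s x) + ker \<alpha> 3 t s *\<^sub>C Rp 3 s x) has_integral bdry x t (real (Suc n)) - bdry x t (1 / real (Suc n))) ?J"
  proof (rule fundamental_theorem_of_calculus[OF window_conv(3)])
    fix s assume "s \<in> ?J"
    then have s: "0 < s" using window_conv(2)[of n] by (meson atLeastAtMost_iff less_le_trans)
    have r: "((\<lambda>s. Rp 3 s x) has_vector_derivative - (3 *\<^sub>R Rp 4 s x)) (at s)"
      using bounded_linear.has_vector_derivative[OF blinfun.bounded_linear_left[of x] Rp_has_vector_derivative[OF s, of 3]]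
      by (simp add: blinfun.bilinear_simps numeral_eq_Suc)
    have k: "((\<lambda>s. ker \<alpha> 4 t s) has_vector_derivative ker \<alpha> 3 t s) (at s)"
      using ker_has_vector_derivative_s[OF t s, of \<alpha> 3] by (simp add: numeral_eq_Suc)
    show "((\<lambda>s. bdry x t s) has_vector_derivative ker \<alpha> 4 t s *\<^sub>C - (3 *\<^sub>R Rp 4 s x) + ker \<alpha> 3 t s *\<^sub>C Rp 3 s x) (at s within ?J)"
      unfolding bdry_def by (rule has_vector_derivative_at_within, rule scaleC.has_vector_derivative[OF k r])
  qed
  moreover have "(yker x t has_integral integral ?J (yker x t)) ?J"
  proof (intro integrable_integral integrable_continuous_real)
    have "?J \<subseteq> {0<..}" using window_subset[of n] unfolding window_conv(1) .
    then show "continuous_on ?J (yker x t)"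
      by (rule continuous_on_subset[OF continuous_on_slice(1)[OF continuous_on_uker_yker(2) t]])
  qed
  ultimately have "((\<lambda>s. yker x t s - (ker \<alpha> 4 t s *\<^sub>C - (3 *\<^sub>R Rp 4 s x) + ker \<alpha> 3 t s *\<^sub>C Rp 3 s x)) has_integral
     integral ?J (yker x t) - (bdry x t (real (Suc n)) - bdry x t (1 / real (Suc n)))) ?J"
    by (intro has_integral_diff)
  moreover have "yker x t s - (ker \<alpha> 4 t s *\<^sub>C - (3 *\<^sub>R Rp 4 s x) + ker \<alpha> 3 t s *\<^sub>C Rp 3 s x) = (3 * ker \<alpha> 4 t s - of_real s * ker \<alpha> 3 t s) *\<^sub>C Rp 4 s x" for s
  proof -
    have "3 *\<^sub>R v = 3 *\<^sub>C v" for v :: 'a using scaleC_of_real[of 3 v] by simp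
    moreover have "s *\<^sub>R v = of_real s *\<^sub>C v" for v :: 'a using scaleC_of_real[of s v] by simp
    ultimately show ?thesis
      unfolding yker_def by (simp add: scaleC.diff_right scaleC.minus_right scaleC.diff_left scaleC_scaleC mult.commute)
  qed
  ultimately show ?thesis unfolding window_conv(1) by (simp add: integral_unique)
qed

text \<open>On each window the integrals are exchanged, \<open>ker_adjoint\<close> acts in t for
  fixed s, and \<open>window_identity\<close> acts in s for fixed t. Uniform convergence on the
  support interval carries the identity to the limit.\<close>

lemma usol_weak:
  assumes p: "0 < p" "p \<le> q"
    and z: "\<phi> p = 0" "\<phi> q = 0" "vderiv \<phi> p = 0" "vderiv \<phi> q = 0"
    and d: "\<And>t. (\<phi> has_vector_derivative vderiv \<phi> t) (at t)"
      "\<And>t. (vderiv \<phi> has_vector_derivative vderiv (vderiv \<phi>) t) (at t)"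
      "continuous_on UNIV (vderiv (vderiv \<phi>))"
  shows "integral {p..q} (\<lambda>t. adj \<alpha> \<phi> t *\<^sub>C usol x t) = integral {p..q} (\<lambda>t. \<phi> t *\<^sub>C ysol x t)"
proof -
  let ?J = "{p..q}"
  have Jpos: "?J \<subseteq> {0<..}" using p by auto
  have ca: "continuous_on ?J (adj \<alpha> \<phi>)" by (rule continuous_on_subset[OF continuous_on_adj[OF d] Jpos])
  have c\<phi>: "continuous_on ?J \<phi>"
    using d(1) by (auto intro: continuous_at_imp_continuous_on has_vector_derivative_continuous)
  have cint: "continuous_on ?J (\<lambda>t. integral (window n) (f t))" if "continuous_on ({0<..} \<times> {0<..}) (\<lambda>(t, s). f t s)" for f :: "real \<Rightarrow> real \<Rightarrow> 'a" and n
  proof -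
    have "?J \<times> {1 / real (Suc n)..real (Suc n)} \<subseteq> {0<..} \<times> {0<..}"
      using Jpos window_subset[of n] unfolding window_conv(1) by blast
    then show ?thesis unfolding window_conv(1)
      by (intro continuous_on_integral_Icc continuous_on_subset[OF that])
  qed
  have cb: "continuous_on ?J (\<lambda>t. bdry x t s)" if "0 < s" for s
    by (rule continuous_on_subset[OF continuous_on_slice(2)[OF continuous_on_uker_yker(3) that] Jpos])
  have lim1: "(\<lambda>n. integral ?J (\<lambda>t. adj \<alpha> \<phi> t *\<^sub>C integral (window n) (uker x t))) \<longlonglongrightarrow> integral ?J (\<lambda>t. adj \<alpha> \<phi> t *\<^sub>C usol x t)"
    by (rule integral_scaleC_uniform_limit[OF usol_limit[OF p(1)] cint[OF continuous_on_uker_yker(1)] ca])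
  have "uniform_limit ?J (\<lambda>n t. integral (window n) (yker x t) - (bdry x t (real (Suc n)) - bdry x t (1 / real (Suc n)))) (\<lambda>t. ysol x t - 0) sequentially"
    by (intro uniform_limit_minus ysol_limit[OF p(1)] bdry_limit[OF p(1)])
  then have ul: "uniform_limit ?J (\<lambda>n t. integral (window n) (yker x t) - (bdry x t (real (Suc n)) - bdry x t (1 / real (Suc n)))) (ysol x) sequentially"
    by simp
  have lim2: "(\<lambda>n. integral ?J (\<lambda>t. \<phi> t *\<^sub>C (integral (window n) (yker x t) - (bdry x t (real (Suc n)) - bdry x t (1 / real (Suc n)))))) \<longlonglongrightarrow> integral ?J (\<lambda>t. \<phi> t *\<^sub>C ysol x t)"
    by (rule integral_scaleC_uniform_limit[OF ul _ c\<phi>]) (intro continuous_intros cint[OF continuous_on_uker_yker(2)] cb; simp)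
  have "integral ?J (\<lambda>t. adj \<alpha> \<phi> t *\<^sub>C integral (window n) (uker x t)) = integral ?J (\<lambda>t. \<phi> t *\<^sub>C (integral (window n) (yker x t) - (bdry x t (real (Suc n)) - bdry x t (1 / real (Suc n)))))" for n
  proof -
    let ?W = "{1 / real (Suc n)..real (Suc n)}"
    let ?m = "\<lambda>t s. 3 * ker \<alpha> 4 t s - of_real s * ker \<alpha> 3 t s"
    have W: "?W \<subseteq> {0<..}" using window_subset[of n] unfolding window_conv(1) .
    have sub: "?J \<times> ?W \<subseteq> {0<..} \<times> {0<..}" using Jpos W by blast
    have ck: "continuous_on (?J \<times> ?W) (\<lambda>x. ker \<alpha> k (fst x) (snd x))" for k
      by (rule continuous_on_subset[OF continuous_on_ker sub])
    have cR: "continuous_on (?J \<times> ?W) (\<lambda>y. Rp 4 (snd y) x)"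
      by (rule continuous_on_Rp_fst) (use sub in auto)
    have cR': "continuous_on ?W (\<lambda>s. Rp 4 s x)"
      by (intro continuous_intros continuous_on_subset[OF continuous_on_Rp W])
    have ca2: "continuous_on (?J \<times> ?W) (\<lambda>x. adj \<alpha> \<phi> (fst x))" "continuous_on (?J \<times> ?W) (\<lambda>x. \<phi> (fst x))"
      by (rule continuous_on_compose2[OF ca] continuous_on_compose2[OF c\<phi>]; auto intro: continuous_intros)+
    have kt: "continuous_on ?J (\<lambda>t. ker \<alpha> k t s)" if "s \<in> ?W" for s k
    proof -
      have "0 < s" using that W by auto
      then show ?thesis using Jpos unfolding ker_def by (intro continuous_intros) auto
    qed
    have ks: "continuous_on ?W (\<lambda>s. ker \<alpha> k t s)" if "t \<in> ?J" for t k
    proof -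
      have "0 < t" using that Jpos by auto
      then show ?thesis using W unfolding ker_def by (intro continuous_intros) auto
    qed
    have "integral ?J (\<lambda>t. adj \<alpha> \<phi> t *\<^sub>C integral ?W (uker x t)) = integral ?J (\<lambda>t. integral ?W (\<lambda>s. (adj \<alpha> \<phi> t * ker \<alpha> 3 t s) *\<^sub>C Rp 4 s x))"
    proof (rule integral_cong)
      fix t assume t: "t \<in> ?J"
      have "uker x t integrable_on ?W"
        unfolding uker_def by (intro integrable_continuous_real continuous_intros ks[OF t] cR')
      then show "adj \<alpha> \<phi> t *\<^sub>C integral ?W (uker x t) = integral ?W (\<lambda>s. (adj \<alpha> \<phi> t * ker \<alpha> 3 t s) *\<^sub>C Rp 4 s x)"
        by (simp add: integral_scaleC_right[symmetric] uker_def scaleC_scaleC)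
    qed
    also have "\<dots> = integral ?W (\<lambda>s. integral ?J (\<lambda>t. (adj \<alpha> \<phi> t * ker \<alpha> 3 t s) *\<^sub>C Rp 4 s x))"
      by (rule integral_swap_Icc) (unfold case_prod_unfold, intro continuous_intros ca2 ck cR)
    also have "\<dots> = integral ?W (\<lambda>s. integral ?J (\<lambda>t. (\<phi> t * ?m t s) *\<^sub>C Rp 4 s x))"
    proof (rule integral_cong)
      fix s assume s: "s \<in> ?W"
      then have s0: "0 < s" using W by auto
      have i: "(\<lambda>t. adj \<alpha> \<phi> t * ker \<alpha> 3 t s) integrable_on ?J" "(\<lambda>t. \<phi> t * ?m t s) integrable_on ?J"
        by (intro integrable_continuous_real continuous_intros ca c\<phi> kt[OF s])+
      have "integral ?J (\<lambda>t. adj \<alpha> \<phi> t * ker \<alpha> 3 t s) = integral ?J (\<lambda>t. \<phi> t * ?m t s)"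
        using ker_adjoint[where \<alpha> = \<alpha> and k = 3, OF s0 p z d] by (simp add: numeral_eq_Suc)
      then show "integral ?J (\<lambda>t. (adj \<alpha> \<phi> t * ker \<alpha> 3 t s) *\<^sub>C Rp 4 s x) = integral ?J (\<lambda>t. (\<phi> t * ?m t s) *\<^sub>C Rp 4 s x)"
        by (simp only: integral_scaleC_left[OF i(1)] integral_scaleC_left[OF i(2)])
    qed
    also have "\<dots> = integral ?J (\<lambda>t. integral ?W (\<lambda>s. (\<phi> t * ?m t s) *\<^sub>C Rp 4 s x))"
      by (rule integral_swap_Icc[symmetric]) (unfold case_prod_unfold, intro continuous_intros ca2 ck cR)
    also have "\<dots> = integral ?J (\<lambda>t. \<phi> t *\<^sub>C (integral ?W (yker x t) - (bdry x t (real (Suc n)) - bdry x t (1 / real (Suc n)))))"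
    proof (rule integral_cong)
      fix t assume t: "t \<in> ?J"
      then have t0: "0 < t" using Jpos by auto
      have i: "(\<lambda>s. ?m t s *\<^sub>C Rp 4 s x) integrable_on ?W"
        by (intro integrable_continuous_real continuous_intros ks[OF t] cR')
      have "integral ?W (\<lambda>s. (\<phi> t * ?m t s) *\<^sub>C Rp 4 s x) = \<phi> t *\<^sub>C integral ?W (\<lambda>s. ?m t s *\<^sub>C Rp 4 s x)"
        by (simp only: integral_scaleC_right[OF i, symmetric] scaleC_scaleC)
      then show "integral ?W (\<lambda>s. (\<phi> t * ?m t s) *\<^sub>C Rp 4 s x) = \<phi> t *\<^sub>C (integral ?W (yker x t) - (bdry x t (real (Suc n)) - bdry x t (1 / real (Suc n))))"
        using window_identity[OF t0, of n x] unfolding window_conv(1) by simp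
    qed
    finally show ?thesis unfolding window_conv(1) .
  qed
  then show ?thesis using lim1 lim2 LIMSEQ_unique by simp
qed

text \<open>Closedness of \<open>A\<close> in the form of a bounded operator: R 1 (u + A u) = u
  holds for the window integrals and passes to the limit, and the range of \<open>R 1\<close> lies
  in the domain.\<close>

lemma usol_in_D:
  assumes t: "0 < t"
  shows "usol x t \<in> D" "A (usol x t) = ysol x t"
proof -
  have "R 1 (integral (window n) (uker x t) + integral (window n) (yker x t)) = integral (window n) (uker x t)" for n
  proof -
    have W: "window n \<subseteq> {0<..}" by (rule window_subset)
    have i: "uker x t integrable_on window n" "yker x t integrable_on window n"
      using continuous_on_subset[OF continuous_on_slice(1)[OF continuous_on_uker_yker(1) t] W]
        continuous_on_subset[OF continuous_on_slice(1)[OF continuous_on_uker_yker(2) t] W]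
      unfolding window_conv(1) by (auto intro: integrable_continuous_real)
    have "R 1 (integral (window n) (uker x t) + integral (window n) (yker x t)) = R 1 (integral (window n) (\<lambda>s. uker x t s + yker x t s))"
      by (simp add: Henstock_Kurzweil_Integration.integral_add[OF i])
    also have "\<dots> = integral (window n) (\<lambda>s. R 1 (uker x t s + yker x t s))"
      using integral_linear[OF integrable_add[OF i] blinfun.bounded_linear_right[of "R 1"]] by (simp add: o_def)
    also have "\<dots> = integral (window n) (uker x t)"
    proof (rule integral_cong)
      fix s assume "s \<in> window n"
      then have s: "0 < s" using W by auto
      have e: "Rp 4 s x = R s (Rp 3 s x)" by (simp add: numeral_eq_Suc)
      have "R 1 (1 *\<^sub>R Rp 4 s x + A (Rp 4 s x)) = Rp 4 s x" unfolding e by (rule R_A[OF zero_less_one R_in[OF s]])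
      moreover have "A (Rp 4 s x) = Rp 3 s x - s *\<^sub>R Rp 4 s x" unfolding e by (rule A_R[OF s])
      ultimately have "R 1 (Rp 4 s x + (Rp 3 s x - s *\<^sub>R Rp 4 s x)) = Rp 4 s x" by simp
      then show "R 1 (uker x t s + yker x t s) = uker x t s"
        unfolding uker_def yker_def scaleC_add_right[symmetric] by (simp add: R_scaleC)
    qed
    finally show ?thesis .
  qed
  moreover have "(\<lambda>n. R 1 (integral (window n) (uker x t) + integral (window n) (yker x t))) \<longlonglongrightarrow> R 1 (usol x t + ysol x t)"
    by (intro blinfun.tendsto tendsto_const tendsto_add usol_tendsto ysol_tendsto t)
  ultimately have e: "R 1 (usol x t + ysol x t) = usol x t"
    using usol_tendsto[OF t, of x] LIMSEQ_unique by simp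
  show "usol x t \<in> D" using R_in[of 1 "usol x t + ysol x t"] e by simp
  show "A (usol x t) = ysol x t" using A_R[of 1 "usol x t + ysol x t"] e by simp
qed

lemma continuous_on_usol_ysol: "continuous_on {0<..} (usol x)" "continuous_on {0<..} (ysol x)"
proof -
  have loc: "continuous_on {0<..} f" if "\<And>p q. 0 < p \<Longrightarrow> continuous_on {p..q} f" for f :: "real \<Rightarrow> 'a"
  proof (intro continuous_at_imp_continuous_on ballI)
    fix t :: real assume "t \<in> {0<..}"
    then have "t \<in> interior {t/2..t+1}" "0 < t / 2" by auto
    then show "continuous (at t) f" using that continuous_on_interior by blast
  qed
  have cint: "continuous_on {p..q} (\<lambda>t. integral (window n) (f t))" if "continuous_on ({0<..} \<times> {0<..}) (\<lambda>(t, s). f t s)" "0 < p" for f :: "real \<Rightarrow> real \<Rightarrow> 'a" and n p q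
  proof -
    have "{p..q} \<subseteq> {0<..}" using that(2) by auto
    then have "{p..q} \<times> {1 / real (Suc n)..real (Suc n)} \<subseteq> {0<..} \<times> {0<..}"
      using window_subset[of n] unfolding window_conv(1) by blast
    then show ?thesis unfolding window_conv(1)
      by (intro continuous_on_integral_Icc continuous_on_subset[OF that(1)])
  qed
  show "continuous_on {0<..} (usol x)"
  proof (rule loc)
    fix p q :: real assume p: "0 < p"
    show "continuous_on {p..q} (usol x)"
      by (rule uniform_limit_theorem[OF always_eventually[OF allI] usol_limit[OF p]]) (use cint[OF continuous_on_uker_yker(1) p] in auto)
  qed
  show "continuous_on {0<..} (ysol x)"
  proof (rule loc)
    fix p q :: real assume p: "0 < p"
    show "continuous_on {p..q} (ysol x)"
      by (rule uniform_limit_theorem[OF always_eventually[OF allI] ysol_limit[OF p]]) (use cint[OF continuous_on_uker_yker(2) p] in auto)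
  qed
qed

end

section \<open>Behaviour of the integral representation at t = 0\<close>

context bessel_operator begin

text \<open>Half of the decay b0 secures convergence at both ends; the other half is available as
  the extra exponent \<theta>. The case \<theta> = 0 gives boundedness, and \<theta> = b0/2 a rate
  as t tends to 0.\<close>

lemma bess_majorant:
  assumes \<theta>: "0 \<le> \<theta>" "\<theta> \<le> b0 / 2"
  shows "\<exists>C\<ge>0. \<forall>z>0. norm (bess (\<alpha> + 3) z) * z powr (- 4 - \<theta>) \<le> C * majorant (b0 / 2) z"
proof -
  obtain B where B: "0 \<le> B" "\<And>t. 0 < t \<Longrightarrow> norm (bess (\<alpha> + 3) t) \<le> B * t powr ((a + 3) / 2)"
    "\<And>t. 0 < t \<Longrightarrow> norm (bess (\<alpha> + 3) t) \<le> B * t powr (a + 3)"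
    by (rule bess_bounds[OF \<alpha>, of 3]) auto
  have "norm (bess (\<alpha> + 3) z) * z powr (- 4 - \<theta>) \<le> 4 * B / (b0 / 2) * majorant (b0 / 2) z" if z: "0 < z" for z
  proof (rule majorant_bound[where p = "a + 3 + (- 4 - \<theta>)" and q = "(a + 3) / 2 + (- 4 - \<theta>)"])
    show "norm (bess (\<alpha> + 3) z) * z powr (- 4 - \<theta>) \<le> B * z powr (a + 3 + (- 4 - \<theta>))"
      unfolding powr_add[of z "a + 3"] mult.assoc[symmetric] by (intro mult_right_mono B(3)[OF z]) simp
    show "norm (bess (\<alpha> + 3) z) * z powr (- 4 - \<theta>) \<le> B * z powr ((a + 3) / 2 + (- 4 - \<theta>))"
      unfolding powr_add[of z "(a + 3) / 2"] mult.assoc[symmetric] by (intro mult_right_mono B(2)[OF z]) simp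
    show "(a + 3) / 2 + (- 4 - \<theta>) \<le> - (b0 / 2) - 1" using b0 \<theta> by argo
    show "b0 / 2 - 1 \<le> a + 3 + (- 4 - \<theta>)" using b0 \<theta> by argo
  qed (use b0 B z in auto)
  moreover have "0 \<le> 4 * B / (b0 / 2)" using B(1) b0(1) by simp
  ultimately show ?thesis by blast
qed

text \<open>The substitution z = t^2 s, realised by the dilated majorant with \<tau> = t^2. Decay
  s^(-4) of v gives a bound independent of t, and each extra power s^(-\<theta>) becomes
  t^(2\<theta>).\<close>

lemma ker_window_bound:
  assumes \<theta>: "0 \<le> \<theta>" "\<theta> \<le> b0 / 2"
  shows "\<exists>C\<ge>0. \<forall>(v :: real \<Rightarrow> 'a) K t n. continuous_on {0<..} v \<longrightarrow> 0 \<le> K \<longrightarrow> 0 < t \<longrightarrow>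
    (\<forall>s>0. norm (v s) \<le> K * s powr (- 4 - \<theta>)) \<longrightarrow>
    norm (integral (window n) (\<lambda>s. ker \<alpha> 3 t s *\<^sub>C v s)) \<le> C * K * t powr (2 * \<theta>)"
proof -
  obtain C where C: "0 \<le> C" "\<And>z. 0 < z \<Longrightarrow> norm (bess (\<alpha> + 3) z) * z powr (- 4 - \<theta>) \<le> C * majorant (b0 / 2) z"
    using bess_majorant[OF \<theta>] by blast
  have "norm (integral (window n) (\<lambda>s. ker \<alpha> 3 t s *\<^sub>C v s)) \<le> C * K * t powr (2 * \<theta>)"
    if v: "continuous_on {0<..} v" "\<And>s. 0 < s \<Longrightarrow> norm (v s) \<le> K * s powr (- 4 - \<theta>)" and K: "0 \<le> K" and t: "0 < t"
    for v :: "real \<Rightarrow> 'a" and K t n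
    unfolding window_conv(1)
  proof (rule norm_integral_le_majorant[where \<tau> = "t\<^sup>2" and b = "b0 / 2"])
    let ?W = "{1 / real (Suc n)..real (Suc n)}"
    have W: "?W \<subseteq> {0<..}" using window_subset[of n] unfolding window_conv(1) .
    have "continuous_on {0<..} (\<lambda>s. ker \<alpha> 3 t s)" unfolding ker_def using t by (intro continuous_intros) auto
    then show "continuous_on ?W (\<lambda>s. ker \<alpha> 3 t s *\<^sub>C v s)"
      using W by (intro continuous_intros continuous_on_subset[OF v(1)]) (auto intro: continuous_on_subset)
    fix s assume "s \<in> ?W"
    then have s: "0 < s" using W by auto
    let ?N = "norm (bess (\<alpha> + 3) (t\<^sup>2 * s))"
    have z: "0 < t\<^sup>2 * s" using s t by simp
    have "norm (ker \<alpha> 3 t s) = t powr (- 6) * ?N"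
      using t powr_realpow[OF t, of 6] by (simp add: ker_def norm_mult norm_power norm_inverse powr_minus power_inverse)
    then have "norm (ker \<alpha> 3 t s *\<^sub>C v s) \<le> t powr (- 6) * ?N * (K * s powr (- 4 - \<theta>))"
      using v(2)[OF s] by (simp only: norm_scaleC) (intro mult_left_mono; simp)
    \<comment> \<open>The exponent -6 is split as 2\<theta> + 2 + 2(-4 - \<theta>): the gain, the
      Jacobian of z = t^2 s, and the part that completes s^(-4-\<theta>) to z^(-4-\<theta>).\<close>
    also have "\<dots> = K * ((t powr (2 * \<theta>) * t powr 2 * t powr (2 * (- 4 - \<theta>))) * ?N * s powr (- 4 - \<theta>))"
    proof -
      have "2 * \<theta> + 2 + 2 * (- 4 - \<theta>) = - 6" by simp
      then have "t powr (2 * \<theta>) * t powr 2 * t powr (2 * (- 4 - \<theta>)) = t powr (- 6)" by (simp only: powr_add[symmetric])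
      then show ?thesis by (simp only: mult_ac)
    qed
    also have "\<dots> = K * (t powr (2 * \<theta>) * (t powr 2 * (?N * (t\<^sup>2 * s) powr (- 4 - \<theta>))))"
      unfolding square_mult_powr[OF t s] by (simp only: mult_ac)
    also have "\<dots> \<le> K * (t powr (2 * \<theta>) * (t powr 2 * (C * majorant (b0 / 2) (t\<^sup>2 * s))))"
      using K by (intro mult_left_mono C(2)[OF z]) auto
    also have "\<dots> = C * K * t powr (2 * \<theta>) * (t\<^sup>2 * majorant (b0 / 2) (t\<^sup>2 * s))"
      using t by (simp add: powr_numeral)
    finally show "norm (ker \<alpha> 3 t s *\<^sub>C v s) \<le> C * K * t powr (2 * \<theta>) * (t\<^sup>2 * majorant (b0 / 2) (t\<^sup>2 * s))" .
  qed (use t C(1) K in auto)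
  then show ?thesis using C(1) by blast
qed

lemma usol_bound: "\<exists>C\<ge>0. \<forall>t>0. \<forall>x. norm (usol x t) \<le> C * norm x"
proof -
  obtain C where C: "0 \<le> C" "\<And>(v :: real \<Rightarrow> 'a) K t n. continuous_on {0<..} v \<Longrightarrow> 0 \<le> K \<Longrightarrow> 0 < t \<Longrightarrow>
    (\<And>s. 0 < s \<Longrightarrow> norm (v s) \<le> K * s powr (- 4 - 0)) \<Longrightarrow>
    norm (integral (window n) (\<lambda>s. ker \<alpha> 3 t s *\<^sub>C v s)) \<le> C * K * t powr (2 * 0)"
    using ker_window_bound[of 0] b0(1) by auto
  have "norm (usol x t) \<le> C * M ^ 4 * norm x" if t: "0 < t" for t x
  proof (rule tendsto_upperbound[OF tendsto_norm[OF usol_tendsto[OF t]] always_eventually[OF allI]])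
    fix n
    have "norm (integral (window n) (\<lambda>s. ker \<alpha> 3 t s *\<^sub>C Rp 4 s x)) \<le> C * (M ^ 4 * norm x) * t powr (2 * 0)"
    proof (rule C(2)[OF _ _ t])
      show "continuous_on {0<..} (\<lambda>s. Rp 4 s x)" by (intro continuous_intros continuous_on_Rp)
      show "norm (Rp 4 s x) \<le> M ^ 4 * norm x * s powr (- 4 - 0)" if "0 < s" for s
        using Rp_norm_powr[OF that, of 4 x] by simp
    qed (use M1 in simp)
    then show "norm (integral (window n) (uker x t)) \<le> C * M ^ 4 * norm x"
      using t by (simp add: uker_def[abs_def] mult.assoc)
  qed simp
  moreover have "0 \<le> C * M ^ 4" using C(1) M1 by simp
  ultimately show ?thesis by blast
qed

lemma usol_diff:
  assumes t: "0 < t" shows "usol (x - y) t = usol x t - usol y t"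
proof (rule LIMSEQ_unique[OF usol_tendsto[OF t]])
  have i: "uker x t integrable_on window n" for x n
    using continuous_on_subset[OF continuous_on_slice(1)[OF continuous_on_uker_yker(1) t] window_subset]
    unfolding window_conv(1) by (auto intro: integrable_continuous_real)
  have "uker (x - y) t = (\<lambda>s. uker x t s - uker y t s)"
    by (simp add: uker_def fun_eq_iff blinfun.diff_right scaleC.diff_right)
  then have "integral (window n) (uker (x - y) t) = integral (window n) (uker x t) - integral (window n) (uker y t)" for n
    by (simp add: Henstock_Kurzweil_Integration.integral_diff[OF i i])
  then show "(\<lambda>n. integral (window n) (uker (x - y) t)) \<longlonglongrightarrow> usol x t - usol y t"
    by (simp add: tendsto_diff[OF usol_tendsto[OF t] usol_tendsto[OF t]])
qed

text \<open>The scalar kernel that results when \<open>Rp 4 s x\<close> is replaced by its leading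
  behaviour s^(-4) x for large s.\<close>

definition gain :: "real \<Rightarrow> real \<Rightarrow> complex" where "gain t s = ker \<alpha> 3 t s * inverse (of_real s) ^ 4"

definition gain0 :: complex where "gain0 = (LINT s:{0<..}|lborel. bess (\<alpha> + 3) s / of_real s ^ 4)"

lemma gain_improper:
  assumes t: "0 < t"
  shows "set_integrable lborel {0<..} (gain t)" "improper (gain t) = (LINT s:{0<..}|lborel. gain t s)"
    "(\<lambda>n. integral (window n) (gain t)) \<longlonglongrightarrow> improper (gain t)"
proof -
  have c: "continuous_on {0<..} (gain t)"
    unfolding gain_def[abs_def] ker_def using t by (intro continuous_intros) auto
  obtain C where C: "0 \<le> C" "\<And>s. 0 < s \<Longrightarrow> norm (ker \<alpha> 3 t s) * s powr (- 4) \<le> C * majorant b0 s"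
    using ker_majorant[OF t, of 4 t] by auto
  have b: "norm (gain t s) \<le> C * majorant b0 s" if s: "0 < s" for s
  proof -
    have "norm (gain t s) = norm (ker \<alpha> 3 t s) * s powr (- 4)"
      using s powr_realpow[OF s, of 4] by (simp add: gain_def norm_mult norm_power norm_inverse powr_minus power_inverse)
    then show ?thesis using C(2)[OF s] by simp
  qed
  show "set_integrable lborel {0<..} (gain t)" "improper (gain t) = (LINT s:{0<..}|lborel. gain t s)"
    by (rule improper_eq_set_lebesgue_integral[OF c b0(1) C(1) b]; assumption)+
  show "(\<lambda>n. integral (window n) (gain t)) \<longlonglongrightarrow> improper (gain t)"
    by (rule improper_window(1)[OF c b0(1) C(1) b])
qed

lemma gain_one: "gain 1 = (\<lambda>s. bess (\<alpha> + 3) s / of_real s ^ 4)"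
  by (simp add: gain_def ker_def fun_eq_iff divide_inverse power_inverse)

lemma gain0_nonzero: "gain0 \<noteq> 0"
  unfolding gain0_def using gain_improper(1)[of 1] \<alpha> unfolding gain_one by (intro bess_normalisation) auto

text \<open>The integral of the kernel does not depend on \<open>t\<close>, by the substitution \<open>s \<mapsto> t\<^sup>2 s\<close>.\<close>

lemma gain_tendsto:
  assumes t: "0 < t"
  shows "(\<lambda>n. integral (window n) (gain t)) \<longlonglongrightarrow> gain0"
proof -
  have "gain0 = (LINT s|lborel. indicator {0<..} s *\<^sub>R gain 1 s)"
    by (simp add: gain0_def gain_one set_lebesgue_integral_def)
  also have "\<dots> = \<bar>t\<^sup>2\<bar> *\<^sub>R (LINT s|lborel. indicator {0<..} (0 + t\<^sup>2 * s) *\<^sub>R gain 1 (0 + t\<^sup>2 * s))"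
    using t by (intro lborel_integral_real_affine) simp
  also have "\<dots> = (LINT s|lborel. t\<^sup>2 *\<^sub>R (indicator {0<..} (t\<^sup>2 * s) *\<^sub>R gain 1 (t\<^sup>2 * s)))"
    by (simp only: integral_scaleR_right add_0 abs_power2)
  also have "\<dots> = (LINT s|lborel. indicator {0<..} s *\<^sub>R gain t s)"
  proof (rule Bochner_Integration.integral_cong[OF refl])
    fix s
    have "t\<^sup>2 *\<^sub>R gain 1 (t\<^sup>2 * s) = gain t s" if s: "0 < s"
    proof -
      have "T * T * (x / (T * T * S) ^ 4) = (inverse T ^ 6 * x) * inverse S ^ 4" if "T \<noteq> 0" "S \<noteq> 0" for T S x :: complex
        using that by (simp add: field_simps eval_nat_numeral)
      from this[of "of_real t" "of_real s" "bess (\<alpha> + 3) (t\<^sup>2 * s)"] show ?thesis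
        using t s by (simp add: gain_one gain_def ker_def scaleR_conv_of_real power2_eq_square)
    qed
    then show "t\<^sup>2 *\<^sub>R (indicator {0<..} (t\<^sup>2 * s) *\<^sub>R gain 1 (t\<^sup>2 * s)) = indicator {0<..} s *\<^sub>R gain t s"
      using t by (auto simp: indicator_def zero_less_mult_iff)
  qed
  also have "\<dots> = improper (gain t)" by (simp add: gain_improper(2)[OF t] set_lebesgue_integral_def)
  finally show ?thesis using gain_improper(3)[OF t] by simp
qed

text \<open>The difference between \<open>Rp 4 s x\<close> and s^(-4) x is O(s^(-4)) everywhere and
  O(s^(-5)) for x in the domain. Both are at most a constant times s^(-4-b0/2) in their ranges s <=
  1 and s >= 1, so \<open>ker_window_bound\<close> gives the rate t^b0.\<close>

lemma usol_near_0:
  assumes x: "x \<in> D"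
  shows "\<exists>C. \<forall>t>0. norm (usol x t - gain0 *\<^sub>C x) \<le> C * t powr b0"
proof -
  have \<theta>: "0 \<le> b0 / 2" "b0 / 2 \<le> b0 / 2" using b0(1) by auto
  have \<theta>1: "b0 / 2 \<le> 1" using b0 \<alpha> by auto
  obtain C where C: "0 \<le> C" "\<And>(v :: real \<Rightarrow> 'a) K t n. continuous_on {0<..} v \<Longrightarrow> 0 \<le> K \<Longrightarrow> 0 < t \<Longrightarrow>
    (\<And>s. 0 < s \<Longrightarrow> norm (v s) \<le> K * s powr (- 4 - b0 / 2)) \<Longrightarrow>
    norm (integral (window n) (\<lambda>s. ker \<alpha> 3 t s *\<^sub>C v s)) \<le> C * K * t powr (2 * (b0 / 2))"
    using ker_window_bound[OF \<theta>] by auto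
  obtain E where E: "0 \<le> E" "\<And>s. 0 < s \<Longrightarrow> norm (s ^ 4 *\<^sub>R Rp 4 s x - x) \<le> E / s"
    using Rp_approx[OF x, of 4] by blast
  define F where "F = M ^ 4 * norm x + norm x"
  have F: "norm (s ^ 4 *\<^sub>R Rp 4 s x - x) \<le> F" if s: "0 < s" for s
  proof -
    have "norm (s ^ 4 *\<^sub>R Rp 4 s x) \<le> s ^ 4 * ((M / s) ^ 4 * norm x)"
      using s Rp_norm[OF s, of 4 x] by (simp add: mult_left_mono)
    also have "\<dots> = M ^ 4 * norm x" using s by (simp add: power_divide)
    finally show ?thesis unfolding F_def by (intro order_trans[OF norm_triangle_ineq4] add_right_mono)
  qed
  define v where "v s = Rp 4 s x - (1 / s ^ 4) *\<^sub>R x" for s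
  let ?K = "max E F"
  have v: "norm (v s) \<le> ?K * s powr (- 4 - b0 / 2)" if s: "0 < s" for s
  proof -
    have "norm (s ^ 4 *\<^sub>R Rp 4 s x - x) \<le> ?K * s powr (- (b0 / 2))"
    proof (cases "s \<le> 1")
      case True
      have "0 \<le> F" using M1 by (simp add: F_def)
      moreover have "1 \<le> s powr (- (b0 / 2))" using powr_mono'[of "- (b0 / 2)" 0 s] True s b0(1) by simp
      ultimately have "F \<le> F * s powr (- (b0 / 2))" using mult_left_mono by fastforce
      also have "\<dots> \<le> ?K * s powr (- (b0 / 2))" by (intro mult_right_mono) auto
      finally show ?thesis using F[OF s] by simp
    next
      case False
      have "E / s = E * s powr (- 1)" using s by (simp add: powr_minus divide_inverse)
      also have "\<dots> \<le> ?K * s powr (- (b0 / 2))"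
        using False \<theta>1 E(1) by (intro mult_mono powr_mono) auto
      finally show ?thesis using E(2)[OF s] by simp
    qed
    moreover have "norm (v s) = s powr (- 4) * norm (s ^ 4 *\<^sub>R Rp 4 s x - x)"
    proof -
      have "v s = (1 / s ^ 4) *\<^sub>R (s ^ 4 *\<^sub>R Rp 4 s x - x)" using s by (simp add: v_def scaleR_diff_right)
      then show ?thesis using s powr_realpow[OF s, of 4] by (simp add: powr_minus divide_inverse)
    qed
    ultimately have "norm (v s) \<le> s powr (- 4) * (?K * s powr (- (b0 / 2)))" by (simp add: mult_left_mono)
    also have "\<dots> = ?K * s powr (- 4 + - (b0 / 2))" unfolding powr_add by (simp only: mult_ac)
    finally show ?thesis by simp
  qed
  have vc: "continuous_on {0<..} v"
    unfolding v_def by (intro continuous_intros continuous_on_Rp) auto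
  have "norm (usol x t - gain0 *\<^sub>C x) \<le> C * ?K * t powr b0" if t: "0 < t" for t
  proof (rule tendsto_upperbound[OF _ always_eventually[OF allI]])
    show "(\<lambda>n. norm (integral (window n) (uker x t) - integral (window n) (gain t) *\<^sub>C x)) \<longlonglongrightarrow> norm (usol x t - gain0 *\<^sub>C x)"
      by (intro tendsto_norm tendsto_diff usol_tendsto[OF t] scaleC.tendsto gain_tendsto[OF t] tendsto_const)
    fix n
    have c: "continuous_on (window n) (uker x t)" "continuous_on (window n) (gain t)"
      using continuous_on_subset[OF continuous_on_slice(1)[OF continuous_on_uker_yker(1) t] window_subset] t window_subset[of n]
      unfolding gain_def[abs_def] ker_def by (auto intro!: continuous_intros)
    have i: "uker x t integrable_on window n" "gain t integrable_on window n" "(\<lambda>s. gain t s *\<^sub>C x) integrable_on window n"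
      using c unfolding window_conv(1) by (auto intro!: integrable_continuous_real continuous_intros)
    have "integral (window n) (gain t) *\<^sub>C x = integral (window n) (\<lambda>s. gain t s *\<^sub>C x)"
      by (rule integral_scaleC_left[OF i(2), symmetric])
    then have "integral (window n) (uker x t) - integral (window n) (gain t) *\<^sub>C x = integral (window n) (\<lambda>s. uker x t s - gain t s *\<^sub>C x)"
      by (simp add: Henstock_Kurzweil_Integration.integral_diff[OF i(1,3)])
    also have "(\<lambda>s. uker x t s - gain t s *\<^sub>C x) = (\<lambda>s. ker \<alpha> 3 t s *\<^sub>C v s)"
    proof
      fix s
      have "(1 / s ^ 4) *\<^sub>R x = inverse (of_real s) ^ 4 *\<^sub>C x"
        using scaleC_of_real[of "1 / s ^ 4" x] by (simp add: divide_inverse power_inverse)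
      then show "uker x t s - gain t s *\<^sub>C x = ker \<alpha> 3 t s *\<^sub>C v s"
        by (simp add: uker_def gain_def v_def scaleC.diff_right scaleC_scaleC)
    qed
    finally show "norm (integral (window n) (uker x t) - integral (window n) (gain t) *\<^sub>C x) \<le> C * ?K * t powr b0"
      using C(2)[OF vc _ t v] E(1) by (simp add: le_max_iff_disj)
  qed simp
  then show ?thesis by blast
qed

text \<open>Convergence holds on the dense domain by \<open>usol_near_0\<close>, and the maps x ->
  \<open>usol x t\<close> are bounded uniformly in t, so it extends to all x. This is the point
  where density enters.\<close>

lemma usol_tendsto_at_0:
  assumes dense: "closure D = UNIV"
  shows "(usol x \<longlongrightarrow> gain0 *\<^sub>C x) (at_right 0)"
proof (rule tendstoI)
  fix e :: real assume e: "0 < e"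
  obtain C where C: "0 \<le> C" "\<And>t x. 0 < t \<Longrightarrow> norm (usol x t) \<le> C * norm x" using usol_bound by blast
  define \<delta> where "\<delta> = e / (3 * (C + norm gain0 + 1))"
  have C1: "0 < C + norm gain0 + 1" using C(1) by (simp add: add_nonneg_pos)
  then have \<delta>: "0 < \<delta>" using e by (simp add: \<delta>_def)
  have "(C + norm gain0) * \<delta> \<le> (C + norm gain0 + 1) * \<delta>" using \<delta> by (intro mult_right_mono) auto
  also have "\<dots> = e / 3" using C1 unfolding \<delta>_def by (metis less_irrefl mult.commute nonzero_mult_divide_mult_cancel_right times_divide_eq_right)
  finally have \<delta>e: "(C + norm gain0) * \<delta> \<le> e / 3" .
  obtain y where y: "y \<in> D" "dist y x < \<delta>"
    using closure_approachable[of x D] dense \<delta> by auto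
  obtain E where E: "\<And>t. 0 < t \<Longrightarrow> norm (usol y t - gain0 *\<^sub>C y) \<le> E * t powr b0" using usol_near_0[OF y(1)] by blast
  have "((\<lambda>t. E * t powr b0) \<longlongrightarrow> E * (0 powr b0)) (at_right 0)"
    using b0(1) by (intro tendsto_mult tendsto_const tendsto_powr2 tendsto_intros) (auto simp: eventually_at_filter)
  then have "\<forall>\<^sub>F t in at_right 0. E * t powr b0 < e / 3"
    using e by (intro order_tendstoD(2)[where y = "E * 0 powr b0"]) auto
  moreover have "\<forall>\<^sub>F t in at_right (0::real). 0 < t" by (simp add: eventually_at_filter)
  ultimately show "\<forall>\<^sub>F t in at_right 0. dist (usol x t) (gain0 *\<^sub>C x) < e"
  proof eventually_elim
    case (elim t)
    have xy: "norm (x - y) \<le> \<delta>" using y(2) by (simp add: dist_norm norm_minus_commute)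
    have tri: "norm ((p - q) + r) \<le> norm p + norm q + norm r" for p q r :: 'a
      by (rule order_trans[OF norm_triangle_ineq add_right_mono[OF norm_triangle_ineq4]])
    have "usol x t - gain0 *\<^sub>C x = (usol (x - y) t - gain0 *\<^sub>C (x - y)) + (usol y t - gain0 *\<^sub>C y)"
      by (simp add: usol_diff[OF elim(2)] scaleC.diff_right)
    then have "norm (usol x t - gain0 *\<^sub>C x) \<le> norm (usol (x - y) t) + norm (gain0 *\<^sub>C (x - y)) + norm (usol y t - gain0 *\<^sub>C y)"
      by (simp only: tri)
    also have "norm (usol (x - y) t) \<le> C * \<delta>"
      using C(2)[OF elim(2), of "x - y"] mult_left_mono[OF xy C(1)] by linarith
    also have "norm (gain0 *\<^sub>C (x - y)) \<le> norm gain0 * \<delta>" unfolding norm_scaleC by (intro mult_left_mono xy) simp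
    also have "C * \<delta> + norm gain0 * \<delta> + norm (usol y t - gain0 *\<^sub>C y) \<le> (C + norm gain0) * \<delta> + E * t powr b0"
      using E[OF elim(2)] by (simp add: distrib_right)
    also have "\<dots> \<le> e / 3 + E * t powr b0" using \<delta>e by simp
    also have "\<dots> < e" using elim(1) e by simp
    finally show ?case by (simp add: dist_norm)
  qed
qed

end

section \<open>Uniqueness and existence of solutions\<close>

context bessel_operator begin

text \<open>The difference is formed at the level of \<open>weak\<close>, an identity between
  integrals of continuous functions where linearity is immediate; strong integrals of A u and A v
  need not be combined.\<close>

lemma solution_unique:
  assumes u: "is_solution D A \<alpha> x u" and v: "is_solution D A \<alpha> x v" and t: "0 \<le> t"
  shows "u t = v t"
proof (cases "t = 0")
  case True
  then show ?thesis using u v by (simp add: is_solution_def)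
next
  case False
  define w where "w t = u t - v t" for t
  have c: "continuous_on {0..} u" "continuous_on {0..} v" and b: "bounded (u ` {0..})" "bounded (v ` {0..})"
    using u v by (simp_all add: is_solution_def)
  have cont: "continuous_on {0..} w" unfolding w_def by (intro continuous_intros c)
  obtain B C where "\<And>t. 0 \<le> t \<Longrightarrow> norm (u t) \<le> B" "\<And>t. 0 \<le> t \<Longrightarrow> norm (v t) \<le> C"
    using b unfolding bounded_iff by auto
  then have bdd: "norm (w t) \<le> B + C" if "0 \<le> t" for t
    unfolding w_def using that by (intro order_trans[OF norm_triangle_ineq4] add_mono) auto
  have w: "weak \<alpha> w"
    unfolding weak_def
  proof (intro allI impI, elim conjE)
    fix \<phi> p q and s :: real
    assume \<phi>: "test_function \<phi>" and p: "0 < p" "p \<le> q" and z: "\<forall>t. t \<notin> {p..q} \<longrightarrow> \<phi> t = 0" and s: "0 < s"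
    obtain p' q' where d: "\<And>t. (\<phi> has_vector_derivative vderiv \<phi> t) (at t)"
      "\<And>t. (vderiv \<phi> has_vector_derivative vderiv (vderiv \<phi>) t) (at t)" "continuous_on UNIV (vderiv (vderiv \<phi>))"
      by (rule test_functionE[OF \<phi>]) blast
    let ?J = "{p..q}"
    have J: "?J \<subseteq> {0<..}" "?J \<subseteq> {0..}" using p by auto
    have c\<phi>: "continuous_on ?J \<phi>"
      using d(1) by (auto intro: continuous_at_imp_continuous_on has_vector_derivative_continuous)
    have i: "(\<lambda>t. \<phi> t *\<^sub>C f t) integrable_on ?J" "(\<lambda>t. (adj \<alpha> \<phi> t + of_real s * \<phi> t) *\<^sub>C f t) integrable_on ?J"
      if "continuous_on {0..} f" for f :: "real \<Rightarrow> 'a"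
      by (intro integrable_continuous_real continuous_intros c\<phi> continuous_on_subset[OF continuous_on_adj[OF d] J(1)]
          continuous_on_subset[OF that J(2)])+
    have "integral ?J (\<lambda>t. \<phi> t *\<^sub>C f t) = R s (integral ?J (\<lambda>t. (adj \<alpha> \<phi> t + of_real s * \<phi> t) *\<^sub>C f t))"
      if "weak \<alpha> f" for f
      using that \<phi> p z s unfolding weak_def by blast
    note e = this[OF solution_imp_weak[OF u]] this[OF solution_imp_weak[OF v]]
    show "integral ?J (\<lambda>t. \<phi> t *\<^sub>C w t) = R s (integral ?J (\<lambda>t. (adj \<alpha> \<phi> t + of_real s * \<phi> t) *\<^sub>C w t))"
      unfolding w_def scaleC.diff_right
        Henstock_Kurzweil_Integration.integral_diff[OF i(1)[OF c(1)] i(1)[OF c(2)]]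
        Henstock_Kurzweil_Integration.integral_diff[OF i(2)[OF c(1)] i(2)[OF c(2)]] blinfun.diff_right
      by (simp only: e)
  qed
  have "w 0 = 0" using u v by (simp add: w_def is_solution_def)
  from weak_zero[OF w cont bdd this] have "w t = 0" using t False by simp
  then show ?thesis by (simp add: w_def)
qed

lemma solution_zero:
  assumes u: "is_solution D A \<alpha> 0 u" and t: "0 \<le> t"
  shows "u t = 0"
proof (cases "t = 0")
  case True
  then show ?thesis using u by (simp add: is_solution_def)
next
  case False
  have c: "continuous_on {0..} u" "u 0 = 0" and "bounded (u ` {0..})" using u by (simp_all add: is_solution_def)
  then obtain B where B: "\<And>t. 0 \<le> t \<Longrightarrow> norm (u t) \<le> B" unfolding bounded_iff by auto
  show ?thesis by (rule weak_zero[OF solution_imp_weak[OF u] c(1) B c(2)]) (use t False in auto)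
qed

text \<open>Division by \<open>gain0\<close> normalises the limit at 0, and the value at t = 0,
  where the integral formula has no meaning, is set to x by hand. Local integrability of
  \<open>A u\<close> follows from its continuity on the open half-line.\<close>

lemma usol_is_solution:
  assumes dense: "closure D = UNIV"
  shows "is_solution D A \<alpha> x (\<lambda>t. if t = 0 then x else inverse gain0 *\<^sub>C usol x t)"
    (is "is_solution D A \<alpha> x ?u")
  unfolding is_solution_def
proof (intro conjI allI impI; (elim conjE)?)
  let ?c = "inverse gain0"
  have uc: "continuous_on {0<..} (\<lambda>t. ?c *\<^sub>C usol x t)" "continuous_on {0<..} (\<lambda>t. ?c *\<^sub>C ysol x t)"
    by (intro continuous_intros continuous_on_usol_ysol)+
  have uD: "?u t \<in> D" "A (?u t) = ?c *\<^sub>C ysol x t" if "0 < t" for t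
    using lin usol_in_D[OF that, of x] that unfolding linear_operator_def by auto
  show "continuous_on {0..} ?u"
    unfolding continuous_on_eq_continuous_within
  proof
    fix t :: real assume t: "t \<in> {0..}"
    show "continuous (at t within {0..}) ?u"
    proof (cases "t = 0")
      case True
      have "((\<lambda>t. ?c *\<^sub>C usol x t) \<longlongrightarrow> ?c *\<^sub>C (gain0 *\<^sub>C x)) (at_right 0)"
        by (intro scaleC.tendsto tendsto_const usol_tendsto_at_0[OF dense])
      moreover have "?c *\<^sub>C (gain0 *\<^sub>C x) = x"
        using gain0_nonzero scaleC_of_real[of 1 x] by (simp add: scaleC_scaleC)
      ultimately have "((\<lambda>t. ?c *\<^sub>C usol x t) \<longlongrightarrow> x) (at_right 0)" by simp
      then have "(?u \<longlongrightarrow> x) (at_right 0)"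
        by (rule Lim_transform_eventually) (simp add: eventually_at_filter)
      then show ?thesis unfolding True continuous_within at_within_Ici_at_right by simp
    next
      case False
      then have "0 < t" using t by simp
      then have "isCont (\<lambda>t. ?c *\<^sub>C usol x t) t" using uc(1) by (simp add: continuous_on_eq_continuous_at)
      moreover have "\<forall>\<^sub>F s in nhds t. (?c *\<^sub>C usol x s) = ?u s"
        by (rule eventually_mono[OF eventually_nhds_in_open[of "{0<..}" t]]) (use \<open>0 < t\<close> in auto)
      ultimately have "isCont ?u t" by (simp only: isCont_cong)
      then show ?thesis by (rule continuous_at_imp_continuous_at_within)
    qed
  qed
  obtain C where C: "0 \<le> C" "\<And>t x. 0 < t \<Longrightarrow> norm (usol x t) \<le> C * norm x" using usol_bound by blast
  show "bounded (?u ` {0..})"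
    unfolding bounded_iff
  proof (intro exI[of _ "norm x + norm ?c * (C * norm x)"] ballI, elim imageE)
    fix y t assume y: "y = ?u t" and "t \<in> {0..}"
    then have t: "0 \<le> t" by simp
    have b: "norm (?c *\<^sub>C usol x t) \<le> norm ?c * (C * norm x)" if "0 < t"
      unfolding norm_scaleC by (intro mult_left_mono C(2) that norm_ge_zero)
    have "0 \<le> norm ?c * (C * norm x)" using C(1) by simp
    then show "norm y \<le> norm x + norm ?c * (C * norm x)"
      unfolding y using b t norm_ge_zero[of x] by (cases "t = 0") (simp, simp only: if_False, linarith)
  qed
  show "?u 0 = x" by simp
  show "?u t \<in> D" if "0 < t" for t by (rule uD(1)[OF that])
  show "strong_bochner_integrable (lebesgue_on K) (\<lambda>t. A (?u t))" if K: "compact K" "K \<subseteq> {0<..}" for K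
  proof -
    have "strong_bochner_integrable (lebesgue_on K) (\<lambda>t. ?c *\<^sub>C ysol x t)"
      by (rule strong_bochner_integrable_compact[OF _ K]) (rule uc(2))
    then obtain I where I: "has_strong_bochner_integral (lebesgue_on K) (\<lambda>t. ?c *\<^sub>C ysol x t) I"
      unfolding strong_bochner_integrable_def by blast
    have "has_strong_bochner_integral (lebesgue_on K) (\<lambda>t. A (?u t)) I"
      by (rule has_strong_bochner_integral_cong[OF I]) (use uD(2) K(2) in auto)
    then show ?thesis unfolding strong_bochner_integrable_def by blast
  qed
  fix \<phi> assume \<phi>: "test_function \<phi>"
  obtain p q where p: "0 < p" "p \<le> q" and sup: "\<And>t. t \<notin> {p..q} \<Longrightarrow> \<phi> t = 0"
    "\<And>t. t \<notin> {p..q} \<Longrightarrow> vderiv \<phi> t = 0" "\<And>t. t \<notin> {p..q} \<Longrightarrow> vderiv (vderiv \<phi>) t = 0"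
    and d: "\<And>t. (\<phi> has_vector_derivative vderiv \<phi> t) (at t)"
    "\<And>t. (vderiv \<phi> has_vector_derivative vderiv (vderiv \<phi>) t) (at t)"
    "continuous_on UNIV (vderiv (vderiv \<phi>))"
    by (rule test_functionE[OF \<phi>]) blast
  \<comment> \<open>The support interval is enlarged on both sides, so that \<phi> and \<phi>'
    vanish at the endpoints, as \<open>usol_weak\<close> requires.\<close>
  let ?M = "lebesgue_on {0<..} :: real measure" and ?J = "{p/2..q+1}"
  have J: "0 < p / 2" "p / 2 \<le> q + 1" "?J \<subseteq> {0<..}" "{p..q} \<subseteq> ?J" using p by auto
  have c\<phi>: "continuous_on {0<..} \<phi>"
    using d(1) by (auto intro: continuous_at_imp_continuous_on has_vector_derivative_continuous)
  have ca: "continuous_on {0<..} (adj \<alpha> \<phi>)" by (rule continuous_on_adj[OF d])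
  have az: "adj \<alpha> \<phi> t = 0" if "0 < t" "t \<notin> {p..q}" for t by (rule adj_zero_outside[OF sup d(1) that])
  have "integral ?J (\<lambda>t. adj \<alpha> \<phi> t *\<^sub>C usol x t) = integral ?J (\<lambda>t. \<phi> t *\<^sub>C ysol x t)"
    by (rule usol_weak[OF J(1,2) _ _ _ _ d]) (use p sup in auto)
  moreover have "integral ?J (\<lambda>t. ?c *\<^sub>C (f t *\<^sub>C g t)) = ?c *\<^sub>C integral ?J (\<lambda>t. f t *\<^sub>C g t)"
    if "continuous_on {0<..} f" "continuous_on {0<..} g" for f and g :: "real \<Rightarrow> 'a"
    by (intro integral_scaleC_right integrable_continuous_real continuous_intros continuous_on_subset[OF that(1) J(3)]
        continuous_on_subset[OF that(2) J(3)])
  ultimately have e: "integral ?J (\<lambda>t. ?c *\<^sub>C (adj \<alpha> \<phi> t *\<^sub>C usol x t)) = integral ?J (\<lambda>t. ?c *\<^sub>C (\<phi> t *\<^sub>C ysol x t))"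
    using ca c\<phi> continuous_on_usol_ysol by simp
  have "has_strong_bochner_integral ?M (\<lambda>t. ?c *\<^sub>C (adj \<alpha> \<phi> t *\<^sub>C usol x t)) (integral ?J (\<lambda>t. ?c *\<^sub>C (adj \<alpha> \<phi> t *\<^sub>C usol x t)))"
    by (rule has_strong_bochner_integral_compact_support[OF _ J(1,2)])
       (use J(4) az in \<open>auto intro!: continuous_intros ca continuous_on_usol_ysol\<close>)
  then have L: "has_strong_bochner_integral ?M (\<lambda>t. vderiv (vderiv \<phi>) t *\<^sub>C ?u t - vderiv (\<lambda>s. (1 - 2 * \<alpha>) / complex_of_real s * \<phi> s) t *\<^sub>C ?u t)
     (integral ?J (\<lambda>t. ?c *\<^sub>C (adj \<alpha> \<phi> t *\<^sub>C usol x t)))"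
  proof (rule has_strong_bochner_integral_cong)
    fix t :: real assume "t \<in> space ?M"
    then have "?u t = ?c *\<^sub>C usol x t" by simp
    moreover have "?c *\<^sub>C ((g - h) *\<^sub>C y) = g *\<^sub>C (?c *\<^sub>C y) - h *\<^sub>C (?c *\<^sub>C y)" for g h and y :: 'a
      by (simp add: scaleC_scaleC scaleC.diff_left[symmetric] algebra_simps)
    ultimately show "?c *\<^sub>C (adj \<alpha> \<phi> t *\<^sub>C usol x t)
      = vderiv (vderiv \<phi>) t *\<^sub>C ?u t - vderiv (\<lambda>s. (1 - 2 * \<alpha>) / complex_of_real s * \<phi> s) t *\<^sub>C ?u t"
      unfolding adj_def by (simp only:)
  qed
  have "has_strong_bochner_integral ?M (\<lambda>t. ?c *\<^sub>C (\<phi> t *\<^sub>C ysol x t)) (integral ?J (\<lambda>t. ?c *\<^sub>C (\<phi> t *\<^sub>C ysol x t)))"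
    by (rule has_strong_bochner_integral_compact_support[OF _ J(1,2)])
       (use J(4) sup in \<open>auto intro!: continuous_intros c\<phi> continuous_on_usol_ysol\<close>)
  then have "has_strong_bochner_integral ?M (\<lambda>t. \<phi> t *\<^sub>C A (?u t)) (integral ?J (\<lambda>t. ?c *\<^sub>C (\<phi> t *\<^sub>C ysol x t)))"
    by (rule has_strong_bochner_integral_cong) (use uD(2) in \<open>simp add: scaleC_scaleC mult.commute\<close>)
  then show "strong_bochner_integral ?M
      (\<lambda>t. vderiv (vderiv \<phi>) t *\<^sub>C ?u t - vderiv (\<lambda>s. (1 - 2 * \<alpha>) / complex_of_real s * \<phi> s) t *\<^sub>C ?u t)
    = strong_bochner_integral ?M (\<lambda>t. \<phi> t *\<^sub>C A (?u t))"
    unfolding e[symmetric] strong_bochner_integral_eq[OF L] by (rule strong_bochner_integral_eq[symmetric])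
qed

end

theorem theorem5p8:
  fixes D :: "'a::complex_banach set" and A :: "'a \<Rightarrow> 'a"
    and \<omega> :: real and \<alpha> :: complex
  assumes "0 \<le> \<omega>" and "\<omega> < pi"
    and "(D, A) \<in> Sect \<omega>"
    and "0 < Re \<alpha>" and "Re \<alpha> < 1"
  shows "(\<forall>u. is_solution D A \<alpha> 0 u \<longrightarrow> (\<forall>t\<ge>0. u t = 0)) \<and>
    (\<forall>x u v. is_solution D A \<alpha> x u \<and> is_solution D A \<alpha> x v \<longrightarrow> (\<forall>t\<ge>0. u t = v t)) \<and>
    (closure D = UNIV \<longrightarrow>
      (\<forall>x. \<exists>u. is_solution D A \<alpha> x u \<and>
        (\<forall>v. is_solution D A \<alpha> x v \<longrightarrow> (\<forall>t\<ge>0. v t = u t))))"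
proof -
  have "sectorial D A" using assms(3) by (simp add: Sect_def)
  then obtain R M where RM: "nonneg_operator D A R M" using sectorial_imp_nonneg_operator by blast
  interpret bessel_operator D A R M \<alpha>
    using RM assms(4,5) by (intro bessel_operator.intro bessel_operator_axioms.intro)
  show ?thesis
  proof (intro conjI allI impI)
    show "u t = 0" if "is_solution D A \<alpha> 0 u" "0 \<le> t" for u t by (rule solution_zero[OF that])
    show "u t = v t" if "is_solution D A \<alpha> x u \<and> is_solution D A \<alpha> x v" "0 \<le> t" for x u v t
      using solution_unique[of x u v t] that by simp
    fix x assume "closure D = UNIV"
    then obtain u where u: "is_solution D A \<alpha> x u" using usol_is_solution by blast
    then show "\<exists>u. is_solution D A \<alpha> x u \<and> (\<forall>v. is_solution D A \<alpha> x v \<longrightarrow> (\<forall>t\<ge>0. v t = u t))"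
      using solution_unique[OF _ u] by (intro exI[of _ u]) auto
  qed
qed

end
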